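(* Let $\{\varepsilon_t\}_{t\in\mathbb{Z}}$ be i.i.d. real random variables with mean zero, variance $\sigma_0^2>0$ and $E\varepsilon_1^4<\infty$, and let $\{Y_t\}_{t\in\mathbb{Z}}$ be the strictly stationary solution of $Y_t=\mu_0+\phi_0Y_{t-2}+b_0Y_{t-2}\varepsilon_{t-1}+\varepsilon_t$. Write $\theta=(\mu,\phi,\sigma^2,b^2)^\top$ and $\theta_0=(\mu_0,\phi_0,\sigma_0^2,b_0^2)^\top$. Suppose the parameter space $\Theta$ is a compact subset of $$\{\theta:\ E\ln|\phi+b\varepsilon_1|<0,\ |\mu|\le\bar\mu,\ |\phi|\le\bar\phi,\ \underline\omega\le\sigma^2\le\overline\omega,\ \underline\alpha\le b^2\le\overline\alpha\},$$ where $\bar\mu,\bar\phi,\underline\omega,\overline\omega,\underline\alpha,\overline\alpha$ are some finite positive constants, and that the true parameter value $\theta_0$ is an interior point of $\Theta$. Let $\hat\theta_n$ be the maximizer over $\Theta$ of the quasi-log-likelihood $L_n(\theta)=\sum_{t=1}^n\ell_t(\theta)$ defined in the context, and let $\Sigma,\Omega$ be the matrices defined in the context. Then, as $n\to\infty$, (a) $\hat\theta_n\to\theta_0$ almost surely; (b) $\sqrt n(\hat\theta_n-\theta_0)\overset{d}{\to}N(0,\Sigma^{-1}\Omega\Sigma^{-1})$.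
   Context: For $\theta=(\mu,\phi,\sigma^2,b^2)^\top$, $$\ell_t(\theta)=-\frac12\left[\ln[\sigma^2(1+b^2Y_{t-2}^2)]+\frac{(Y_t-\mu-\phi Y_{t-2})^2}{\sigma^2(1+b^2Y_{t-2}^2)}\right].$$ The function $\ell_t$ depends on $b$ only through $b^2$, and $\sigma^2$ and $b^2$ are the third and fourth coordinates of $\theta$; $\partial\ell_t/\partial\theta$ is the gradient with respect to $(\mu,\phi,\sigma^2,b^2)$. In the condition $E\ln|\phi+b\varepsilon_1|<0$ defining the parameter set, $\varepsilon_1$ is the actual innovation and $b$ is the square root of the fourth coordinate $b^2$ having the same sign as $b_0$. The observations, including the values $Y_{-1},Y_0$ appearing in $\ell_1,\ell_2$, come from the strictly stationary solution. The matrices (which do not depend on $t$, by stationarity) are $$\Omega=E\left[\frac{\partial\ell_t(\theta_0)}{\partial\theta}+\frac{\partial\ell_{t-1}(\theta_0)}{\partial\theta}\right]\left[\frac{\partial\ell_t(\theta_0)}{\partial\theta}+\frac{\partial\ell_{t-1}(\theta_0)}{\partial\theta}\right]^\top-E\left[\frac{\partial\ell_t(\theta_0)}{\partial\theta}\frac{\partial\ell_t(\theta_0)}{\partial\theta^\top}\right],$$ and $\Sigma={\rm diag}\{\Sigma_1,\Sigma_2\}$ (block diagonal, $4\times4$) with $$\Sigma_1=E\left[\frac{1}{\sigma_0^2(1+b_0^2Y_{t-2}^2)}\begin{pmatrix}1&Y_{t-2}\\ Y_{t-2}&Y_{t-2}^2\end{pmatrix}\right],\qquad \Sigma_2=E\begin{pmatrix}\dfrac{1}{2\sigma_0^4}&\dfrac{Y_{t-2}^2}{2\sigma_0^2(1+b_0^2Y_{t-2}^2)}\\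 \dfrac{Y_{t-2}^2}{2\sigma_0^2(1+b_0^2Y_{t-2}^2)}&\dfrac{Y_{t-2}^4}{2(1+b_0^2Y_{t-2}^2)^2}\end{pmatrix}.$$ *)

theory Defs
  imports "HOL-Probability.Probability"
begin

section \<open>Expectations and processes\<close>

text \<open>
  The library sets \<open>ln 0 = 0\<close>. The condition \<open>E ln |\<phi> + b \<epsilon>| < 0\<close> requires the value
  \<open>- \<infinity>\<close> at \<open>0\<close>, and the expectation itself may be \<open>- \<infinity>\<close> (for instance if \<open>\<epsilon>\<close> has
  an atom at \<open>- \<phi> / b\<close>). It is therefore the difference of the expected positive part
  and the expected negative part (\<^const>\<open>e2ennreal\<close> is the positive part).
  In the situation \<open>\<infinity> - \<infinity>\<close> the arithmetic of \<^typ>\<open>ereal\<close> yields \<open>\<infinity>\<close>, which is not negative.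
\<close>

definition ln_abs :: "real \<Rightarrow> ereal" where
  "ln_abs x = (if x = 0 then - \<infinity> else ereal (ln \<bar>x\<bar>))"

definition ereal_expectation :: "'a measure \<Rightarrow> ('a \<Rightarrow> ereal) \<Rightarrow> ereal" where
  "ereal_expectation M f =
     enn2ereal (\<integral>\<^sup>+ \<omega>. e2ennreal (f \<omega>) \<partial>M) - enn2ereal (\<integral>\<^sup>+ \<omega>. e2ennreal (- f \<omega>) \<partial>M)"

definition iid :: "'a measure \<Rightarrow> (int \<Rightarrow> 'a \<Rightarrow> real) \<Rightarrow> bool" where
  "iid M X \<longleftrightarrow> prob_space.indep_vars M (\<lambda>_. borel) X UNIV \<and>
               (\<forall>s t. distr M borel (X s) = distr M borel (X t))"

definition strictly_stationary :: "'a measure \<Rightarrow> (int \<Rightarrow> 'a \<Rightarrow> real) \<Rightarrow> bool" where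
  "strictly_stationary M X \<longleftrightarrow>
     (\<forall>t. X t \<in> borel_measurable M) \<and>
     (\<forall>h. distr M (\<Pi>\<^sub>M t\<in>(UNIV :: int set). (borel :: real measure)) (\<lambda>\<omega> t. X (t + h) \<omega>)
        = distr M (\<Pi>\<^sub>M t\<in>(UNIV :: int set). (borel :: real measure)) (\<lambda>\<omega> t. X t \<omega>))"

definition bilinear_solution ::
  "'a measure \<Rightarrow> (int \<Rightarrow> 'a \<Rightarrow> real) \<Rightarrow> real \<Rightarrow> real \<Rightarrow> real \<Rightarrow> (int \<Rightarrow> 'a \<Rightarrow> real) \<Rightarrow> bool" where
  "bilinear_solution M \<epsilon> \<mu> \<phi> b Y \<longleftrightarrow>
     (\<forall>t. AE \<omega> in M. Y t \<omega> = \<mu> + \<phi> * Y (t - 2) \<omega> + b * Y (t - 2) \<omega> * \<epsilon> (t - 1) \<omega> + \<epsilon> t \<omega>)"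

section \<open>Weak convergence and the normal law on Euclidean space\<close>

definition converges_in_distribution ::
  "'a measure \<Rightarrow> (nat \<Rightarrow> 'a \<Rightarrow> 'b::euclidean_space) \<Rightarrow> 'b measure \<Rightarrow> bool" where
  "converges_in_distribution M X N \<longleftrightarrow>
     (\<forall>f :: 'b \<Rightarrow> real. continuous_on UNIV f \<longrightarrow> bounded (range f) \<longrightarrow>
        (\<lambda>n. \<integral>\<omega>. f (X n \<omega>) \<partial>M) \<longlonglongrightarrow> (\<integral>x. f x \<partial>N))"

text \<open>Normal laws with mean \<open>m\<close> and variance \<open>v\<close>; they are point masses if \<open>v = 0\<close>.\<close>

definition normal_law :: "real \<Rightarrow> real \<Rightarrow> real measure" where
  "normal_law m v =
     (if v = 0 then return borel m else density lborel (\<lambda>x. ennreal (normal_density m (sqrt v) x)))"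

text \<open>
  \<open>N\<close> is the law \<open>N(m, V)\<close> if every linear functional \<open>u\<close> is normal with mean \<open>u \<bullet> m\<close>
  and variance \<open>u \<bullet> V u\<close>. The matrix \<open>V\<close> may be singular. This
  determines \<open>N\<close>, and such an \<open>N\<close> exists exactly if \<open>V\<close> is symmetric and positive semidefinite.
\<close>

definition is_normal_law :: "(real ^ 'n) measure \<Rightarrow> real ^ 'n \<Rightarrow> real ^ 'n ^ 'n \<Rightarrow> bool" where
  "is_normal_law N m V \<longleftrightarrow>
     prob_space N \<and> sets N = sets borel \<and> transpose V = V \<and>
     (\<forall>u. 0 \<le> u \<bullet> (V *v u) \<and>
          distr N borel (\<lambda>x. u \<bullet> x) = normal_law (u \<bullet> m) (u \<bullet> (V *v u)))"

section \<open>Quasi-likelihood\<close>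

text \<open>
  A parameter is \<open>\<theta> = (\<mu>, \<phi>, \<sigma>\<^sup>2, b\<^sup>2)\<close>: the coordinates \<open>\<theta> $ 3\<close> and \<open>\<theta> $ 4\<close> are
  the squares themselves.
\<close>

definition cond_var :: "(int \<Rightarrow> 'a \<Rightarrow> real) \<Rightarrow> int \<Rightarrow> real ^ 4 \<Rightarrow> 'a \<Rightarrow> real" where
  "cond_var Y t \<theta> \<omega> = \<theta> $ 3 * (1 + \<theta> $ 4 * (Y (t - 2) \<omega>)\<^sup>2)"

definition quasi_ll :: "(int \<Rightarrow> 'a \<Rightarrow> real) \<Rightarrow> int \<Rightarrow> real ^ 4 \<Rightarrow> 'a \<Rightarrow> real" where
  "quasi_ll Y t \<theta> \<omega> =
     - (1 / 2) * (ln (cond_var Y t \<theta> \<omega>)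
        + (Y t \<omega> - \<theta> $ 1 - \<theta> $ 2 * Y (t - 2) \<omega>)\<^sup>2 / cond_var Y t \<theta> \<omega>)"

definition total_quasi_ll :: "(int \<Rightarrow> 'a \<Rightarrow> real) \<Rightarrow> nat \<Rightarrow> real ^ 4 \<Rightarrow> 'a \<Rightarrow> real" where
  "total_quasi_ll Y n \<theta> \<omega> = (\<Sum>t = 1..int n. quasi_ll Y t \<theta> \<omega>)"

definition gradient :: "('b::real_inner \<Rightarrow> real) \<Rightarrow> 'b \<Rightarrow> 'b" where
  "gradient f x = (THE D. GDERIV f x :> D)"

definition score :: "(int \<Rightarrow> 'a \<Rightarrow> real) \<Rightarrow> int \<Rightarrow> real ^ 4 \<Rightarrow> 'a \<Rightarrow> real ^ 4" where
  "score Y t \<theta> \<omega> = gradient (\<lambda>\<theta>'. quasi_ll Y t \<theta>' \<omega>) \<theta>"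

section \<open>The matrices of the limit law\<close>

definition outer :: "real ^ 'n \<Rightarrow> real ^ 'n ^ 'n" where
  "outer v = (columnvector v :: real ^ 1 ^ 'n) ** (rowvector v :: real ^ 'n ^ 1)"

definition Omega :: "'a measure \<Rightarrow> (int \<Rightarrow> 'a \<Rightarrow> real) \<Rightarrow> int \<Rightarrow> real ^ 4 \<Rightarrow> real ^ 4 ^ 4" where
  "Omega M Y t \<theta> =
     (\<integral>\<omega>. outer (score Y t \<theta> \<omega> + score Y (t - 1) \<theta> \<omega>) \<partial>M) - (\<integral>\<omega>. outer (score Y t \<theta> \<omega>) \<partial>M)"

definition Sigma1 :: "'a measure \<Rightarrow> (int \<Rightarrow> 'a \<Rightarrow> real) \<Rightarrow> int \<Rightarrow> real ^ 4 \<Rightarrow> real ^ 2 ^ 2" where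
  "Sigma1 M Y t \<theta> =
     (\<integral>\<omega>. (1 / cond_var Y t \<theta> \<omega>) *\<^sub>R
             vector [vector [1, Y (t - 2) \<omega>],
                     vector [Y (t - 2) \<omega>, (Y (t - 2) \<omega>)\<^sup>2]] \<partial>M)"

definition Sigma2 :: "'a measure \<Rightarrow> (int \<Rightarrow> 'a \<Rightarrow> real) \<Rightarrow> int \<Rightarrow> real ^ 4 \<Rightarrow> real ^ 2 ^ 2" where
  "Sigma2 M Y t \<theta> =
     (\<integral>\<omega>. vector
        [vector [1 / (2 * (\<theta> $ 3)\<^sup>2),
                 (Y (t - 2) \<omega>)\<^sup>2 / (2 * cond_var Y t \<theta> \<omega>)],
         vector [(Y (t - 2) \<omega>)\<^sup>2 / (2 * cond_var Y t \<theta> \<omega>),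
                 (Y (t - 2) \<omega>) ^ 4 / (2 * (1 + \<theta> $ 4 * (Y (t - 2) \<omega>)\<^sup>2)\<^sup>2)]] \<partial>M)"

definition block_diag :: "real ^ 2 ^ 2 \<Rightarrow> real ^ 2 ^ 2 \<Rightarrow> real ^ 4 ^ 4" where
  "block_diag A B =
     vector [vector [A $ 1 $ 1, A $ 1 $ 2, 0, 0],
             vector [A $ 2 $ 1, A $ 2 $ 2, 0, 0],
             vector [0, 0, B $ 1 $ 1, B $ 1 $ 2],
             vector [0, 0, B $ 2 $ 1, B $ 2 $ 2]]"

definition Sigma_mat :: "'a measure \<Rightarrow> (int \<Rightarrow> 'a \<Rightarrow> real) \<Rightarrow> int \<Rightarrow> real ^ 4 \<Rightarrow> real ^ 4 ^ 4" where
  "Sigma_mat M Y t \<theta> = block_diag (Sigma1 M Y t \<theta>) (Sigma2 M Y t \<theta>)"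

lemma vector_4 [simp]:
  fixes a b c d :: "'a::zero"
  shows "(vector [a, b, c, d] :: 'a ^ 4) $ 1 = a"
    "(vector [a, b, c, d] :: 'a ^ 4) $ 2 = b"
    "(vector [a, b, c, d] :: 'a ^ 4) $ 3 = c"
    "(vector [a, b, c, d] :: 'a ^ 4) $ 4 = d"
  unfolding vector_def by simp_all

end

theory Submission
  imports Defs
begin

text \<open>Under the log-moment condition some moment \<open>E|\<phi> + b \<epsilon>|\<^sup>d\<close> with \<open>d > 0\<close> is less than 1, so the
  stationary solution is almost surely a causal function of the innovations that is approximated
  exponentially fast by functions of finitely many of them. The increments of \<open>\<ell>\<^sub>t\<close> are bounded Lipschitz
  functions of \<open>Y\<^sub>t\<^sub>-\<^sub>2\<close> times polynomials of degree two in \<open>\<epsilon>\<^sub>t\<^sub>-\<^sub>1, \<epsilon>\<^sub>t\<close>, so their covariances decay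
  exponentially and satisfy a strong law of large numbers; this and the positivity of the Kullback
  divergence give consistency by compactness.

  The score is uncorrelated with everything up to time \<open>t - 2\<close>, so only neighbouring scores are correlated,
  which produces \<open>\<Omega>\<close>; a blocking argument yields its central limit theorem. A quadratic expansion of
  \<open>L\<^sub>n\<close> around \<open>\<theta>\<^sub>0\<close> with Hessian \<open>- n \<Sigma>\<close>, uniform on a neighbourhood, shows that \<open>sqrt n (\<theta>hat\<^sub>n - \<theta>\<^sub>0)\<close> is close to
  \<open>\<Sigma>\<^sup>-\<^sup>1\<close> times the normalized score.\<close>

section \<open>Square integrable random variables\<close>

text \<open>The obstacle behind most choices is that the log-moment condition gives \<open>Y\<close>
  only moments of some small positive order, so not even a mean of \<open>Y\<close> is available.
  The replacement is that the fourth coordinate of every admissible parameter is positive: the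
  conditional standard deviation then grows linearly in the lagged value, all standardized
  quantities are bounded and Lipschitz in it, and only the two innovations have to carry moments.
  Squares of polynomials of degree two in them are integrable by the fourth moment, so all limit
  theorems can live in L^2. The score at time t involves the innovations at both t - 1 and t and is
  no martingale difference for the natural filtration; this is why blocks are used. Single
  log-variances are unbounded in \<open>Y\<close>, but the difference for two parameters is bounded;
  the criterion is therefore always compared with its value at the true parameter. Identifiability
  and positive definiteness of the information matrix rest on one fact: neither 1 and
  \<open>Y\<close> nor 1 and the square of \<open>Y\<close> are linearly dependent almost
  surely.\<close>

context prob_space
begin

lemma integrable_mult_L2:
  fixes f g :: "'a \<Rightarrow> real"
  assumes [measurable]: "f \<in> borel_measurable M" "g \<in> borel_measurable M"
    and "integrable M (\<lambda>x. (f x)\<^sup>2)" "integrable M (\<lambda>x. (g x)\<^sup>2)"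
  shows "integrable M (\<lambda>x. f x * g x)"
proof (rule Bochner_Integration.integrable_bound)
  show "integrable M (\<lambda>x. (f x)\<^sup>2 + (g x)\<^sup>2)" using assms by auto
  show "AE x in M. norm (f x * g x) \<le> norm ((f x)\<^sup>2 + (g x)\<^sup>2)"
  proof (intro AE_I2)
    fix x
    have "\<bar>f x * g x\<bar> \<le> (f x)\<^sup>2 + (g x)\<^sup>2"
      using zero_le_power2[of "\<bar>f x\<bar> - \<bar>g x\<bar>"] mult_nonneg_nonneg[of "\<bar>f x\<bar>" "\<bar>g x\<bar>"]
      by (simp add: power2_diff abs_mult mult.assoc del: mult_nonneg_nonneg)
    then show "norm (f x * g x) \<le> norm ((f x)\<^sup>2 + (g x)\<^sup>2)" by simp
  qed
qed measurable

lemma integrable_add_L2: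
  fixes f g :: "'a \<Rightarrow> real"
  assumes [measurable]: "f \<in> borel_measurable M" "g \<in> borel_measurable M"
    and "integrable M (\<lambda>x. (f x)\<^sup>2)" "integrable M (\<lambda>x. (g x)\<^sup>2)"
  shows "integrable M (\<lambda>x. (f x + g x)\<^sup>2)"
  using assms integrable_mult_L2[of f g] by (auto simp: power2_sum mult.assoc)

lemma integrable_diff_L2:
  fixes f g :: "'a \<Rightarrow> real"
  assumes [measurable]: "f \<in> borel_measurable M" "g \<in> borel_measurable M"
    and "integrable M (\<lambda>x. (f x)\<^sup>2)" "integrable M (\<lambda>x. (g x)\<^sup>2)"
  shows "integrable M (\<lambda>x. (f x - g x)\<^sup>2)"
  using assms integrable_mult_L2[of f g] by (auto simp: power2_diff mult.assoc)

lemma integrable_sum_L2: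
  fixes f :: "'i \<Rightarrow> 'a \<Rightarrow> real"
  assumes "finite A" "\<And>i. i \<in> A \<Longrightarrow> f i \<in> borel_measurable M"
    "\<And>i. i \<in> A \<Longrightarrow> integrable M (\<lambda>x. (f i x)\<^sup>2)"
  shows "integrable M (\<lambda>x. (\<Sum>i\<in>A. f i x)\<^sup>2)"
  using assms
proof (induction A rule: finite_induct)
  case (insert a A)
  then show ?case by (simp, intro integrable_add_L2) auto
qed simp

lemma integrable_L2:
  fixes f :: "'a \<Rightarrow> real"
  assumes "f \<in> borel_measurable M" "integrable M (\<lambda>x. (f x)\<^sup>2)"
  shows "integrable M f"
  using integrable_mult_L2[of f "\<lambda>_. 1"] assms by simp

lemma Cauchy_Schwarz_expectation:
  fixes f g :: "'a \<Rightarrow> real"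
  assumes [measurable]: "f \<in> borel_measurable M" "g \<in> borel_measurable M"
    and f: "integrable M (\<lambda>x. (f x)\<^sup>2)" and g: "integrable M (\<lambda>x. (g x)\<^sup>2)"
  shows "\<bar>expectation (\<lambda>x. f x * g x)\<bar>
           \<le> sqrt (expectation (\<lambda>x. (f x)\<^sup>2)) * sqrt (expectation (\<lambda>x. (g x)\<^sup>2))"
proof -
  define a b c where "a = expectation (\<lambda>x. (f x)\<^sup>2)" and "b = expectation (\<lambda>x. f x * g x)"
    and "c = expectation (\<lambda>x. (g x)\<^sup>2)"
  have fg: "integrable M (\<lambda>x. f x * g x)" by (rule integrable_mult_L2) (use assms in auto)
  have nonneg: "0 \<le> a * s\<^sup>2 + 2 * b * s * r + c * r\<^sup>2" for s r
  proof -
    have "0 \<le> expectation (\<lambda>x. (s * f x + r * g x)\<^sup>2)" by simp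
    also have "(\<lambda>x. (s * f x + r * g x)\<^sup>2) = (\<lambda>x. s\<^sup>2 * (f x)\<^sup>2 + 2 * s * r * (f x * g x) + r\<^sup>2 * (g x)\<^sup>2)"
      by (auto simp: power2_eq_square algebra_simps)
    also have "expectation \<dots> = s\<^sup>2 * a + 2 * s * r * b + r\<^sup>2 * c"
      using f g fg by (simp add: a_def b_def c_def)
    finally show ?thesis by (simp add: algebra_simps)
  qed
  have a0: "0 \<le> a" and c0: "0 \<le> c" by (simp_all add: a_def c_def)
  have "b\<^sup>2 \<le> a * c"
  proof (cases "c = 0")
    case True
    have "b = 0"
    proof (rule ccontr)
      assume "b \<noteq> 0"
      \<comment> \<open>For \<open>c = 0\<close> the form is affine in \<open>r\<close>; this choice
        of \<open>r\<close> gives it the value -1.\<close>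
      then show False using nonneg[of 1 "- (a + 1) / (2 * b)"] True a0 by (simp add: field_simps)
    qed
    then show ?thesis using a0 c0 by simp
  next
    case False
    have "0 \<le> c * (a * c - b\<^sup>2)" using nonneg[of c "- b"] by (simp add: power2_eq_square algebra_simps)
    then show ?thesis using False c0 by (simp add: zero_le_mult_iff)
  qed
  then have "\<bar>b\<bar> \<le> sqrt (a * c)" by (metis real_sqrt_abs real_sqrt_le_mono)
  then show ?thesis by (simp add: a_def b_def c_def real_sqrt_mult)
qed

lemma expectation_abs_le_sqrt:
  fixes f :: "'a \<Rightarrow> real"
  assumes [measurable]: "f \<in> borel_measurable M" and "integrable M (\<lambda>x. (f x)\<^sup>2)"
  shows "expectation (\<lambda>x. \<bar>f x\<bar>) \<le> sqrt (expectation (\<lambda>x. (f x)\<^sup>2))"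
proof -
  have "\<bar>expectation (\<lambda>x. \<bar>f x\<bar> * 1)\<bar> \<le> sqrt (expectation (\<lambda>x. \<bar>f x\<bar>\<^sup>2)) * sqrt (expectation (\<lambda>x. 1\<^sup>2))"
    by (rule Cauchy_Schwarz_expectation) (use assms in auto)
  then show ?thesis by (simp add: prob_space)
qed

lemma expectation_square_sum_orthogonal:
  fixes f :: "'i \<Rightarrow> 'a \<Rightarrow> real"
  assumes "finite A" and m: "\<And>i. i \<in> A \<Longrightarrow> f i \<in> borel_measurable M"
    and sq: "\<And>i. i \<in> A \<Longrightarrow> integrable M (\<lambda>x. (f i x)\<^sup>2)"
    and orth: "\<And>i j. i \<in> A \<Longrightarrow> j \<in> A \<Longrightarrow> i \<noteq> j \<Longrightarrow> expectation (\<lambda>x. f i x * f j x) = 0"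
  shows "expectation (\<lambda>x. (\<Sum>i\<in>A. f i x)\<^sup>2) = (\<Sum>i\<in>A. expectation (\<lambda>x. (f i x)\<^sup>2))"
  using assms
proof (induction A rule: finite_induct)
  case (insert a A)
  have int: "integrable M (\<lambda>x. (\<Sum>i\<in>A. f i x)\<^sup>2)" "integrable M (\<lambda>x. (f a x)\<^sup>2)"
    by (intro integrable_sum_L2 insert(1)) (use insert in auto)
  have cross: "expectation (\<lambda>x. f a x * (\<Sum>i\<in>A. f i x)) = 0"
    "integrable M (\<lambda>x. f a x * (\<Sum>i\<in>A. f i x))"
  proof -
    have i: "integrable M (\<lambda>x. f a x * f i x)" if "i \<in> A" for i
      by (rule integrable_mult_L2) (use insert that in auto)
    have "expectation (\<lambda>x. f a x * (\<Sum>i\<in>A. f i x)) = (\<Sum>i\<in>A. expectation (\<lambda>x. f a x * f i x))"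
      using i by (simp add: sum_distrib_left)
    also have "\<dots> = 0" using insert by (intro sum.neutral) auto
    finally show "expectation (\<lambda>x. f a x * (\<Sum>i\<in>A. f i x)) = 0" .
    show "integrable M (\<lambda>x. f a x * (\<Sum>i\<in>A. f i x))"
      using i by (simp add: sum_distrib_left)
  qed
  have "expectation (\<lambda>x. (\<Sum>i\<in>insert a A. f i x)\<^sup>2)
      = expectation (\<lambda>x. (f a x)\<^sup>2 + (\<Sum>i\<in>A. f i x)\<^sup>2 + 2 * (f a x * (\<Sum>i\<in>A. f i x)))"
    using insert(1,2) by (simp add: power2_sum mult.assoc)
  also have "\<dots> = expectation (\<lambda>x. (f a x)\<^sup>2) + expectation (\<lambda>x. (\<Sum>i\<in>A. f i x)\<^sup>2)"
    using int cross by simp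
  finally show ?case using insert by simp
qed simp

text \<open>Splitting the index set into even and odd indices yields two orthogonal families.\<close>

lemma expectation_square_sum_lag2:
  fixes f :: "nat \<Rightarrow> 'a \<Rightarrow> real"
  assumes "finite A" and m: "\<And>i. i \<in> A \<Longrightarrow> f i \<in> borel_measurable M"
    and sq: "\<And>i. i \<in> A \<Longrightarrow> integrable M (\<lambda>x. (f i x)\<^sup>2)"
    and orth: "\<And>i j. i \<in> A \<Longrightarrow> j \<in> A \<Longrightarrow> i + 2 \<le> j \<Longrightarrow> expectation (\<lambda>x. f i x * f j x) = 0"
  shows "expectation (\<lambda>x. (\<Sum>i\<in>A. f i x)\<^sup>2) \<le> 2 * (\<Sum>i\<in>A. expectation (\<lambda>x. (f i x)\<^sup>2))"
proof -
  let ?E = "{i\<in>A. even i}" and ?O = "{i\<in>A. odd i}"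
  have orth': "expectation (\<lambda>x. f i x * f j x) = 0" if "i \<in> A" "j \<in> A" "i \<noteq> j" "even i = even j" for i j
  proof (cases "i < j")
    case True
    then have "i + 2 \<le> j" using that by presburger
    then show ?thesis using orth that by blast
  next
    case False
    then have "j + 2 \<le> i" using that by presburger
    then show ?thesis using orth[of j i] that by (simp add: mult.commute)
  qed
  have e: "expectation (\<lambda>x. (\<Sum>i\<in>?E. f i x)\<^sup>2) = (\<Sum>i\<in>?E. expectation (\<lambda>x. (f i x)\<^sup>2))"
    and o: "expectation (\<lambda>x. (\<Sum>i\<in>?O. f i x)\<^sup>2) = (\<Sum>i\<in>?O. expectation (\<lambda>x. (f i x)\<^sup>2))"
    by (rule expectation_square_sum_orthogonal; use assms orth' in auto)+
  have ie: "integrable M (\<lambda>x. (\<Sum>i\<in>?E. f i x)\<^sup>2)" and io: "integrable M (\<lambda>x. (\<Sum>i\<in>?O. f i x)\<^sup>2)"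
    by (rule integrable_sum_L2; use assms in auto)+
  have split: "(\<Sum>i\<in>A. h i) = (\<Sum>i\<in>?E. h i) + (\<Sum>i\<in>?O. h i)" for h :: "nat \<Rightarrow> real"
  proof -
    have "A = ?E \<union> ?O" by auto
    then show ?thesis using assms(1) by (metis (no_types, lifting) sum.union_disjoint finite_Un disjoint_iff mem_Collect_eq)
  qed
  have "expectation (\<lambda>x. (\<Sum>i\<in>A. f i x)\<^sup>2)
      \<le> expectation (\<lambda>x. 2 * (\<Sum>i\<in>?E. f i x)\<^sup>2 + 2 * (\<Sum>i\<in>?O. f i x)\<^sup>2)"
  proof (rule integral_mono)
    show "integrable M (\<lambda>x. (\<Sum>i\<in>A. f i x)\<^sup>2)" by (rule integrable_sum_L2) (use assms in auto)
    show "integrable M (\<lambda>x. 2 * (\<Sum>i\<in>?E. f i x)\<^sup>2 + 2 * (\<Sum>i\<in>?O. f i x)\<^sup>2)" using ie io by simp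
    show "(\<Sum>i\<in>A. f i x)\<^sup>2 \<le> 2 * (\<Sum>i\<in>?E. f i x)\<^sup>2 + 2 * (\<Sum>i\<in>?O. f i x)\<^sup>2" for x
      unfolding split[of "\<lambda>i. f i x"]
      using zero_le_power2[of "(\<Sum>i\<in>?E. f i x) - (\<Sum>i\<in>?O. f i x)"]
      by (simp add: power2_sum power2_diff)
  qed
  also have "\<dots> = 2 * (\<Sum>i\<in>A. expectation (\<lambda>x. (f i x)\<^sup>2))"
    using ie io e o split[of "\<lambda>i. expectation (\<lambda>x. (f i x)\<^sup>2)"] by simp
  finally show ?thesis .
qed

section \<open>A strong law of large numbers in \<open>L\<^sup>2\<close>\<close>

text \<open>The series of the squares has finite expectation, hence is almost surely finite, and the
  terms of a convergent series tend to 0.\<close>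

lemma AE_tendsto_0_if_summable_L2:
  fixes Z :: "nat \<Rightarrow> 'a \<Rightarrow> real"
  assumes [measurable]: "\<And>n. Z n \<in> borel_measurable M"
    and sq: "\<And>n. integrable M (\<lambda>x. (Z n x)\<^sup>2)"
    and s: "summable (\<lambda>n. expectation (\<lambda>x. (Z n x)\<^sup>2))"
  shows "AE x in M. (\<lambda>n. Z n x) \<longlonglongrightarrow> 0"
proof -
  have "(\<integral>\<^sup>+x. (\<Sum>n. ennreal ((Z n x)\<^sup>2)) \<partial>M) = (\<Sum>n. \<integral>\<^sup>+x. ennreal ((Z n x)\<^sup>2) \<partial>M)"
    by (intro nn_integral_suminf) measurable
  also have "\<dots> = (\<Sum>n. ennreal (expectation (\<lambda>x. (Z n x)\<^sup>2)))"
    using sq by (intro suminf_cong nn_integral_eq_integral) auto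
  also have "\<dots> = ennreal (\<Sum>n. expectation (\<lambda>x. (Z n x)\<^sup>2))"
    by (intro suminf_ennreal2 s) simp
  also have "\<dots> \<noteq> \<infinity>" by simp
  finally have "AE x in M. (\<Sum>n. ennreal ((Z n x)\<^sup>2)) \<noteq> \<infinity>"
    by (intro nn_integral_PInf_AE) measurable
  then show ?thesis
  proof eventually_elim
    case (elim x)
    then have "summable (\<lambda>n. (Z n x)\<^sup>2)" by (intro summable_suminf_not_top) auto
    then have "(\<lambda>n. (Z n x)\<^sup>2) \<longlonglongrightarrow> 0" by (rule summable_LIMSEQ_zero)
    then have "(\<lambda>n. sqrt ((Z n x)\<^sup>2)) \<longlonglongrightarrow> sqrt 0" by (rule tendsto_real_sqrt)
    then show ?case by (simp add: tendsto_rabs_zero_iff)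
  qed
qed

text \<open>Convergence holds along the squares by summability; between consecutive squares the
  sums move by less than the sum of the absolute values.\<close>

lemma strong_law_L2:
  fixes X :: "nat \<Rightarrow> 'a \<Rightarrow> real"
  assumes m[measurable]: "\<And>i. X i \<in> borel_measurable M"
    and sq: "\<And>i. integrable M (\<lambda>x. (X i x)\<^sup>2)"
    and C: "\<And>i. expectation (\<lambda>x. (X i x)\<^sup>2) \<le> C"
    and S: "\<And>n. expectation (\<lambda>x. (\<Sum>i<n. X i x)\<^sup>2) \<le> C * real n"
  shows "AE x in M. (\<lambda>n. (\<Sum>i<n. X i x) / real n) \<longlonglongrightarrow> 0"
proof -
  have C0: "0 \<le> C" by (rule order_trans[OF _ C[of 0]]) simp
  have inv: "summable (\<lambda>n. c * inverse (real n ^ 2))" for c :: real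
    by (intro summable_mult inverse_power_summable) auto
  define Z where "Z n x = (\<Sum>i<n\<^sup>2. X i x) / real (n\<^sup>2)" for n x
  define D where "D n x = (\<Sum>i\<in>{n\<^sup>2..<(Suc n)\<^sup>2}. \<bar>X i x\<bar>) / real (n\<^sup>2)" for n x
  have Zsq: "integrable M (\<lambda>x. (Z n x)\<^sup>2)" for n
    unfolding Z_def power_divide using sq by (intro integrable_divide integrable_sum_L2) auto
  have Dsq: "integrable M (\<lambda>x. (D n x)\<^sup>2)" for n
    unfolding D_def power_divide using sq by (intro integrable_divide integrable_sum_L2) auto
  have "AE x in M. (\<lambda>n. Z n x) \<longlonglongrightarrow> 0"
  proof (rule AE_tendsto_0_if_summable_L2)
    show "Z n \<in> borel_measurable M" for n unfolding Z_def by measurable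
    show "integrable M (\<lambda>x. (Z n x)\<^sup>2)" for n by (rule Zsq)
    have "expectation (\<lambda>x. (Z n x)\<^sup>2) \<le> C * inverse (real n ^ 2)" for n
    proof -
      have "expectation (\<lambda>x. (Z n x)\<^sup>2) = expectation (\<lambda>x. (\<Sum>i<n\<^sup>2. X i x)\<^sup>2) / (real (n\<^sup>2))\<^sup>2"
        unfolding Z_def power_divide by simp
      also have "\<dots> \<le> C * real (n\<^sup>2) / (real (n\<^sup>2))\<^sup>2" by (intro divide_right_mono S) simp
      also have "\<dots> = C * inverse (real n ^ 2)" by (simp add: field_simps power2_eq_square)
      finally show ?thesis .
    qed
    then show "summable (\<lambda>n. expectation (\<lambda>x. (Z n x)\<^sup>2))"
      by (intro summable_comparison_test'[OF inv[of C], of 0]) simp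
  qed
  moreover have "AE x in M. (\<lambda>n. D n x) \<longlonglongrightarrow> 0"
  proof (rule AE_tendsto_0_if_summable_L2)
    show "D n \<in> borel_measurable M" for n unfolding D_def by measurable
    show "integrable M (\<lambda>x. (D n x)\<^sup>2)" for n by (rule Dsq)
    have "expectation (\<lambda>x. (D n x)\<^sup>2) \<le> (9 * C) * inverse (real n ^ 2)" if "n \<ge> 1" for n
    proof -
      define B where "B = {n\<^sup>2..<(Suc n)\<^sup>2}"
      have cB: "real (card B) = 2 * real n + 1" by (simp add: B_def power2_eq_square)
      have "expectation (\<lambda>x. (D n x)\<^sup>2) = expectation (\<lambda>x. (\<Sum>i\<in>B. \<bar>X i x\<bar>)\<^sup>2) / (real (n\<^sup>2))\<^sup>2"
        unfolding D_def B_def power_divide by simp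
      also have "\<dots> \<le> C * (3 * real n)\<^sup>2 / (real (n\<^sup>2))\<^sup>2"
      proof (rule divide_right_mono)
        \<comment> \<open>Cauchy-Schwarz over the \<open>2 * n + 1\<close> indices between
          consecutive squares; \<open>2 * n + 1 <= 3 * n\<close> for \<open>n >= 1\<close> is the
          origin of the constant 9.\<close>
        have "expectation (\<lambda>x. (\<Sum>i\<in>B. \<bar>X i x\<bar>)\<^sup>2)
            \<le> expectation (\<lambda>x. real (card B) * (\<Sum>i\<in>B. (X i x)\<^sup>2))"
        proof (rule integral_mono)
          show "integrable M (\<lambda>x. (\<Sum>i\<in>B. \<bar>X i x\<bar>)\<^sup>2)"
            using sq by (intro integrable_sum_L2) (auto simp: B_def)
          show "integrable M (\<lambda>x. real (card B) * (\<Sum>i\<in>B. (X i x)\<^sup>2))" using sq by simp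
          show "(\<Sum>i\<in>B. \<bar>X i x\<bar>)\<^sup>2 \<le> real (card B) * (\<Sum>i\<in>B. (X i x)\<^sup>2)" for x
            using sum_squared_le_sum_of_squares[of "\<lambda>i. \<bar>X i x\<bar>" B]
            by (simp add: mult.commute)
        qed
        also have "\<dots> = real (card B) * (\<Sum>i\<in>B. expectation (\<lambda>x. (X i x)\<^sup>2))" using sq by simp
        also have "\<dots> \<le> real (card B) * (\<Sum>i\<in>B. C)"
          by (intro mult_left_mono sum_mono C) auto
        also have "\<dots> = C * (2 * real n + 1)\<^sup>2" by (simp add: cB power2_eq_square)
        also have "\<dots> \<le> C * (3 * real n)\<^sup>2" using that C0 by (intro mult_left_mono power_mono) auto
        finally show "expectation (\<lambda>x. (\<Sum>i\<in>B. \<bar>X i x\<bar>)\<^sup>2) \<le> C * (3 * real n)\<^sup>2" .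
      qed simp
      also have "\<dots> = (9 * C) * inverse (real n ^ 2)" by (simp add: field_simps power2_eq_square)
      finally show ?thesis .
    qed
    then show "summable (\<lambda>n. expectation (\<lambda>x. (D n x)\<^sup>2))"
      by (intro summable_comparison_test'[OF inv[of "9 * C"], of 1]) simp
  qed
  ultimately show ?thesis
  proof eventually_elim
    case (elim x)
    \<comment> \<open>The integer square root, so that \<open>n\<close> lies between the square of
      \<open>q n\<close> and the next square.\<close>
    define q where "q n = nat \<lfloor>sqrt (real n)\<rfloor>" for n
    have q1: "(q n)\<^sup>2 \<le> n" and q2: "n < (Suc (q n))\<^sup>2" for n
    proof -
      have "real (q n) \<le> sqrt (real n)" by (simp add: q_def)
      then have "(real (q n))\<^sup>2 \<le> (sqrt (real n))\<^sup>2" by (intro power_mono) auto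
      then have "real ((q n)\<^sup>2) \<le> real n" by simp
      then show "(q n)\<^sup>2 \<le> n" by linarith
      have "sqrt (real n) < real (Suc (q n))" unfolding q_def by linarith
      then have "(sqrt (real n))\<^sup>2 < (real (Suc (q n)))\<^sup>2" by (intro power_strict_mono) auto
      then have "real n < real ((Suc (q n))\<^sup>2)" by (simp only: of_nat_power) simp
      then show "n < (Suc (q n))\<^sup>2" by linarith
    qed
    have qlim: "filterlim q at_top at_top"
      unfolding filterlim_at_top
    proof
      fix k
      have "k \<le> q n" if "n \<ge> k\<^sup>2" for n
      proof (rule ccontr)
        assume "\<not> k \<le> q n"
        then have "(Suc (q n))\<^sup>2 \<le> k\<^sup>2" by (intro power_mono) auto
        then show False using q2[of n] that by linarith
      qed
      then show "\<forall>\<^sub>F n in sequentially. k \<le> q n" by (auto simp: eventually_sequentially)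
    qed
    have "(\<lambda>n. \<bar>Z (q n) x\<bar> + \<bar>D (q n) x\<bar>) \<longlonglongrightarrow> \<bar>0\<bar> + \<bar>0\<bar>"
      by (intro tendsto_add tendsto_rabs filterlim_compose[OF elim(1) qlim] filterlim_compose[OF elim(2) qlim])
    then have lim: "(\<lambda>n. \<bar>Z (q n) x\<bar> + \<bar>D (q n) x\<bar>) \<longlonglongrightarrow> 0" by simp
    show ?case
    proof (rule tendsto_rabs_zero_cancel, rule tendsto_sandwich[OF _ _ tendsto_const lim])
      show "\<forall>\<^sub>F n in sequentially. 0 \<le> \<bar>(\<Sum>i<n. X i x) / real n\<bar>" by simp
      show "\<forall>\<^sub>F n in sequentially. \<bar>(\<Sum>i<n. X i x) / real n\<bar> \<le> \<bar>Z (q n) x\<bar> + \<bar>D (q n) x\<bar>"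
      proof (rule eventually_sequentiallyI[of 1])
        fix n :: nat assume n: "1 \<le> n"
        define k where "k = q n"
        have k1: "k\<^sup>2 \<le> n" "n < (Suc k)\<^sup>2" using q1 q2 by (auto simp: k_def)
        have "k \<ge> 1" using k1 n by (cases k) auto
        then have k2: "0 < real (k\<^sup>2)" by simp
        have "(\<Sum>i<n. X i x) = (\<Sum>i<k\<^sup>2. X i x) + (\<Sum>i\<in>{k\<^sup>2..<n}. X i x)"
          using k1 by (metis (no_types, lifting) lessThan_atLeast0 sum.atLeastLessThan_concat zero_le)
        then have "\<bar>\<Sum>i<n. X i x\<bar> \<le> \<bar>\<Sum>i<k\<^sup>2. X i x\<bar> + \<bar>\<Sum>i\<in>{k\<^sup>2..<n}. X i x\<bar>" by linarith
        also have "\<bar>\<Sum>i\<in>{k\<^sup>2..<n}. X i x\<bar> \<le> (\<Sum>i\<in>{k\<^sup>2..<n}. \<bar>X i x\<bar>)" by (rule sum_abs)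
        also have "\<dots> \<le> (\<Sum>i\<in>{k\<^sup>2..<(Suc k)\<^sup>2}. \<bar>X i x\<bar>)" using k1 by (intro sum_mono2) auto
        finally have "\<bar>\<Sum>i<n. X i x\<bar> / real (k\<^sup>2)
            \<le> (\<bar>\<Sum>i<k\<^sup>2. X i x\<bar> + (\<Sum>i\<in>{k\<^sup>2..<(Suc k)\<^sup>2}. \<bar>X i x\<bar>)) / real (k\<^sup>2)"
          using k2 by (intro divide_right_mono) auto
        also have "\<dots> \<le> \<bar>Z k x\<bar> + \<bar>D k x\<bar>"
          by (simp add: Z_def D_def add_divide_distrib sum_nonneg)
        finally have "\<bar>\<Sum>i<n. X i x\<bar> / real (k\<^sup>2) \<le> \<bar>Z k x\<bar> + \<bar>D k x\<bar>" .
        moreover have "\<bar>(\<Sum>i<n. X i x) / real n\<bar> \<le> \<bar>\<Sum>i<n. X i x\<bar> / real (k\<^sup>2)"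
        proof -
          have "real (k\<^sup>2) \<le> real n" using k1(1) by (rule of_nat_mono)
          then show ?thesis using k2 n unfolding abs_divide abs_of_nat
            by (intro divide_left_mono mult_pos_pos) auto
        qed
        ultimately show "\<bar>(\<Sum>i<n. X i x) / real n\<bar> \<le> \<bar>Z (q n) x\<bar> + \<bar>D (q n) x\<bar>"
          unfolding k_def by linarith
      qed
    qed
  qed
qed

end

section \<open>Functions of independent, identically distributed innovations\<close>

text \<open>Stands for measurability with respect to the innovations with index in \<open>I\<close>.
  It speaks of functionals of the whole path and not of random variables, so that time shifts become
  substitutions in the argument and independence can be read off from disjoint index sets.\<close>

definition depends_on :: "int set \<Rightarrow> ((int \<Rightarrow> real) \<Rightarrow> real) \<Rightarrow> bool" where
  "depends_on I \<Phi> \<longleftrightarrow> \<Phi> \<in> borel_measurable (Pi\<^sub>M UNIV (\<lambda>_. borel)) \<and>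
     (\<forall>e e'. (\<forall>i\<in>I. e i = e' i) \<longrightarrow> \<Phi> e = \<Phi> e')"

lemma depends_on_measurable:
  "depends_on I \<Phi> \<Longrightarrow> \<Phi> \<in> borel_measurable (Pi\<^sub>M UNIV (\<lambda>_. borel))"
  by (simp add: depends_on_def)

lemma depends_on_mono: "depends_on I \<Phi> \<Longrightarrow> I \<subseteq> J \<Longrightarrow> depends_on J \<Phi>"
  unfolding depends_on_def by blast

lemma depends_on_const [simp]: "depends_on I (\<lambda>_. c)"
  by (simp add: depends_on_def)

lemma depends_on_coordinate: "i \<in> I \<Longrightarrow> depends_on I (\<lambda>e. e i)"
  by (simp add: depends_on_def)

lemma depends_on_compose:
  assumes "depends_on I \<Phi>" "g \<in> borel_measurable borel"
  shows "depends_on I (\<lambda>e. g (\<Phi> e))"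
  using assms measurable_compose[of \<Phi> _ borel g borel] unfolding depends_on_def by metis

lemma depends_on_compose3:
  assumes "depends_on I \<Phi>1" "depends_on I \<Phi>2" "depends_on I \<Phi>3"
    and g: "(\<lambda>(x, y, z). g x y z :: real) \<in> borel_measurable (borel \<Otimes>\<^sub>M borel \<Otimes>\<^sub>M borel)"
  shows "depends_on I (\<lambda>e. g (\<Phi>1 e) (\<Phi>2 e) (\<Phi>3 e))"
proof -
  note [measurable] = assms(1-3)[THEN depends_on_measurable]
  have m: "(\<lambda>e. (\<Phi>1 e, \<Phi>2 e, \<Phi>3 e)) \<in> Pi\<^sub>M UNIV (\<lambda>_. borel) \<rightarrow>\<^sub>M borel \<Otimes>\<^sub>M borel \<Otimes>\<^sub>M borel"
    by measurable
  have "g (\<Phi>1 e) (\<Phi>2 e) (\<Phi>3 e) = g (\<Phi>1 e') (\<Phi>2 e') (\<Phi>3 e')" if "\<forall>i\<in>I. e i = e' i" for e e'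
    using assms(1-3) that unfolding depends_on_def by metis
  then show ?thesis
    using measurable_compose[OF m g] unfolding depends_on_def by simp
qed

lemma depends_on_add: "depends_on I \<Phi> \<Longrightarrow> depends_on I \<Psi> \<Longrightarrow> depends_on I (\<lambda>e. \<Phi> e + \<Psi> e)"
  unfolding depends_on_def using borel_measurable_add[of \<Phi> _ \<Psi>] by metis

lemma depends_on_mult: "depends_on I \<Phi> \<Longrightarrow> depends_on I \<Psi> \<Longrightarrow> depends_on I (\<lambda>e. \<Phi> e * \<Psi> e)"
  unfolding depends_on_def using borel_measurable_times[of \<Phi> _ \<Psi>] by metis

lemma depends_on_diff: "depends_on I \<Phi> \<Longrightarrow> depends_on I \<Psi> \<Longrightarrow> depends_on I (\<lambda>e. \<Phi> e - \<Psi> e)"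
  unfolding depends_on_def using borel_measurable_diff[of \<Phi> _ \<Psi>] by metis

lemma depends_on_sum:
  "(\<And>i. i \<in> A \<Longrightarrow> depends_on I (\<Phi> i)) \<Longrightarrow> depends_on I (\<lambda>e. \<Sum>i\<in>A. \<Phi> i e)"
  by (induction A rule: infinite_finite_induct) (auto intro: depends_on_add)

text \<open>Paths that agree on \<open>I\<close> produce the same sequence of values, and
  \<open>lim\<close> is a function of that sequence even where it diverges.\<close>

lemma depends_on_lim:
  fixes \<Phi> :: "nat \<Rightarrow> (int \<Rightarrow> real) \<Rightarrow> real"
  assumes "\<And>m. depends_on I (\<Phi> m)"
  shows "depends_on I (\<lambda>e. lim (\<lambda>m. \<Phi> m e))"
proof -
  have "lim (\<lambda>m. \<Phi> m e) = lim (\<lambda>m. \<Phi> m e')" if "\<forall>i\<in>I. e i = e' i" for e e'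
  proof -
    have "(\<lambda>m. \<Phi> m e) = (\<lambda>m. \<Phi> m e')" using assms that unfolding depends_on_def by blast
    then show ?thesis by simp
  qed
  then show ?thesis
    using assms[THEN depends_on_measurable] unfolding depends_on_def
    by (auto intro!: borel_measurable_lim_metric)
qed

lemma depends_on_factor:
  assumes "depends_on I \<Phi>"
  obtains \<Psi> where "\<Psi> \<in> borel_measurable (Pi\<^sub>M I (\<lambda>_. borel))" "\<And>e. \<Phi> e = \<Psi> (restrict e I)"
proof
  \<comment> \<open>Coordinates outside \<open>I\<close> are filled with 0; by the dependence
    condition this does not change the value of \<open>\<Phi>\<close>.\<close>
  define \<Psi> where "\<Psi> e = \<Phi> (\<lambda>s. if s \<in> I then e s else 0)" for e
  have "(\<lambda>e s. if s \<in> I then e s else 0) \<in> Pi\<^sub>M I (\<lambda>_. borel) \<rightarrow>\<^sub>M Pi\<^sub>M UNIV (\<lambda>_. borel :: real measure)"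
  proof (rule measurable_PiM_single')
    show "(\<lambda>e. if s \<in> I then e s else 0) \<in> borel_measurable (Pi\<^sub>M I (\<lambda>_. borel :: real measure))" for s
      by (cases "s \<in> I") auto
  qed auto
  then show "\<Psi> \<in> borel_measurable (Pi\<^sub>M I (\<lambda>_. borel))"
    unfolding \<Psi>_def using depends_on_measurable[OF assms] by (rule measurable_compose)
  show "\<Phi> e = \<Psi> (restrict e I)" for e
  proof -
    have "\<And>e e'. (\<forall>i\<in>I. e i = e' i) \<Longrightarrow> \<Phi> e = \<Phi> e'"
      using assms unfolding depends_on_def by blast
    from this[of e "\<lambda>s. if s \<in> I then restrict e I s else 0"] show ?thesis
      unfolding \<Psi>_def by simp
  qed
qed

locale innovations = prob_space M for M :: "'a measure" +
  fixes \<epsilon> :: "int \<Rightarrow> 'a \<Rightarrow> real"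
  assumes indep: "indep_vars (\<lambda>_. borel) \<epsilon> UNIV"
    and ident: "\<And>s t. distr M borel (\<epsilon> s) = distr M borel (\<epsilon> t)"
begin

definition path :: "'a \<Rightarrow> int \<Rightarrow> real" where
  "path \<omega> = (\<lambda>s. \<epsilon> s \<omega>)"

lemma measurable_innovation [measurable]: "\<epsilon> s \<in> borel_measurable M"
  using indep by (auto simp: indep_vars_def)

lemma measurable_path [measurable]: "path \<in> M \<rightarrow>\<^sub>M Pi\<^sub>M UNIV (\<lambda>_. borel)"
  unfolding path_def by (rule measurable_PiM_single') auto

lemma measurable_path_compose:
  "depends_on I \<Phi> \<Longrightarrow> (\<lambda>\<omega>. \<Phi> (path \<omega>)) \<in> borel_measurable M"
  by (rule measurable_compose[OF measurable_path depends_on_measurable])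

lemma indep_var_depends_on:
  assumes "depends_on I \<Phi>" "depends_on J \<Psi>" "I \<inter> J = {}"
  shows "indep_var borel (\<lambda>\<omega>. \<Phi> (path \<omega>)) borel (\<lambda>\<omega>. \<Psi> (path \<omega>))"
proof -
  obtain f where f: "f \<in> borel_measurable (Pi\<^sub>M I (\<lambda>_. borel))" "\<And>e. \<Phi> e = f (restrict e I)"
    using depends_on_factor[OF assms(1)] by metis
  obtain g where g: "g \<in> borel_measurable (Pi\<^sub>M J (\<lambda>_. borel))" "\<And>e. \<Psi> e = g (restrict e J)"
    using depends_on_factor[OF assms(2)] by metis
  have "indep_var borel (f \<circ> (\<lambda>\<omega>. restrict (\<lambda>i. \<epsilon> i \<omega>) I)) borel (g \<circ> (\<lambda>\<omega>. restrict (\<lambda>i. \<epsilon> i \<omega>) J))"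
    by (rule indep_var_compose[OF indep_var_restrict[OF indep assms(3)] f(1) g(1)]) auto
  then show ?thesis by (simp add: comp_def f(2) g(2) path_def)
qed

lemma indep_vars_depends_on:
  assumes "\<And>j :: nat. depends_on (K j) (\<Phi> j)" "disjoint_family K"
  shows "indep_vars (\<lambda>_. borel) (\<lambda>j \<omega>. \<Phi> j (path \<omega>)) UNIV"
proof -
  have "\<exists>f. f \<in> borel_measurable (Pi\<^sub>M (K j) (\<lambda>_. borel)) \<and> (\<forall>e. \<Phi> j e = f (restrict e (K j)))" for j
    using depends_on_factor[OF assms(1)[of j]] by metis
  then obtain f where f: "\<And>j. f j \<in> borel_measurable (Pi\<^sub>M (K j) (\<lambda>_. borel))"
    "\<And>j e. \<Phi> j e = f j (restrict e (K j))" by metis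
  have "indep_vars (\<lambda>j. Pi\<^sub>M (K j) (\<lambda>_. borel)) (\<lambda>j \<omega>. restrict (\<lambda>i. \<epsilon> i \<omega>) (K j)) UNIV"
    by (rule indep_vars_restrict[OF indep _ assms(2)]) auto
  then have "indep_vars (\<lambda>_. borel) (\<lambda>j \<omega>. f j (restrict (\<lambda>i. \<epsilon> i \<omega>) (K j))) UNIV"
    by (rule indep_vars_compose2) (use f in auto)
  then show ?thesis by (simp add: f(2) path_def)
qed

lemma
  assumes "depends_on I \<Phi>" "depends_on J \<Psi>" "I \<inter> J = {}"
    and "integrable M (\<lambda>\<omega>. \<Phi> (path \<omega>))" "integrable M (\<lambda>\<omega>. \<Psi> (path \<omega>))"
  shows integrable_mult_depends_on: "integrable M (\<lambda>\<omega>. \<Phi> (path \<omega>) * \<Psi> (path \<omega>))"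
    and expectation_mult_depends_on: "expectation (\<lambda>\<omega>. \<Phi> (path \<omega>) * \<Psi> (path \<omega>))
      = expectation (\<lambda>\<omega>. \<Phi> (path \<omega>)) * expectation (\<lambda>\<omega>. \<Psi> (path \<omega>))"
  using indep_var_integrable[OF indep_var_depends_on[OF assms(1-3)] assms(4,5)]
    indep_var_lebesgue_integral[OF indep_var_depends_on[OF assms(1-3)] assms(4,5)] by auto

text \<open>Independence turns both laws into product measures, and their factors agree because the
  innovations are identically distributed. All stationarity used later comes from here.\<close>

lemma distr_path_shift:
  "distr M (Pi\<^sub>M UNIV (\<lambda>_. borel)) (\<lambda>\<omega> s. path \<omega> (s + h)) = distr M (Pi\<^sub>M UNIV (\<lambda>_. borel)) path"
proof -
  \<comment> \<open>Reindexing by a shift is expressed as grouping the innovations into the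
    singletons \<open>{s + h}\<close>.\<close>
  have "indep_vars (\<lambda>s. Pi\<^sub>M {s + h} (\<lambda>_. borel)) (\<lambda>s \<omega>. restrict (\<lambda>i. \<epsilon> i \<omega>) {s + h}) UNIV"
    by (rule indep_vars_restrict[OF indep]) (auto simp: disjoint_family_on_def)
  then have "indep_vars (\<lambda>_. borel) (\<lambda>s \<omega>. (restrict (\<lambda>i. \<epsilon> i \<omega>) {s + h}) (s + h)) UNIV"
    by (rule indep_vars_compose2) measurable
  then have i: "indep_vars (\<lambda>_. borel) (\<lambda>s. \<epsilon> (s + h)) UNIV" by simp
  have "distr M (Pi\<^sub>M UNIV (\<lambda>_. borel)) (\<lambda>\<omega>. \<lambda>s\<in>UNIV. \<epsilon> (s + h) \<omega>) = Pi\<^sub>M UNIV (\<lambda>s. distr M borel (\<epsilon> (s + h)))"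
    using i by (subst (asm) indep_vars_iff_distr_eq_PiM) auto
  also have "\<dots> = Pi\<^sub>M UNIV (\<lambda>s. distr M borel (\<epsilon> s))" using ident by (intro PiM_cong) auto
  also have "\<dots> = distr M (Pi\<^sub>M UNIV (\<lambda>_. borel)) (\<lambda>\<omega>. \<lambda>s\<in>UNIV. \<epsilon> s \<omega>)"
    using indep by (subst (asm) indep_vars_iff_distr_eq_PiM) auto
  finally show ?thesis by (simp add: path_def[abs_def] restrict_UNIV)
qed

lemma measurable_path_shift [measurable]: "(\<lambda>\<omega> s. path \<omega> (s + h)) \<in> M \<rightarrow>\<^sub>M Pi\<^sub>M UNIV (\<lambda>_. borel)"
  unfolding path_def by (rule measurable_PiM_single') auto

lemma distr_depends_on_shift:
  assumes "depends_on I \<Phi>"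
  shows "distr M borel (\<lambda>\<omega>. \<Phi> (\<lambda>s. path \<omega> (s + h))) = distr M borel (\<lambda>\<omega>. \<Phi> (path \<omega>))"
proof -
  note [measurable] = depends_on_measurable[OF assms]
  have "distr M borel (\<lambda>\<omega>. \<Phi> (\<lambda>s. path \<omega> (s + h)))
      = distr (distr M (Pi\<^sub>M UNIV (\<lambda>_. borel)) (\<lambda>\<omega> s. path \<omega> (s + h))) borel \<Phi>"
    by (subst distr_distr) (auto simp: comp_def)
  also have "\<dots> = distr M borel (\<lambda>\<omega>. \<Phi> (path \<omega>))"
    unfolding distr_path_shift by (subst distr_distr) (auto simp: comp_def)
  finally show ?thesis .
qed

lemma expectation_shift:
  assumes "depends_on I \<Phi>"
  shows "expectation (\<lambda>\<omega>. \<Phi> (\<lambda>s. path \<omega> (s + h))) = expectation (\<lambda>\<omega>. \<Phi> (path \<omega>))"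
proof -
  have m1: "(\<lambda>\<omega>. \<Phi> (\<lambda>s. path \<omega> (s + h))) \<in> borel_measurable M"
    by (rule measurable_compose[OF measurable_path_shift depends_on_measurable[OF assms]])
  have m2: "(\<lambda>\<omega>. \<Phi> (path \<omega>)) \<in> borel_measurable M"
    by (rule measurable_path_compose[OF assms])
  show "expectation (\<lambda>\<omega>. \<Phi> (\<lambda>s. path \<omega> (s + h))) = expectation (\<lambda>\<omega>. \<Phi> (path \<omega>))"
    using integral_distr[OF m1, of "\<lambda>x. x"] integral_distr[OF m2, of "\<lambda>x. x"]
      distr_depends_on_shift[OF assms, of h] by simp
qed

end

section \<open>A contracting moment\<close>

text \<open>From \<open>u <= exp u - 1 <= u * exp u\<close> follows
  \<open>exp u - 1 - u <= u * (exp u - 1)\<close>; the two signs of \<open>u\<close> use the upper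
  and the lower bound once more and account for the maximum.\<close>

lemma exp_le_quadratic: "exp (u :: real) \<le> 1 + u + u\<^sup>2 * max 1 (exp u)"
proof -
  have le: "exp u - 1 \<le> u * exp u"
  proof -
    have "1 - u \<le> exp (- u)" using exp_ge_add_one_self[of "- u"] by simp
    then have "(1 - u) * exp u \<le> exp (- u) * exp u" by (intro mult_right_mono) auto
    then show ?thesis by (simp add: algebra_simps flip: exp_add)
  qed
  have ge: "u \<le> exp u - 1" using exp_ge_add_one_self[of u] by linarith
  have "exp u - 1 - u \<le> u * (exp u - 1)" using le by (simp add: algebra_simps)
  also have "\<dots> \<le> u\<^sup>2 * max 1 (exp u)"
  proof (cases "0 \<le> u")
    case True
    have "u * (exp u - 1) \<le> u * (u * exp u)" using True le by (intro mult_left_mono) auto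
    also have "\<dots> \<le> u * u * max 1 (exp u)" by (simp add: mult_left_mono mult.assoc True)
    finally show ?thesis by (simp add: power2_eq_square)
  next
    case False
    have "u * (exp u - 1) \<le> u * u" using False ge by (intro mult_left_mono_neg) auto
    also have "\<dots> \<le> u * u * max 1 (exp u)" by (simp add: mult_left_mono[of 1 "max 1 (exp u)" "u * u", simplified])
    finally show ?thesis by (simp add: power2_eq_square)
  qed
  finally show ?thesis by simp
qed

text \<open>Cutting \<open>|a|\<close> off at \<open>exp (- L)\<close> keeps the logarithm of
  \<open>x\<close> above \<open>- L\<close>. Below 1 its square is thus at most the square of
  \<open>L\<close>; above 1 the condition \<open>d <= 1\<close> bounds the quadratic term by the
  fourth power of \<open>x\<close>. The coefficient of the square of \<open>d\<close> does not
  depend on \<open>d\<close>, so for small \<open>d\<close> the linear term decides.\<close>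

lemma powr_le_quadratic:
  fixes a d L x :: real
  assumes "0 < d" "d \<le> 1" "0 \<le> L" "x = max \<bar>a\<bar> (exp (- L))"
  shows "\<bar>a\<bar> powr d \<le> 1 + d * ln x + d\<^sup>2 * (L\<^sup>2 + 1 + a ^ 4)"
proof -
  have x: "0 < x" unfolding assms(4) by (simp only: less_max_iff_disj exp_gt_zero simp_thms)
  have "\<bar>a\<bar> powr d \<le> x powr d" using assms by (intro powr_mono2) auto
  also have "x powr d = exp (d * ln x)" using x by (simp add: powr_def)
  also have "\<dots> \<le> 1 + d * ln x + (d * ln x)\<^sup>2 * max 1 (exp (d * ln x))" by (rule exp_le_quadratic)
  also have "(d * ln x)\<^sup>2 * max 1 (exp (d * ln x)) = d\<^sup>2 * ((ln x)\<^sup>2 * max 1 (exp (d * ln x)))"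
    by (simp add: power_mult_distrib)
  also have "(ln x)\<^sup>2 * max 1 (exp (d * ln x)) \<le> L\<^sup>2 + 1 + a ^ 4"
  proof (cases "1 \<le> x")
    case True
    have l: "0 \<le> ln x" "ln x \<le> x" using True ln_le_minus_one[of x] by auto
    have e: "exp (d * ln x) \<le> x"
    proof -
      have "exp (d * ln x) \<le> exp (1 * ln x)" using assms(2) l by (simp add: mult_left_le_one_le assms(1) less_imp_le)
      then show ?thesis using x by simp
    qed
    have "(ln x)\<^sup>2 * max 1 (exp (d * ln x)) \<le> x\<^sup>2 * x\<^sup>2"
    proof (intro mult_mono power_mono l)
      have "x \<le> x\<^sup>2" using True by (simp add: power2_eq_square)
      then show "max 1 (exp (d * ln x)) \<le> x\<^sup>2" using e True by simp
    qed auto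
    also have "\<dots> = x ^ 4" by (simp flip: power_add)
    also have "x ^ 4 \<le> 1 + a ^ 4"
    proof (cases "\<bar>a\<bar> \<le> exp (- L)")
      case True
      then have "x = exp (- L)" using assms(4) by simp
      then have "x \<le> 1" using assms(3) by simp
      then have "x ^ 4 \<le> 1" using x by (intro power_le_one) auto
      moreover have "0 \<le> a ^ 4" by simp
      ultimately show ?thesis by linarith
    next
      case False
      then have "x = \<bar>a\<bar>" using assms(4) by simp
      then show ?thesis by simp
    qed
    finally show ?thesis using zero_le_power2[of L] by linarith
  next
    case False
    have "exp (- L) \<le> x" using assms(4) by simp
    then have "- L \<le> ln x" using x by (simp add: ln_ge_iff)
    moreover have "ln x \<le> 0" using False x by simp
    ultimately have "(ln x)\<^sup>2 \<le> L\<^sup>2" by (metis abs_le_square_iff abs_of_nonneg abs_of_nonpos assms(3) minus_le_iff)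
    moreover have "max 1 (exp (d * ln x)) = 1" using \<open>ln x \<le> 0\<close> assms(1) by (simp add: mult_le_0_iff)
    moreover have "0 \<le> a ^ 4" by simp
    ultimately show ?thesis unfolding \<open>max 1 (exp (d * ln x)) = 1\<close> by linarith
  qed
  finally show ?thesis by (simp add: mult_left_mono)
qed

context prob_space
begin

text \<open>The mean of \<open>ln |A|\<close> may be minus infinity, which is useless in an
  expansion. Cutting the negative part off at level \<open>n\<close> makes it integrable, and
  monotone convergence keeps the mean negative for large \<open>n\<close>.\<close>

lemma truncated_log_moment_negative:
  fixes A :: "'a \<Rightarrow> real"
  assumes [measurable]: "A \<in> borel_measurable M" and A: "integrable M A"
    and neg: "ereal_expectation M (\<lambda>\<omega>. ln_abs (A \<omega>)) < 0"
  obtains n :: nat where "integrable M (\<lambda>\<omega>. ln (max \<bar>A \<omega>\<bar> (exp (- real n))))"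
    "expectation (\<lambda>\<omega>. ln (max \<bar>A \<omega>\<bar> (exp (- real n)))) < 0"
proof -
  define u where "u x = max 0 (ln \<bar>x\<bar>)" for x :: real
  \<comment> \<open>At 0 the truncated negative part must be \<open>n\<close>, since
    \<open>ln_abs 0\<close> is minus infinity while \<open>ln 0 = 0\<close>.\<close>
  define h where "h n x = (if x = 0 then real n else min (real n) (max 0 (- ln \<bar>x\<bar>)))" for n and x :: real
  define g where "g x = (if x = 0 then \<top> else ennreal (max 0 (- ln \<bar>x\<bar>)))" for x :: real
  have [measurable]: "u \<in> borel_measurable borel" "h n \<in> borel_measurable borel" "g \<in> borel_measurable borel" for n
    unfolding u_def[abs_def] h_def[abs_def] g_def[abs_def] by measurable
  have pos: "e2ennreal (ln_abs x) = ennreal (u x)" for x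
    by (auto simp: ln_abs_def u_def max_def ennreal_neg e2ennreal_neg)
  have negp: "e2ennreal (- ln_abs x) = g x" for x
    by (auto simp: ln_abs_def g_def max_def ennreal_neg e2ennreal_neg)
  have iu: "integrable M (\<lambda>\<omega>. u (A \<omega>))"
  proof (rule Bochner_Integration.integrable_bound[OF integrable_abs[OF A]])
    have "\<bar>u x\<bar> \<le> \<bar>x\<bar>" for x
      using ln_le_minus_one[of "\<bar>x\<bar>"] by (cases "x = 0") (auto simp: u_def max_def)
    then show "AE x in M. norm (u (A x)) \<le> norm \<bar>A x\<bar>" by simp
  qed measurable
  have ih: "integrable M (\<lambda>\<omega>. h n (A \<omega>))" for n
    by (rule integrable_const_bound[where B = "real n"]) (auto simp: h_def)
  have P: "(\<integral>\<^sup>+\<omega>. ennreal (u (A \<omega>)) \<partial>M) = ennreal (expectation (\<lambda>\<omega>. u (A \<omega>)))"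
    by (rule nn_integral_eq_integral[OF iu]) (simp add: u_def)
  have "(\<lambda>n. \<integral>\<^sup>+\<omega>. ennreal (h n (A \<omega>)) \<partial>M) \<longlonglongrightarrow> (\<integral>\<^sup>+\<omega>. g (A \<omega>) \<partial>M)"
  proof (rule nn_integral_LIMSEQ)
    show "incseq (\<lambda>n \<omega>. ennreal (h n (A \<omega>)))"
      by (auto simp: incseq_def le_fun_def h_def intro!: ennreal_leI)
    show "(\<lambda>n. ennreal (h n (A \<omega>))) \<longlonglongrightarrow> g (A \<omega>)" for \<omega>
    proof (cases "A \<omega> = 0")
      case True
      then show ?thesis
        using of_nat_tendsto_top_ennreal by (simp add: h_def g_def ennreal_of_nat_eq_real_of_nat)
    next
      case False
      obtain k :: nat where k: "max 0 (- ln \<bar>A \<omega>\<bar>) \<le> real k" using real_arch_simple by blast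
      have "h n (A \<omega>) = max 0 (- ln \<bar>A \<omega>\<bar>)" if "n \<ge> k" for n
        using False k that by (simp add: h_def)
      then have "\<forall>\<^sub>F n in sequentially. ennreal (h n (A \<omega>)) = g (A \<omega>)"
        using False by (intro eventually_sequentiallyI[of k]) (simp add: g_def)
      then show ?thesis by (rule tendsto_eventually)
    qed
  qed measurable
  \<comment> \<open>The positive part has finite mean, so a negative total forces the negative part
    to have a strictly larger, possibly infinite, mean.\<close>
  moreover have "ennreal (expectation (\<lambda>\<omega>. u (A \<omega>))) < (\<integral>\<^sup>+\<omega>. g (A \<omega>) \<partial>M)"
  proof (rule ccontr)
    assume "\<not> ?thesis"
    then have le: "(\<integral>\<^sup>+\<omega>. g (A \<omega>) \<partial>M) \<le> ennreal (expectation (\<lambda>\<omega>. u (A \<omega>)))" by simp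
    then have "enn2ereal (\<integral>\<^sup>+\<omega>. g (A \<omega>) \<partial>M) \<le> enn2ereal (ennreal (expectation (\<lambda>\<omega>. u (A \<omega>))))"
      by (simp add: less_eq_ennreal.rep_eq)
    moreover have "enn2ereal (ennreal (expectation (\<lambda>\<omega>. u (A \<omega>)))) \<noteq> \<infinity>" by simp
    moreover have "0 \<le> enn2ereal (\<integral>\<^sup>+\<omega>. g (A \<omega>) \<partial>M)" by simp
    ultimately have "0 \<le> enn2ereal (ennreal (expectation (\<lambda>\<omega>. u (A \<omega>)))) - enn2ereal (\<integral>\<^sup>+\<omega>. g (A \<omega>) \<partial>M)"
      by (intro ereal_diff_positive) auto
    then show False using neg by (simp add: ereal_expectation_def pos negp P)
  qed
  ultimately have "\<forall>\<^sub>F n in sequentially. ennreal (expectation (\<lambda>\<omega>. u (A \<omega>))) < (\<integral>\<^sup>+\<omega>. ennreal (h n (A \<omega>)) \<partial>M)"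
    by (rule order_tendstoD(1))
  then obtain n where n: "ennreal (expectation (\<lambda>\<omega>. u (A \<omega>))) < (\<integral>\<^sup>+\<omega>. ennreal (h n (A \<omega>)) \<partial>M)"
    by (auto simp: eventually_sequentially)
  have "(\<integral>\<^sup>+\<omega>. ennreal (h n (A \<omega>)) \<partial>M) = ennreal (expectation (\<lambda>\<omega>. h n (A \<omega>)))"
    by (rule nn_integral_eq_integral[OF ih]) (simp add: h_def)
  with n have less: "expectation (\<lambda>\<omega>. u (A \<omega>)) < expectation (\<lambda>\<omega>. h n (A \<omega>))"
    by (simp add: ennreal_less_iff u_def)
  have eq: "ln (max \<bar>x\<bar> (exp (- real n))) = u x - h n x" for x
  proof (cases "x = 0")
    case False
    then have "\<bar>x\<bar> \<le> exp (- real n) \<longleftrightarrow> ln \<bar>x\<bar> \<le> - real n"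
      using ln_le_cancel_iff[of "\<bar>x\<bar>" "exp (- real n)"] by simp
    then have "ln (max \<bar>x\<bar> (exp (- real n))) = max (ln \<bar>x\<bar>) (- real n)"
      by (auto simp: max_def)
    moreover have "max l (- real n) = max 0 l - min (real n) (max 0 (- l))" for l
      by (auto simp: max_def min_def)
    ultimately show ?thesis using False by (simp only: u_def h_def if_False)
  qed (simp add: u_def h_def)
  show ?thesis
  proof (rule that[of n])
    show "integrable M (\<lambda>\<omega>. ln (max \<bar>A \<omega>\<bar> (exp (- real n))))" unfolding eq using iu ih by simp
    show "expectation (\<lambda>\<omega>. ln (max \<bar>A \<omega>\<bar> (exp (- real n)))) < 0"
      unfolding eq using iu ih[of n] less by simp
  qed
qed

text \<open>Near \<open>d = 0\<close> the moment of order \<open>d\<close> behaves like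
  \<open>1 + d * l\<close> with the negative truncated log-moment \<open>l\<close>, and the error is
  at most \<open>K\<close> times the square of \<open>d\<close>.\<close>

lemma contracting_moment:
  fixes A :: "'a \<Rightarrow> real"
  assumes [measurable]: "A \<in> borel_measurable M" and A4: "integrable M (\<lambda>\<omega>. A \<omega> ^ 4)"
    and neg: "ereal_expectation M (\<lambda>\<omega>. ln_abs (A \<omega>)) < 0"
  obtains d where "0 < d" "d \<le> 1" "integrable M (\<lambda>\<omega>. \<bar>A \<omega>\<bar> powr d)"
    "expectation (\<lambda>\<omega>. \<bar>A \<omega>\<bar> powr d) < 1"
proof -
  have A1: "integrable M A"
  proof (rule Bochner_Integration.integrable_bound)
    show "integrable M (\<lambda>\<omega>. 1 + A \<omega> ^ 4)" using A4 by simp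
    have "\<bar>x\<bar> \<le> 1 + x ^ 4" for x :: real
    proof (cases "\<bar>x\<bar> \<le> 1")
      case False
      then have "\<bar>x\<bar> ^ 1 \<le> \<bar>x\<bar> ^ 4" by (intro power_increasing) auto
      then show ?thesis by simp
    next
      case True
      moreover have "0 \<le> x ^ 4" by simp
      ultimately show ?thesis by linarith
    qed
    then show "AE \<omega> in M. norm (A \<omega>) \<le> norm (1 + A \<omega> ^ 4)"
      by (auto intro!: AE_I2 order_trans[OF _ abs_ge_self])
  qed measurable
  obtain n :: nat where n: "integrable M (\<lambda>\<omega>. ln (max \<bar>A \<omega>\<bar> (exp (- real n))))"
    "expectation (\<lambda>\<omega>. ln (max \<bar>A \<omega>\<bar> (exp (- real n)))) < 0"
    using truncated_log_moment_negative[OF assms(1) A1 neg] by blast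
  define l where "l = expectation (\<lambda>\<omega>. ln (max \<bar>A \<omega>\<bar> (exp (- real n))))"
  define K where "K = (real n)\<^sup>2 + 1 + expectation (\<lambda>\<omega>. A \<omega> ^ 4)"
  have K: "1 \<le> K" by (simp add: K_def)
  \<comment> \<open>Half of the value at which \<open>l + d * K\<close> vanishes, so that
    \<open>l + d * K <= l / 2\<close>; capped at 1 for the bound on the power.\<close>
  define d where "d = min 1 (- l / (2 * K))"
  have d: "0 < d" "d \<le> 1" using n(2) K by (auto simp: d_def l_def field_simps)
  have bound: "\<bar>A \<omega>\<bar> powr d \<le> 1 + d * ln (max \<bar>A \<omega>\<bar> (exp (- real n))) + d\<^sup>2 * ((real n)\<^sup>2 + 1 + A \<omega> ^ 4)" for \<omega>
    by (rule powr_le_quadratic[OF d]) auto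
  have int: "integrable M (\<lambda>\<omega>. 1 + d * ln (max \<bar>A \<omega>\<bar> (exp (- real n))) + d\<^sup>2 * ((real n)\<^sup>2 + 1 + A \<omega> ^ 4))"
    using n(1) A4 by simp
  have ip: "integrable M (\<lambda>\<omega>. \<bar>A \<omega>\<bar> powr d)"
    by (rule Bochner_Integration.integrable_bound[OF int]) (use bound in \<open>auto intro!: AE_I2 order_trans[OF _ abs_ge_self]\<close>)
  have "expectation (\<lambda>\<omega>. \<bar>A \<omega>\<bar> powr d)
      \<le> expectation (\<lambda>\<omega>. 1 + d * ln (max \<bar>A \<omega>\<bar> (exp (- real n))) + d\<^sup>2 * ((real n)\<^sup>2 + 1 + A \<omega> ^ 4))"
    by (rule integral_mono[OF ip int bound])
  also have "\<dots> = 1 + d * (l + d * K)"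
    using n(1) A4 by (simp add: l_def K_def prob_space power2_eq_square algebra_simps)
  also have "\<dots> < 1"
  proof -
    have "d * K \<le> - l / (2 * K) * K" using K by (intro mult_right_mono) (auto simp: d_def)
    then have "l + d * K < 0" using K n(2) by (simp add: l_def)
    then show ?thesis using d by (simp add: mult_less_0_iff)
  qed
  finally show ?thesis using that[OF d ip] by blast
qed

end

section \<open>The causal solution\<close>

locale bilinear_process = innovations M \<epsilon> for M :: "'a measure" and \<epsilon> +
  fixes \<mu> \<phi> b \<sigma>2 :: real
  assumes fourth_moment: "integrable M (\<lambda>\<omega>. \<epsilon> 1 \<omega> ^ 4)"
    and mean: "expectation (\<epsilon> 1) = 0"
    and second_moment: "expectation (\<lambda>\<omega>. (\<epsilon> 1 \<omega>)\<^sup>2) = \<sigma>2"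
    and variance_pos: "0 < \<sigma>2"
    and log_moment: "ereal_expectation M (\<lambda>\<omega>. ln_abs (\<phi> + b * \<epsilon> 1 \<omega>)) < 0"
begin

lemma
  assumes "g \<in> borel_measurable borel"
  shows innovation_integrable: "integrable M (\<lambda>\<omega>. g (\<epsilon> t \<omega>) :: real) \<longleftrightarrow> integrable M (\<lambda>\<omega>. g (\<epsilon> 1 \<omega>))"
    and innovation_expectation: "expectation (\<lambda>\<omega>. g (\<epsilon> t \<omega>) :: real) = expectation (\<lambda>\<omega>. g (\<epsilon> 1 \<omega>))"
proof -
  have "distr M borel (\<epsilon> t) = distr M borel (\<epsilon> 1)" by (rule ident)
  then show "integrable M (\<lambda>\<omega>. g (\<epsilon> t \<omega>)) \<longleftrightarrow> integrable M (\<lambda>\<omega>. g (\<epsilon> 1 \<omega>))"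
    "expectation (\<lambda>\<omega>. g (\<epsilon> t \<omega>)) = expectation (\<lambda>\<omega>. g (\<epsilon> 1 \<omega>))"
    using integrable_distr_eq[OF measurable_innovation[of t] assms] integral_distr[OF measurable_innovation[of t] assms]
      integrable_distr_eq[OF measurable_innovation[of 1] assms] integral_distr[OF measurable_innovation[of 1] assms]
    by (simp_all only:)
qed

lemma integrable_innovation_power:
  assumes "k \<le> 4"
  shows "integrable M (\<lambda>\<omega>. \<bar>\<epsilon> t \<omega>\<bar> ^ k)"
proof -
  have "integrable M (\<lambda>\<omega>. \<bar>\<epsilon> 1 \<omega>\<bar> ^ k)"
  proof (rule Bochner_Integration.integrable_bound)
    show "integrable M (\<lambda>\<omega>. 1 + \<epsilon> 1 \<omega> ^ 4)" using fourth_moment by simp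
    have "\<bar>x\<bar> ^ k \<le> 1 + x ^ 4" for x :: real
    proof (cases "\<bar>x\<bar> \<le> 1")
      case True
      then have "\<bar>x\<bar> ^ k \<le> 1" by (intro power_le_one) auto
      moreover have "0 \<le> x ^ 4" by simp
      ultimately show ?thesis by linarith
    next
      case False
      then have "\<bar>x\<bar> ^ k \<le> \<bar>x\<bar> ^ 4" using assms by (intro power_increasing) auto
      then show ?thesis by simp
    qed
    then show "AE \<omega> in M. norm (\<bar>\<epsilon> 1 \<omega>\<bar> ^ k) \<le> norm (1 + \<epsilon> 1 \<omega> ^ 4)"
      by (auto intro!: AE_I2 order_trans[OF _ abs_ge_self])
  qed measurable
  then show ?thesis by (subst innovation_integrable) auto
qed

lemma integrable_innovation_power':
  assumes "k \<le> 4"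
  shows "integrable M (\<lambda>\<omega>. \<epsilon> t \<omega> ^ k)"
  by (rule integrable_abs_cancel) (use integrable_innovation_power[OF assms, of t] in \<open>auto simp: power_abs\<close>)

lemma integrable_innovation [simp]: "integrable M (\<epsilon> t)"
  using integrable_innovation_power'[of 1 t] unfolding power_one_right by simp

lemma integrable_innovation_square [simp]: "integrable M (\<lambda>\<omega>. (\<epsilon> t \<omega>)\<^sup>2)"
  using integrable_innovation_power'[of 2 t] by simp

lemma expectation_innovation [simp]: "expectation (\<epsilon> t) = 0"
  using innovation_expectation[OF measurable_ident, of t] unfolding id_def mean .

lemma expectation_innovation_square [simp]: "expectation (\<lambda>\<omega>. (\<epsilon> t \<omega>)\<^sup>2) = \<sigma>2"
  by (rule trans[OF innovation_expectation[of "\<lambda>x. x\<^sup>2" t] second_moment]) measurable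

text \<open>The recursion run for \<open>k\<close> steps from the artificial initial value 0 at time
  \<open>t - 2 * k\<close>. It reads only the innovations at times \<open>t - 2 * k + 1\<close> to
  \<open>t\<close>.\<close>

primrec trunc :: "nat \<Rightarrow> int \<Rightarrow> (int \<Rightarrow> real) \<Rightarrow> real" where
  "trunc 0 t e = 0"
| "trunc (Suc k) t e = \<mu> + e t + (\<phi> + b * e (t - 1)) * trunc k (t - 2) e"

definition causal :: "int \<Rightarrow> (int \<Rightarrow> real) \<Rightarrow> real" where
  "causal t e = lim (\<lambda>k. trunc k t e)"

definition incr :: "nat \<Rightarrow> int \<Rightarrow> (int \<Rightarrow> real) \<Rightarrow> real" where
  "incr k t e = trunc (Suc k) t e - trunc k t e"

lemma incr_0: "incr 0 t e = \<mu> + e t"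
  by (simp add: incr_def)

text \<open>The inhomogeneous part cancels in the difference of two truncations, which leaves a
  purely multiplicative recursion whose moments factorize.\<close>

lemma incr_Suc: "incr (Suc k) t e = (\<phi> + b * e (t - 1)) * incr k (t - 2) e"
proof -
  have "(x + a * y) - (x + a * z) = a * (y - z)" for x y z a :: real by (simp add: algebra_simps)
  then show ?thesis unfolding incr_def trunc.simps(2)[of "Suc k"] trunc.simps(2)[of k t] .
qed

lemma trunc_eq_sum: "trunc k t e = (\<Sum>j<k. incr j t e)"
proof (induction k)
  case (Suc k)
  then show ?case unfolding sum.lessThan_Suc incr_def by linarith
qed simp

lemma trunc_shift: "trunc k t (\<lambda>s. e (s + h)) = trunc k (t + h) e"
proof (induction k arbitrary: t)
  case (Suc k)
  have "trunc k (t - 2) (\<lambda>s. e (s + h)) = trunc k (t + h - 2) e"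
    unfolding Suc by (rule arg_cong[where f = "\<lambda>t. trunc k t e"]) linarith
  moreover have "t - 1 + h = t + h - 1" by linarith
  ultimately show ?case by (simp only: trunc.simps)
qed simp

lemma causal_shift: "causal t (\<lambda>s. e (s + h)) = causal (t + h) e"
  by (simp add: causal_def trunc_shift)

lemma depends_on_trunc: "depends_on {t - 2 * int k + 1..t} (trunc k t)"
proof (induction k arbitrary: t)
  case (Suc k)
  let ?I = "{t - 2 * int (Suc k) + 1..t}"
  have "depends_on ?I (trunc k (t - 2))" by (rule depends_on_mono[OF Suc]) auto
  moreover have "depends_on ?I (\<lambda>e. e t)" "depends_on ?I (\<lambda>e. e (t - 1))"
    by (auto intro!: depends_on_coordinate)
  ultimately show ?case by (simp, intro depends_on_add depends_on_mult depends_on_const)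
next
  case 0
  have "trunc 0 t = (\<lambda>e. 0)" by (rule ext) (rule trunc.simps(1))
  then show ?case by (simp only: depends_on_const)
qed

lemma depends_on_trunc_past: "depends_on {..t} (trunc k t)"
  by (rule depends_on_mono[OF depends_on_trunc]) auto

lemma depends_on_incr: "depends_on {..t} (incr k t)"
  unfolding incr_def[abs_def] by (intro depends_on_diff depends_on_trunc_past)

lemma depends_on_causal: "depends_on {..t} (causal t)"
  unfolding causal_def[abs_def] by (intro depends_on_lim depends_on_trunc_past)

text \<open>The random coefficient with which the value at time \<open>t - 2 * k\<close> enters the
  value at time \<open>t\<close>.\<close>

definition gain :: "nat \<Rightarrow> int \<Rightarrow> (int \<Rightarrow> real) \<Rightarrow> real" where
  "gain k t e = (\<Prod>j<k. \<phi> + b * e (t - 1 - 2 * int j))"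

lemma gain_Suc: "gain (Suc k) t e = (\<phi> + b * e (t - 1)) * gain k (t - 2) e"
  unfolding gain_def prod.lessThan_Suc_shift by (simp add: algebra_simps)

lemma depends_on_gain: "depends_on {..t} (gain k t)"
proof (induction k arbitrary: t)
  case (Suc k)
  have "depends_on {..t} (gain k (t - 2))" by (rule depends_on_mono[OF Suc]) auto
  then show ?case
    unfolding gain_Suc by (intro depends_on_add depends_on_mult depends_on_const depends_on_coordinate) auto
next
  case 0
  have "gain 0 t = (\<lambda>e. 1)" by (rule ext) (simp add: gain_def)
  then show ?case by (simp only: depends_on_const)
qed

lemma contraction:
  obtains d \<rho> where "0 < d" "d \<le> 1" "0 < \<rho>" "\<rho> < 1"
    "\<And>t. integrable M (\<lambda>\<omega>. \<bar>\<phi> + b * \<epsilon> t \<omega>\<bar> powr d)"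
    "\<And>t. expectation (\<lambda>\<omega>. \<bar>\<phi> + b * \<epsilon> t \<omega>\<bar> powr d) \<le> \<rho>"
proof -
  have "integrable M (\<lambda>\<omega>. (\<phi> + b * \<epsilon> 1 \<omega>) ^ 4)"
  proof (rule Bochner_Integration.integrable_bound)
    show "integrable M (\<lambda>\<omega>. 16 * \<phi> ^ 4 + 16 * b ^ 4 * \<epsilon> 1 \<omega> ^ 4)" using fourth_moment by simp
    have "(x + y) ^ 4 \<le> 16 * x ^ 4 + 16 * y ^ 4" for x y :: real
    proof -
      have "\<bar>x + y\<bar> ^ 4 \<le> (2 * max \<bar>x\<bar> \<bar>y\<bar>) ^ 4" by (intro power_mono) auto
      also have "\<dots> \<le> 16 * \<bar>x\<bar> ^ 4 + 16 * \<bar>y\<bar> ^ 4" by (auto simp: max_def power_mult_distrib)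
      finally show ?thesis by (simp add: power_abs)
    qed
    from this[of \<phi> "b * \<epsilon> 1 _"]
    show "AE \<omega> in M. norm ((\<phi> + b * \<epsilon> 1 \<omega>) ^ 4) \<le> norm (16 * \<phi> ^ 4 + 16 * b ^ 4 * \<epsilon> 1 \<omega> ^ 4)"
      by (auto intro!: AE_I2 order_trans[OF _ abs_ge_self] simp: power_mult_distrib mult.assoc)
  qed measurable
  from contracting_moment[OF _ this log_moment]
  obtain d where d: "0 < d" "d \<le> 1" and i: "integrable M (\<lambda>\<omega>. \<bar>\<phi> + b * \<epsilon> 1 \<omega>\<bar> powr d)"
    and e: "expectation (\<lambda>\<omega>. \<bar>\<phi> + b * \<epsilon> 1 \<omega>\<bar> powr d) < 1" by auto
  \<comment> \<open>The maximum with 1/2 keeps \<open>\<rho>\<close> positive even when the moment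
    is 0.\<close>
  define \<rho> where "\<rho> = max (1 / 2) (expectation (\<lambda>\<omega>. \<bar>\<phi> + b * \<epsilon> 1 \<omega>\<bar> powr d))"
  show ?thesis
  proof (rule that[OF d, of \<rho>])
    show "integrable M (\<lambda>\<omega>. \<bar>\<phi> + b * \<epsilon> t \<omega>\<bar> powr d)" for t
      using i by (subst innovation_integrable) auto
    show "expectation (\<lambda>\<omega>. \<bar>\<phi> + b * \<epsilon> t \<omega>\<bar> powr d) \<le> \<rho>" for t
      by (subst innovation_expectation) (auto simp: \<rho>_def)
  qed (use e in \<open>auto simp: \<rho>_def\<close>)
qed

text \<open>The new factor reads the innovation at \<open>t - 1\<close>, the previous term only
  those up to \<open>t - 2\<close>; independence multiplies the moments, one factor
  \<open>\<rho>\<close> per step. It serves for \<open>incr\<close> and for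
  \<open>gain\<close>.\<close>

lemma linear_recursion_moment:
  fixes Z :: "nat \<Rightarrow> int \<Rightarrow> (int \<Rightarrow> real) \<Rightarrow> real"
  assumes rec: "\<And>k t e. Z (Suc k) t e = (\<phi> + b * e (t - 1)) * Z k (t - 2) e"
    and dep: "\<And>k t. depends_on {..t} (Z k t)"
    and A: "\<And>t. integrable M (\<lambda>\<omega>. \<bar>\<phi> + b * \<epsilon> t \<omega>\<bar> powr d)"
      "\<And>t. expectation (\<lambda>\<omega>. \<bar>\<phi> + b * \<epsilon> t \<omega>\<bar> powr d) \<le> \<rho>"
    and Z0: "\<And>t. integrable M (\<lambda>\<omega>. \<bar>Z 0 t (path \<omega>)\<bar> powr d)"
      "\<And>t. expectation (\<lambda>\<omega>. \<bar>Z 0 t (path \<omega>)\<bar> powr d) \<le> C"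
  shows "integrable M (\<lambda>\<omega>. \<bar>Z k t (path \<omega>)\<bar> powr d) \<and>
    expectation (\<lambda>\<omega>. \<bar>Z k t (path \<omega>)\<bar> powr d) \<le> C * \<rho> ^ k"
proof (induction k arbitrary: t)
  case 0
  then show ?case using Z0 by simp
next
  case (Suc k)
  have \<rho>0: "0 \<le> \<rho>" by (rule order_trans[OF _ A(2)[of 0]]) simp
  have C0: "0 \<le> C" by (rule order_trans[OF _ Z0(2)[of 0]]) simp
  have eq: "\<bar>Z (Suc k) t (path \<omega>)\<bar> powr d
      = \<bar>\<phi> + b * path \<omega> (t - 1)\<bar> powr d * \<bar>Z k (t - 2) (path \<omega>)\<bar> powr d" for \<omega>
    by (simp add: rec abs_mult powr_mult)
  have d1: "depends_on {t - 1} (\<lambda>e. \<bar>\<phi> + b * e (t - 1)\<bar> powr d)"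
    by (rule depends_on_compose[OF depends_on_coordinate]) auto
  have d2: "depends_on {..t - 2} (\<lambda>e. \<bar>Z k (t - 2) e\<bar> powr d)"
    by (rule depends_on_compose[OF dep]) auto
  have a: "integrable M (\<lambda>\<omega>. \<bar>\<phi> + b * path \<omega> (t - 1)\<bar> powr d)"
    "expectation (\<lambda>\<omega>. \<bar>\<phi> + b * path \<omega> (t - 1)\<bar> powr d) \<le> \<rho>"
    using A by (auto simp: path_def)
  have "expectation (\<lambda>\<omega>. \<bar>\<phi> + b * path \<omega> (t - 1)\<bar> powr d) * expectation (\<lambda>\<omega>. \<bar>Z k (t - 2) (path \<omega>)\<bar> powr d)
      \<le> \<rho> * (C * \<rho> ^ k)"
    using Suc a \<rho>0 by (intro mult_mono) auto
  moreover have "{t - 1} \<inter> {..t - 2} = {}" by auto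
  ultimately show ?case
    unfolding eq using Suc a
      integrable_mult_depends_on[OF d1 d2] expectation_mult_depends_on[OF d1 d2]
    by (simp add: mult.left_commute)
qed

text \<open>Bounded truncation turns the geometric decay of the \<open>d\<close>-th moments into geometric
  decay in \<open>L\<^sup>1\<close>, although \<open>causal t\<close> itself need not have a first moment.\<close>

lemma causal_approximation:
  obtains C \<rho> where "0 \<le> C" "0 < \<rho>" "\<rho> < 1"
    "\<And>k t. expectation (\<lambda>\<omega>. min 1 \<bar>causal t (path \<omega>) - trunc k t (path \<omega>)\<bar>) \<le> C * \<rho> ^ k"
    "\<And>t. AE \<omega> in M. (\<lambda>k. trunc k t (path \<omega>)) \<longlonglongrightarrow> causal t (path \<omega>)"
proof -
  obtain d \<rho> where d: "0 < d" "d \<le> 1" and \<rho>: "0 < \<rho>" "\<rho> < 1"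
    and A: "\<And>t. integrable M (\<lambda>\<omega>. \<bar>\<phi> + b * \<epsilon> t \<omega>\<bar> powr d)"
      "\<And>t. expectation (\<lambda>\<omega>. \<bar>\<phi> + b * \<epsilon> t \<omega>\<bar> powr d) \<le> \<rho>"
    using contraction by blast
  define C where "C = expectation (\<lambda>\<omega>. \<bar>\<mu> + \<epsilon> 1 \<omega>\<bar> powr d)"
  have C0: "0 \<le> C" by (simp add: C_def)
  have i0: "integrable M (\<lambda>\<omega>. \<bar>\<mu> + \<epsilon> t \<omega>\<bar> powr d)" for t
  proof (rule Bochner_Integration.integrable_bound)
    show "integrable M (\<lambda>\<omega>. 1 + \<bar>\<mu> + \<epsilon> t \<omega>\<bar>)" by simp
    have "\<bar>x\<bar> powr d \<le> 1 + \<bar>x\<bar>" for x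
    proof (cases "\<bar>x\<bar> \<le> 1")
      case True
      then have "\<bar>x\<bar> powr d \<le> 1" using d by (intro powr_le1) auto
      then show ?thesis by simp
    next
      case False
      then have "\<bar>x\<bar> powr d \<le> \<bar>x\<bar> powr 1" using d by (intro powr_mono) auto
      then show ?thesis by simp
    qed
    then show "AE \<omega> in M. norm (\<bar>\<mu> + \<epsilon> t \<omega>\<bar> powr d) \<le> norm (1 + \<bar>\<mu> + \<epsilon> t \<omega>\<bar>)" by simp
  qed measurable
  have incr: "integrable M (\<lambda>\<omega>. \<bar>incr k t (path \<omega>)\<bar> powr d)"
    "expectation (\<lambda>\<omega>. \<bar>incr k t (path \<omega>)\<bar> powr d) \<le> C * \<rho> ^ k" for k t
  proof -
    have "expectation (\<lambda>\<omega>. \<bar>incr 0 t (path \<omega>)\<bar> powr d) \<le> C" for t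
      unfolding C_def incr_0 path_def by (subst innovation_expectation) auto
    moreover have "integrable M (\<lambda>\<omega>. \<bar>incr 0 t (path \<omega>)\<bar> powr d)" for t
      using i0 by (simp add: incr_0 path_def)
    ultimately have "integrable M (\<lambda>\<omega>. \<bar>incr k t (path \<omega>)\<bar> powr d) \<and>
      expectation (\<lambda>\<omega>. \<bar>incr k t (path \<omega>)\<bar> powr d) \<le> C * \<rho> ^ k"
      by (intro linear_recursion_moment[of incr, OF incr_Suc depends_on_incr A])
    then show "integrable M (\<lambda>\<omega>. \<bar>incr k t (path \<omega>)\<bar> powr d)"
      "expectation (\<lambda>\<omega>. \<bar>incr k t (path \<omega>)\<bar> powr d) \<le> C * \<rho> ^ k" by blast+
  qed
  have [measurable]: "(\<lambda>\<omega>. incr k t (path \<omega>)) \<in> borel_measurable M"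
    "(\<lambda>\<omega>. trunc k t (path \<omega>)) \<in> borel_measurable M"
    "(\<lambda>\<omega>. causal t (path \<omega>)) \<in> borel_measurable M" for k t
    using measurable_path_compose[OF depends_on_incr] measurable_path_compose[OF depends_on_trunc]
      measurable_path_compose[OF depends_on_causal] by auto
  \<comment> \<open>Tail sums in the extended nonnegative reals: their expectation can be computed
    term by term before finiteness is known, and then yields it almost surely.\<close>
  define T where "T k t \<omega> = (\<Sum>j. ennreal (\<bar>incr (j + k) t (path \<omega>)\<bar> powr d))" for k t \<omega>
  have [measurable]: "T k t \<in> borel_measurable M" for k t
    unfolding T_def[abs_def] by measurable
  have geo: "(\<lambda>j. C * \<rho> ^ (j + k)) sums (C * \<rho> ^ k / (1 - \<rho>))" for k
    using sums_mult[OF geometric_sums[of \<rho>], of "C * \<rho> ^ k"] \<rho> by (simp add: power_add mult_ac)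
  have T: "(\<integral>\<^sup>+\<omega>. T k t \<omega> \<partial>M) \<le> ennreal (C * \<rho> ^ k / (1 - \<rho>))" for k t
  proof -
    have "(\<integral>\<^sup>+\<omega>. T k t \<omega> \<partial>M) = (\<Sum>j. \<integral>\<^sup>+\<omega>. ennreal (\<bar>incr (j + k) t (path \<omega>)\<bar> powr d) \<partial>M)"
      unfolding T_def by (rule nn_integral_suminf) measurable
    also have "\<dots> = (\<Sum>j. ennreal (expectation (\<lambda>\<omega>. \<bar>incr (j + k) t (path \<omega>)\<bar> powr d)))"
      using incr by (intro suminf_cong nn_integral_eq_integral) auto
    also have "\<dots> \<le> (\<Sum>j. ennreal (C * \<rho> ^ (j + k)))"
      using incr by (intro suminf_le ennreal_leI) auto
    also have "\<dots> = ennreal (C * \<rho> ^ k / (1 - \<rho>))"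
      using geo[of k] C0 \<rho> by (intro suminf_ennreal_eq) auto
    finally show ?thesis .
  qed
  have T_fin: "AE \<omega> in M. T 0 t \<omega> \<noteq> \<infinity>" for t
  proof (rule nn_integral_PInf_AE)
    show "(\<integral>\<^sup>+\<omega>. T 0 t \<omega> \<partial>M) \<noteq> \<infinity>" using T[of 0 t] by (auto simp: top_unique)
  qed measurable
  have main: "(\<lambda>k. trunc k t (path \<omega>)) \<longlonglongrightarrow> causal t (path \<omega>) \<and>
      (\<forall>k. ennreal (min 1 \<bar>causal t (path \<omega>) - trunc k t (path \<omega>)\<bar>) \<le> T k t \<omega>)"
    if fin: "T 0 t \<omega> \<noteq> \<infinity>" for \<omega> t
  proof
    define a where "a j = incr j t (path \<omega>)" for j
    have sd: "summable (\<lambda>j. \<bar>a j\<bar> powr d)"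
      using fin unfolding T_def a_def by (intro summable_suminf_not_top) auto
    have le1: "\<bar>x\<bar> \<le> \<bar>x\<bar> powr d" if "\<bar>x\<bar> \<le> 1" for x
      using powr_mono'[of d 1 "\<bar>x\<bar>"] d that by auto
    have "(\<lambda>j. \<bar>a j\<bar> powr d) \<longlonglongrightarrow> 0" using sd by (rule summable_LIMSEQ_zero)
    then have "\<forall>\<^sub>F j in sequentially. \<bar>a j\<bar> powr d < 1" by (rule order_tendstoD) simp
    then have "\<forall>\<^sub>F j in sequentially. norm (a j) \<le> \<bar>a j\<bar> powr d"
    proof eventually_elim
      case (elim j)
      have "\<bar>a j\<bar> \<le> 1"
        using elim ge_one_powr_ge_zero[of "\<bar>a j\<bar>" d] d by (intro leI notI) auto
      then show ?case using le1 by simp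
    qed
    then have "summable (\<lambda>j. \<bar>a j\<bar>)"
      using summable_comparison_test_ev[OF _ sd, of "\<lambda>j. \<bar>a j\<bar>"] by simp
    then have sa: "summable a" by (rule summable_rabs_cancel)
    have tr: "trunc k t (path \<omega>) = sum a {..<k}" for k by (simp add: trunc_eq_sum a_def)
    have lim: "(\<lambda>k. trunc k t (path \<omega>)) \<longlonglongrightarrow> suminf a"
      unfolding tr using summable_LIMSEQ[OF sa] .
    then have ca: "causal t (path \<omega>) = suminf a" unfolding causal_def by (rule limI)
    then show "(\<lambda>k. trunc k t (path \<omega>)) \<longlonglongrightarrow> causal t (path \<omega>)" using lim by simp
    show "\<forall>k. ennreal (min 1 \<bar>causal t (path \<omega>) - trunc k t (path \<omega>)\<bar>) \<le> T k t \<omega>"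
    proof
      fix k
      have sdk: "summable (\<lambda>j. \<bar>a (j + k)\<bar> powr d)"
        using sd by (rule summable_ignore_initial_segment[where f = "\<lambda>j. \<bar>a j\<bar> powr d"])
      have Tk: "T k t \<omega> = ennreal (\<Sum>j. \<bar>a (j + k)\<bar> powr d)"
        unfolding T_def a_def[symmetric] using sdk by (intro suminf_ennreal2) auto
      have "min 1 \<bar>causal t (path \<omega>) - trunc k t (path \<omega>)\<bar> \<le> (\<Sum>j. \<bar>a (j + k)\<bar> powr d)"
      \<comment> \<open>If all tail increments are at most 1, each is bounded by its power of order
        \<open>d <= 1\<close>. Otherwise a single one makes the right-hand side at least 1, and the
        minimum never exceeds 1.\<close>
      proof (cases "\<forall>j. \<bar>a (j + k)\<bar> \<le> 1")
        case True
        then have le: "\<bar>a (j + k)\<bar> \<le> \<bar>a (j + k)\<bar> powr d" for j using le1 by blast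
        then have sk: "summable (\<lambda>j. \<bar>a (j + k)\<bar>)"
          by (intro summable_comparison_test'[OF sdk, of 0]) simp
        have "causal t (path \<omega>) - trunc k t (path \<omega>) = (\<Sum>j. a (j + k))"
          unfolding ca tr using suminf_minus_initial_segment[OF sa, of k] by simp
        then have "\<bar>causal t (path \<omega>) - trunc k t (path \<omega>)\<bar> \<le> (\<Sum>j. \<bar>a (j + k)\<bar>)"
          using summable_rabs[OF sk] by simp
        also have "\<dots> \<le> (\<Sum>j. \<bar>a (j + k)\<bar> powr d)" by (intro suminf_le le sk sdk)
        finally show ?thesis by simp
      next
        case False
        then obtain j where "1 < \<bar>a (j + k)\<bar>" by (auto simp: not_le)
        then have "1 \<le> \<bar>a (j + k)\<bar> powr d" using d by (intro ge_one_powr_ge_zero) auto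
        also have "\<dots> \<le> (\<Sum>j. \<bar>a (j + k)\<bar> powr d)"
          using sum_le_suminf[OF sdk, of "{j}"] by simp
        finally show ?thesis by simp
      qed
      then show "ennreal (min 1 \<bar>causal t (path \<omega>) - trunc k t (path \<omega>)\<bar>) \<le> T k t \<omega>"
        unfolding Tk by (rule ennreal_leI)
    qed
  qed
  show ?thesis
  proof (rule that[of "C / (1 - \<rho>)" \<rho>])
    show "0 \<le> C / (1 - \<rho>)" using C0 \<rho> by simp
    show "AE \<omega> in M. (\<lambda>k. trunc k t (path \<omega>)) \<longlonglongrightarrow> causal t (path \<omega>)" for t
      using T_fin[of t] main by (auto elim!: eventually_mono)
    show "expectation (\<lambda>\<omega>. min 1 \<bar>causal t (path \<omega>) - trunc k t (path \<omega>)\<bar>) \<le> C / (1 - \<rho>) * \<rho> ^ k" for k t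
    proof -
      have int: "integrable M (\<lambda>\<omega>. min 1 \<bar>causal t (path \<omega>) - trunc k t (path \<omega>)\<bar>)"
        by (rule integrable_const_bound[where B = 1]) auto
      have "ennreal (expectation (\<lambda>\<omega>. min 1 \<bar>causal t (path \<omega>) - trunc k t (path \<omega>)\<bar>))
          = (\<integral>\<^sup>+\<omega>. ennreal (min 1 \<bar>causal t (path \<omega>) - trunc k t (path \<omega>)\<bar>) \<partial>M)"
        by (rule nn_integral_eq_integral[OF int, symmetric]) simp
      also have "\<dots> \<le> (\<integral>\<^sup>+\<omega>. T k t \<omega> \<partial>M)"
        using T_fin[of t] main by (intro nn_integral_mono_AE) (auto elim!: eventually_mono)
      also have "\<dots> \<le> ennreal (C * \<rho> ^ k / (1 - \<rho>))" by (rule T)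
      finally show ?thesis using C0 \<rho> by (simp add: ennreal_le_iff)
    qed
  qed (use \<rho> in auto)
qed

lemma stationary_solution_causal:
  assumes stat: "strictly_stationary M Y" and sol: "bilinear_solution M \<epsilon> \<mu> \<phi> b Y"
  shows "AE \<omega> in M. \<forall>t. Y t \<omega> = causal t (path \<omega>)"
proof -
  have [measurable]: "Y t \<in> borel_measurable M" for t using stat by (auto simp: strictly_stationary_def)
  have [measurable]: "(\<lambda>\<omega>. trunc k t (path \<omega>)) \<in> borel_measurable M"
    "(\<lambda>\<omega>. causal t (path \<omega>)) \<in> borel_measurable M"
    "(\<lambda>\<omega>. gain k t (path \<omega>)) \<in> borel_measurable M" for k t
    using measurable_path_compose[OF depends_on_gain] measurable_path_compose[OF depends_on_trunc]
      measurable_path_compose[OF depends_on_causal] by auto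
  have Y_distr: "distr M borel (Y t) = distr M borel (Y 0)" for t
  proof -
    have m: "(\<lambda>\<omega> s. Y (s + h) \<omega>) \<in> M \<rightarrow>\<^sub>M Pi\<^sub>M UNIV (\<lambda>_. borel)" for h
      by (rule measurable_PiM_single') auto
    have "distr (distr M (Pi\<^sub>M UNIV (\<lambda>_. borel)) (\<lambda>\<omega> s. Y (s + t) \<omega>)) borel (\<lambda>y. y 0)
        = distr (distr M (Pi\<^sub>M UNIV (\<lambda>_. borel)) (\<lambda>\<omega> s. Y s \<omega>)) borel (\<lambda>y. y 0)"
      using stat unfolding strictly_stationary_def by simp
    then show ?thesis using m[of t] m[of 0] by (subst (asm) (1 2) distr_distr) (auto simp: comp_def)
  qed
  have sol': "AE \<omega> in M. \<forall>t. Y t \<omega> = \<mu> + \<phi> * Y (t - 2) \<omega> + b * Y (t - 2) \<omega> * \<epsilon> (t - 1) \<omega> + \<epsilon> t \<omega>"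
    using sol unfolding bilinear_solution_def AE_all_countable by blast
  have remainder: "Y t \<omega> - trunc k t (path \<omega>) = gain k t (path \<omega>) * Y (t - 2 * int k) \<omega>"
    if eq: "\<forall>t. Y t \<omega> = \<mu> + \<phi> * Y (t - 2) \<omega> + b * Y (t - 2) \<omega> * \<epsilon> (t - 1) \<omega> + \<epsilon> t \<omega>" for \<omega> k t
  proof (induction k arbitrary: t)
    case (Suc k)
    have "Y t \<omega> - trunc (Suc k) t (path \<omega>) = (\<phi> + b * path \<omega> (t - 1)) * (Y (t - 2) \<omega> - trunc k (t - 2) (path \<omega>))"
      using eq[rule_format, of t] by (simp add: path_def algebra_simps)
    also have "\<dots> = gain (Suc k) t (path \<omega>) * Y (t - 2 - 2 * int k) \<omega>"
      unfolding Suc by (simp add: gain_Suc)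
    finally show ?case by (simp add: algebra_simps)
  qed (simp add: gain_def)
  obtain C r where C: "0 \<le> C" "0 < r" "r < 1"
    and approx: "\<And>k t. expectation (\<lambda>\<omega>. min 1 \<bar>causal t (path \<omega>) - trunc k t (path \<omega>)\<bar>) \<le> C * r ^ k"
    using causal_approximation by metis
  obtain d \<rho> where d: "0 < d" "d \<le> 1" and \<rho>: "0 < \<rho>" "\<rho> < 1"
    and A: "\<And>t. integrable M (\<lambda>\<omega>. \<bar>\<phi> + b * \<epsilon> t \<omega>\<bar> powr d)"
      "\<And>t. expectation (\<lambda>\<omega>. \<bar>\<phi> + b * \<epsilon> t \<omega>\<bar> powr d) \<le> \<rho>"
    using contraction by blast
  have gain: "integrable M (\<lambda>\<omega>. \<bar>gain k t (path \<omega>)\<bar> powr d)"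
    "expectation (\<lambda>\<omega>. \<bar>gain k t (path \<omega>)\<bar> powr d) \<le> 1 * \<rho> ^ k" for k t
  proof -
    have "integrable M (\<lambda>\<omega>. \<bar>gain 0 t (path \<omega>)\<bar> powr d)" "expectation (\<lambda>\<omega>. \<bar>gain 0 t (path \<omega>)\<bar> powr d) \<le> 1" for t
      by (auto simp: gain_def prob_space)
    then have "integrable M (\<lambda>\<omega>. \<bar>gain k t (path \<omega>)\<bar> powr d) \<and>
      expectation (\<lambda>\<omega>. \<bar>gain k t (path \<omega>)\<bar> powr d) \<le> 1 * \<rho> ^ k"
      by (intro linear_recursion_moment[of gain, OF gain_Suc depends_on_gain A])
    then show "integrable M (\<lambda>\<omega>. \<bar>gain k t (path \<omega>)\<bar> powr d)"
      "expectation (\<lambda>\<omega>. \<bar>gain k t (path \<omega>)\<bar> powr d) \<le> 1 * \<rho> ^ k" by blast+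
  qed
  \<comment> \<open>Three errors: the truncation of \<open>causal\<close>; the gain acting on a
    remote value of size at most \<open>K\<close>, estimated by \<open>min 1 x <= x powr d\<close>;
    and the event that the remote value exceeds \<open>K\<close>, whose probability does not depend
    on \<open>k\<close> by stationarity.\<close>
  have bound: "expectation (\<lambda>\<omega>. min 1 \<bar>Y t \<omega> - causal t (path \<omega>)\<bar>)
      \<le> C * r ^ k + (K powr d * \<rho> ^ k + prob {\<omega> \<in> space M. K < \<bar>Y 0 \<omega>\<bar>})" if K: "0 < K" for K k t
  proof -
    let ?I = "\<lambda>\<omega>. indicat_real {\<omega> \<in> space M. K < \<bar>Y (t - 2 * int k) \<omega>\<bar>} \<omega>"
    have i1: "integrable M (\<lambda>\<omega>. min 1 \<bar>causal t (path \<omega>) - trunc k t (path \<omega>)\<bar>)"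
      by (rule integrable_const_bound[where B = 1]) auto
    have i2: "integrable M ?I" by (rule integrable_const_bound[where B = 1]) auto
    have "expectation (\<lambda>\<omega>. min 1 \<bar>Y t \<omega> - causal t (path \<omega>)\<bar>)
      \<le> expectation (\<lambda>\<omega>. min 1 \<bar>causal t (path \<omega>) - trunc k t (path \<omega>)\<bar>
            + (K powr d * \<bar>gain k t (path \<omega>)\<bar> powr d + ?I \<omega>))"
    proof (rule integral_mono_AE)
      show "integrable M (\<lambda>\<omega>. min 1 \<bar>Y t \<omega> - causal t (path \<omega>)\<bar>)"
        by (rule integrable_const_bound[where B = 1]) auto
      show "integrable M (\<lambda>\<omega>. min 1 \<bar>causal t (path \<omega>) - trunc k t (path \<omega>)\<bar>
            + (K powr d * \<bar>gain k t (path \<omega>)\<bar> powr d + ?I \<omega>))"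
        using i1 i2 gain by simp
      show "AE \<omega> in M. min 1 \<bar>Y t \<omega> - causal t (path \<omega>)\<bar>
          \<le> min 1 \<bar>causal t (path \<omega>) - trunc k t (path \<omega>)\<bar> + (K powr d * \<bar>gain k t (path \<omega>)\<bar> powr d + ?I \<omega>)"
        using sol' AE_space
      proof eventually_elim
        case (elim \<omega>)
        define g y where "g = gain k t (path \<omega>)" and "y = Y (t - 2 * int k) \<omega>"
        have "min 1 \<bar>Y t \<omega> - causal t (path \<omega>)\<bar>
            \<le> min 1 \<bar>causal t (path \<omega>) - trunc k t (path \<omega>)\<bar> + min 1 \<bar>Y t \<omega> - trunc k t (path \<omega>)\<bar>"
          by (simp add: min_def) linarith
        also have "Y t \<omega> - trunc k t (path \<omega>) = g * y"
          using remainder[OF elim(1)] by (simp add: g_def y_def)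
        also have "min 1 \<bar>g * y\<bar> \<le> K powr d * \<bar>g\<bar> powr d + ?I \<omega>"
        proof (cases "K < \<bar>y\<bar>")
          case True
          then have "?I \<omega> = 1" using elim(2) by (simp add: y_def)
          moreover have "0 \<le> K powr d * \<bar>g\<bar> powr d" "min 1 \<bar>g * y\<bar> \<le> 1" by simp_all
          ultimately show ?thesis by linarith
        next
          case False
          then have "\<bar>g * y\<bar> \<le> K * \<bar>g\<bar>" by (simp add: abs_mult mult.commute[of K] mult_left_mono)
          moreover have "min 1 (K * \<bar>g\<bar>) \<le> (K * \<bar>g\<bar>) powr d"
          proof (cases "K * \<bar>g\<bar> \<le> 1")
            case True
            then show ?thesis using powr_mono'[of d 1 "K * \<bar>g\<bar>"] d K by simp
          next
            case False
            then show ?thesis using ge_one_powr_ge_zero[of "K * \<bar>g\<bar>" d] d by simp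
          qed
          moreover have "(K * \<bar>g\<bar>) powr d = K powr d * \<bar>g\<bar> powr d" using K by (simp add: powr_mult)
          moreover have "0 \<le> ?I \<omega>" by simp
          ultimately show ?thesis by linarith
        qed
        finally show ?case by (simp add: g_def)
      qed
    qed
    also have "\<dots> = expectation (\<lambda>\<omega>. min 1 \<bar>causal t (path \<omega>) - trunc k t (path \<omega>)\<bar>)
        + (K powr d * expectation (\<lambda>\<omega>. \<bar>gain k t (path \<omega>)\<bar> powr d) + prob {\<omega> \<in> space M. K < \<bar>Y (t - 2 * int k) \<omega>\<bar>})"
      using i1 i2 gain by simp
    also have "prob {\<omega> \<in> space M. K < \<bar>Y (t - 2 * int k) \<omega>\<bar>} = prob {\<omega> \<in> space M. K < \<bar>Y 0 \<omega>\<bar>}"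
    proof -
      have "measure (distr M borel (Y s)) {y. K < \<bar>y\<bar>} = prob {\<omega> \<in> space M. K < \<bar>Y s \<omega>\<bar>}" for s
        by (subst measure_distr) (auto intro!: arg_cong[where f = prob])
      then show ?thesis using Y_distr by metis
    qed
    also have "expectation (\<lambda>\<omega>. min 1 \<bar>causal t (path \<omega>) - trunc k t (path \<omega>)\<bar>) \<le> C * r ^ k" by (rule approx)
    also have "K powr d * expectation (\<lambda>\<omega>. \<bar>gain k t (path \<omega>)\<bar> powr d) \<le> K powr d * \<rho> ^ k"
      using gain(2)[of k t] by (intro mult_left_mono) auto
    finally show ?thesis by simp
  qed
  \<comment> \<open>For fixed \<open>K\<close> the depth \<open>k\<close> goes to infinity;
    afterwards \<open>K\<close> runs through the natural numbers.\<close>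
  have bound': "expectation (\<lambda>\<omega>. min 1 \<bar>Y t \<omega> - causal t (path \<omega>)\<bar>) \<le> prob {\<omega> \<in> space M. K < \<bar>Y 0 \<omega>\<bar>}"
    if K: "0 < K" for K t
  proof (rule LIMSEQ_le_const)
    have "(\<lambda>k. C * r ^ k + (K powr d * \<rho> ^ k + prob {\<omega> \<in> space M. K < \<bar>Y 0 \<omega>\<bar>}))
        \<longlonglongrightarrow> C * 0 + (K powr d * 0 + prob {\<omega> \<in> space M. K < \<bar>Y 0 \<omega>\<bar>})"
      using C \<rho> by (intro tendsto_intros LIMSEQ_realpow_zero) auto
    then show "(\<lambda>k. C * r ^ k + (K powr d * \<rho> ^ k + prob {\<omega> \<in> space M. K < \<bar>Y 0 \<omega>\<bar>}))
        \<longlonglongrightarrow> prob {\<omega> \<in> space M. K < \<bar>Y 0 \<omega>\<bar>}" by simp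
  qed (use bound[OF K] in auto)
  have "(\<lambda>n. prob {\<omega> \<in> space M. real n < \<bar>Y 0 \<omega>\<bar>}) \<longlonglongrightarrow> prob (\<Inter>n. {\<omega> \<in> space M. real n < \<bar>Y 0 \<omega>\<bar>})"
    by (rule finite_Lim_measure_decseq) (auto simp: decseq_def)
  moreover have "(\<Inter>n. {\<omega> \<in> space M. real n < \<bar>Y 0 \<omega>\<bar>}) = {}"
  proof -
    have "\<exists>n. \<not> real n < \<bar>Y 0 \<omega>\<bar>" for \<omega> using reals_Archimedean2[of "\<bar>Y 0 \<omega>\<bar>"] by (meson less_asym)
    then show ?thesis by auto
  qed
  ultimately have tail: "(\<lambda>n. prob {\<omega> \<in> space M. real n < \<bar>Y 0 \<omega>\<bar>}) \<longlonglongrightarrow> 0" by simp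
  have "AE \<omega> in M. Y t \<omega> = causal t (path \<omega>)" for t
  proof -
    have int: "integrable M (\<lambda>\<omega>. min 1 \<bar>Y t \<omega> - causal t (path \<omega>)\<bar>)"
      by (rule integrable_const_bound[where B = 1]) auto
    have "expectation (\<lambda>\<omega>. min 1 \<bar>Y t \<omega> - causal t (path \<omega>)\<bar>) \<le> 0"
      by (rule LIMSEQ_le_const[OF tail]) (use bound' in \<open>auto intro!: exI[of _ 1]\<close>)
    then have "expectation (\<lambda>\<omega>. min 1 \<bar>Y t \<omega> - causal t (path \<omega>)\<bar>) = 0"
      by (intro antisym) auto
    then have "AE \<omega> in M. min 1 \<bar>Y t \<omega> - causal t (path \<omega>)\<bar> = 0"
      using integral_nonneg_eq_0_iff_AE[OF int] by simp
    then show ?thesis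
    proof eventually_elim
      case (elim \<omega>)
      then show ?case by (simp add: min_def split: if_splits)
    qed
  qed
  then show ?thesis by (simp add: AE_all_countable)
qed

end

section \<open>Functionals of the lagged observation and two innovations\<close>

definition weight :: "real \<Rightarrow> real \<Rightarrow> real" where
  "weight e e' = 1 + \<bar>e\<bar> + \<bar>e'\<bar>"

text \<open>Bounded and Lipschitz in the lagged observation, of growth \<open>k\<close> in the two
  innovations. With a bound and a Lipschitz constant together, changing the lagged value costs a
  multiple of \<open>min 1 |y - y'|\<close>, the only quantity in which the causal solution is
  approximated in mean. Degree 2 is the largest one whose square the fourth moment controls.\<close>

definition reg :: "nat \<Rightarrow> (real \<Rightarrow> real \<Rightarrow> real \<Rightarrow> real) \<Rightarrow> bool" where
  "reg k F \<longleftrightarrow> (\<lambda>(y, e, e'). F y e e') \<in> borel_measurable (borel \<Otimes>\<^sub>M borel \<Otimes>\<^sub>M borel) \<and>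
     (\<exists>C\<ge>0. \<forall>y y' e e'. \<bar>F y e e'\<bar> \<le> C * weight e e' ^ k \<and>
        \<bar>F y e e' - F y' e e'\<bar> \<le> C * \<bar>y - y'\<bar> * weight e e' ^ k)"

lemma weight_ge_1: "1 \<le> weight e e'"
  by (simp add: weight_def)

lemma weight_power_ge_1: "1 \<le> weight e e' ^ k"
  by (simp add: weight_ge_1 one_le_power)

lemma weight_power_nonneg: "0 \<le> weight e e' ^ k"
  using weight_power_ge_1[of e e' k] by linarith

lemma regI:
  assumes "(\<lambda>(y, e, e'). F y e e') \<in> borel_measurable (borel \<Otimes>\<^sub>M borel \<Otimes>\<^sub>M borel)" "0 \<le> C"
    and "\<And>y e e'. \<bar>F y e e'\<bar> \<le> C * weight e e' ^ k"
    and "\<And>y y' e e'. \<bar>F y e e' - F y' e e'\<bar> \<le> C * \<bar>y - y'\<bar> * weight e e' ^ k"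
  shows "reg k F"
  using assms unfolding reg_def by blast

lemma regE:
  assumes "reg k F"
  obtains C where "0 \<le> C" "\<And>y e e'. \<bar>F y e e'\<bar> \<le> C * weight e e' ^ k"
    "\<And>y y' e e'. \<bar>F y e e' - F y' e e'\<bar> \<le> C * \<bar>y - y'\<bar> * weight e e' ^ k"
  using assms unfolding reg_def by blast

lemma reg_measurable:
  "reg k F \<Longrightarrow> (\<lambda>(y, e, e'). F y e e') \<in> borel_measurable (borel \<Otimes>\<^sub>M borel \<Otimes>\<^sub>M borel)"
  by (simp add: reg_def)

lemma reg_of_lag:
  assumes "g \<in> borel_measurable borel" "\<And>y. \<bar>g y\<bar> \<le> C" "\<And>y y'. \<bar>g y - g y'\<bar> \<le> C * \<bar>y - y'\<bar>"
  shows "reg 0 (\<lambda>y e e'. g y)"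
proof (rule regI)
  note [measurable] = assms(1)
  show "(\<lambda>(y, e, e'). g y) \<in> borel_measurable (borel \<Otimes>\<^sub>M (borel :: real measure) \<Otimes>\<^sub>M (borel :: real measure))"
    by measurable
  show "0 \<le> C" using assms(2)[of 0] by linarith
qed (use assms in auto)

lemma reg_const: "reg 0 (\<lambda>y e e'. c)"
  by (rule reg_of_lag[where C = "\<bar>c\<bar>"]) auto

lemma reg_first: "reg 1 (\<lambda>y e e'. e)" and reg_second: "reg 1 (\<lambda>y e e'. e')"
  by (rule regI[where C = 1]; simp add: weight_def)+

lemma reg_mono:
  assumes "reg k F" "k \<le> l"
  shows "reg l F"
proof -
  obtain C where C: "0 \<le> C" "\<And>y e e'. \<bar>F y e e'\<bar> \<le> C * weight e e' ^ k"
    "\<And>y y' e e'. \<bar>F y e e' - F y' e e'\<bar> \<le> C * \<bar>y - y'\<bar> * weight e e' ^ k" using regE[OF assms(1)] by blast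
  have le: "weight e e' ^ k \<le> weight e e' ^ l" for e e'
    by (intro power_increasing assms weight_ge_1)
  show ?thesis
  proof (rule regI[OF reg_measurable[OF assms(1)] C(1)])
    show "\<bar>F y e e'\<bar> \<le> C * weight e e' ^ l" for y e e'
      by (rule order_trans[OF C(2) mult_left_mono[OF le C(1)]])
    show "\<bar>F y e e' - F y' e e'\<bar> \<le> C * \<bar>y - y'\<bar> * weight e e' ^ l" for y y' e e'
      by (rule order_trans[OF C(3) mult_left_mono[OF le]]) (use C(1) in simp)
  qed
qed

lemma reg_add:
  assumes "reg k F" "reg k G"
  shows "reg k (\<lambda>y e e'. F y e e' + G y e e')"
proof -
  obtain C where C: "0 \<le> C" "\<And>y e e'. \<bar>F y e e'\<bar> \<le> C * weight e e' ^ k"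
    "\<And>y y' e e'. \<bar>F y e e' - F y' e e'\<bar> \<le> C * \<bar>y - y'\<bar> * weight e e' ^ k" using regE[OF assms(1)] by blast
  obtain D where D: "0 \<le> D" "\<And>y e e'. \<bar>G y e e'\<bar> \<le> D * weight e e' ^ k"
    "\<And>y y' e e'. \<bar>G y e e' - G y' e e'\<bar> \<le> D * \<bar>y - y'\<bar> * weight e e' ^ k" using regE[OF assms(2)] by blast
  show ?thesis
  proof (rule regI[where C = "C + D"])
    show "(\<lambda>(y, e, e'). F y e e' + G y e e') \<in> borel_measurable (borel \<Otimes>\<^sub>M borel \<Otimes>\<^sub>M borel)"
      using borel_measurable_add[OF assms[THEN reg_measurable]] by (simp add: case_prod_beta')
    show "\<bar>F y e e' + G y e e'\<bar> \<le> (C + D) * weight e e' ^ k" for y e e'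
      using C(2)[of y e e'] D(2)[of y e e'] by (simp add: distrib_right)
    show "\<bar>F y e e' + G y e e' - (F y' e e' + G y' e e')\<bar> \<le> (C + D) * \<bar>y - y'\<bar> * weight e e' ^ k" for y y' e e'
      using C(3)[of y e e' y'] D(3)[of y e e' y'] by (simp add: distrib_right)
  qed (use C D in auto)
qed

lemma reg_mult:
  assumes "reg k F" "reg l G"
  shows "reg (k + l) (\<lambda>y e e'. F y e e' * G y e e')"
proof -
  obtain C where C: "0 \<le> C" "\<And>y e e'. \<bar>F y e e'\<bar> \<le> C * weight e e' ^ k"
    "\<And>y y' e e'. \<bar>F y e e' - F y' e e'\<bar> \<le> C * \<bar>y - y'\<bar> * weight e e' ^ k" using regE[OF assms(1)] by blast
  obtain D where D: "0 \<le> D" "\<And>y e e'. \<bar>G y e e'\<bar> \<le> D * weight e e' ^ l"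
    "\<And>y y' e e'. \<bar>G y e e' - G y' e e'\<bar> \<le> D * \<bar>y - y'\<bar> * weight e e' ^ l" using regE[OF assms(2)] by blast
  show ?thesis
  proof (rule regI[where C = "2 * C * D"])
    show "(\<lambda>(y, e, e'). F y e e' * G y e e') \<in> borel_measurable (borel \<Otimes>\<^sub>M borel \<Otimes>\<^sub>M borel)"
      using borel_measurable_times[OF assms[THEN reg_measurable]] by (simp add: case_prod_beta')
    show "\<bar>F y e e' * G y e e'\<bar> \<le> 2 * C * D * weight e e' ^ (k + l)" for y e e'
    proof -
      have "\<bar>F y e e' * G y e e'\<bar> \<le> (C * weight e e' ^ k) * (D * weight e e' ^ l)"
        unfolding abs_mult by (intro mult_mono C D mult_nonneg_nonneg weight_power_nonneg) auto
      moreover have "0 \<le> C * D * weight e e' ^ (k + l)" using C D by (intro mult_nonneg_nonneg weight_power_nonneg) auto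
      ultimately show ?thesis by (simp add: power_add mult_ac)
    qed
    show "\<bar>F y e e' * G y e e' - F y' e e' * G y' e e'\<bar> \<le> 2 * C * D * \<bar>y - y'\<bar> * weight e e' ^ (k + l)" for y y' e e'
    proof -
      have "F y e e' * G y e e' - F y' e e' * G y' e e'
          = (F y e e' - F y' e e') * G y e e' + F y' e e' * (G y e e' - G y' e e')"
        by (simp add: algebra_simps)
      then have "\<bar>F y e e' * G y e e' - F y' e e' * G y' e e'\<bar>
          \<le> \<bar>F y e e' - F y' e e'\<bar> * \<bar>G y e e'\<bar> + \<bar>F y' e e'\<bar> * \<bar>G y e e' - G y' e e'\<bar>"
        by (metis abs_mult abs_triangle_ineq)
      also have "\<dots> \<le> (C * \<bar>y - y'\<bar> * weight e e' ^ k) * (D * weight e e' ^ l)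
          + (C * weight e e' ^ k) * (D * \<bar>y - y'\<bar> * weight e e' ^ l)"
        by (intro add_mono mult_mono C D mult_nonneg_nonneg weight_power_nonneg) auto
      finally show ?thesis by (simp add: power_add mult_ac)
    qed
  qed (use C D in auto)
qed

lemma reg_cmult: "reg k F \<Longrightarrow> reg k (\<lambda>y e e'. c * F y e e')"
  using reg_mult[OF reg_const[of c], of k F] by simp

lemma reg_diff: "reg k F \<Longrightarrow> reg k G \<Longrightarrow> reg k (\<lambda>y e e'. F y e e' - G y e e')"
  using reg_add[of k F "\<lambda>y e e'. (-1) * G y e e'"] reg_cmult[of k G "-1"] by simp

lemma reg_mult2: "reg 1 F \<Longrightarrow> reg 1 G \<Longrightarrow> reg 2 (\<lambda>y e e'. F y e e' * G y e e')"
  using reg_mult[of 1 F 1 G] by (simp add: numeral_2_eq_2)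

lemma reg_lag_mult: "reg 0 F \<Longrightarrow> reg k G \<Longrightarrow> reg k (\<lambda>y e e'. F y e e' * G y e e')"
  using reg_mult[of 0 F k G] by simp

text \<open>A lag of \<open>i\<close> leaves room for a truncation of depth
  \<open>(i - 2) div 2\<close>, since the recursion moves in steps of two. Passing to the square
  root of \<open>\<rho>\<close> turns decay in the depth into decay in the lag; the power 3 absorbs
  the rounding.\<close>

lemma power_div_le:
  fixes \<rho> :: real
  assumes "0 < \<rho>" "\<rho> < 1"
  obtains K q where "0 < q" "q < 1" "0 \<le> K" "\<And>i. \<rho> ^ ((i - 2) div 2) \<le> K * q ^ i"
proof -
  define q where "q = sqrt \<rho>"
  have q: "0 < q" "q < 1" using assms by (auto simp: q_def real_sqrt_lt_1_iff)
  have q2: "q ^ 2 = \<rho>" using assms by (simp add: q_def)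
  have "\<rho> ^ ((i - 2) div 2) \<le> inverse (q ^ 3) * q ^ i" for i
  proof -
    have "i \<le> 2 * ((i - 2) div 2) + 3" by presburger
    then have "q ^ (2 * ((i - 2) div 2) + 3) \<le> q ^ i" using q by (intro power_decreasing) auto
    moreover have "q ^ (2 * ((i - 2) div 2) + 3) = \<rho> ^ ((i - 2) div 2) * q ^ 3"
      unfolding power_add power_mult q2 by simp
    ultimately have "\<rho> ^ ((i - 2) div 2) * q ^ 3 \<le> q ^ i" by simp
    then show ?thesis using q by (simp add: field_simps)
  qed
  then show ?thesis using q by (intro that[of q "inverse (q ^ 3)"]) auto
qed

text \<open>Appending one term adds its variance and twice its covariances with all earlier terms, a
  geometric sum bounded independently of \<open>n\<close>.\<close>

lemma (in prob_space) expectation_square_sum_decay: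
  fixes a :: "nat \<Rightarrow> 'a \<Rightarrow> real"
  assumes [measurable]: "\<And>i. a i \<in> borel_measurable M"
    and sq: "\<And>i. integrable M (\<lambda>x. (a i x)\<^sup>2)"
    and q: "0 < q" "q < 1" "0 \<le> K"
    and cov: "\<And>i j. i \<le> j \<Longrightarrow> \<bar>expectation (\<lambda>x. a i x * a j x)\<bar> \<le> K * q ^ (j - i)"
  shows "expectation (\<lambda>x. (\<Sum>i<n. a i x)\<^sup>2) \<le> 2 * K / (1 - q) * real n"
proof (induction n)
  case (Suc n)
  have i1: "integrable M (\<lambda>x. (\<Sum>i<n. a i x)\<^sup>2)" using sq by (intro integrable_sum_L2) auto
  have i2: "integrable M (\<lambda>x. a i x * a n x)" for i by (intro integrable_mult_L2 sq) auto
  have i3: "integrable M (\<lambda>x. (\<Sum>i<n. a i x) * a n x)" unfolding sum_distrib_right using i2 by simp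
  have "expectation (\<lambda>x. (\<Sum>i<Suc n. a i x)\<^sup>2)
      = expectation (\<lambda>x. (\<Sum>i<n. a i x)\<^sup>2 + (a n x)\<^sup>2 + 2 * ((\<Sum>i<n. a i x) * a n x))"
    by (simp add: power2_sum mult.assoc)
  also have "\<dots> = expectation (\<lambda>x. (\<Sum>i<n. a i x)\<^sup>2) + expectation (\<lambda>x. (a n x)\<^sup>2)
      + 2 * expectation (\<lambda>x. (\<Sum>i<n. a i x) * a n x)"
    using i1 i3 sq by simp
  also have "expectation (\<lambda>x. (\<Sum>i<n. a i x) * a n x) = (\<Sum>i<n. expectation (\<lambda>x. a i x * a n x))"
    unfolding sum_distrib_right using i2 by simp
  also have "\<dots> \<le> (\<Sum>i<n. K * q ^ (n - i))"
    by (intro sum_mono order_trans[OF abs_ge_self cov]) auto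
  \<comment> \<open>Doubling the variance makes it the lag 0 term of the geometric sum of
    covariances, which also carries a factor 2.\<close>
  also have "expectation (\<lambda>x. (a n x)\<^sup>2) \<le> 2 * (K * q ^ (n - n))"
  proof -
    have "expectation (\<lambda>x. (a n x)\<^sup>2) \<le> K" using cov[of n n] by (simp add: power2_eq_square abs_le_iff)
    then show ?thesis using q by simp
  qed
  also have "expectation (\<lambda>x. (\<Sum>i<n. a i x)\<^sup>2) + 2 * (K * q ^ (n - n)) + 2 * (\<Sum>i<n. K * q ^ (n - i))
      = expectation (\<lambda>x. (\<Sum>i<n. a i x)\<^sup>2) + 2 * K * (\<Sum>i<Suc n. q ^ (n - i))"
    by (simp add: sum_distrib_left algebra_simps)
  also have "(\<Sum>i<Suc n. q ^ (n - i)) = (\<Sum>i<Suc n. q ^ i)"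
    by (subst sum.nat_diff_reindex[symmetric]) (simp add: )
  also have "\<dots> = (1 - q ^ Suc n) / (1 - q)" using q by (subst sum_gp_strict) auto
  also have "\<dots> \<le> 1 / (1 - q)" using q by (intro divide_right_mono) auto
  finally have "expectation (\<lambda>x. (\<Sum>i<Suc n. a i x)\<^sup>2)
      \<le> expectation (\<lambda>x. (\<Sum>i<n. a i x)\<^sup>2) + 2 * K * (1 / (1 - q))"
    using q by (simp add: mult_left_mono)
  also have "\<dots> \<le> 2 * K / (1 - q) * real n + 2 * K / (1 - q)" using Suc by simp
  also have "\<dots> = 2 * K / (1 - q) * real (Suc n)" unfolding of_nat_Suc distrib_left by simp
  finally show ?case .
qed simp

section \<open>Moments, approximation and the strong law for functionals of the process\<close>

context bilinear_process
begin

definition obs :: "(real \<Rightarrow> real \<Rightarrow> real \<Rightarrow> real) \<Rightarrow> int \<Rightarrow> (int \<Rightarrow> real) \<Rightarrow> real" where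
  "obs F t e = F (causal (t - 2) e) (e (t - 1)) (e t)"

definition obs_trunc :: "(real \<Rightarrow> real \<Rightarrow> real \<Rightarrow> real) \<Rightarrow> nat \<Rightarrow> int \<Rightarrow> (int \<Rightarrow> real) \<Rightarrow> real" where
  "obs_trunc F m t e = F (trunc m (t - 2) e) (e (t - 1)) (e t)"

lemma obs_shift: "obs F t (\<lambda>s. e (s + h)) = obs F (t + h) e"
proof -
  have "t - 2 + h = t + h - 2" "t - 1 + h = t + h - 1" by linarith+
  then show ?thesis unfolding obs_def causal_shift by (simp only:)
qed

lemma obs_trunc_shift: "obs_trunc F m t (\<lambda>s. e (s + h)) = obs_trunc F m (t + h) e"
proof -
  have "t - 2 + h = t + h - 2" "t - 1 + h = t + h - 1" by linarith+
  then show ?thesis unfolding obs_trunc_def trunc_shift by (simp only:)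
qed

lemma depends_on_lagged:
  assumes "reg k F" "depends_on I \<Psi>" "t - 1 \<in> I" "t \<in> I"
  shows "depends_on I (\<lambda>e. F (\<Psi> e) (e (t - 1)) (e t))"
  by (rule depends_on_compose3[OF assms(2) depends_on_coordinate depends_on_coordinate reg_measurable[OF assms(1)]])
    (use assms in auto)

lemma depends_on_obs: "reg k F \<Longrightarrow> depends_on {..t} (obs F t)"
  unfolding obs_def[abs_def]
  by (rule depends_on_lagged) (auto intro: depends_on_mono[OF depends_on_causal])

lemma depends_on_obs_trunc: "reg k F \<Longrightarrow> depends_on {t - 2 * int m - 1..t} (obs_trunc F m t)"
  unfolding obs_trunc_def[abs_def]
  by (rule depends_on_lagged) (auto intro: depends_on_mono[OF depends_on_trunc])

lemma depends_on_weight: "depends_on {t - 1, t} (\<lambda>e. weight (e (t - 1)) (e t) ^ k)"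
proof -
  have "depends_on {t - 1, t} (\<lambda>e. (\<lambda>x y z. weight x y ^ k) (e (t - 1)) (e t) (e t))"
    by (rule depends_on_compose3) (auto intro!: depends_on_coordinate simp: weight_def)
  then show ?thesis by simp
qed

text \<open>\<open>27 = 9 * 3\<close> results from applying the inequality for the square of a sum
  of three terms twice to the fourth power of \<open>weight\<close>; both innovations contribute the
  same fourth moment.\<close>

definition weight_bound :: real where
  "weight_bound = 27 * (1 + 2 * expectation (\<lambda>\<omega>. \<epsilon> 1 \<omega> ^ 4))"

lemma weight_bound_nonneg: "0 \<le> weight_bound"
  by (simp add: weight_bound_def)

lemma
  shows integrable_weight: "integrable M (\<lambda>\<omega>. weight (path \<omega> (t - 1)) (path \<omega> t) ^ 4)"
    and expectation_weight: "expectation (\<lambda>\<omega>. weight (path \<omega> (t - 1)) (path \<omega> t) ^ 4) \<le> weight_bound"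
proof -
  have le: "weight x y ^ 4 \<le> 27 * (1 + x ^ 4 + y ^ 4)" for x y
  proof -
    have "weight x y ^ 2 \<le> 3 * (1 + x\<^sup>2 + y\<^sup>2)"
      using zero_le_power2[of "1 - \<bar>x\<bar>"] zero_le_power2[of "1 - \<bar>y\<bar>"] zero_le_power2[of "\<bar>x\<bar> - \<bar>y\<bar>"]
      by (simp add: weight_def power2_eq_square algebra_simps)
    then have "(weight x y ^ 2) ^ 2 \<le> (3 * (1 + x\<^sup>2 + y\<^sup>2)) ^ 2" by (intro power_mono) auto
    also have "\<dots> = 9 * (1 + x\<^sup>2 + y\<^sup>2)\<^sup>2" unfolding power_mult_distrib by simp
    also have "(1 + x\<^sup>2 + y\<^sup>2)\<^sup>2 \<le> 3 * (1 + (x\<^sup>2)\<^sup>2 + (y\<^sup>2)\<^sup>2)"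
      using zero_le_power2[of "1 - x\<^sup>2"] zero_le_power2[of "1 - y\<^sup>2"] zero_le_power2[of "x\<^sup>2 - y\<^sup>2"]
      by (simp add: power2_eq_square algebra_simps)
    finally show ?thesis by (simp flip: power_mult)
  qed
  have int: "integrable M (\<lambda>\<omega>. 27 * (1 + \<epsilon> (t - 1) \<omega> ^ 4 + \<epsilon> t \<omega> ^ 4))"
    using integrable_innovation_power'[of 4] by simp
  show 1: "integrable M (\<lambda>\<omega>. weight (path \<omega> (t - 1)) (path \<omega> t) ^ 4)"
  proof (rule Bochner_Integration.integrable_bound[OF int])
    show "(\<lambda>\<omega>. weight (path \<omega> (t - 1)) (path \<omega> t) ^ 4) \<in> borel_measurable M"
      by (rule measurable_path_compose[OF depends_on_weight])
    show "AE \<omega> in M. norm (weight (path \<omega> (t - 1)) (path \<omega> t) ^ 4) \<le> norm (27 * (1 + \<epsilon> (t - 1) \<omega> ^ 4 + \<epsilon> t \<omega> ^ 4))"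
      using le by (auto simp: path_def intro!: AE_I2 order_trans[OF _ abs_ge_self])
  qed
  have "expectation (\<lambda>\<omega>. weight (path \<omega> (t - 1)) (path \<omega> t) ^ 4)
      \<le> expectation (\<lambda>\<omega>. 27 * (1 + \<epsilon> (t - 1) \<omega> ^ 4 + \<epsilon> t \<omega> ^ 4))"
    by (rule integral_mono[OF 1 int]) (use le in \<open>auto simp: path_def\<close>)
  also have "\<dots> = 27 * (1 + expectation (\<lambda>\<omega>. \<epsilon> (t - 1) \<omega> ^ 4) + expectation (\<lambda>\<omega>. \<epsilon> t \<omega> ^ 4))"
    using integrable_innovation_power'[of 4] by (simp add: prob_space)
  also have "\<dots> = weight_bound"
    using innovation_expectation[of "\<lambda>x. x ^ 4" "t - 1"] innovation_expectation[of "\<lambda>x. x ^ 4" t]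
    by (simp add: weight_bound_def)
  finally show "expectation (\<lambda>\<omega>. weight (path \<omega> (t - 1)) (path \<omega> t) ^ 4) \<le> weight_bound" .
qed

text \<open>The lagged value is an arbitrary functional \<open>\<Psi>\<close> of the past, since
  \<open>F\<close> is bounded in it by \<open>weight\<close> alone. This gives the same bound for
  \<open>causal\<close> and for all of its truncations.\<close>

lemma
  assumes F: "reg 2 F" and C: "0 \<le> C" "\<And>y e e'. \<bar>F y e e'\<bar> \<le> C * weight e e' ^ 2"
    and \<Psi>: "depends_on {..t - 2} \<Psi>"
  shows integrable_square_lagged: "integrable M (\<lambda>\<omega>. (F (\<Psi> (path \<omega>)) (path \<omega> (t - 1)) (path \<omega> t))\<^sup>2)"
    and expectation_square_lagged:
      "expectation (\<lambda>\<omega>. (F (\<Psi> (path \<omega>)) (path \<omega> (t - 1)) (path \<omega> t))\<^sup>2) \<le> C\<^sup>2 * weight_bound"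
proof -
  have le: "(F y e e')\<^sup>2 \<le> C\<^sup>2 * weight e e' ^ 4" for y e e'
  proof -
    have "\<bar>F y e e'\<bar>\<^sup>2 \<le> (C * weight e e' ^ 2)\<^sup>2" by (intro power_mono C) auto
    then show ?thesis by (simp add: power_mult_distrib flip: power_mult)
  qed
  have d: "depends_on {..t} (\<lambda>e. F (\<Psi> e) (e (t - 1)) (e t))"
    by (rule depends_on_lagged[OF F]) (auto intro: depends_on_mono[OF \<Psi>])
  note [measurable] = measurable_path_compose[OF d]
  have int: "integrable M (\<lambda>\<omega>. C\<^sup>2 * weight (path \<omega> (t - 1)) (path \<omega> t) ^ 4)"
    using integrable_weight by simp
  show 1: "integrable M (\<lambda>\<omega>. (F (\<Psi> (path \<omega>)) (path \<omega> (t - 1)) (path \<omega> t))\<^sup>2)"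
    by (rule Bochner_Integration.integrable_bound[OF int])
      (use le in \<open>auto intro!: AE_I2 order_trans[OF _ abs_ge_self]\<close>)
  have "expectation (\<lambda>\<omega>. (F (\<Psi> (path \<omega>)) (path \<omega> (t - 1)) (path \<omega> t))\<^sup>2)
      \<le> expectation (\<lambda>\<omega>. C\<^sup>2 * weight (path \<omega> (t - 1)) (path \<omega> t) ^ 4)"
    by (rule integral_mono[OF 1 int le])
  also have "\<dots> \<le> C\<^sup>2 * weight_bound" using expectation_weight by (simp add: mult_left_mono)
  finally show "expectation (\<lambda>\<omega>. (F (\<Psi> (path \<omega>)) (path \<omega> (t - 1)) (path \<omega> t))\<^sup>2) \<le> C\<^sup>2 * weight_bound" .
qed

lemma integrable_square_obs: "reg 2 F \<Longrightarrow> integrable M (\<lambda>\<omega>. (obs F t (path \<omega>))\<^sup>2)"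
  unfolding obs_def by (rule regE, assumption) (rule integrable_square_lagged[OF _ _ _ depends_on_causal], auto)

lemma integrable_square_obs_trunc: "reg 2 F \<Longrightarrow> integrable M (\<lambda>\<omega>. (obs_trunc F m t (path \<omega>))\<^sup>2)"
  unfolding obs_trunc_def by (rule regE, assumption) (rule integrable_square_lagged[OF _ _ _ depends_on_trunc_past], auto)

lemma measurable_obs: "reg k F \<Longrightarrow> (\<lambda>\<omega>. obs F t (path \<omega>)) \<in> borel_measurable M"
  by (rule measurable_path_compose[OF depends_on_obs])

lemma measurable_obs_trunc: "reg k F \<Longrightarrow> (\<lambda>\<omega>. obs_trunc F m t (path \<omega>)) \<in> borel_measurable M"
  by (rule measurable_path_compose[OF depends_on_obs_trunc])

lemma integrable_obs: "reg 2 F \<Longrightarrow> integrable M (\<lambda>\<omega>. obs F t (path \<omega>))"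
  by (rule integrable_L2[OF measurable_obs integrable_square_obs])

lemma integrable_obs_trunc: "reg 2 F \<Longrightarrow> integrable M (\<lambda>\<omega>. obs_trunc F m t (path \<omega>))"
  by (rule integrable_L2[OF measurable_obs_trunc integrable_square_obs_trunc])

lemma expectation_obs:
  assumes "reg k F"
  shows "expectation (\<lambda>\<omega>. obs F t (path \<omega>)) = expectation (\<lambda>\<omega>. obs F s (path \<omega>))"
  using expectation_shift[OF depends_on_obs[OF assms, of t], of "s - t"] by (simp add: obs_shift)

text \<open>The squared difference is at most \<open>min 1 |y - y'|\<close> times the fourth power
  of \<open>weight\<close>, up to a constant. The first factor reads innovations up to
  \<open>t - 2\<close>, the second those at \<open>t - 1\<close> and \<open>t\<close>, so the
  expectation factorizes and the geometric rate of the first factor survives without any moment of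
  \<open>causal\<close>.\<close>

lemma obs_approximation:
  assumes F: "reg 2 F"
  obtains C \<rho> where "0 \<le> C" "0 < \<rho>" "\<rho> < 1"
    "\<And>m t. expectation (\<lambda>\<omega>. (obs F t (path \<omega>) - obs_trunc F m t (path \<omega>))\<^sup>2) \<le> C * \<rho> ^ m"
    "\<And>t. expectation (\<lambda>\<omega>. (obs F t (path \<omega>))\<^sup>2) \<le> C"
    "\<And>m t. expectation (\<lambda>\<omega>. (obs_trunc F m t (path \<omega>))\<^sup>2) \<le> C"
proof -
  obtain A where A: "0 \<le> A" "\<And>y e e'. \<bar>F y e e'\<bar> \<le> A * weight e e' ^ 2"
    "\<And>y y' e e'. \<bar>F y e e' - F y' e e'\<bar> \<le> A * \<bar>y - y'\<bar> * weight e e' ^ 2" using regE[OF F] by blast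
  obtain K \<rho> where K: "0 \<le> K" and \<rho>: "0 < \<rho>" "\<rho> < 1"
    and approx: "\<And>k t. expectation (\<lambda>\<omega>. min 1 \<bar>causal t (path \<omega>) - trunc k t (path \<omega>)\<bar>) \<le> K * \<rho> ^ k"
    by (rule causal_approximation) (rule that)
  have W: "0 \<le> weight_bound" by (rule weight_bound_nonneg)
  have le: "(F y e e' - F y' e e')\<^sup>2 \<le> 4 * A\<^sup>2 * (min 1 \<bar>y - y'\<bar> * weight e e' ^ 4)" for y y' e e'
  proof -
    have "\<bar>F y e e' - F y' e e'\<bar> \<le> 2 * A * min 1 \<bar>y - y'\<bar> * weight e e' ^ 2"
    proof (cases "\<bar>y - y'\<bar> \<le> 1")
      case True
      have "0 \<le> A * \<bar>y - y'\<bar> * weight e e' ^ 2" using A by simp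
      then show ?thesis using A(3)[of y e e' y'] True by simp
    next
      case False
      then show ?thesis using A(2)[of y e e'] A(2)[of y' e e'] by simp
    qed
    then have "\<bar>F y e e' - F y' e e'\<bar>\<^sup>2 \<le> (2 * A * min 1 \<bar>y - y'\<bar> * weight e e' ^ 2)\<^sup>2"
      by (intro power_mono) auto
    also have "\<dots> = 4 * A\<^sup>2 * ((min 1 \<bar>y - y'\<bar>)\<^sup>2 * weight e e' ^ 4)"
      by (simp add: power_mult_distrib flip: power_mult)
    also have "\<dots> \<le> 4 * A\<^sup>2 * (min 1 \<bar>y - y'\<bar> * weight e e' ^ 4)"
    proof -
      have "(min 1 \<bar>y - y'\<bar>)\<^sup>2 \<le> min 1 \<bar>y - y'\<bar>"
        unfolding power2_eq_square by (rule mult_left_le_one_le) auto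
      then show ?thesis by (intro mult_left_mono mult_right_mono) auto
    qed
    finally show ?thesis by simp
  qed
  have main: "expectation (\<lambda>\<omega>. (obs F t (path \<omega>) - obs_trunc F m t (path \<omega>))\<^sup>2) \<le> 4 * A\<^sup>2 * K * weight_bound * \<rho> ^ m" for m t
  proof -
    let ?f = "\<lambda>e. min 1 \<bar>causal (t - 2) e - trunc m (t - 2) e\<bar>"
    have d1: "depends_on {..t - 2} ?f"
      by (rule depends_on_compose[OF depends_on_diff[OF depends_on_causal depends_on_trunc_past]]) measurable
    have d: "{..t - 2} \<inter> {t - 1, t} = {}" by auto
    have i1: "integrable M (\<lambda>\<omega>. ?f (path \<omega>))"
      by (rule integrable_const_bound[where B = 1]) (use measurable_path_compose[OF d1] in auto)
    note prod = integrable_mult_depends_on[OF d1 depends_on_weight d i1 integrable_weight]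
      expectation_mult_depends_on[OF d1 depends_on_weight d i1 integrable_weight]
    have "expectation (\<lambda>\<omega>. (obs F t (path \<omega>) - obs_trunc F m t (path \<omega>))\<^sup>2)
        \<le> expectation (\<lambda>\<omega>. 4 * A\<^sup>2 * (?f (path \<omega>) * weight (path \<omega> (t - 1)) (path \<omega> t) ^ 4))"
    proof (rule integral_mono)
      show "integrable M (\<lambda>\<omega>. (obs F t (path \<omega>) - obs_trunc F m t (path \<omega>))\<^sup>2)"
        by (intro integrable_diff_L2 measurable_obs[OF F] measurable_obs_trunc[OF F] integrable_square_obs[OF F]
            integrable_square_obs_trunc[OF F])
      show "integrable M (\<lambda>\<omega>. 4 * A\<^sup>2 * (?f (path \<omega>) * weight (path \<omega> (t - 1)) (path \<omega> t) ^ 4))"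
        by (intro integrable_mult_right prod)
    qed (simp only: obs_def obs_trunc_def le)
    also have "\<dots> = 4 * A\<^sup>2 * (expectation (\<lambda>\<omega>. ?f (path \<omega>)) * expectation (\<lambda>\<omega>. weight (path \<omega> (t - 1)) (path \<omega> t) ^ 4))"
      using prod by simp
    also have "\<dots> \<le> 4 * A\<^sup>2 * ((K * \<rho> ^ m) * weight_bound)"
    proof (intro mult_left_mono mult_mono approx expectation_weight)
      show "0 \<le> K * \<rho> ^ m" using K \<rho> by simp
      show "0 \<le> expectation (\<lambda>\<omega>. weight (path \<omega> (t - 1)) (path \<omega> t) ^ 4)" by simp
    qed auto
    finally show ?thesis by (simp add: mult_ac)
  qed
  define B where "B = 4 * A\<^sup>2 * K * weight_bound + A\<^sup>2 * weight_bound"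
  show ?thesis
  proof (rule that[of B \<rho>])
    show "0 \<le> B" using W K by (simp add: B_def)
    have "4 * A\<^sup>2 * K * weight_bound * \<rho> ^ m \<le> B * \<rho> ^ m" for m
      using W \<rho> by (intro mult_right_mono) (auto simp: B_def)
    then show "expectation (\<lambda>\<omega>. (obs F t (path \<omega>) - obs_trunc F m t (path \<omega>))\<^sup>2) \<le> B * \<rho> ^ m" for m t
      using main[of t m] by (rule order_trans[rotated])
    have B: "A\<^sup>2 * weight_bound \<le> B" using W K by (simp add: B_def)
    show "expectation (\<lambda>\<omega>. (obs F t (path \<omega>))\<^sup>2) \<le> B" for t
      unfolding obs_def by (rule order_trans[OF expectation_square_lagged[OF F A(1,2) depends_on_causal] B])
    show "expectation (\<lambda>\<omega>. (obs_trunc F m t (path \<omega>))\<^sup>2) \<le> B" for m t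
      unfolding obs_trunc_def by (rule order_trans[OF expectation_square_lagged[OF F A(1,2) depends_on_trunc_past] B])
  qed (use \<rho> in auto)
qed

text \<open>Replacing the later observation by its truncation makes the two factors independent, so
  only the exponentially small truncation error contributes to the covariance.\<close>

lemma covariance_obs:
  assumes F: "reg 2 F" and zero: "expectation (\<lambda>\<omega>. obs F 1 (path \<omega>)) = 0"
  obtains K q where "0 < q" "q < 1" "0 \<le> K"
    "\<And>s d. \<bar>expectation (\<lambda>\<omega>. obs F s (path \<omega>) * obs F (s + int d) (path \<omega>))\<bar> \<le> K * q ^ d"
proof -
  obtain C \<rho> where C: "0 \<le> C" and \<rho>: "0 < \<rho>" "\<rho> < 1"
    and approx: "\<And>m t. expectation (\<lambda>\<omega>. (obs F t (path \<omega>) - obs_trunc F m t (path \<omega>))\<^sup>2) \<le> C * \<rho> ^ m"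
    and sq: "\<And>t. expectation (\<lambda>\<omega>. (obs F t (path \<omega>))\<^sup>2) \<le> C"
    by (rule obs_approximation[OF F]) (rule that)
  note [measurable] = measurable_obs[OF F] measurable_obs_trunc[OF F]
  note L2 = integrable_square_obs[OF F] integrable_square_obs_trunc[OF F]
  define r where "r = sqrt \<rho>"
  have r: "0 < r" "r < 1" using \<rho> by (auto simp: r_def real_sqrt_lt_1_iff)
  obtain q K where q: "0 < q" "q < 1" "0 \<le> K" "\<And>i. r ^ ((i - 2) div 2) \<le> K * q ^ i"
    by (rule power_div_le[OF r]) (rule that)
  have main: "\<bar>expectation (\<lambda>\<omega>. obs F s (path \<omega>) * obs F (s + int d) (path \<omega>))\<bar> \<le> C * r ^ ((d - 2) div 2)" for s d
  proof (cases "2 \<le> d")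
    \<comment> \<open>For \<open>d < 2\<close> truncated subtraction gives
      \<open>(d - 2) div 2 = 0\<close>, so no decay is claimed.\<close>
    case False
    have "\<bar>expectation (\<lambda>\<omega>. obs F s (path \<omega>) * obs F (s + int d) (path \<omega>))\<bar>
        \<le> sqrt (expectation (\<lambda>\<omega>. (obs F s (path \<omega>))\<^sup>2)) * sqrt (expectation (\<lambda>\<omega>. (obs F (s + int d) (path \<omega>))\<^sup>2))"
      by (rule Cauchy_Schwarz_expectation) (use L2 in auto)
    also have "\<dots> \<le> sqrt C * sqrt C" by (intro mult_mono real_sqrt_le_mono sq) (use C in auto)
    finally show ?thesis using False C by simp
  next
    case True
    \<comment> \<open>As \<open>2 * m <= d - 2\<close>, the window of the truncation begins at
      \<open>t - 2 * m - 1 >= s + 1\<close>, after everything that the earlier observation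
      reads.\<close>
    define m t where "m = (d - 2) div 2" and "t = s + int d"
    define \<Delta> where "\<Delta> \<omega> = obs F t (path \<omega>) - obs_trunc F m t (path \<omega>)" for \<omega>
    have \<Delta>m [measurable]: "\<Delta> \<in> borel_measurable M" unfolding \<Delta>_def by measurable
    have \<Delta>2: "integrable M (\<lambda>\<omega>. (\<Delta> \<omega>)\<^sup>2)" unfolding \<Delta>_def using L2 by (intro integrable_diff_L2) auto
    have disj: "{..s} \<inter> {t - 2 * int m - 1..t} = {}" using True by (auto simp: m_def t_def)
    note dep = depends_on_obs[OF F, of s] depends_on_obs_trunc[OF F, of t m] disj
      integrable_obs[OF F, of s] integrable_obs_trunc[OF F, of m t]
    have i1: "integrable M (\<lambda>\<omega>. obs F s (path \<omega>) * \<Delta> \<omega>)"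
      by (intro integrable_mult_L2 \<Delta>2 L2) auto
    have "expectation (\<lambda>\<omega>. obs F s (path \<omega>) * obs F t (path \<omega>))
        = expectation (\<lambda>\<omega>. obs F s (path \<omega>) * \<Delta> \<omega> + obs F s (path \<omega>) * obs_trunc F m t (path \<omega>))"
      by (simp add: \<Delta>_def algebra_simps)
    also have "\<dots> = expectation (\<lambda>\<omega>. obs F s (path \<omega>) * \<Delta> \<omega>)"
      using i1 integrable_mult_depends_on[OF dep] expectation_mult_depends_on[OF dep]
        expectation_obs[OF F, of s 1] zero by simp
    finally have "\<bar>expectation (\<lambda>\<omega>. obs F s (path \<omega>) * obs F t (path \<omega>))\<bar> = \<bar>expectation (\<lambda>\<omega>. obs F s (path \<omega>) * \<Delta> \<omega>)\<bar>"
      by simp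
    also have "\<dots> \<le> sqrt (expectation (\<lambda>\<omega>. (obs F s (path \<omega>))\<^sup>2)) * sqrt (expectation (\<lambda>\<omega>. (\<Delta> \<omega>)\<^sup>2))"
      by (rule Cauchy_Schwarz_expectation) (use L2 \<Delta>2 in auto)
    also have "\<dots> \<le> sqrt C * sqrt (C * \<rho> ^ m)"
      unfolding \<Delta>_def by (intro mult_mono real_sqrt_le_mono sq approx) (use C in auto)
    also have "\<dots> = C * r ^ m" using C by (simp add: real_sqrt_mult r_def real_sqrt_power)
    finally show ?thesis by (simp add: m_def t_def)
  qed
  show ?thesis
  proof (rule that[OF q(1,2), of "C * K"])
    show "0 \<le> C * K" using C q by simp
    show "\<bar>expectation (\<lambda>\<omega>. obs F s (path \<omega>) * obs F (s + int d) (path \<omega>))\<bar> \<le> C * K * q ^ d" for s d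
      using order_trans[OF main mult_left_mono[OF q(4) C]] by (simp add: mult.assoc)
  qed
qed

theorem strong_law_obs:
  assumes F: "reg 2 F"
  shows "AE \<omega> in M. (\<lambda>n. (\<Sum>i<n. obs F (int i + 1) (path \<omega>)) / real n)
    \<longlonglongrightarrow> expectation (\<lambda>\<omega>. obs F 1 (path \<omega>))"
proof -
  define c where "c = expectation (\<lambda>\<omega>. obs F 1 (path \<omega>))"
  define G where "G y e e' = F y e e' - c" for y e e'
  have G: "reg 2 G"
    unfolding G_def[abs_def] by (intro reg_diff F reg_mono[OF reg_const]) auto
  have GF: "obs G t e = obs F t e - c" for t e by (simp add: obs_def G_def)
  have "expectation (\<lambda>\<omega>. obs G 1 (path \<omega>)) = 0"
    unfolding GF using integrable_obs[OF F, of 1] by (simp add: c_def prob_space)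
  then obtain K q where q: "0 < q" "q < 1" "0 \<le> K"
    and cov: "\<And>s d. \<bar>expectation (\<lambda>\<omega>. obs G s (path \<omega>) * obs G (s + int d) (path \<omega>))\<bar> \<le> K * q ^ d"
    by (rule covariance_obs[OF G]) (rule that)
  have cov': "\<bar>expectation (\<lambda>\<omega>. obs G (int i + 1) (path \<omega>) * obs G (int j + 1) (path \<omega>))\<bar> \<le> K * q ^ (j - i)"
    if "i \<le> j" for i j :: nat
  proof -
    have "int j + 1 = int i + 1 + int (j - i)" using that by simp
    then show ?thesis using cov[of "int i + 1" "j - i"] by (simp only:)
  qed
  have "AE \<omega> in M. (\<lambda>n. (\<Sum>i<n. obs G (int i + 1) (path \<omega>)) / real n) \<longlonglongrightarrow> 0"
  proof (rule strong_law_L2)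
    show "(\<lambda>\<omega>. obs G (int i + 1) (path \<omega>)) \<in> borel_measurable M" for i by (rule measurable_obs[OF G])
    show "integrable M (\<lambda>\<omega>. (obs G (int i + 1) (path \<omega>))\<^sup>2)" for i by (rule integrable_square_obs[OF G])
    have le: "K \<le> 2 * K / (1 - q)"
    proof -
      have "K * (1 - q) \<le> K * 2" using q by (intro mult_left_mono) auto
      then show ?thesis using q by (simp add: field_simps)
    qed
    show "expectation (\<lambda>\<omega>. (obs G (int i + 1) (path \<omega>))\<^sup>2) \<le> 2 * K / (1 - q)" for i
      using cov'[of i i] le by (simp add: power2_eq_square abs_le_iff)
    show "expectation (\<lambda>\<omega>. (\<Sum>i<n. obs G (int i + 1) (path \<omega>))\<^sup>2) \<le> 2 * K / (1 - q) * real n" for n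
      by (rule expectation_square_sum_decay[OF measurable_obs[OF G] integrable_square_obs[OF G] q cov'])
  qed
  then show ?thesis
  proof eventually_elim
    case (elim \<omega>)
    have "(\<lambda>n. (\<Sum>i<n. obs G (int i + 1) (path \<omega>)) / real n + c) \<longlonglongrightarrow> 0 + c"
      by (intro tendsto_add elim tendsto_const)
    moreover have "\<forall>\<^sub>F n in sequentially. (\<Sum>i<n. obs G (int i + 1) (path \<omega>)) / real n + c
        = (\<Sum>i<n. obs F (int i + 1) (path \<omega>)) / real n"
      by (rule eventually_sequentiallyI[of 1]) (simp add: GF sum_subtractf field_simps)
    ultimately show ?case unfolding c_def[symmetric] by (simp add: tendsto_cong)
  qed
qed

end

section \<open>Characteristic functions\<close>

lemma norm_iexp_diff_le: "norm (iexp x - iexp y) \<le> \<bar>x - y\<bar>"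
proof -
  have "iexp x - iexp y = iexp y * (iexp (x - y) - 1)"
    by (simp add: right_diff_distrib flip: exp_add)
  then have "norm (iexp x - iexp y) = norm (iexp (x - y) - 1)"
    by (simp add: norm_mult)
  also have "\<dots> \<le> \<bar>x - y\<bar>" using iexp_approx1[of "x - y" 0] by simp
  finally show ?thesis .
qed

context prob_space
begin

lemma integrable_iexp_compose:
  assumes [measurable]: "X \<in> borel_measurable M"
  shows "integrable M (\<lambda>\<omega>. iexp (X \<omega>))"
  by (rule integrable_const_bound[where B = 1]) auto

lemma char_diff_le:
  assumes [measurable]: "X \<in> borel_measurable M" "Y \<in> borel_measurable M"
    and sq: "integrable M (\<lambda>\<omega>. (X \<omega> - Y \<omega>)\<^sup>2)"
  shows "norm ((CLINT \<omega>|M. iexp (X \<omega>)) - (CLINT \<omega>|M. iexp (Y \<omega>)))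
    \<le> sqrt (expectation (\<lambda>\<omega>. (X \<omega> - Y \<omega>)\<^sup>2))"
proof -
  have int: "integrable M (\<lambda>\<omega>. X \<omega> - Y \<omega>)" by (rule integrable_L2[OF _ sq]) measurable
  have "norm ((CLINT \<omega>|M. iexp (X \<omega>)) - (CLINT \<omega>|M. iexp (Y \<omega>)))
      = norm (CLINT \<omega>|M. iexp (X \<omega>) - iexp (Y \<omega>))"
    by (simp add: integrable_iexp_compose)
  also have "\<dots> \<le> expectation (\<lambda>\<omega>. norm (iexp (X \<omega>) - iexp (Y \<omega>)))" by (rule integral_norm_bound)
  also have "\<dots> \<le> expectation (\<lambda>\<omega>. \<bar>X \<omega> - Y \<omega>\<bar>)"
    by (intro integral_mono norm_iexp_diff_le integrable_norm Bochner_Integration.integrable_diff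
        integrable_iexp_compose integrable_abs int) auto
  also have "\<dots> \<le> sqrt (expectation (\<lambda>\<omega>. (X \<omega> - Y \<omega>)\<^sup>2))"
    by (rule expectation_abs_le_sqrt[OF _ sq]) measurable
  finally show ?thesis .
qed

text \<open>For \<open>v = 0\<close> all summands vanish almost surely. Otherwise the central limit
  theorem normalized to variance 1 is evaluated at the frequency \<open>sqrt v\<close>, which
  restores the variance \<open>v\<close>.\<close>

lemma char_normalized_sum_tendsto:
  fixes B :: "nat \<Rightarrow> 'a \<Rightarrow> real"
  assumes indep: "indep_vars (\<lambda>_. borel) B UNIV"
    and mean: "\<And>n. expectation (B n) = 0"
    and sq: "\<And>n. integrable M (\<lambda>x. (B n x)\<^sup>2)"
    and var: "\<And>n. expectation (\<lambda>x. (B n x)\<^sup>2) = v"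
    and law: "\<And>n. distr M borel (B n) = D"
  shows "(\<lambda>k. CLINT \<omega>|M. iexp ((\<Sum>q<k. B q \<omega>) / sqrt (real k))) \<longlonglongrightarrow> complex_of_real (exp (- v / 2))"
proof (cases "v = 0")
  case True
  have [measurable]: "B n \<in> borel_measurable M" for n using indep by (auto simp: indep_vars_def)
  have "AE \<omega> in M. (B n \<omega>)\<^sup>2 = 0" for n
    using integral_nonneg_eq_0_iff_AE[OF sq[of n]] var[of n] True by simp
  then have ae: "AE \<omega> in M. \<forall>n. B n \<omega> = 0" by (simp add: AE_all_countable)
  have "(CLINT \<omega>|M. iexp ((\<Sum>q<k. B q \<omega>) / sqrt (real k))) = (CLINT \<omega>|M. 1)" for k
  proof (rule integral_cong_AE)
    show "AE \<omega> in M. iexp ((\<Sum>q<k. B q \<omega>) / sqrt (real k)) = 1" using ae by eventually_elim simp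
  qed measurable
  then show ?thesis using True by (simp add: prob_space)
next
  case False
  have [measurable]: "B n \<in> borel_measurable M" for n using indep by (auto simp: indep_vars_def)
  have v: "0 < v" using False var[of 0] integral_nonneg_AE[of "\<lambda>x. (B 0 x)\<^sup>2" M] by simp
  have "weak_conv_m (\<lambda>n. distr M borel (\<lambda>x. (\<Sum>i<n. B i x) / sqrt (real n * (sqrt v)\<^sup>2))) std_normal_distribution"
  proof (rule central_limit_theorem_zero_mean[OF indep mean _ sq _ law])
    show "variance (B n) = (sqrt v)\<^sup>2" for n using mean var v by simp
  qed (use v in simp)
  then have "(\<lambda>n. char (distr M borel (\<lambda>x. (\<Sum>i<n. B i x) / sqrt (real n * (sqrt v)\<^sup>2))) (sqrt v))
      \<longlonglongrightarrow> char std_normal_distribution (sqrt v)"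
    by (intro levy_continuity1 real_distribution_distr real_dist_normal_dist) auto
  moreover have "char (distr M borel (\<lambda>x. (\<Sum>i<n. B i x) / sqrt (real n * (sqrt v)\<^sup>2))) (sqrt v)
      = (CLINT \<omega>|M. iexp ((\<Sum>q<n. B q \<omega>) / sqrt (real n)))" for n
    unfolding char_def using v by (subst integral_distr) (auto simp: real_sqrt_mult simp flip: of_real_mult of_real_divide)
  ultimately show ?thesis using v by (simp add: char_std_normal_distribution)
qed

text \<open>The reverse triangle inequality of the L^2 norm, a consequence of Cauchy-Schwarz. It
  compares variances of sums whose difference is small in L^2.\<close>

lemma sqrt_expectation_diff_le:
  assumes [measurable]: "X \<in> borel_measurable M" "Y \<in> borel_measurable M"
    and X: "integrable M (\<lambda>\<omega>. (X \<omega>)\<^sup>2)" and Y: "integrable M (\<lambda>\<omega>. (Y \<omega>)\<^sup>2)"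
  shows "\<bar>sqrt (expectation (\<lambda>\<omega>. (X \<omega>)\<^sup>2)) - sqrt (expectation (\<lambda>\<omega>. (Y \<omega>)\<^sup>2))\<bar>
    \<le> sqrt (expectation (\<lambda>\<omega>. (X \<omega> - Y \<omega>)\<^sup>2))"
proof -
  define a b where "a = expectation (\<lambda>\<omega>. (X \<omega>)\<^sup>2)" and "b = expectation (\<lambda>\<omega>. (Y \<omega>)\<^sup>2)"
  have ab: "0 \<le> a" "0 \<le> b" by (simp_all add: a_def b_def)
  have i: "integrable M (\<lambda>\<omega>. X \<omega> * Y \<omega>)" by (rule integrable_mult_L2) (use X Y in auto)
  have "(sqrt a - sqrt b)\<^sup>2 = a + b - 2 * (sqrt a * sqrt b)" using ab by (simp add: power2_diff)
  also have "\<dots> \<le> a + b - 2 * expectation (\<lambda>\<omega>. X \<omega> * Y \<omega>)"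
    using Cauchy_Schwarz_expectation[OF _ _ X Y] by (simp add: a_def b_def abs_le_iff)
  also have "\<dots> = expectation (\<lambda>\<omega>. (X \<omega> - Y \<omega>)\<^sup>2)"
    using X Y i by (simp add: power2_diff a_def b_def mult.assoc)
  finally have "sqrt ((sqrt a - sqrt b)\<^sup>2) \<le> sqrt (expectation (\<lambda>\<omega>. (X \<omega> - Y \<omega>)\<^sup>2))"
    by (rule real_sqrt_le_mono)
  then show ?thesis by (simp add: a_def b_def)
qed

end

lemma sum_lessThan_add:
  fixes g :: "nat \<Rightarrow> 'b::comm_monoid_add"
  shows "(\<Sum>i<m + n. g i) = (\<Sum>i<m. g i) + (\<Sum>j<n. g (m + j))"
  by (induction n) (simp_all add: add.assoc)

lemma sum_lessThan_blocks:
  fixes g :: "nat \<Rightarrow> 'b::comm_monoid_add"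
  shows "(\<Sum>q<k. \<Sum>j<r. g (q * r + j)) = (\<Sum>i<k * r. g i)"
proof (induction k)
  case (Suc k)
  have "Suc k * r = k * r + r" by simp
  then show ?case using Suc by (simp only: sum.lessThan_Suc sum_lessThan_add)
qed simp

section \<open>A central limit theorem\<close>

context bilinear_process
begin

text \<open>Conditional centring given the innovations up to \<open>t - 2\<close>, tested against
  square integrable functionals instead of through conditional expectations. Quantifying over
  \<open>\<Psi>\<close> demands it for every possible lagged value, so the true lag and its
  truncations inherit the orthogonality alike.\<close>

definition cent :: "(real \<Rightarrow> real \<Rightarrow> real \<Rightarrow> real) \<Rightarrow> bool" where
  "cent F \<longleftrightarrow> reg 2 F \<and> (\<forall>t \<Phi> \<Psi>. depends_on {..t - 2} \<Phi> \<longrightarrow> depends_on {..t - 2} \<Psi> \<longrightarrow>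
     integrable M (\<lambda>\<omega>. (\<Phi> (path \<omega>))\<^sup>2) \<longrightarrow>
     expectation (\<lambda>\<omega>. \<Phi> (path \<omega>) * F (\<Psi> (path \<omega>)) (path \<omega> (t - 1)) (path \<omega> t)) = 0)"

lemma cent_reg: "cent F \<Longrightarrow> reg 2 F"
  by (simp add: cent_def)

lemma integrable_mult_lagged:
  assumes F: "reg 2 F" and \<Phi>: "depends_on {..t - 2} \<Phi>" and \<Psi>: "depends_on {..t - 2} \<Psi>"
    and sq: "integrable M (\<lambda>\<omega>. (\<Phi> (path \<omega>))\<^sup>2)"
  shows "integrable M (\<lambda>\<omega>. \<Phi> (path \<omega>) * F (\<Psi> (path \<omega>)) (path \<omega> (t - 1)) (path \<omega> t))"
proof (rule integrable_mult_L2[OF _ _ sq])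
  obtain C where C: "0 \<le> C" "\<And>y e e'. \<bar>F y e e'\<bar> \<le> C * weight e e' ^ 2"
    by (rule regE[OF F]) (rule that)
  show "integrable M (\<lambda>\<omega>. (F (\<Psi> (path \<omega>)) (path \<omega> (t - 1)) (path \<omega> t))\<^sup>2)"
    by (rule integrable_square_lagged[OF F C \<Psi>])
  show "(\<lambda>\<omega>. \<Phi> (path \<omega>)) \<in> borel_measurable M" by (rule measurable_path_compose[OF \<Phi>])
  have d: "depends_on {..t} (\<lambda>e. F (\<Psi> e) (e (t - 1)) (e t))"
    by (rule depends_on_lagged[OF F]) (auto intro: depends_on_mono[OF \<Psi>])
  show "(\<lambda>\<omega>. F (\<Psi> (path \<omega>)) (path \<omega> (t - 1)) (path \<omega> t)) \<in> borel_measurable M"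
    by (rule measurable_path_compose[OF d])
qed

lemma cent_add:
  assumes "cent F" "cent G"
  shows "cent (\<lambda>y e e'. F y e e' + G y e e')"
  unfolding cent_def
proof (intro conjI allI impI)
  show "reg 2 (\<lambda>y e e'. F y e e' + G y e e')" by (intro reg_add cent_reg assms)
  fix t \<Phi> \<Psi>
  assume a: "depends_on {..t - 2} \<Phi>" "depends_on {..t - 2} \<Psi>" "integrable M (\<lambda>\<omega>. (\<Phi> (path \<omega>))\<^sup>2)"
  show "expectation (\<lambda>\<omega>. \<Phi> (path \<omega>) * (F (\<Psi> (path \<omega>)) (path \<omega> (t - 1)) (path \<omega> t)
      + G (\<Psi> (path \<omega>)) (path \<omega> (t - 1)) (path \<omega> t))) = 0"
    using integrable_mult_lagged[OF cent_reg[OF assms(1)] a] integrable_mult_lagged[OF cent_reg[OF assms(2)] a]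
      assms a unfolding cent_def distrib_left by simp
qed

text \<open>The lag factor and \<open>\<Phi>\<close> read innovations up to \<open>t - 2\<close>
  only and are independent of the factor \<open>p\<close>, which has mean zero.\<close>

lemma cent_lag_mult:
  assumes g: "reg 0 (\<lambda>y e e'. g y)" and p: "reg 2 (\<lambda>y e e'. p e e')"
    and zero: "\<And>t. expectation (\<lambda>\<omega>. p (\<epsilon> (t - 1) \<omega>) (\<epsilon> t \<omega>)) = 0"
  shows "cent (\<lambda>y e e'. g y * p e e')"
  unfolding cent_def
proof (intro conjI allI impI)
  show "reg 2 (\<lambda>y e e'. g y * p e e')" by (rule reg_lag_mult[OF g p])
  obtain C where "\<And>y e e'. \<bar>g y\<bar> \<le> C * weight e e' ^ 0"
    by (rule regE[OF g]) (rule that)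
  then have C: "\<And>y. \<bar>g y\<bar> \<le> C" by simp
  fix t \<Phi> \<Psi>
  assume \<Phi>: "depends_on {..t - 2} \<Phi>" and \<Psi>: "depends_on {..t - 2} \<Psi>" and sq: "integrable M (\<lambda>\<omega>. (\<Phi> (path \<omega>))\<^sup>2)"
  have d0: "depends_on {..t - 2} (\<lambda>e. (\<lambda>y _ _. g y) (\<Psi> e) (\<Psi> e) (\<Psi> e))"
    by (rule depends_on_compose3[OF \<Psi> \<Psi> \<Psi> reg_measurable[OF g]])
  then have d1: "depends_on {..t - 2} (\<lambda>e. \<Phi> e * g (\<Psi> e))" by (intro depends_on_mult \<Phi>) simp
  have d2: "depends_on {t - 1, t} (\<lambda>e. p (e (t - 1)) (e t))"
    using depends_on_lagged[OF p, of "{t - 1, t}" "\<lambda>_. 0" t] by simp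
  have disj: "{..t - 2} \<inter> {t - 1, t} = {}" by auto
  have i\<Phi>: "integrable M (\<lambda>\<omega>. \<Phi> (path \<omega>))" by (rule integrable_L2[OF measurable_path_compose[OF \<Phi>] sq])
  have i1: "integrable M (\<lambda>\<omega>. \<Phi> (path \<omega>) * g (\<Psi> (path \<omega>)))"
  proof (rule Bochner_Integration.integrable_bound)
    show "integrable M (\<lambda>\<omega>. C * \<bar>\<Phi> (path \<omega>)\<bar>)" using i\<Phi> by simp
    have "\<bar>\<Phi> (path \<omega>)\<bar> * \<bar>g (\<Psi> (path \<omega>))\<bar> \<le> \<bar>C * \<bar>\<Phi> (path \<omega>)\<bar>\<bar>" for \<omega>
      using mult_right_mono[OF C[of "\<Psi> (path \<omega>)"], of "\<bar>\<Phi> (path \<omega>)\<bar>"]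
        abs_ge_self[of "C * \<bar>\<Phi> (path \<omega>)\<bar>"]
      unfolding mult.commute[of "\<bar>\<Phi> (path \<omega>)\<bar>" "\<bar>g (\<Psi> (path \<omega>))\<bar>"] by linarith
    then show "AE \<omega> in M. norm (\<Phi> (path \<omega>) * g (\<Psi> (path \<omega>))) \<le> norm (C * \<bar>\<Phi> (path \<omega>)\<bar>)"
      by (simp add: abs_mult)
  qed (rule measurable_path_compose[OF d1])
  have i2: "integrable M (\<lambda>\<omega>. p (path \<omega> (t - 1)) (path \<omega> t))"
    using integrable_mult_lagged[OF p, of t "\<lambda>_. 1" "\<lambda>_. 0"] by simp
  show "expectation (\<lambda>\<omega>. \<Phi> (path \<omega>) * (g (\<Psi> (path \<omega>)) * p (path \<omega> (t - 1)) (path \<omega> t))) = 0"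
    using expectation_mult_depends_on[OF d1 d2 disj i1 i2] zero[of t] by (simp add: path_def mult.assoc)
qed

lemma
  assumes "cent F" "depends_on {..t - 2} \<Phi>" "integrable M (\<lambda>\<omega>. (\<Phi> (path \<omega>))\<^sup>2)"
  shows cent_orthogonal: "expectation (\<lambda>\<omega>. \<Phi> (path \<omega>) * obs F t (path \<omega>)) = 0"
    and cent_orthogonal_trunc: "expectation (\<lambda>\<omega>. \<Phi> (path \<omega>) * obs_trunc F m t (path \<omega>)) = 0"
  using assms depends_on_causal[of "t - 2"] depends_on_trunc_past[of "t - 2" m]
  unfolding cent_def obs_def obs_trunc_def by blast+

lemma cent_mean_trunc: "cent F \<Longrightarrow> expectation (\<lambda>\<omega>. obs_trunc F m t (path \<omega>)) = 0"
  using cent_orthogonal_trunc[of F t "\<lambda>_. 1" m] by simp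

text \<open>The sum of the autocovariances over all lags; centring given the innovations up to
  \<open>t - 2\<close> removes every lag beyond 1.\<close>

definition long_run_variance :: "(real \<Rightarrow> real \<Rightarrow> real \<Rightarrow> real) \<Rightarrow> real" where
  "long_run_variance F = expectation (\<lambda>\<omega>. (obs F 1 (path \<omega>))\<^sup>2)
     + 2 * expectation (\<lambda>\<omega>. obs F 1 (path \<omega>) * obs F 2 (path \<omega>))"

lemma expectation_obs_square:
  assumes "reg 2 F"
  shows "expectation (\<lambda>\<omega>. (obs F t (path \<omega>))\<^sup>2) = expectation (\<lambda>\<omega>. (obs F s (path \<omega>))\<^sup>2)"
  using expectation_shift[OF depends_on_compose[OF depends_on_obs[OF assms, of s], of "\<lambda>x. x\<^sup>2"], of "t - s"]
  by (simp add: obs_shift)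

lemma expectation_obs_product:
  assumes "reg 2 F"
  shows "expectation (\<lambda>\<omega>. obs F t (path \<omega>) * obs F (t + 1) (path \<omega>))
    = expectation (\<lambda>\<omega>. obs F s (path \<omega>) * obs F (s + 1) (path \<omega>))"
proof -
  have "depends_on {..s + 1} (\<lambda>e. obs F s e * obs F (s + 1) e)"
    by (intro depends_on_mult depends_on_mono[OF depends_on_obs[OF assms, of s]] depends_on_obs[OF assms]) auto
  from expectation_shift[OF this, of "t - s"] show ?thesis by (simp add: obs_shift add.commute)
qed

text \<open>A new term is orthogonal to all earlier ones except its immediate predecessor:
  \<open>n + 1\<close> terms have \<open>n\<close> neighbouring pairs, and the formula is
  exact.\<close>

lemma expectation_square_sum_obs:
  assumes F: "cent F"
  shows "expectation (\<lambda>\<omega>. (\<Sum>i<Suc n. obs F (int i + 1) (path \<omega>))\<^sup>2)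
    = real (Suc n) * expectation (\<lambda>\<omega>. (obs F 1 (path \<omega>))\<^sup>2)
      + 2 * real n * expectation (\<lambda>\<omega>. obs F 1 (path \<omega>) * obs F 2 (path \<omega>))"
proof (induction n)
  case 0
  then show ?case by simp
next
  case (Suc n)
  note R = cent_reg[OF F]
  note [measurable] = measurable_obs[OF R]
  define x where "x i \<omega> = obs F (int i + 1) (path \<omega>)" for i \<omega>
  have x_meas [measurable]: "x i \<in> borel_measurable M" for i unfolding x_def by measurable
  have sq: "integrable M (\<lambda>\<omega>. (x i \<omega>)\<^sup>2)" for i unfolding x_def by (rule integrable_square_obs[OF R])
  have i2: "integrable M (\<lambda>\<omega>. x i \<omega> * x (Suc n) \<omega>)" for i by (intro integrable_mult_L2 sq) auto
  have i1: "integrable M (\<lambda>\<omega>. (\<Sum>i<Suc n. x i \<omega>)\<^sup>2)" using sq by (intro integrable_sum_L2) auto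
  have i3: "integrable M (\<lambda>\<omega>. (\<Sum>i<Suc n. x i \<omega>) * x (Suc n) \<omega>)"
    unfolding sum_distrib_right by (intro Bochner_Integration.integrable_sum i2)
  have "expectation (\<lambda>\<omega>. (\<Sum>i<Suc (Suc n). x i \<omega>)\<^sup>2)
      = expectation (\<lambda>\<omega>. (\<Sum>i<Suc n. x i \<omega>)\<^sup>2 + (x (Suc n) \<omega>)\<^sup>2 + 2 * ((\<Sum>i<Suc n. x i \<omega>) * x (Suc n) \<omega>))"
    unfolding sum.lessThan_Suc[of _ "Suc n"] by (simp only: power2_sum mult.assoc)
  also have "\<dots> = expectation (\<lambda>\<omega>. (\<Sum>i<Suc n. x i \<omega>)\<^sup>2) + expectation (\<lambda>\<omega>. (x (Suc n) \<omega>)\<^sup>2)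
      + 2 * expectation (\<lambda>\<omega>. (\<Sum>i<Suc n. x i \<omega>) * x (Suc n) \<omega>)"
    using i1 i3 sq by simp
  also have "expectation (\<lambda>\<omega>. (\<Sum>i<Suc n. x i \<omega>) * x (Suc n) \<omega>) = (\<Sum>i<Suc n. expectation (\<lambda>\<omega>. x i \<omega> * x (Suc n) \<omega>))"
    unfolding sum_distrib_right by (rule Bochner_Integration.integral_sum) (rule i2)
  also have "\<dots> = expectation (\<lambda>\<omega>. x n \<omega> * x (Suc n) \<omega>)"
  proof -
    have "expectation (\<lambda>\<omega>. x i \<omega> * x (Suc n) \<omega>) = 0" if "i < n" for i
      unfolding x_def
      by (rule cent_orthogonal[OF F depends_on_mono[OF depends_on_obs[OF R]] integrable_square_obs[OF R]])
        (use that in auto)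
    then show ?thesis by simp
  qed
  also have "\<dots> = expectation (\<lambda>\<omega>. obs F 1 (path \<omega>) * obs F 2 (path \<omega>))"
    using expectation_obs_product[OF R, of "int n + 1" 1] by (simp add: x_def add.commute)
  also have "expectation (\<lambda>\<omega>. (x (Suc n) \<omega>)\<^sup>2) = expectation (\<lambda>\<omega>. (obs F 1 (path \<omega>))\<^sup>2)"
    unfolding x_def by (rule expectation_obs_square[OF R])
  finally show ?case using Suc unfolding x_def[symmetric] by (simp add: algebra_simps)
qed

text \<open>The sequence is cut into blocks of length \<open>r\<close>, and within each block the lagged observation
  is replaced by its truncation to innovations of that block (the first term of the block is dropped).
  This makes the block sums i.i.d. without any gaps between them, and the
  total \<open>L\<^sup>2\<close>-error per block is bounded independently of \<open>r\<close>.\<close>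

definition blocked :: "(real \<Rightarrow> real \<Rightarrow> real \<Rightarrow> real) \<Rightarrow> int \<Rightarrow> nat \<Rightarrow> (int \<Rightarrow> real) \<Rightarrow> real" where
  "blocked F s j e = (if j = 0 then 0 else obs_trunc F ((j - 1) div 2) (s + int j + 1) e)"

text \<open>The term \<open>j\<close> sits at time \<open>s + j + 1\<close>, and
  \<open>(j - 1) div 2\<close> is the largest depth whose window stays after time \<open>s\<close>.
  The term \<open>j = 0\<close> would need the innovation at time \<open>s\<close>, which belongs to
  the preceding block.\<close>

lemma depends_on_blocked:
  assumes "reg 2 F" "j < r"
  shows "depends_on {s + 1..s + int r} (blocked F s j)"
proof (cases "j = 0")
  case True
  then have "blocked F s j = (\<lambda>e. 0)" by (simp add: blocked_def fun_eq_iff)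
  then show ?thesis by simp
next
  case False
  then have "blocked F s j = obs_trunc F ((j - 1) div 2) (s + int j + 1)" by (simp add: blocked_def fun_eq_iff)
  moreover have "2 * int ((j - 1) div 2) \<le> int j - 1" using False by presburger
  ultimately show ?thesis
    using assms by (auto intro!: depends_on_mono[OF depends_on_obs_trunc[OF assms(1)]])
qed

lemma depends_on_blocked_past: "reg 2 F \<Longrightarrow> depends_on {..s + int j + 1} (blocked F s j)"
  by (rule depends_on_mono[OF depends_on_blocked[of F j "Suc j"]]) auto

lemma blocked_shift: "blocked F s j (\<lambda>u. e (u + h)) = blocked F (s + h) j e"
proof -
  have "s + int j + 1 + h = s + h + int j + 1" by simp
  then show ?thesis unfolding blocked_def obs_trunc_shift by (simp only:)
qed

lemma integrable_square_blocked: "reg 2 F \<Longrightarrow> integrable M (\<lambda>\<omega>. (blocked F s j (path \<omega>))\<^sup>2)"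
  by (cases "j = 0") (simp_all add: blocked_def integrable_square_obs_trunc)

lemma measurable_blocked: "reg 2 F \<Longrightarrow> (\<lambda>\<omega>. blocked F s j (path \<omega>)) \<in> borel_measurable M"
  by (rule measurable_path_compose[OF depends_on_blocked_past])

lemma cent_orthogonal_blocked:
  assumes "cent F" "depends_on {..s + int j - 1} \<Phi>" "integrable M (\<lambda>\<omega>. (\<Phi> (path \<omega>))\<^sup>2)"
  shows "expectation (\<lambda>\<omega>. \<Phi> (path \<omega>) * blocked F s j (path \<omega>)) = 0"
proof (cases "j = 0")
  case False
  have "s + int j + 1 - 2 = s + int j - 1" by simp
  then show ?thesis
    using cent_orthogonal_trunc[OF assms(1), of "s + int j + 1" \<Phi>] assms False by (simp add: blocked_def)
qed (simp add: blocked_def)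

text \<open>The replacement error at position \<open>j\<close> of a block decays geometrically in
  \<open>j\<close>, because deeper positions admit deeper truncations. Errors two or more steps
  apart are orthogonal, so the squared errors add up to a geometric series per block;
  \<open>n div r + 1\<close> counts the blocks with the incomplete last one.\<close>

lemma block_error:
  assumes F: "cent F"
  obtains C where "0 \<le> C"
    "\<And>s j. expectation (\<lambda>\<omega>. (blocked F s j (path \<omega>))\<^sup>2) \<le> C"
    "\<And>r n. 0 < r \<Longrightarrow> expectation (\<lambda>\<omega>. ((\<Sum>i<n. obs F (int i + 1) (path \<omega>))
        - (\<Sum>i<n. blocked F (int (i div r * r)) (i mod r) (path \<omega>)))\<^sup>2) \<le> C * real (n div r + 1)"
proof -
  note R = cent_reg[OF F]
  obtain C \<rho> where C: "0 \<le> C" and \<rho>: "0 < \<rho>" "\<rho> < 1"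
    and approx: "\<And>m t. expectation (\<lambda>\<omega>. (obs F t (path \<omega>) - obs_trunc F m t (path \<omega>))\<^sup>2) \<le> C * \<rho> ^ m"
    and sq: "\<And>t. expectation (\<lambda>\<omega>. (obs F t (path \<omega>))\<^sup>2) \<le> C"
      "\<And>m t. expectation (\<lambda>\<omega>. (obs_trunc F m t (path \<omega>))\<^sup>2) \<le> C"
    by (rule obs_approximation[OF R]) (rule that)
  obtain q K where q: "0 < q" "q < 1" "0 \<le> K" "\<And>i. \<rho> ^ ((i - 2) div 2) \<le> K * q ^ i"
    by (rule power_div_le[OF \<rho>]) (rule that)
  define A where "A = C * (1 + K)"
  have A: "0 \<le> A" using C q by (simp add: A_def)
  define x where "x i \<omega> = obs F (int i + 1) (path \<omega>)" for i \<omega>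
  define z where "z r i \<omega> = blocked F (int (i div r * r)) (i mod r) (path \<omega>)" for r i \<omega>
  note [measurable] = measurable_obs[OF R] measurable_blocked[OF R]
  have [measurable]: "x i \<in> borel_measurable M" "z r i \<in> borel_measurable M" for i r
    unfolding x_def z_def by measurable
  have pos: "int (i div r * r) + int (i mod r) = int i" for i r :: nat
    unfolding of_nat_add[symmetric] by simp
  have xz: "expectation (\<lambda>\<omega>. (x i \<omega> - z r i \<omega>)\<^sup>2) \<le> A * q ^ (i mod r)" for i r
  proof (cases "i mod r = 0")
    case True
    have "C \<le> A" using C q by (simp add: A_def mult_le_cancel_left1)
    then show ?thesis using sq(1)[of "int i + 1"] True by (simp add: x_def z_def blocked_def)
  next
    case False
    define j where "j = i mod r"
    have "expectation (\<lambda>\<omega>. (x i \<omega> - z r i \<omega>)\<^sup>2) \<le> C * \<rho> ^ ((j - 1) div 2)"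
      using approx[of "int i + 1" "(j - 1) div 2"] False unfolding x_def z_def blocked_def pos j_def by simp
    also have "(j - 1) div 2 = (Suc j - 2) div 2" by simp
    also have "C * \<rho> ^ ((Suc j - 2) div 2) \<le> C * (K * q ^ Suc j)" by (rule mult_left_mono[OF q(4) C])
    also have "\<dots> \<le> C * ((1 + K) * q ^ j)"
      using C q by (intro mult_left_mono mult_mono power_decreasing) auto
    finally show ?thesis by (simp add: A_def j_def mult.assoc)
  qed
  have dsq: "integrable M (\<lambda>\<omega>. (x i \<omega> - z r i \<omega>)\<^sup>2)" for i r
    unfolding x_def z_def
    by (intro integrable_diff_L2 measurable_obs[OF R] measurable_blocked[OF R] integrable_square_obs[OF R]
        integrable_square_blocked[OF R])
  have orth: "expectation (\<lambda>\<omega>. (x i \<omega> - z r i \<omega>) * (x j \<omega> - z r j \<omega>)) = 0" if "i + 2 \<le> j" for i j r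
  proof -
    \<comment> \<open>The error at index \<open>i\<close> reads innovations up to time
      \<open>i + 1\<close>, and \<open>i + 1 <= j - 1\<close> is two steps before the time
      \<open>j + 1\<close> of index \<open>j\<close>.\<close>
    define \<Phi> where "\<Phi> e = obs F (int i + 1) e - blocked F (int (i div r * r)) (i mod r) e" for e
    have "depends_on {..int i + 1} \<Phi>"
      unfolding \<Phi>_def
      by (intro depends_on_diff depends_on_obs[OF R] depends_on_mono[OF depends_on_blocked_past[OF R]]) (simp only: pos order_refl)
    then have d: "depends_on {..int j - 1} \<Phi>" by (rule depends_on_mono) (use that in auto)
    have \<Phi>: "x i \<omega> - z r i \<omega> = \<Phi> (path \<omega>)" for \<omega> by (simp add: x_def z_def \<Phi>_def)
    have \<Phi>2: "integrable M (\<lambda>\<omega>. (\<Phi> (path \<omega>))\<^sup>2)" using dsq[of i r] by (simp only: \<Phi>)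
    have 1: "expectation (\<lambda>\<omega>. \<Phi> (path \<omega>) * x j \<omega>) = 0"
      unfolding x_def by (rule cent_orthogonal[OF F _ \<Phi>2]) (use d in simp)
    have 2: "expectation (\<lambda>\<omega>. \<Phi> (path \<omega>) * z r j \<omega>) = 0"
      unfolding z_def by (rule cent_orthogonal_blocked[OF F _ \<Phi>2]) (use d in \<open>simp only: pos\<close>)
    note m = measurable_path_compose[OF d]
    have "integrable M (\<lambda>\<omega>. \<Phi> (path \<omega>) * x j \<omega>)" "integrable M (\<lambda>\<omega>. \<Phi> (path \<omega>) * z r j \<omega>)"
      unfolding x_def z_def using m \<Phi>2
      by (auto intro!: integrable_mult_L2 integrable_square_obs[OF R] integrable_square_blocked[OF R])
    then show ?thesis unfolding \<Phi> right_diff_distrib using 1 2 by simp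
  qed
  have geo: "(\<Sum>i<n. q ^ (i mod r)) \<le> real (n div r + 1) * (1 / (1 - q))" if r: "0 < r" for n r
  proof -
    \<comment> \<open>The incomplete last block is filled up so that the sum splits into full
      blocks.\<close>
    have "n \<le> (n div r + 1) * r" using r by (metis add.commute div_mult_mod_eq dividend_less_div_times less_imp_le mult_Suc Suc_eq_plus1)
    then have "(\<Sum>i<n. q ^ (i mod r)) \<le> (\<Sum>i<(n div r + 1) * r. q ^ (i mod r))"
      using q by (intro sum_mono2) auto
    also have "\<dots> = (\<Sum>k<n div r + 1. \<Sum>j<r. q ^ ((k * r + j) mod r))" by (rule sum_lessThan_blocks[symmetric])
    also have "\<dots> = (\<Sum>k<n div r + 1. \<Sum>j<r. q ^ j)" by (intro sum.cong) auto
    also have "\<dots> \<le> (\<Sum>k<n div r + 1. 1 / (1 - q))"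
    proof (intro sum_mono)
      have "(\<Sum>j<r. q ^ j) = (1 - q ^ r) / (1 - q)" using q by (subst sum_gp_strict) auto
      also have "\<dots> \<le> 1 / (1 - q)" using q by (intro divide_right_mono) auto
      finally show "(\<Sum>j<r. q ^ j) \<le> 1 / (1 - q)" .
    qed
    finally show ?thesis by simp
  qed
  define D where "D = C + 2 * A * (1 / (1 - q))"
  have D: "0 \<le> 2 * A * (1 / (1 - q))" "0 \<le> D" using A q C by (auto simp: D_def)
  show ?thesis
  proof (rule that[of D])
    show "0 \<le> D" by (rule D)
    show "expectation (\<lambda>\<omega>. (blocked F s j (path \<omega>))\<^sup>2) \<le> D" for s j
    proof -
      have "expectation (\<lambda>\<omega>. (blocked F s j (path \<omega>))\<^sup>2) \<le> C"
        using sq(2) C by (cases "j = 0") (simp_all add: blocked_def)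
      then show ?thesis using D by (simp add: D_def)
    qed
    fix r n :: nat assume r: "0 < r"
    have "expectation (\<lambda>\<omega>. ((\<Sum>i<n. x i \<omega>) - (\<Sum>i<n. z r i \<omega>))\<^sup>2) = expectation (\<lambda>\<omega>. (\<Sum>i<n. x i \<omega> - z r i \<omega>)\<^sup>2)"
      by (simp add: sum_subtractf)
    also have "\<dots> \<le> 2 * (\<Sum>i<n. expectation (\<lambda>\<omega>. (x i \<omega> - z r i \<omega>)\<^sup>2))"
      by (rule expectation_square_sum_lag2) (use dsq orth in auto)
    also have "\<dots> \<le> 2 * (\<Sum>i<n. A * q ^ (i mod r))" by (intro mult_left_mono sum_mono xz) auto
    also have "\<dots> = 2 * A * (\<Sum>i<n. q ^ (i mod r))" by (simp add: sum_distrib_left mult.assoc)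
    also have "\<dots> \<le> 2 * A * (real (n div r + 1) * (1 / (1 - q)))" using A by (intro mult_left_mono geo r) auto
    also have "\<dots> \<le> D * real (n div r + 1)"
      using C by (simp add: D_def distrib_right)
    finally show "expectation (\<lambda>\<omega>. ((\<Sum>i<n. obs F (int i + 1) (path \<omega>))
        - (\<Sum>i<n. blocked F (int (i div r * r)) (i mod r) (path \<omega>)))\<^sup>2) \<le> D * real (n div r + 1)"
      by (simp only: x_def z_def)
  qed
qed

text \<open>Block \<open>q\<close> reads exactly the window of times \<open>q * r + 1\<close> to
  \<open>q * r + r\<close> and is block 0 shifted by \<open>q * r\<close>. Disjoint windows give
  independence, shift invariance gives equal laws.\<close>

lemma block_sums:
  fixes r :: nat
  assumes F: "cent F"
  defines "W \<equiv> \<lambda>q \<omega>. \<Sum>j<r. blocked F (int (q * r)) j (path \<omega>)"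
  shows "W q \<in> borel_measurable M" "integrable M (\<lambda>\<omega>. (W q \<omega>)\<^sup>2)" "expectation (W q) = 0"
    "indep_vars (\<lambda>_. borel) W UNIV" "distr M borel (W q) = distr M borel (W 0)"
    "expectation (\<lambda>\<omega>. (W q \<omega>)\<^sup>2) = expectation (\<lambda>\<omega>. (W 0 \<omega>)\<^sup>2)"
    "expectation (\<lambda>\<omega>. (\<Sum>q<k. W q \<omega>)\<^sup>2) = real k * expectation (\<lambda>\<omega>. (W 0 \<omega>)\<^sup>2)"
proof -
  note R = cent_reg[OF F]
  define \<Phi> where "\<Phi> s e = (\<Sum>j<r. blocked F s j e)" for s e
  have W: "W q = (\<lambda>\<omega>. \<Phi> (int (q * r)) (path \<omega>))" for q by (simp add: W_def \<Phi>_def)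
  have dep: "depends_on {s + 1..s + int r} (\<Phi> s)" for s
    unfolding \<Phi>_def by (intro depends_on_sum depends_on_blocked[OF R]) auto
  have shift: "\<Phi> s (\<lambda>u. e (u + h)) = \<Phi> (s + h) e" for s e h by (simp add: \<Phi>_def blocked_shift)
  show m: "W q \<in> borel_measurable M" for q unfolding W by (rule measurable_path_compose[OF dep])
  show sq: "integrable M (\<lambda>\<omega>. (W q \<omega>)\<^sup>2)" for q
    unfolding W_def by (intro integrable_sum_L2 measurable_blocked[OF R] integrable_square_blocked[OF R]) auto
  show mean: "expectation (W q) = 0" for q
  proof -
    have "expectation (\<lambda>\<omega>. blocked F s j (path \<omega>)) = 0" for s j
      using cent_mean_trunc[OF F] by (cases "j = 0") (simp_all add: blocked_def)
    moreover have "integrable M (\<lambda>\<omega>. blocked F s j (path \<omega>))" for s j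
      by (rule integrable_L2[OF measurable_blocked[OF R] integrable_square_blocked[OF R]])
    ultimately show ?thesis by (simp add: W_def)
  qed
  have disj: "{int (p * r) + 1..int (p * r) + int r} \<inter> {int (q * r) + 1..int (q * r) + int r} = {}" if "p \<noteq> q" for p q
  proof -
    have *: "p * r + r \<le> q * r" if "p < q" for p q :: nat
      using mult_le_mono1[of "Suc p" q r] that by simp
    show ?thesis using *[of p q] *[of q p] that by (cases "p < q") (auto simp flip: of_nat_mult of_nat_add)
  qed
  have "disjoint_family (\<lambda>q. {int (q * r) + 1..int (q * r) + int r})"
    unfolding disjoint_family_on_def using disj by blast
  then have "indep_vars (\<lambda>_. borel) (\<lambda>q \<omega>. \<Phi> (int (q * r)) (path \<omega>)) UNIV"
    by (rule indep_vars_depends_on[OF dep])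
  moreover have "(\<lambda>q \<omega>. \<Phi> (int (q * r)) (path \<omega>)) = W" by (rule ext) (rule W[symmetric])
  ultimately show "indep_vars (\<lambda>_. borel) W UNIV" by simp
  show law: "distr M borel (W q) = distr M borel (W 0)" for q
    using distr_depends_on_shift[OF dep[of 0], of "int (q * r)"] unfolding W shift by simp
  show var: "expectation (\<lambda>\<omega>. (W q \<omega>)\<^sup>2) = expectation (\<lambda>\<omega>. (W 0 \<omega>)\<^sup>2)" for q
    using integral_distr[OF m, of "\<lambda>x. x\<^sup>2" q] integral_distr[OF m, of "\<lambda>x. x\<^sup>2" 0] law[of q] by simp
  have "expectation (\<lambda>\<omega>. (\<Sum>q<k. W q \<omega>)\<^sup>2) = (\<Sum>q<k. expectation (\<lambda>\<omega>. (W q \<omega>)\<^sup>2))"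
  proof (rule expectation_square_sum_orthogonal)
    show "expectation (\<lambda>\<omega>. W p \<omega> * W q \<omega>) = 0" if "p \<noteq> q" for p q
      using expectation_mult_depends_on[OF dep dep disj[OF that]] integrable_L2[OF m sq] mean
      unfolding W by simp
  qed (use m sq in auto)
  then show "expectation (\<lambda>\<omega>. (\<Sum>q<k. W q \<omega>)\<^sup>2) = real k * expectation (\<lambda>\<omega>. (W 0 \<omega>)\<^sup>2)"
    by (simp add: sum.cong[OF refl var])
qed

lemma div_mult_over_tendsto_1:
  assumes "0 < r"
  shows "(\<lambda>n. real (n div r * r) / real n) \<longlonglongrightarrow> 1"
proof (rule tendsto_sandwich)
  show "\<forall>\<^sub>F n in sequentially. 1 - real r / real n \<le> real (n div r * r) / real n"
  proof (rule eventually_sequentiallyI[of 1])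
    fix n :: nat assume "1 \<le> n"
    have "n \<le> n div r * r + r" using assms by (metis add_left_mono div_mult_mod_eq less_imp_le mod_less_divisor)
    then have "real n \<le> real (n div r * r) + real r" by (simp only: of_nat_add[symmetric] of_nat_le_iff)
    then show "1 - real r / real n \<le> real (n div r * r) / real n"
      using \<open>1 \<le> n\<close> divide_right_mono[of "real n - real r" "real (n div r * r)" "real n"]
      by (simp add: diff_divide_distrib)
  qed
  show "\<forall>\<^sub>F n in sequentially. real (n div r * r) / real n \<le> 1"
  proof (rule eventually_sequentiallyI[of 1])
    fix n :: nat assume "1 \<le> n"
    have "n div r * r \<le> n" by simp
    then have "real (n div r * r) \<le> real n" by (simp only: of_nat_le_iff)
    then show "real (n div r * r) / real n \<le> 1" using \<open>1 \<le> n\<close> by simp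
  qed
  show "(\<lambda>n. 1 - real r / real n) \<longlonglongrightarrow> 1"
    using tendsto_diff[OF tendsto_const[of 1] lim_const_over_n[of "real r"]] by simp
qed simp

text \<open>A double limit: for fixed block length \<open>r\<close> the classical theorem applies as
  \<open>n\<close> grows, and the errors that remain in that limit vanish as \<open>r\<close> grows.
  The long-run variance appears as the limit of the block variances divided by \<open>r\<close>,
  which also shows that it is nonnegative.\<close>

theorem central_limit_obs:
  assumes F: "cent F"
  shows "0 \<le> long_run_variance F"
    and "(\<lambda>n. CLINT \<omega>|M. iexp ((\<Sum>i<n. obs F (int i + 1) (path \<omega>)) / sqrt (real n)))
      \<longlonglongrightarrow> complex_of_real (exp (- long_run_variance F / 2))"
proof -
  note R = cent_reg[OF F]
  obtain C where C: "0 \<le> C"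
    and bl: "\<And>s j. expectation (\<lambda>\<omega>. (blocked F s j (path \<omega>))\<^sup>2) \<le> C"
    and err: "\<And>r n. 0 < r \<Longrightarrow> expectation (\<lambda>\<omega>. ((\<Sum>i<n. obs F (int i + 1) (path \<omega>))
        - (\<Sum>i<n. blocked F (int (i div r * r)) (i mod r) (path \<omega>)))\<^sup>2) \<le> C * real (n div r + 1)"
    by (rule block_error[OF F]) (rule that)
  define V where "V = long_run_variance F"
  define S where "S n \<omega> = (\<Sum>i<n. obs F (int i + 1) (path \<omega>))" for n \<omega>
  define T where "T r n \<omega> = (\<Sum>i<n. blocked F (int (i div r * r)) (i mod r) (path \<omega>))" for r n \<omega>
  define W where "W r q \<omega> = (\<Sum>j<r. blocked F (int (q * r)) j (path \<omega>))" for r q \<omega>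
  define v where "v r = expectation (\<lambda>\<omega>. (W r 0 \<omega>)\<^sup>2)" for r
  note [measurable] = measurable_obs[OF R] measurable_blocked[OF R]
  have [measurable]: "S n \<in> borel_measurable M" "T r n \<in> borel_measurable M" "W r q \<in> borel_measurable M" for n r q
    unfolding S_def T_def W_def by measurable
  have S2: "integrable M (\<lambda>\<omega>. (S n \<omega>)\<^sup>2)" for n
    unfolding S_def by (intro integrable_sum_L2 integrable_square_obs[OF R]) auto
  have T2: "integrable M (\<lambda>\<omega>. (T r n \<omega>)\<^sup>2)" for r n
    unfolding T_def by (intro integrable_sum_L2 integrable_square_blocked[OF R]) auto
  note W = block_sums[OF F, folded W_def]
  have W2: "integrable M (\<lambda>\<omega>. (\<Sum>q<k. W r q \<omega>)\<^sup>2)" for r k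
    by (intro integrable_sum_L2 W(2)) auto
  have TW: "T r (k * r) \<omega> = (\<Sum>q<k. W r q \<omega>)" for r k \<omega>
    unfolding T_def W_def sum_lessThan_blocks[symmetric] by (intro sum.cong) auto

  have ST: "expectation (\<lambda>\<omega>. (S n \<omega> - T r n \<omega>)\<^sup>2) \<le> C * real (n div r + 1)" if "0 < r" for n r
    using err[OF that] by (simp add: S_def T_def)
  \<comment> \<open>The exact variance of the sum of length \<open>r\<close> and that of a single
    block differ, on the scale of standard deviations, by at most \<open>sqrt (2 * C)\<close>; after
    division by \<open>sqrt r\<close> this disappears.\<close>
  have lim1: "(\<lambda>n. sqrt (v (Suc n) / real (Suc n))) \<longlonglongrightarrow> sqrt V"
  proof -
    define s where "s n = expectation (\<lambda>\<omega>. (S n \<omega>)\<^sup>2)" for n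
    define c0 c1 where "c0 = expectation (\<lambda>\<omega>. (obs F 1 (path \<omega>))\<^sup>2)"
      and "c1 = expectation (\<lambda>\<omega>. obs F 1 (path \<omega>) * obs F 2 (path \<omega>))"
    have s_eq: "s (Suc n) / real (Suc n) = V - 2 * c1 / real (Suc n)" for n
    proof -
      have "s (Suc n) = real (Suc n) * c0 + 2 * real n * c1"
        unfolding s_def S_def c0_def c1_def by (rule expectation_square_sum_obs[OF F])
      also have "\<dots> = real (Suc n) * V - 2 * c1"
        by (simp add: V_def long_run_variance_def c0_def c1_def algebra_simps)
      finally show ?thesis by (simp add: diff_divide_distrib)
    qed
    have inv0: "(\<lambda>n. c / real (Suc n)) \<longlonglongrightarrow> 0" for c
      using LIMSEQ_Suc[OF lim_const_over_n[of c]] by simp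
    have "(\<lambda>n. sqrt (s (Suc n) / real (Suc n))) \<longlonglongrightarrow> sqrt (V - 0)"
      unfolding s_eq by (intro tendsto_real_sqrt tendsto_diff tendsto_const inv0)
    moreover have "(\<lambda>n. sqrt (v (Suc n) / real (Suc n)) - sqrt (s (Suc n) / real (Suc n))) \<longlonglongrightarrow> 0"
    proof (rule Lim_null_comparison)
      show "\<forall>\<^sub>F n in sequentially. norm (sqrt (v (Suc n) / real (Suc n)) - sqrt (s (Suc n) / real (Suc n)))
          \<le> sqrt (2 * C / real (Suc n))"
      proof (intro always_eventually allI)
        fix n
        have vT: "v (Suc n) = expectation (\<lambda>\<omega>. (T (Suc n) (Suc n) \<omega>)\<^sup>2)"
          using TW[of "Suc n" 1] by (simp add: v_def)
        have "\<bar>sqrt (v (Suc n)) - sqrt (s (Suc n))\<bar> \<le> sqrt (expectation (\<lambda>\<omega>. (T (Suc n) (Suc n) \<omega> - S (Suc n) \<omega>)\<^sup>2))"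
          unfolding vT s_def by (rule sqrt_expectation_diff_le) (use S2 T2 in auto)
        also have "\<dots> \<le> sqrt (2 * C)"
          using ST[of "Suc n" "Suc n"] by (simp add: power2_commute mult.commute)
        finally have "\<bar>sqrt (v (Suc n)) - sqrt (s (Suc n))\<bar> / sqrt (real (Suc n)) \<le> sqrt (2 * C) / sqrt (real (Suc n))"
          by (intro divide_right_mono) auto
        then show "norm (sqrt (v (Suc n) / real (Suc n)) - sqrt (s (Suc n) / real (Suc n))) \<le> sqrt (2 * C / real (Suc n))"
          by (simp add: real_sqrt_divide abs_divide diff_divide_distrib[symmetric])
      qed
      show "(\<lambda>n. sqrt (2 * C / real (Suc n))) \<longlonglongrightarrow> 0"
        using tendsto_real_sqrt[OF inv0[of "2 * C"]] by simp
    qed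
    ultimately have "(\<lambda>n. (sqrt (v (Suc n) / real (Suc n)) - sqrt (s (Suc n) / real (Suc n)))
        + sqrt (s (Suc n) / real (Suc n))) \<longlonglongrightarrow> 0 + sqrt (V - 0)"
      by (intro tendsto_add)
    then show ?thesis by simp
  qed
  have v0: "0 \<le> v r" for r by (simp add: v_def)
  show V0: "0 \<le> long_run_variance F"
  proof -
    have "0 \<le> sqrt V" by (rule LIMSEQ_le_const[OF lim1]) (use v0 in auto)
    then show ?thesis by (simp add: V_def)
  qed
  have lim2: "(\<lambda>n. v (Suc n) / real (Suc n)) \<longlonglongrightarrow> V"
  proof -
    have "(\<lambda>n. (sqrt (v (Suc n) / real (Suc n)))\<^sup>2) \<longlonglongrightarrow> (sqrt V)\<^sup>2" by (intro tendsto_power lim1)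
    then show ?thesis using V0 v0 by (simp add: V_def)
  qed
  \<comment> \<open>What is left for block length \<open>r\<close> after \<open>n\<close> has gone
    to infinity: the blocking error and the error in the limiting variance.\<close>
  define a where "a r = sqrt (2 * C / real r) + \<bar>exp (- (v r / real r) / 2) - exp (- V / 2)\<bar>" for r
  have a_lim: "(\<lambda>n. a (Suc n)) \<longlonglongrightarrow> 0"
  proof -
    have "(\<lambda>n. sqrt (2 * C / real (Suc n))) \<longlonglongrightarrow> sqrt 0"
      using LIMSEQ_Suc[OF lim_const_over_n[of "2 * C"]] by (intro tendsto_real_sqrt) simp
    moreover have "(\<lambda>n. \<bar>exp (- (v (Suc n) / real (Suc n)) / 2) - exp (- V / 2)\<bar>) \<longlonglongrightarrow> \<bar>exp (- V / 2) - exp (- V / 2)\<bar>"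
      by (intro tendsto_intros lim2) auto
    ultimately have "(\<lambda>n. a (Suc n)) \<longlonglongrightarrow> sqrt 0 + \<bar>exp (- V / 2) - exp (- V / 2)\<bar>"
      unfolding a_def by (rule tendsto_add)
    then show ?thesis by simp
  qed
  define g where "g n = (CLINT \<omega>|M. iexp (S n \<omega> / sqrt (real n)))" for n
  have main: "\<forall>\<^sub>F n in sequentially. norm (g n - complex_of_real (exp (- V / 2))) < \<eta>"
    if r: "0 < r" and ar: "a r < \<eta>" for r \<eta>
  proof -
    define L where "L k \<omega> = (\<Sum>q<k. W r q \<omega>)" for k \<omega>
    have [measurable]: "L k \<in> borel_measurable M" for k unfolding L_def by measurable
    have L2: "integrable M (\<lambda>\<omega>. (L k \<omega>)\<^sup>2)" for k unfolding L_def by (rule W2)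
    \<comment> \<open>The first summand comes from the replacement inside the blocks, the second
      from the at most \<open>r\<close> terms after the last complete block, whose orthogonality at
      distance two costs another factor 2.\<close>
    define E where "E n = 2 * (C * real (n div r + 1)) + 2 * (2 * (real r * C))" for n
    have SL: "expectation (\<lambda>\<omega>. (S n \<omega> - L (n div r) \<omega>)\<^sup>2) \<le> E n" for n
    proof -
      have rem: "T r n \<omega> = L (n div r) \<omega> + (\<Sum>i\<in>{n div r * r..<n}. blocked F (int (i div r * r)) (i mod r) (path \<omega>))" for \<omega>
      proof -
        have "L (n div r) \<omega> = (\<Sum>i<n div r * r. blocked F (int (i div r * r)) (i mod r) (path \<omega>))"
          unfolding L_def TW[symmetric] T_def ..
        then show ?thesis
          unfolding T_def lessThan_atLeast0 by (simp only: sum.atLeastLessThan_concat[OF le0] div_times_less_eq_dividend)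
      qed
      have "expectation (\<lambda>\<omega>. (\<Sum>i\<in>{n div r * r..<n}. blocked F (int (i div r * r)) (i mod r) (path \<omega>))\<^sup>2)
          \<le> 2 * (\<Sum>i\<in>{n div r * r..<n}. expectation (\<lambda>\<omega>. (blocked F (int (i div r * r)) (i mod r) (path \<omega>))\<^sup>2))"
      proof (rule expectation_square_sum_lag2)
        fix i j :: nat assume ij: "i + 2 \<le> j"
        have pos: "int (i div r * r) + int (i mod r) = int i" for i
          unfolding of_nat_add[symmetric] by simp
        have "depends_on {..int i + 1} (blocked F (int (i div r * r)) (i mod r))"
          using depends_on_blocked_past[OF R, of "int (i div r * r)" "i mod r"] by (simp only: pos)
        then have d: "depends_on {..int j - 1} (blocked F (int (i div r * r)) (i mod r))"
          by (rule depends_on_mono) (use ij in auto)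
        show "expectation (\<lambda>\<omega>. blocked F (int (i div r * r)) (i mod r) (path \<omega>)
            * blocked F (int (j div r * r)) (j mod r) (path \<omega>)) = 0"
          by (rule cent_orthogonal_blocked[OF F _ integrable_square_blocked[OF R]]) (use d in \<open>simp only: pos\<close>)
      qed (auto intro: integrable_square_blocked[OF R] measurable_blocked[OF R])
      also have "\<dots> \<le> 2 * (\<Sum>i\<in>{n div r * r..<n}. C)" by (intro mult_left_mono sum_mono bl) auto
      also have "\<dots> \<le> 2 * (real r * C)"
      proof -
        have "n - n div r * r \<le> r" using r by (simp add: minus_div_mult_eq_mod less_imp_le)
        then have "real (n - n div r * r) * C \<le> real r * C" using C by (intro mult_right_mono of_nat_mono) auto
        then show ?thesis unfolding sum_constant card_atLeastLessThan by (rule mult_left_mono) simp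
      qed
      finally have TL: "expectation (\<lambda>\<omega>. (T r n \<omega> - L (n div r) \<omega>)\<^sup>2) \<le> 2 * (real r * C)" by (simp add: rem)
      have iTL: "integrable M (\<lambda>\<omega>. (T r n \<omega> - L (n div r) \<omega>)\<^sup>2)" "integrable M (\<lambda>\<omega>. (S n \<omega> - T r n \<omega>)\<^sup>2)"
        by (intro integrable_diff_L2 T2 L2 S2; measurable)+
      have "expectation (\<lambda>\<omega>. (S n \<omega> - L (n div r) \<omega>)\<^sup>2)
          \<le> expectation (\<lambda>\<omega>. 2 * (S n \<omega> - T r n \<omega>)\<^sup>2 + 2 * (T r n \<omega> - L (n div r) \<omega>)\<^sup>2)"
      proof (rule integral_mono)
        show "integrable M (\<lambda>\<omega>. (S n \<omega> - L (n div r) \<omega>)\<^sup>2)" by (intro integrable_diff_L2 S2 L2) auto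
        show "integrable M (\<lambda>\<omega>. 2 * (S n \<omega> - T r n \<omega>)\<^sup>2 + 2 * (T r n \<omega> - L (n div r) \<omega>)\<^sup>2)" using iTL by simp
        have "(x + y)\<^sup>2 \<le> 2 * x\<^sup>2 + 2 * y\<^sup>2" for x y :: real
          using zero_le_power2[of "x - y"] by (simp add: power2_eq_square algebra_simps)
        then show "(S n \<omega> - L (n div r) \<omega>)\<^sup>2 \<le> 2 * (S n \<omega> - T r n \<omega>)\<^sup>2 + 2 * (T r n \<omega> - L (n div r) \<omega>)\<^sup>2" for \<omega>
          by (metis diff_add_cancel add_diff_eq)
      qed
      also have "\<dots> = 2 * expectation (\<lambda>\<omega>. (S n \<omega> - T r n \<omega>)\<^sup>2) + 2 * expectation (\<lambda>\<omega>. (T r n \<omega> - L (n div r) \<omega>)\<^sup>2)"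
        using iTL by simp
      also have "\<dots> \<le> E n" unfolding E_def by (intro add_mono mult_left_mono ST r TL) auto
      finally show ?thesis .
    qed
    \<comment> \<open>Four consecutive errors: \<open>b1\<close> for replacing the sum by complete
      blocks, \<open>b2\<close> for normalizing by \<open>sqrt n\<close> instead of the square root
      of \<open>n div r * r\<close>, \<open>b3\<close> for the central limit theorem over the
      blocks, \<open>b4\<close> for the variance of a block of finite length. The first two and the
      third are controlled by the growth of \<open>n\<close>, the last only by
      \<open>r\<close>.\<close>
    define b1 where "b1 n = sqrt (2 * C / real r + (2 * C + 4 * real r * C) / real n)" for n
    define b2 where "b2 n = sqrt (v r / real r) * \<bar>sqrt (real (n div r * r) / real n) - 1\<bar>" for n
    define b3 where "b3 k = norm ((CLINT \<omega>|M. iexp ((\<Sum>q<k. W r q \<omega> / sqrt (real r)) / sqrt (real k)))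
        - complex_of_real (exp (- (v r / real r) / 2)))" for k
    define b4 where "b4 = \<bar>exp (- (v r / real r) / 2) - exp (- V / 2)\<bar>"
    have bound: "norm (g n - complex_of_real (exp (- V / 2))) \<le> b1 n + b2 n + b3 (n div r) + b4" if n: "r \<le> n" for n
    proof -
      have tri: "norm (x - z) \<le> norm (x - y) + norm (y - z)" for x y z :: complex
        using norm_triangle_ineq[of "x - y" "y - z"] by simp
      define k where "k = n div r"
      have k: "1 \<le> k" using n r by (simp add: k_def div_greater_zero_iff Suc_le_eq)
      have kr: "real k * real r \<le> real n" by (simp add: k_def flip: of_nat_mult)
      have n0: "0 < real n" "0 < real r" "0 < real k" using n r k by auto
      have 1: "norm (g n - (CLINT \<omega>|M. iexp (L k \<omega> / sqrt (real n)))) \<le> b1 n"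
      proof -
        have "norm (g n - (CLINT \<omega>|M. iexp (L k \<omega> / sqrt (real n))))
            \<le> sqrt (expectation (\<lambda>\<omega>. (S n \<omega> / sqrt (real n) - L k \<omega> / sqrt (real n))\<^sup>2))"
          unfolding g_def by (intro char_diff_le integrable_diff_L2) (auto simp: power_divide S2 L2)
        also have "(\<lambda>\<omega>. (S n \<omega> / sqrt (real n) - L k \<omega> / sqrt (real n))\<^sup>2) = (\<lambda>\<omega>. (S n \<omega> - L k \<omega>)\<^sup>2 / real n)"
          using n0 by (simp add: power_divide flip: diff_divide_distrib)
        also have "sqrt (expectation (\<lambda>\<omega>. (S n \<omega> - L k \<omega>)\<^sup>2 / real n)) \<le> b1 n"
        proof -
          have "expectation (\<lambda>\<omega>. (S n \<omega> - L k \<omega>)\<^sup>2 / real n) \<le> E n / real n"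
            using SL[of n] n0 by (simp add: k_def divide_right_mono)
          also have "\<dots> \<le> (2 * C * (real n / real r) + (2 * C + 4 * real r * C)) / real n"
          proof (rule divide_right_mono)
            have "real k \<le> real n / real r" using kr n0 by (simp add: field_simps)
            then have "2 * C * real k \<le> 2 * C * (real n / real r)" using C by (intro mult_left_mono) auto
            then show "E n \<le> 2 * C * (real n / real r) + (2 * C + 4 * real r * C)"
              unfolding E_def k_def[symmetric] by (simp add: algebra_simps)
          qed simp
          also have "\<dots> = 2 * C / real r + (2 * C + 4 * real r * C) / real n"
            using n0 by (simp add: add_divide_distrib)
          finally show ?thesis unfolding b1_def by (rule real_sqrt_le_mono)
        qed
        finally show ?thesis .
      qed
      have 2: "norm ((CLINT \<omega>|M. iexp (L k \<omega> / sqrt (real n)))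
          - (CLINT \<omega>|M. iexp ((\<Sum>q<k. W r q \<omega> / sqrt (real r)) / sqrt (real k)))) \<le> b2 n"
      proof -
        define \<kappa> where "\<kappa> = 1 / sqrt (real n) - 1 / sqrt (real k * real r)"
        have eq: "(\<Sum>q<k. W r q \<omega> / sqrt (real r)) / sqrt (real k) = L k \<omega> / sqrt (real k * real r)" for \<omega>
          by (simp add: L_def real_sqrt_mult sum_divide_distrib mult.commute)
        have sqeq: "(\<lambda>\<omega>. (L k \<omega> / sqrt (real n) - L k \<omega> / sqrt (real k * real r))\<^sup>2) = (\<lambda>\<omega>. \<kappa>\<^sup>2 * (L k \<omega>)\<^sup>2)"
          by (simp add: \<kappa>_def fun_eq_iff flip: power_mult_distrib) (simp add: algebra_simps)
        have "norm ((CLINT \<omega>|M. iexp (L k \<omega> / sqrt (real n))) - (CLINT \<omega>|M. iexp (L k \<omega> / sqrt (real k * real r))))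
            \<le> sqrt (expectation (\<lambda>\<omega>. (L k \<omega> / sqrt (real n) - L k \<omega> / sqrt (real k * real r))\<^sup>2))"
          by (rule char_diff_le) (auto simp: sqeq L2)
        also have "\<dots> = sqrt (\<kappa>\<^sup>2 * (real k * v r))"
          unfolding sqeq using W(7)[where r = r and k = k] by (simp add: L_def v_def)
        also have "\<dots> = \<bar>\<kappa>\<bar> * sqrt (real k * v r)" by (simp add: real_sqrt_mult)
        also have "\<dots> = b2 n"
        proof -
          have "sqrt (real k * v r) = sqrt (v r / real r) * sqrt (real k * real r)"
            using n0 by (simp flip: real_sqrt_mult)
          then have "\<bar>\<kappa>\<bar> * sqrt (real k * v r) = sqrt (v r / real r) * \<bar>\<kappa> * sqrt (real k * real r)\<bar>"
            by (simp add: abs_mult)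
          also have "\<kappa> * sqrt (real k * real r) = sqrt (real (n div r * r) / real n) - 1"
            using n0 by (simp add: \<kappa>_def left_diff_distrib k_def real_sqrt_divide)
          finally show ?thesis by (simp add: b2_def)
        qed
        finally show ?thesis unfolding eq .
      qed
      have 3: "norm ((CLINT \<omega>|M. iexp ((\<Sum>q<k. W r q \<omega> / sqrt (real r)) / sqrt (real k)))
          - complex_of_real (exp (- V / 2))) \<le> b3 k + b4"
      proof -
        have "b4 = norm (complex_of_real (exp (- (v r / real r) / 2)) - complex_of_real (exp (- V / 2)))"
          unfolding b4_def of_real_diff[symmetric] norm_of_real ..
        then show ?thesis unfolding b3_def by (simp only: tri)
      qed
      show ?thesis
        using 1 2 3 tri[of "g n" "complex_of_real (exp (- V / 2))" "CLINT \<omega>|M. iexp (L k \<omega> / sqrt (real n))"]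
          tri[of "CLINT \<omega>|M. iexp (L k \<omega> / sqrt (real n))" "complex_of_real (exp (- V / 2))"
            "CLINT \<omega>|M. iexp ((\<Sum>q<k. W r q \<omega> / sqrt (real r)) / sqrt (real k))"]
        unfolding k_def[symmetric] by linarith
    qed
    have l1: "b1 \<longlonglongrightarrow> sqrt (2 * C / real r)"
    proof -
      have "b1 \<longlonglongrightarrow> sqrt (2 * C / real r + 0)"
        unfolding b1_def by (intro tendsto_real_sqrt tendsto_add tendsto_const lim_const_over_n)
      then show ?thesis by simp
    qed
    have l2: "b2 \<longlonglongrightarrow> 0"
    proof -
      have "b2 \<longlonglongrightarrow> sqrt (v r / real r) * \<bar>sqrt 1 - 1\<bar>"
        unfolding b2_def by (intro tendsto_mult tendsto_rabs tendsto_diff tendsto_real_sqrt tendsto_const div_mult_over_tendsto_1 r)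
      then show ?thesis by simp
    qed
    have "(\<lambda>k. CLINT \<omega>|M. iexp ((\<Sum>q<k. W r q \<omega> / sqrt (real r)) / sqrt (real k)))
        \<longlonglongrightarrow> complex_of_real (exp (- (v r / real r) / 2))"
    proof (rule char_normalized_sum_tendsto)
      show "indep_vars (\<lambda>_. borel) (\<lambda>q \<omega>. W r q \<omega> / sqrt (real r)) UNIV"
        by (rule indep_vars_compose2[OF W(4)]) measurable
      show "expectation (\<lambda>\<omega>. W r q \<omega> / sqrt (real r)) = 0" for q using W(3)[where r = r and q = q] by simp
      show "integrable M (\<lambda>\<omega>. (W r q \<omega> / sqrt (real r))\<^sup>2)" for q using W(2)[where r = r and q = q] by (simp add: power_divide)
      show "expectation (\<lambda>\<omega>. (W r q \<omega> / sqrt (real r))\<^sup>2) = v r / real r" for q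
        using W(6)[where r = r and q = q] by (simp add: power_divide v_def)
      show "distr M borel (\<lambda>\<omega>. W r q \<omega> / sqrt (real r)) = distr (distr M borel (W r 0)) borel (\<lambda>x. x / sqrt (real r))" for q
        using distr_distr[of "\<lambda>x. x / sqrt (real r)" borel borel "W r q" M] W(5)[where r = r and q = q] by (simp add: comp_def)
    qed
    then have "(\<lambda>k. norm ((CLINT \<omega>|M. iexp ((\<Sum>q<k. W r q \<omega> / sqrt (real r)) / sqrt (real k)))
        - complex_of_real (exp (- (v r / real r) / 2)))) \<longlonglongrightarrow> 0"
      by (subst tendsto_norm_zero_iff) (simp add: LIM_zero_iff)
    then have l3: "b3 \<longlonglongrightarrow> 0" by (simp add: b3_def[abs_def])
    have div_lim: "filterlim (\<lambda>n. n div r) at_top at_top"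
      unfolding filterlim_at_top
    proof
      fix Z
      show "\<forall>\<^sub>F n in sequentially. Z \<le> n div r"
        using r by (intro eventually_sequentiallyI[of "Z * r"]) (simp add: less_eq_div_iff_mult_less_eq)
    qed
    have "(\<lambda>n. b1 n + b2 n + b3 (n div r) + b4) \<longlonglongrightarrow> sqrt (2 * C / real r) + 0 + 0 + b4"
      by (intro tendsto_add l1 l2 filterlim_compose[OF l3 div_lim] tendsto_const)
    moreover have "sqrt (2 * C / real r) + 0 + 0 + b4 < \<eta>" using ar by (simp add: a_def b4_def)
    ultimately have "\<forall>\<^sub>F n in sequentially. b1 n + b2 n + b3 (n div r) + b4 < \<eta>" by (rule order_tendstoD(2))
    then show ?thesis
      using eventually_ge_at_top[of r] by eventually_elim (use bound in \<open>auto intro: le_less_trans\<close>)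
  qed
  have "g \<longlonglongrightarrow> complex_of_real (exp (- V / 2))"
    unfolding tendsto_iff dist_norm
  proof (intro allI impI)
    fix \<eta> :: real assume "0 < \<eta>"
    then have "\<forall>\<^sub>F n in sequentially. a (Suc n) < \<eta>" using order_tendstoD(2)[OF a_lim] by blast
    then obtain n where "a (Suc n) < \<eta>" by (auto simp: eventually_sequentially)
    then show "\<forall>\<^sub>F n in sequentially. norm (g n - complex_of_real (exp (- V / 2))) < \<eta>" by (intro main[of "Suc n"]) auto
  qed
  then show "(\<lambda>n. CLINT \<omega>|M. iexp ((\<Sum>i<n. obs F (int i + 1) (path \<omega>)) / sqrt (real n)))
      \<longlonglongrightarrow> complex_of_real (exp (- long_run_variance F / 2))"
    by (simp add: g_def[abs_def] S_def V_def)
qed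

end

section \<open>Weak convergence on Euclidean spaces\<close>

text \<open>The phase \<open>c\<close> lets a single constructor cover cosines, sines and constants,
  and makes the product-to-sum formula sufficient for closure under products.\<close>

inductive trig_poly :: "('b::euclidean_space \<Rightarrow> real) \<Rightarrow> bool" where
  wave: "trig_poly (\<lambda>x. a * cos (u \<bullet> x + c))"
| add: "trig_poly f \<Longrightarrow> trig_poly g \<Longrightarrow> trig_poly (\<lambda>x. f x + g x)"

lemma trig_poly_const: "trig_poly (\<lambda>x. a)"
  using trig_poly.wave[of a 0 0] by simp

lemma trig_poly_sum: "(\<And>i. i \<in> I \<Longrightarrow> trig_poly (f i)) \<Longrightarrow> trig_poly (\<lambda>x. \<Sum>i\<in>I. f i x)"
  by (induction I rule: infinite_finite_induct) (auto intro: trig_poly_const trig_poly.add)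

lemma trig_poly_mult:
  assumes "trig_poly f" "trig_poly g"
  shows "trig_poly (\<lambda>x. f x * g x)"
  using assms(1)
proof induction
  case (wave a u c)
  from assms(2) show ?case
  proof induction
    case (wave a' u' c')
    have "a * cos (u \<bullet> x + c) * (a' * cos (u' \<bullet> x + c'))
        = a * a' / 2 * cos ((u - u') \<bullet> x + (c - c')) + a * a' / 2 * cos ((u + u') \<bullet> x + (c + c'))" for x
    proof -
      have 1: "(u - u') \<bullet> x + (c - c') = (u \<bullet> x + c) - (u' \<bullet> x + c')" by (simp add: inner_diff_left)
      have 2: "(u + u') \<bullet> x + (c + c') = (u \<bullet> x + c) + (u' \<bullet> x + c')" by (simp add: inner_add_left)
      show ?thesis unfolding 1 2 cos_diff[of "u \<bullet> x + c"] cos_add[of "u \<bullet> x + c"] by (simp add: algebra_simps)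
    qed
    then show ?case by (simp only:) (intro trig_poly.intros)
  next
    case (add f g)
    then show ?case by (simp add: distrib_left trig_poly.add)
  qed
next
  case (add f h)
  then show ?case by (simp add: distrib_right trig_poly.add)
qed

lemma trig_poly_continuous_on: "trig_poly f \<Longrightarrow> continuous_on UNIV f"
  by (induction rule: trig_poly.induct) (auto intro!: continuous_intros)

lemma trig_poly_compose_polynomial:
  fixes p :: "'b::euclidean_space \<Rightarrow> real"
  assumes "real_polynomial_function p"
  shows "trig_poly (\<lambda>x. p (\<Sum>i\<in>Basis. sin (c * (x \<bullet> i)) *\<^sub>R i))"
  using assms
proof induction
  case (linear f)
  \<comment> \<open>A linear functional is a combination of coordinates, and each sine is a cosine
    with phase \<open>- (pi / 2)\<close>.\<close>
  have "f (\<Sum>i\<in>Basis. sin (c * (x \<bullet> i)) *\<^sub>R i) = (\<Sum>i\<in>Basis. f i * cos ((c *\<^sub>R i) \<bullet> x + - (pi / 2)))" for x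
  proof -
    have "f (\<Sum>i\<in>Basis. sin (c * (x \<bullet> i)) *\<^sub>R i) = (\<Sum>i\<in>Basis. sin (c * (x \<bullet> i)) * f i)"
      using bounded_linear.linear[OF linear] by (simp add: linear_sum linear_cmul)
    also have "\<dots> = (\<Sum>i\<in>Basis. f i * cos ((c *\<^sub>R i) \<bullet> x + - (pi / 2)))"
      by (intro sum.cong refl) (simp add: cos_diff inner_commute[of x])
    finally show ?thesis .
  qed
  then show ?case by (simp only:) (intro trig_poly_sum trig_poly.wave)
qed (auto intro: trig_poly_const trig_poly.add trig_poly_mult)

text \<open>The substitution \<open>x\<^sub>i \<mapsto> sin (c x\<^sub>i)\<close> turns a polynomial approximation on the unit cube into a
  trigonometric one that is accurate on a large cube and globally bounded.\<close>

lemma trig_poly_approximation: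
  fixes f :: "'b::euclidean_space \<Rightarrow> real"
  assumes f: "continuous_on UNIV f" and B: "\<And>x. \<bar>f x\<bar> \<le> B" and \<eta>: "0 < \<eta>" and L: "0 < L"
  obtains T where "trig_poly T" "\<And>x. \<bar>T x\<bar> \<le> B + \<eta>" "\<And>x. norm x \<le> L \<Longrightarrow> \<bar>f x - T x\<bar> \<le> \<eta>"
proof -
  \<comment> \<open>Scaling by \<open>c\<close> maps the interval from \<open>- L\<close> to
    \<open>L\<close> onto the range where \<open>arcsin\<close> inverts \<open>sin\<close>.\<close>
  define c where "c = pi / (2 * L)"
  have c: "0 < c" using L by (simp add: c_def)
  define S where "S = cbox (- One) (One :: 'b)"
  have S: "\<bar>y \<bullet> i\<bar> \<le> 1" if "y \<in> S" "i \<in> Basis" for y i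
    using that by (auto simp: S_def mem_box abs_le_iff)
  define g where "g y = f (\<Sum>i\<in>Basis. (arcsin (y \<bullet> i) / c) *\<^sub>R i)" for y
  have "continuous_on S g"
    unfolding g_def
  proof (rule continuous_on_compose2[OF f])
    show "continuous_on S (\<lambda>y. \<Sum>i\<in>Basis. (arcsin (y \<bullet> i) / c) *\<^sub>R i)"
      using c S by (intro continuous_intros) (auto simp: abs_le_iff)
  qed auto
  moreover have "compact S" by (simp add: S_def)
  ultimately obtain p where p: "real_polynomial_function p" "\<And>y. y \<in> S \<Longrightarrow> \<bar>g y - p y\<bar> < \<eta>"
    using Stone_Weierstrass_real_polynomial_function[of S g \<eta>] \<eta> by blast
  define s where "s x = (\<Sum>i\<in>Basis. sin (c * (x \<bullet> i)) *\<^sub>R i)" for x :: 'b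
  have sS: "s x \<in> S" for x by (auto simp: S_def s_def mem_box)
  show ?thesis
  proof (rule that[of "\<lambda>x. p (s x)"])
    show "trig_poly (\<lambda>x. p (s x))" unfolding s_def by (rule trig_poly_compose_polynomial[OF p(1)])
    show "\<bar>p (s x)\<bar> \<le> B + \<eta>" for x
    proof -
      have "\<bar>g (s x)\<bar> \<le> B" unfolding g_def by (rule B)
      then show ?thesis using p(2)[OF sS[of x]] by linarith
    qed
    show "\<bar>f x - p (s x)\<bar> \<le> \<eta>" if "norm x \<le> L" for x
    proof -
      have "arcsin (s x \<bullet> i) / c = x \<bullet> i" if i: "i \<in> Basis" for i
      proof -
        have "\<bar>x \<bullet> i\<bar> \<le> L" using Basis_le_norm[OF i, of x] \<open>norm x \<le> L\<close> by simp
        then have "\<bar>c * (x \<bullet> i)\<bar> \<le> c * L" using c by (simp add: abs_mult)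
        also have "c * L = pi / 2" using L by (simp add: c_def)
        finally have "arcsin (sin (c * (x \<bullet> i))) = c * (x \<bullet> i)" by (intro arcsin_sin) (auto simp: abs_le_iff)
        then show ?thesis using i c by (simp add: s_def)
      qed
      then have "g (s x) = f x" by (simp add: g_def euclidean_representation)
      then show ?thesis using p(2)[OF sS[of x]] by simp
    qed
  qed
qed

lemma (in prob_space) expectation_trig_poly_diff:
  fixes f T :: "'b::euclidean_space \<Rightarrow> real"
  assumes f: "continuous_on UNIV f" and T: "continuous_on UNIV T"
    and B: "\<And>x. \<bar>f x\<bar> \<le> B" "\<And>x. \<bar>T x\<bar> \<le> B + \<eta>" "\<And>x. norm x \<le> L \<Longrightarrow> \<bar>f x - T x\<bar> \<le> \<eta>" "0 < \<eta>"
    and X[measurable]: "X \<in> borel_measurable M"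
    and tail: "prob {\<omega> \<in> space M. L < norm (X \<omega>)} \<le> \<eta>"
  shows "\<bar>expectation (\<lambda>\<omega>. f (X \<omega>)) - expectation (\<lambda>\<omega>. T (X \<omega>))\<bar> \<le> \<eta> + (2 * B + \<eta>) * \<eta>"
proof -
  have [measurable]: "f \<in> borel_measurable borel" "T \<in> borel_measurable borel"
    using f T by (auto intro: borel_measurable_continuous_onI)
  have B0: "0 \<le> B" using order_trans[OF abs_ge_zero B(1)] .
  have if': "integrable M (\<lambda>\<omega>. f (X \<omega>))" by (rule integrable_const_bound[where B = B]) (use B in auto)
  have iT: "integrable M (\<lambda>\<omega>. T (X \<omega>))" by (rule integrable_const_bound[where B = "B + \<eta>"]) (use B in auto)
  let ?I = "indicat_real {\<omega> \<in> space M. L < norm (X \<omega>)}"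
  have iI: "integrable M ?I" by (rule integrable_const_bound[where B = 1]) auto
  have "\<bar>expectation (\<lambda>\<omega>. f (X \<omega>)) - expectation (\<lambda>\<omega>. T (X \<omega>))\<bar> = \<bar>expectation (\<lambda>\<omega>. f (X \<omega>) - T (X \<omega>))\<bar>"
    using if' iT by simp
  also have "\<dots> \<le> expectation (\<lambda>\<omega>. \<bar>f (X \<omega>) - T (X \<omega>)\<bar>)" by (rule integral_abs_bound)
  also have "\<dots> \<le> expectation (\<lambda>\<omega>. \<eta> + (2 * B + \<eta>) * ?I \<omega>)"
  proof (rule integral_mono)
    show "\<bar>f (X \<omega>) - T (X \<omega>)\<bar> \<le> \<eta> + (2 * B + \<eta>) * ?I \<omega>" if "\<omega> \<in> space M" for \<omega>
    proof (cases "L < norm (X \<omega>)")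
      case True
      then have "?I \<omega> = 1" using that by simp
      then show ?thesis using B(1)[of "X \<omega>"] B(2)[of "X \<omega>"] B(4) by simp
    next
      case False
      then show ?thesis using B(3)[of "X \<omega>"] by simp
    qed
  qed (use if' iT iI in auto)
  also have "\<dots> = \<eta> + (2 * B + \<eta>) * prob {\<omega> \<in> space M. L < norm (X \<omega>)}" using iI by (simp add: prob_space)
  also have "\<dots> \<le> \<eta> + (2 * B + \<eta>) * \<eta>" using tail B0 B(4) by (intro add_left_mono mult_left_mono) auto
  finally show ?thesis .
qed

lemma (in prob_space) expectation_trig_poly_tendsto:
  fixes X :: "nat \<Rightarrow> 'a \<Rightarrow> 'b::euclidean_space"
  assumes X[measurable]: "\<And>n. X n \<in> borel_measurable M"
    and N: "prob_space N" "sets N = sets borel"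
    and char: "\<And>u. (\<lambda>n. CLINT \<omega>|M. iexp (u \<bullet> X n \<omega>)) \<longlonglongrightarrow> (CLINT x|N. iexp (u \<bullet> x))"
    and T: "trig_poly T"
  shows "(\<lambda>n. expectation (\<lambda>\<omega>. T (X n \<omega>))) \<longlonglongrightarrow> (LINT x|N. T x)"
  using T
proof induction
  case (wave a u c)
  have eq: "a * cos (y + c) = a * cos c * Re (iexp y) - a * sin c * Im (iexp y)" for y
    by (simp add: cos_add Re_exp Im_exp algebra_simps)
  interpret N: prob_space N by (rule N)
  note [measurable_cong] = N(2)
  have iX: "integrable M (\<lambda>\<omega>. iexp (u \<bullet> X n \<omega>))" for n by (rule integrable_iexp_compose) measurable
  have iN: "integrable N (\<lambda>x. iexp (u \<bullet> x))" by (rule N.integrable_iexp_compose) measurable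
  have "(\<lambda>n. a * cos c * Re (CLINT \<omega>|M. iexp (u \<bullet> X n \<omega>)) - a * sin c * Im (CLINT \<omega>|M. iexp (u \<bullet> X n \<omega>)))
      \<longlonglongrightarrow> a * cos c * Re (CLINT x|N. iexp (u \<bullet> x)) - a * sin c * Im (CLINT x|N. iexp (u \<bullet> x))"
    by (intro tendsto_intros char)
  then show ?case
    unfolding eq using integrable_Re[OF iX] integrable_Im[OF iX] integrable_Re[OF iN] integrable_Im[OF iN]
    by (simp only: Bochner_Integration.integral_diff integrable_mult_right integral_mult_right_zero
        integral_Re[OF iX] integral_Im[OF iX] integral_Re[OF iN] integral_Im[OF iN])
next
  case (add f g)
  have int: "integrable M' (\<lambda>\<omega>. f (Y \<omega>)) \<and> (\<lambda>\<omega>. f (Y \<omega>)) \<in> borel_measurable M'"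
    if "trig_poly f" "prob_space M'" "Y \<in> borel_measurable M'" for M' :: "'c measure" and Y and f :: "'b \<Rightarrow> real"
    using that(1)
  proof induction
    case (wave a u c)
    interpret M': prob_space M' by (rule that(2))
    note [measurable] = that(3)
    show ?case by (intro conjI M'.integrable_const_bound[where B = "\<bar>a\<bar>"]) (auto simp: abs_mult mult_left_le)
  qed auto
  have id: "(\<lambda>x. x) \<in> borel_measurable N" using N(2) by (simp add: measurable_ident_sets)
  have "integrable M (\<lambda>\<omega>. f (X n \<omega>))" "integrable M (\<lambda>\<omega>. g (X n \<omega>))" for n
    using int[OF add.hyps(1) prob_space_axioms X] int[OF add.hyps(2) prob_space_axioms X] by auto
  moreover have "integrable N f" "integrable N g"
    using int[OF add.hyps(1) N(1) id] int[OF add.hyps(2) N(1) id] by auto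
  ultimately show ?case using add.IH by (simp add: tendsto_add)
qed

text \<open>Expectations of trigonometric polynomials converge by the hypothesis on characteristic
  functions. Tightness confines both laws to a ball on which \<open>f\<close> is close to such a
  polynomial; outside, the global bound on the polynomial makes the small tail probabilities
  suffice.\<close>

theorem (in prob_space) converges_in_distribution_char:
  fixes X :: "nat \<Rightarrow> 'a \<Rightarrow> 'b::euclidean_space"
  assumes X: "\<And>n. X n \<in> borel_measurable M"
    and N: "prob_space N" "sets N = sets borel"
    and char: "\<And>u. (\<lambda>n. CLINT \<omega>|M. iexp (u \<bullet> X n \<omega>)) \<longlonglongrightarrow> (CLINT x|N. iexp (u \<bullet> x))"
    and tight: "\<And>\<eta>. 0 < \<eta> \<Longrightarrow> \<exists>K. \<forall>\<^sub>F n in sequentially. prob {\<omega> \<in> space M. K < norm (X n \<omega>)} \<le> \<eta>"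
  shows "converges_in_distribution M X N"
  unfolding converges_in_distribution_def
proof (intro allI impI)
  fix f :: "'b \<Rightarrow> real"
  assume f: "continuous_on UNIV f" and bounded: "bounded (range f)"
  obtain B where B: "\<And>x. \<bar>f x\<bar> \<le> B" using bounded by (auto simp: bounded_iff)
  have B0: "0 \<le> B" using order_trans[OF abs_ge_zero B] .
  interpret N: prob_space N by (rule N)
  note [measurable] = X
  note [measurable_cong] = N(2)
  have idN[measurable]: "(\<lambda>x. x) \<in> borel_measurable N" using N(2) by (simp add: measurable_ident_sets)
  show "(\<lambda>n. expectation (\<lambda>\<omega>. f (X n \<omega>))) \<longlonglongrightarrow> (LINT x|N. f x)"
    unfolding tendsto_iff dist_real_def
  proof (intro allI impI)
    fix \<kappa> :: real assume \<kappa>: "0 < \<kappa>"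
    \<comment> \<open>Chosen so that each of the two approximation errors is at most
      \<open>\<kappa> / 4\<close>; with \<open>\<kappa> / 4\<close> for the polynomial the total
      stays below \<open>\<kappa>\<close>.\<close>
    define \<eta> where "\<eta> = min 1 (\<kappa> / (4 * (2 * B + 3)))"
    have \<eta>: "0 < \<eta>" "\<eta> \<le> 1" using \<kappa> B0 by (auto simp: \<eta>_def)
    have err: "\<eta> + (2 * B + \<eta>) * \<eta> \<le> \<kappa> / 4"
    proof -
      have "\<eta> + (2 * B + \<eta>) * \<eta> = (1 + (2 * B + \<eta>)) * \<eta>" by (simp add: algebra_simps)
      also have "\<dots> \<le> (2 * B + 3) * (\<kappa> / (4 * (2 * B + 3)))"
        using \<eta> B0 by (intro mult_mono) (auto simp: \<eta>_def)
      also have "\<dots> = \<kappa> / 4"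
      proof -
        have "D * (\<kappa> / (4 * D)) = \<kappa> / 4" if "D \<noteq> 0" for D using that by simp
        moreover have "2 * B + 3 \<noteq> 0" using B0 by linarith
        ultimately show ?thesis by blast
      qed
      finally show ?thesis .
    qed
    obtain K1 where K1: "\<forall>\<^sub>F n in sequentially. prob {\<omega> \<in> space M. K1 < norm (X n \<omega>)} \<le> \<eta>"
      using tight[OF \<eta>(1)] by blast
    have "(\<lambda>n. N.prob {x \<in> space N. real n < norm x}) \<longlonglongrightarrow> N.prob (\<Inter>n. {x \<in> space N. real n < norm x})"
      by (rule N.finite_Lim_measure_decseq) (auto simp: decseq_def)
    moreover have "(\<Inter>n. {x \<in> space N. real n < norm x}) = {}"
    proof -
      have "\<exists>n. \<not> real n < norm x" for x :: 'b using reals_Archimedean2[of "norm x"] by (meson less_asym)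
      then show ?thesis by auto
    qed
    ultimately have "(\<lambda>n. N.prob {x \<in> space N. real n < norm x}) \<longlonglongrightarrow> 0" by simp
    then have "\<forall>\<^sub>F n in sequentially. N.prob {x \<in> space N. real n < norm x} < \<eta>"
      by (rule order_tendstoD) (rule \<eta>)
    then obtain k :: nat where k: "N.prob {x \<in> space N. real k < norm x} < \<eta>" by (auto simp: eventually_sequentially)
    define L where "L = max 1 (max K1 (real k))"
    have L: "0 < L" "K1 \<le> L" "real k \<le> L" by (auto simp: L_def)
    have "N.prob {x \<in> space N. L < norm x} \<le> N.prob {x \<in> space N. real k < norm x}"
      by (rule N.finite_measure_mono) (use L in auto)
    with k have tailN: "N.prob {x \<in> space N. L < norm x} \<le> \<eta>" by simp
    obtain T where T: "trig_poly T" "\<And>x. \<bar>T x\<bar> \<le> B + \<eta>" "\<And>x. norm x \<le> L \<Longrightarrow> \<bar>f x - T x\<bar> \<le> \<eta>"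
      by (rule trig_poly_approximation[OF f B \<eta>(1) L(1)]) (rule that)
    have "\<forall>\<^sub>F n in sequentially. \<bar>expectation (\<lambda>\<omega>. T (X n \<omega>)) - (LINT x|N. T x)\<bar> < \<kappa> / 4"
      using tendstoD[OF expectation_trig_poly_tendsto[OF X N char T(1)], of "\<kappa> / 4"] \<kappa> by (simp add: dist_real_def)
    with K1 show "\<forall>\<^sub>F n in sequentially. \<bar>expectation (\<lambda>\<omega>. f (X n \<omega>)) - (LINT x|N. f x)\<bar> < \<kappa>"
    proof eventually_elim
      case (elim n)
      have "prob {\<omega> \<in> space M. L < norm (X n \<omega>)} \<le> prob {\<omega> \<in> space M. K1 < norm (X n \<omega>)}"
        by (rule finite_measure_mono) (use L in auto)
      with elim(1) have tail: "prob {\<omega> \<in> space M. L < norm (X n \<omega>)} \<le> \<eta>" by linarith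
      have "\<bar>expectation (\<lambda>\<omega>. f (X n \<omega>)) - expectation (\<lambda>\<omega>. T (X n \<omega>))\<bar> \<le> \<eta> + (2 * B + \<eta>) * \<eta>"
        by (rule expectation_trig_poly_diff[OF f trig_poly_continuous_on[OF T(1)] B T(2,3) \<eta>(1) X tail])
      moreover have "\<bar>(LINT x|N. f x) - (LINT x|N. T x)\<bar> \<le> \<eta> + (2 * B + \<eta>) * \<eta>"
        by (rule N.expectation_trig_poly_diff[OF f trig_poly_continuous_on[OF T(1)] B T(2,3) \<eta>(1) idN tailN])
      ultimately show ?case using elim(2) err \<kappa> by linarith
    qed
  qed
qed

section \<open>Normal laws with a given covariance matrix\<close>

lemma psd_Cauchy_Schwarz:
  fixes B :: "'b::real_vector \<Rightarrow> 'b \<Rightarrow> real"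
  assumes B: "bilinear B" and sym: "\<And>u v. B u v = B v u" and psd: "\<And>u. 0 \<le> B u u"
  shows "(B e v)\<^sup>2 \<le> B e e * B v v"
proof -
  have q: "0 \<le> B v v - 2 * t * B e v + t\<^sup>2 * B e e" for t
    using psd[of "v - t *\<^sub>R e"] sym[of v e]
    by (simp add: bilinear_lsub[OF B] bilinear_rsub[OF B] bilinear_lmul[OF B] bilinear_rmul[OF B]
        power2_eq_square algebra_simps)
  show ?thesis
  proof (cases "B e e = 0")
    case True
    have "B e v = 0"
    proof (rule ccontr)
      assume "B e v \<noteq> 0"
      \<comment> \<open>With \<open>B e e = 0\<close> the form is affine in \<open>t\<close>, and
        this value of \<open>t\<close> makes it -1.\<close>
      then show False using q[of "(B v v + 1) / (2 * B e v)"] True by (simp add: field_simps)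
    qed
    then show ?thesis using True by simp
  next
    case False
    then have "0 < B e e" using psd[of e] by simp
    then show ?thesis using q[of "B e v / B e e"] by (simp add: field_simps power2_eq_square)
  qed
qed

text \<open>Completing the square along one basis vector at a time.\<close>

lemma psd_sum_of_squares:
  fixes B :: "'b::euclidean_space \<Rightarrow> 'b \<Rightarrow> real"
  assumes B: "bilinear B" and sym: "\<And>u v. B u v = B v u" and psd: "\<And>u. 0 \<le> B u u"
  obtains m :: nat and w :: "nat \<Rightarrow> 'b" where "\<And>u. B u u = (\<Sum>k<m. (w k \<bullet> u)\<^sup>2)"
proof -
  \<comment> \<open>Invariant: squares split off so far plus a positive semidefinite remainder
    \<open>B'\<close> whose kernel contains the basis vectors already treated.\<close>
  let ?P = "\<lambda>S m w B'. bilinear B' \<and> (\<forall>u v. B' u v = B' v u) \<and> (\<forall>u. 0 \<le> B' u u) \<and>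
      (\<forall>u. B u u = (\<Sum>k<m. (w k \<bullet> u)\<^sup>2) + B' u u) \<and> (\<forall>e\<in>S. \<forall>v. B' e v = 0)"
  have ex: "\<exists>(m::nat) (w :: nat \<Rightarrow> 'b) B'. ?P S m w B'" if "finite S" "S \<subseteq> Basis" for S
    using that
  proof (induction S rule: finite_induct)
    case empty
    have "?P {} 0 (\<lambda>_. 0) B" using assms by simp
    then show ?case by (intro exI)
  next
    case (insert e S)
    then have "S \<subseteq> Basis" by simp
    from insert.IH[OF this] obtain m :: nat and w :: "nat \<Rightarrow> 'b" and B' where H: "?P S m w B'"
      by (elim exE) (rule that)
    then have bil: "bilinear B'" and s: "\<And>u v. B' u v = B' v u" and p: "\<And>u. 0 \<le> B' u u"
      and eq: "\<And>u. B u u = (\<Sum>k<m. (w k \<bullet> u)\<^sup>2) + B' u u" and z: "\<And>e v. e \<in> S \<Longrightarrow> B' e v = 0"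
      by (auto simp only:)
    note cs = psd_Cauchy_Schwarz[OF bil s p]
    show ?case
    proof (cases "B' e e = 0")
      case True
      then have e0: "\<And>v. B' e v = 0" using cs[of e] by simp
      have "\<forall>x\<in>insert e S. \<forall>v. B' x v = 0"
      proof (intro ballI allI)
        fix x v assume "x \<in> insert e S"
        then show "B' x v = 0" by (elim insertE) (simp_all only: e0 z)
      qed
      then have "?P (insert e S) m w B'" using H by (simp only: simp_thms)
      then show ?thesis by (intro exI)
    next
      case False
      then have pos: "0 < B' e e" using p[of e] by simp
      \<comment> \<open>The vector representing the functional \<open>B' e\<close> divided by
        \<open>sqrt (B' e e)\<close>; its square is the part of the form that involves the direction
        \<open>e\<close>.\<close>
      define a where "a = (\<Sum>i\<in>Basis. (B' e i / sqrt (B' e e)) *\<^sub>R i)"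
      have au: "a \<bullet> u = B' e u / sqrt (B' e e)" for u
      proof -
        have "B' e u = B' e (\<Sum>i\<in>Basis. (u \<bullet> i) *\<^sub>R i)" by (simp add: euclidean_representation)
        also have "\<dots> = (\<Sum>i\<in>Basis. (u \<bullet> i) * B' e i)"
          using bil by (simp add: bilinear_def linear_sum linear_cmul)
        also have "\<dots> / sqrt (B' e e) = a \<bullet> u"
          unfolding a_def inner_sum_left inner_scaleR_left sum_divide_distrib
          by (intro sum.cong refl) (simp add: inner_commute)
        finally show ?thesis ..
      qed
      \<comment> \<open>The Schur complement: it annihilates \<open>e\<close>, keeps the kernel
        found before, and is positive semidefinite by Cauchy-Schwarz.\<close>
      define B'' where "B'' u v = B' u v - B' e u * B' e v / B' e e" for u v
      define w' where "w' = w(m := a)"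
      have "bilinear B''"
        using bil unfolding B''_def bilinear_def linear_iff
        by (auto simp: algebra_simps add_divide_distrib)
      moreover have "B'' u v = B'' v u" for u v by (simp add: B''_def s[of u v] mult.commute)
      moreover have "0 \<le> B'' u u" for u
        using cs[of e u] pos by (simp add: B''_def field_simps power2_eq_square)
      moreover have "B u u = (\<Sum>k<Suc m. (w' k \<bullet> u)\<^sup>2) + B'' u u" for u
        using eq[of u] pos by (simp add: w'_def au B''_def power_divide power2_eq_square)
      moreover have "\<forall>x\<in>insert e S. \<forall>v. B'' x v = 0"
      proof (intro ballI allI)
        fix x v assume "x \<in> insert e S"
        then show "B'' x v = 0"
        proof
          assume "x = e"
          then show ?thesis using pos by (simp add: B''_def)
        next
          assume "x \<in> S"
          then have "B' x v = 0" "B' e x = 0" using z[of x] s[of e x] by simp_all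
          then show ?thesis by (simp add: B''_def)
        qed
      qed
      ultimately have "?P (insert e S) (Suc m) w' B''" by (simp only: simp_thms ball_simps)
      then show ?thesis by (intro exI)
    qed
  qed
  from ex[OF finite_Basis order_refl] obtain m :: nat and w :: "nat \<Rightarrow> 'b" and B' where H: "?P Basis m w B'"
    by (elim exE) (rule that)
  then have bil: "bilinear B'" and eq: "\<And>u. B u u = (\<Sum>k<m. (w k \<bullet> u)\<^sup>2) + B' u u"
    and z: "\<And>e v. e \<in> Basis \<Longrightarrow> B' e v = 0"
    by (auto simp only:)
  have "B' u u = 0" for u
  proof -
    have "B' u u = B' (\<Sum>i\<in>Basis. (u \<bullet> i) *\<^sub>R i) u" by (simp add: euclidean_representation)
    also have "\<dots> = (\<Sum>i\<in>Basis. (u \<bullet> i) * B' i u)"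
    proof -
      have lin: "linear (\<lambda>x. B' x u)" using bil by (simp add: bilinear_def)
      show ?thesis
        using linear_sum[OF lin, of "\<lambda>i. (u \<bullet> i) *\<^sub>R i" Basis] linear_cmul[OF lin] by simp
    qed
    finally show ?thesis using z by simp
  qed
  then show ?thesis using eq by (intro that[of w m]) simp
qed

lemma char_normal_law:
  assumes "0 \<le> v"
  shows "real_distribution (normal_law 0 v)"
    and "char (normal_law 0 v) t = complex_of_real (exp (- (t\<^sup>2 * v) / 2))"
proof -
  have "real_distribution (normal_law 0 v) \<and> char (normal_law 0 v) t = complex_of_real (exp (- (t\<^sup>2 * v) / 2))"
  proof (cases "v = 0")
    case True
    interpret R: prob_space "return borel (0 :: real)" by (rule prob_space_return) simp
    have "real_distribution (return borel (0 :: real))" by unfold_locales auto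
    then show ?thesis using True by (simp add: normal_law_def char_def integral_return)
  next
    case False
    then have v: "0 < v" using assms by simp
    interpret Z: real_distribution std_normal_distribution by (rule real_dist_normal_dist)
    have "distributed std_normal_distribution lborel (\<lambda>x. x) (normal_density 0 1)"
      unfolding distributed_def
      by (simp add: distr_id2)
    then have d: "distributed std_normal_distribution lborel (\<lambda>x. 0 + sqrt v * x) (normal_density (0 + sqrt v * 0) (\<bar>sqrt v\<bar> * 1))"
      by (rule Z.normal_density_affine) (use v in auto)
    have law: "normal_law 0 v = distr std_normal_distribution borel (\<lambda>x. sqrt v * x)"
    proof -
      have "distr std_normal_distribution borel (\<lambda>x. sqrt v * x) = distr std_normal_distribution lborel (\<lambda>x. sqrt v * x)"
        by (rule distr_cong) auto
      also have "\<dots> = normal_law 0 v" using distributed_distr_eq_density[OF d] v by (simp add: normal_law_def)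
      finally show ?thesis ..
    qed
    have "char (normal_law 0 v) t = char std_normal_distribution (t * sqrt v)"
      unfolding law char_def by (subst integral_distr) (auto simp: mult.assoc)
    also have "\<dots> = complex_of_real (exp (- (t\<^sup>2 * v) / 2))"
      using v by (simp add: char_std_normal_distribution power_mult_distrib)
    finally show ?thesis unfolding law by (auto intro!: Z.real_distribution_distr)
  qed
  then show "real_distribution (normal_law 0 v)" "char (normal_law 0 v) t = complex_of_real (exp (- (t\<^sup>2 * v) / 2))"
    by auto
qed

text \<open>With the quadratic form of \<open>V\<close> written as a sum of squared functionals
  \<open>w k\<close>, the law of a combination of the vectors \<open>w k\<close> with independent
  standard normal coefficients has the right characteristic function. No inverse of \<open>V\<close>
  enters, so singular matrices are covered.\<close>

lemma normal_law_exists: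
  fixes V :: "real ^ 'n ^ 'n"
  assumes sym: "transpose V = V" and psd: "\<And>u. 0 \<le> u \<bullet> (V *v u)"
  obtains N where "is_normal_law N 0 V"
    "\<And>u. (CLINT x|N. iexp (u \<bullet> x)) = complex_of_real (exp (- (u \<bullet> (V *v u)) / 2))"
proof -
  define B where "B u v = u \<bullet> (V *v v)" for u v
  have bil: "bilinear B"
    unfolding B_def bilinear_def linear_iff
    by (simp add: inner_add_left inner_add_right matrix_vector_right_distrib matrix_vector_mult_scaleR)
  have Bsym: "B u v = B v u" for u v
    unfolding B_def using sym dot_lmul_matrix[of u V v] by (metis inner_commute transpose_matrix_vector)
  obtain m :: nat and w :: "nat \<Rightarrow> real ^ 'n" where w: "\<And>u. B u u = (\<Sum>k<m. (w k \<bullet> u)\<^sup>2)"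
    by (rule psd_sum_of_squares[OF bil Bsym]) (use psd in \<open>auto simp: B_def\<close>)
  interpret Z: real_distribution std_normal_distribution by (rule real_dist_normal_dist)
  interpret P: product_prob_space "\<lambda>_. std_normal_distribution" "{..<m}" by unfold_locales
  define P where "P = Pi\<^sub>M {..<m} (\<lambda>_. std_normal_distribution)"
  define N where "N = distr P borel (\<lambda>z. \<Sum>k<m. z k *\<^sub>R w k)"
  have sets_P [measurable_cong]: "sets P = sets (Pi\<^sub>M {..<m} (\<lambda>_. borel))"
    unfolding P_def by (intro sets_PiM_cong) auto
  have m [measurable]: "(\<lambda>z. \<Sum>k<m. z k *\<^sub>R w k) \<in> borel_measurable P"
    by (intro borel_measurable_sum borel_measurable_scaleR) measurable
  interpret PP: prob_space P unfolding P_def by (rule P.prob_space_axioms)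
  interpret N: prob_space N unfolding N_def by (rule PP.prob_space_distr) measurable
  have sets_N [measurable_cong]: "sets N = sets borel" by (simp add: N_def)
  have charN: "(CLINT x|N. iexp (u \<bullet> x)) = complex_of_real (exp (- (u \<bullet> (V *v u)) / 2))" for u
  proof -
    have "(CLINT x|N. iexp (u \<bullet> x)) = (CLINT z|P. iexp (u \<bullet> (\<Sum>k<m. z k *\<^sub>R w k)))"
      unfolding N_def by (rule integral_distr) measurable
    also have "\<dots> = (CLINT z|P. \<Prod>k<m. iexp ((w k \<bullet> u) * z k))"
      by (simp add: inner_sum_right sum_distrib_left exp_sum mult_ac inner_commute)
    also have "\<dots> = (\<Prod>k<m. CLINT x|std_normal_distribution. iexp ((w k \<bullet> u) * x))"
      unfolding P_def
    proof (rule P.product_integral_prod)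
      show "integrable std_normal_distribution (\<lambda>x. iexp ((w k \<bullet> u) * x))" for k
        by (rule Z.integrable_iexp_compose) simp
    qed simp
    also have "\<dots> = (\<Prod>k<m. complex_of_real (exp (- (w k \<bullet> u)\<^sup>2 / 2)))"
      using char_std_normal_distribution by (simp add: char_def fun_eq_iff)
    also have "\<dots> = complex_of_real (\<Prod>k<m. exp (- (w k \<bullet> u)\<^sup>2 / 2))" by simp
    also have "(\<Prod>k<m. exp (- (w k \<bullet> u)\<^sup>2 / 2)) = exp (- B u u / 2)"
      unfolding w by (simp add: sum_negf sum_divide_distrib flip: exp_sum)
    finally show ?thesis by (simp add: B_def)
  qed
  have law: "distr N borel (\<lambda>x. u \<bullet> x) = normal_law (u \<bullet> 0) (u \<bullet> (V *v u))" for u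
  proof -
    have "distr N borel (\<lambda>x. u \<bullet> x) = normal_law 0 (u \<bullet> (V *v u))"
    proof (rule Levy_uniqueness)
      show "real_distribution (distr N borel (\<lambda>x. u \<bullet> x))" by (rule N.real_distribution_distr) measurable
      show "real_distribution (normal_law 0 (u \<bullet> (V *v u)))" by (rule char_normal_law[OF psd])
      show "char (distr N borel (\<lambda>x. u \<bullet> x)) = char (normal_law 0 (u \<bullet> (V *v u)))"
      proof
        fix t
        have "char (distr N borel (\<lambda>x. u \<bullet> x)) t = (CLINT x|N. iexp ((t *\<^sub>R u) \<bullet> x))"
          unfolding char_def by (subst integral_distr) auto
        also have "\<dots> = complex_of_real (exp (- (t\<^sup>2 * (u \<bullet> (V *v u))) / 2))"
          unfolding charN by (simp add: matrix_vector_mult_scaleR power2_eq_square mult.assoc)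
        also have "\<dots> = char (normal_law 0 (u \<bullet> (V *v u))) t" by (rule char_normal_law(2)[OF psd, symmetric])
        finally show "char (distr N borel (\<lambda>x. u \<bullet> x)) t = char (normal_law 0 (u \<bullet> (V *v u))) t" .
      qed
    qed
    then show ?thesis by simp
  qed
  have "is_normal_law N 0 V"
    unfolding is_normal_law_def using N.prob_space_axioms sets_N sym psd law by auto
  then show ?thesis using charN by (rule that)
qed

section \<open>Nondegeneracy of the causal solution\<close>

lemma (in prob_space) integrable_power_le_4:
  fixes X :: "'a \<Rightarrow> real"
  assumes [measurable]: "X \<in> borel_measurable M" and "integrable M (\<lambda>\<omega>. X \<omega> ^ 4)" "k \<le> 4"
  shows "integrable M (\<lambda>\<omega>. X \<omega> ^ k)"
proof (rule Bochner_Integration.integrable_bound)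
  show "integrable M (\<lambda>\<omega>. 1 + X \<omega> ^ 4)" using assms by simp
  have "\<bar>x ^ k\<bar> \<le> 1 + x ^ 4" for x :: real
  proof (cases "\<bar>x\<bar> \<le> 1")
    case True
    then have "\<bar>x\<bar> ^ k \<le> 1" by (intro power_le_one) auto
    moreover have "0 \<le> x ^ 4" by simp
    ultimately show ?thesis unfolding power_abs by linarith
  next
    case False
    then have "\<bar>x\<bar> ^ k \<le> \<bar>x\<bar> ^ 4" using assms(3) by (intro power_increasing) auto
    then show ?thesis by (simp add: power_abs)
  qed
  then show "AE \<omega> in M. norm (X \<omega> ^ k) \<le> norm (1 + X \<omega> ^ 4)"
    by (auto intro!: AE_I2 order_trans[OF _ abs_ge_self])
qed measurable

context bilinear_process
begin

lemma measurable_causal [measurable]: "(\<lambda>\<omega>. causal t (path \<omega>)) \<in> borel_measurable M"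
  by (rule measurable_path_compose[OF depends_on_causal])

text \<open>The value at time \<open>t\<close> without its newest innovation; it is independent of
  that innovation.\<close>

definition drift :: "int \<Rightarrow> (int \<Rightarrow> real) \<Rightarrow> real" where
  "drift t e = \<mu> + (\<phi> + b * e (t - 1)) * causal (t - 2) e"

lemma depends_on_drift: "depends_on {..t - 1} (drift t)"
  unfolding drift_def[abs_def]
  by (intro depends_on_add depends_on_mult depends_on_const depends_on_coordinate
      depends_on_mono[OF depends_on_causal]) auto

lemma measurable_drift [measurable]: "(\<lambda>\<omega>. drift t (path \<omega>)) \<in> borel_measurable M"
  by (rule measurable_path_compose[OF depends_on_drift])

lemma causal_recursion: "AE \<omega> in M. causal t (path \<omega>) = drift t (path \<omega>) + \<epsilon> t \<omega>"
proof -
  obtain C \<rho> where lim: "\<And>t. AE \<omega> in M. (\<lambda>k. trunc k t (path \<omega>)) \<longlonglongrightarrow> causal t (path \<omega>)"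
    by (rule causal_approximation) (rule that)
  from lim[of t] lim[of "t - 2"] show ?thesis
  proof eventually_elim
    case (elim \<omega>)
    have "(\<lambda>k. trunc (Suc k) t (path \<omega>)) \<longlonglongrightarrow> causal t (path \<omega>)" by (rule LIMSEQ_Suc[OF elim(1)])
    moreover have "(\<lambda>k. trunc (Suc k) t (path \<omega>)) \<longlonglongrightarrow> drift t (path \<omega>) + \<epsilon> t \<omega>"
    proof -
      have "(\<lambda>k. \<mu> + path \<omega> t + (\<phi> + b * path \<omega> (t - 1)) * trunc k (t - 2) (path \<omega>))
          \<longlonglongrightarrow> \<mu> + path \<omega> t + (\<phi> + b * path \<omega> (t - 1)) * causal (t - 2) (path \<omega>)"
        by (intro tendsto_intros elim(2))
      moreover have "\<mu> + path \<omega> t + (\<phi> + b * path \<omega> (t - 1)) * causal (t - 2) (path \<omega>) = drift t (path \<omega>) + \<epsilon> t \<omega>"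
        by (simp add: drift_def path_def)
      ultimately show ?thesis by (simp only: trunc.simps)
    qed
    ultimately show ?case by (rule LIMSEQ_unique)
  qed
qed

lemma depends_on_power_coordinate: "depends_on {t} (\<lambda>e. e t ^ k)"
  by (rule depends_on_compose[OF depends_on_coordinate]) auto

lemma expectation_mult_innovation_power:
  assumes "depends_on {..t - 1} \<Phi>" "integrable M (\<lambda>\<omega>. \<Phi> (path \<omega>))" "k \<le> 4"
  shows "integrable M (\<lambda>\<omega>. \<Phi> (path \<omega>) * \<epsilon> t \<omega> ^ k)"
    and "expectation (\<lambda>\<omega>. \<Phi> (path \<omega>) * \<epsilon> t \<omega> ^ k) = expectation (\<lambda>\<omega>. \<Phi> (path \<omega>)) * expectation (\<lambda>\<omega>. \<epsilon> t \<omega> ^ k)"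
proof -
  have d: "{..t - 1} \<inter> {t} = {}" by auto
  have i: "integrable M (\<lambda>\<omega>. path \<omega> t ^ k)" using integrable_innovation_power'[OF assms(3)] by (simp add: path_def)
  show "integrable M (\<lambda>\<omega>. \<Phi> (path \<omega>) * \<epsilon> t \<omega> ^ k)"
    "expectation (\<lambda>\<omega>. \<Phi> (path \<omega>) * \<epsilon> t \<omega> ^ k) = expectation (\<lambda>\<omega>. \<Phi> (path \<omega>)) * expectation (\<lambda>\<omega>. \<epsilon> t \<omega> ^ k)"
    using integrable_mult_depends_on[OF assms(1) depends_on_power_coordinate d assms(2) i]
      expectation_mult_depends_on[OF assms(1) depends_on_power_coordinate d assms(2) i]
    by (simp_all add: path_def)
qed

text \<open>If the solution were a constant \<open>c\<close>, the drift would equal \<open>c\<close>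
  minus the newest innovation and be integrable for that reason. Independence gives the product of
  drift and innovation mean 0, while the substitution gives \<open>- \<sigma>2\<close>.\<close>

lemma causal_affine_degenerate:
  assumes ae: "AE \<omega> in M. \<alpha> + \<beta> * causal t (path \<omega>) = 0"
  shows "\<alpha> = 0" "\<beta> = 0"
proof -
  show \<beta>: "\<beta> = 0"
  proof (rule ccontr)
    assume \<beta>: "\<beta> \<noteq> 0"
    define c where "c = - \<alpha> / \<beta>"
    have W: "AE \<omega> in M. drift t (path \<omega>) = c - \<epsilon> t \<omega>"
      using ae causal_recursion[of t]
    proof eventually_elim
      case (elim \<omega>)
      then have "causal t (path \<omega>) = c" using \<beta> by (simp add: c_def field_simps)
      then show ?case using elim by simp
    qed
    have "integrable M (\<lambda>\<omega>. drift t (path \<omega>)) \<longleftrightarrow> integrable M (\<lambda>\<omega>. c - \<epsilon> t \<omega>)"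
      by (rule integrable_cong_AE) (use W in auto)
    then have i: "integrable M (\<lambda>\<omega>. drift t (path \<omega>))" by simp
    have "expectation (\<lambda>\<omega>. drift t (path \<omega>) * \<epsilon> t \<omega> ^ 1) = 0"
      using expectation_mult_innovation_power(2)[OF depends_on_drift i, of 1] by simp
    moreover have "expectation (\<lambda>\<omega>. drift t (path \<omega>) * \<epsilon> t \<omega> ^ 1) = expectation (\<lambda>\<omega>. c * \<epsilon> t \<omega> - (\<epsilon> t \<omega>)\<^sup>2)"
    proof (rule integral_cong_AE)
      show "AE \<omega> in M. drift t (path \<omega>) * \<epsilon> t \<omega> ^ 1 = c * \<epsilon> t \<omega> - (\<epsilon> t \<omega>)\<^sup>2"
        using W
      proof eventually_elim
        case (elim \<omega>)
        show ?case unfolding elim by (simp add: algebra_simps power2_eq_square)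
      qed
    qed measurable
    moreover have "expectation (\<lambda>\<omega>. c * \<epsilon> t \<omega> - (\<epsilon> t \<omega>)\<^sup>2) = - \<sigma>2" by simp
    ultimately show False using variance_pos by simp
  qed
  show "\<alpha> = 0" using ae by (simp add: \<beta>)
qed

text \<open>If \<open>Y\<^sup>2 = k\<close> with \<open>Y = W + \<epsilon>\<close>, then \<open>0 = k E[(W - E W) \<epsilon>] = E[(W - E W) \<epsilon> (W + \<epsilon>)\<^sup>2] = 2 \<sigma>\<^sup>2 Var W\<close>,
  so the drift \<open>W\<close> is constant; as it contains the product of a fresh innovation and the lagged
  value, this forces \<open>k = 0\<close>.\<close>

lemma causal_square_affine_degenerate:
  assumes b: "b \<noteq> 0" and ae: "\<And>t. AE \<omega> in M. \<alpha> + \<beta> * (causal t (path \<omega>))\<^sup>2 = 0"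
  shows "\<alpha> = 0" "\<beta> = 0"
proof -
  show \<beta>: "\<beta> = 0"
  proof (rule ccontr)
    assume \<beta>: "\<beta> \<noteq> 0"
    define k where "k = - \<alpha> / \<beta>"
    have Y: "AE \<omega> in M. (causal t (path \<omega>))\<^sup>2 = k" for t
      using ae[of t] by eventually_elim (use \<beta> in \<open>simp add: k_def field_simps\<close>)
    have k0: "0 \<le> k"
    proof -
      have "AE \<omega> in M. 0 \<le> k" using Y[of 0] by eventually_elim (metis zero_le_power2)
      then show ?thesis by simp
    qed
    define W where "W \<omega> = drift 0 (path \<omega>)" for \<omega>
    have [measurable]: "W \<in> borel_measurable M" unfolding W_def by measurable
    have WY: "AE \<omega> in M. (W \<omega> + \<epsilon> 0 \<omega>)\<^sup>2 = k"
      using Y[of 0] causal_recursion[of 0] by eventually_elim (simp add: W_def)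
    have W4: "integrable M (\<lambda>\<omega>. W \<omega> ^ 4)"
    proof (rule Bochner_Integration.integrable_bound)
      show "integrable M (\<lambda>\<omega>. 16 * (sqrt k) ^ 4 + 16 * \<epsilon> 0 \<omega> ^ 4)"
        using integrable_innovation_power'[of 4 0] by simp
      show "AE \<omega> in M. norm (W \<omega> ^ 4) \<le> norm (16 * (sqrt k) ^ 4 + 16 * \<epsilon> 0 \<omega> ^ 4)"
        using WY
      proof eventually_elim
        case (elim \<omega>)
        have "\<bar>W \<omega> + \<epsilon> 0 \<omega>\<bar> = sqrt k" using elim by (metis real_sqrt_abs)
        then have "\<bar>W \<omega>\<bar> \<le> 2 * max (sqrt k) \<bar>\<epsilon> 0 \<omega>\<bar>" by linarith
        then have "\<bar>W \<omega>\<bar> ^ 4 \<le> (2 * max (sqrt k) \<bar>\<epsilon> 0 \<omega>\<bar>) ^ 4" by (intro power_mono) auto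
        also have "\<dots> \<le> 16 * (sqrt k) ^ 4 + 16 * \<bar>\<epsilon> 0 \<omega>\<bar> ^ 4" by (auto simp: max_def power_mult_distrib k0)
        finally have "W \<omega> ^ 4 \<le> 16 * (sqrt k) ^ 4 + 16 * \<epsilon> 0 \<omega> ^ 4" by simp
        moreover have "0 \<le> W \<omega> ^ 4" by simp
        ultimately show ?case unfolding real_norm_def by linarith
      qed
    qed measurable
    have Wj: "integrable M (\<lambda>\<omega>. W \<omega> ^ j)" if "j \<le> 4" for j
      by (rule integrable_power_le_4[OF _ W4 that]) measurable
    have W1: "integrable M W" using Wj[of 1] by simp
    define m where "m = expectation W"
    define D where "D e = drift 0 e - m" for e
    have D: "D (path \<omega>) = W \<omega> - m" for \<omega> by (simp add: D_def W_def)
    have dD: "depends_on {..- 1} D"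
      unfolding D_def[abs_def] using depends_on_drift[of 0] by (intro depends_on_diff) auto
    have dW: "depends_on {..- 1} (drift 0)" using depends_on_drift[of 0] by simp
    have d1: "depends_on {..0 - 1} (\<lambda>e. D e * (drift 0 e)\<^sup>2)" "depends_on {..0 - 1} (\<lambda>e. D e * drift 0 e)"
      "depends_on {..0 - 1} D"
      using dD dW by (auto intro!: depends_on_mult simp: power2_eq_square)
    have i1: "integrable M (\<lambda>\<omega>. D (path \<omega>) * (drift 0 (path \<omega>))\<^sup>2)"
      "integrable M (\<lambda>\<omega>. D (path \<omega>) * drift 0 (path \<omega>))" "integrable M (\<lambda>\<omega>. D (path \<omega>))"
      unfolding D unfolding W_def[symmetric]
      using Wj[of 3] Wj[of 2] W1 by (simp_all add: left_diff_distrib power2_eq_square power3_eq_cube mult.assoc)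
    have ED: "expectation (\<lambda>\<omega>. D (path \<omega>)) = 0" unfolding D using W1 by (simp add: m_def prob_space)
    note E1 = expectation_mult_innovation_power[OF d1(1) i1(1), of 1]
      and E2 = expectation_mult_innovation_power[OF d1(2) i1(2), of 2]
      and E3 = expectation_mult_innovation_power[OF d1(3) i1(3), of 3]
      and E0 = expectation_mult_innovation_power[OF d1(3) i1(3), of 1]
    \<comment> \<open>The square of \<open>W + \<epsilon>\<close> expanded and multiplied by the
      centred drift and the innovation. The terms with the first power of the innovation vanish by
      its zero mean, the one with the third power because \<open>D\<close> is centred.\<close>
    have "expectation (\<lambda>\<omega>. D (path \<omega>) * (drift 0 (path \<omega>))\<^sup>2 * \<epsilon> 0 \<omega> ^ 1
        + 2 * (D (path \<omega>) * drift 0 (path \<omega>) * \<epsilon> 0 \<omega> ^ 2) + D (path \<omega>) * \<epsilon> 0 \<omega> ^ 3)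
      = expectation (\<lambda>\<omega>. k * (D (path \<omega>) * \<epsilon> 0 \<omega> ^ 1))"
    proof (rule integral_cong_AE)
      show "AE \<omega> in M. D (path \<omega>) * (drift 0 (path \<omega>))\<^sup>2 * \<epsilon> 0 \<omega> ^ 1
          + 2 * (D (path \<omega>) * drift 0 (path \<omega>) * \<epsilon> 0 \<omega> ^ 2) + D (path \<omega>) * \<epsilon> 0 \<omega> ^ 3
          = k * (D (path \<omega>) * \<epsilon> 0 \<omega> ^ 1)"
        using WY
      proof eventually_elim
        case (elim \<omega>)
        show ?case unfolding elim[symmetric] W_def
          by (simp add: power2_eq_square power3_eq_cube algebra_simps)
      qed
    qed (unfold D, measurable)
    then have "2 * (expectation (\<lambda>\<omega>. D (path \<omega>) * drift 0 (path \<omega>)) * \<sigma>2) = 0"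
      using E0 E1 E2 E3 ED by simp
    then have EDW: "expectation (\<lambda>\<omega>. D (path \<omega>) * drift 0 (path \<omega>)) = 0" using variance_pos by simp
    have sqD: "(\<lambda>\<omega>. (W \<omega> - m)\<^sup>2) = (\<lambda>\<omega>. D (path \<omega>) * drift 0 (path \<omega>) - m * D (path \<omega>))"
      by (auto simp: D W_def power2_eq_square algebra_simps)
    have "expectation (\<lambda>\<omega>. (W \<omega> - m)\<^sup>2) = 0" unfolding sqD using i1 EDW ED by simp
    moreover have iD: "integrable M (\<lambda>\<omega>. (W \<omega> - m)\<^sup>2)" unfolding sqD using i1 by simp
    ultimately have "AE \<omega> in M. (W \<omega> - m)\<^sup>2 = 0"
      using integral_nonneg_eq_0_iff_AE[OF iD] by simp
    then have Wm: "AE \<omega> in M. (\<phi> + b * \<epsilon> (- 1) \<omega>) * causal (- 2) (path \<omega>) = m - \<mu>"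
      by eventually_elim (simp add: W_def drift_def path_def)
    have yd: "depends_on {..- 1 - 1} (causal (- 2))" using depends_on_causal[of "- 2"] by simp
    have yi: "integrable M (\<lambda>\<omega>. causal (- 2) (path \<omega>))"
    proof (rule integrable_const_bound[where B = "sqrt k"])
      show "AE \<omega> in M. norm (causal (- 2) (path \<omega>)) \<le> sqrt k"
        using Y[of "- 2"] by eventually_elim (metis order_refl real_norm_def real_sqrt_abs)
    qed measurable
    \<comment> \<open>The constancy of the drift multiplied by the lagged value and the innovation:
      the square of the lagged value becomes \<open>k\<close>, so the left mean is
      \<open>k * b * \<sigma>2\<close>, while the right one vanishes by independence.\<close>
    have "expectation (\<lambda>\<omega>. k * \<phi> * \<epsilon> (- 1) \<omega> + k * b * (\<epsilon> (- 1) \<omega>)\<^sup>2)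
        = expectation (\<lambda>\<omega>. (m - \<mu>) * (causal (- 2) (path \<omega>) * \<epsilon> (- 1) \<omega> ^ 1))"
    proof (rule integral_cong_AE)
      show "AE \<omega> in M. k * \<phi> * \<epsilon> (- 1) \<omega> + k * b * (\<epsilon> (- 1) \<omega>)\<^sup>2 = (m - \<mu>) * (causal (- 2) (path \<omega>) * \<epsilon> (- 1) \<omega> ^ 1)"
        using Wm Y[of "- 2"]
      proof eventually_elim
        case (elim \<omega>)
        show ?case unfolding elim(1)[symmetric] elim(2)[symmetric] by (simp add: power2_eq_square algebra_simps)
      qed
    qed measurable
    then have "k * b * \<sigma>2 = 0" using expectation_mult_innovation_power[OF yd yi, of 1] by simp
    then have "k = 0" using b variance_pos by simp
    then have "AE \<omega> in M. 0 + 1 * causal 0 (path \<omega>) = 0" using Y[of 0] by simp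
    from causal_affine_degenerate(2)[OF this] show False by simp
  qed
  show "\<alpha> = 0" using ae[of 0] by (simp add: \<beta>)
qed

text \<open>The general polynomial of degree two in the innovations that is centred given the lag.
  Every centred functional of the likelihood below is brought into this shape, so one centring
  argument serves them all.\<close>

definition quad_form :: "(real \<Rightarrow> real) \<Rightarrow> (real \<Rightarrow> real) \<Rightarrow> (real \<Rightarrow> real) \<Rightarrow> (real \<Rightarrow> real) \<Rightarrow> (real \<Rightarrow> real)
    \<Rightarrow> real \<Rightarrow> real \<Rightarrow> real \<Rightarrow> real" where
  "quad_form g1 g2 g3 g4 g5 y e e' =
     g1 y * e + g2 y * e' + g3 y * (e\<^sup>2 - \<sigma>2) + g4 y * (e'\<^sup>2 - \<sigma>2) + g5 y * (e * e')"

lemma cent_quad_form: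
  assumes "reg 0 (\<lambda>y e e'. g1 y)" "reg 0 (\<lambda>y e e'. g2 y)" "reg 0 (\<lambda>y e e'. g3 y)"
    "reg 0 (\<lambda>y e e'. g4 y)" "reg 0 (\<lambda>y e e'. g5 y)"
  shows "cent (quad_form g1 g2 g3 g4 g5)"
proof -
  have c: "reg 2 (\<lambda>y e e'. c)" for c by (rule reg_mono[OF reg_const]) simp
  have r1: "reg 2 (\<lambda>y e e'. e)" "reg 2 (\<lambda>y e e'. e')"
    using reg_mono[OF reg_first, of 2] reg_mono[OF reg_second, of 2] by auto
  have r2: "reg 2 (\<lambda>y e e'. e\<^sup>2 - \<sigma>2)" "reg 2 (\<lambda>y e e'. e'\<^sup>2 - \<sigma>2)" "reg 2 (\<lambda>y e e'. e * e')"
    unfolding power2_eq_square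
    by (intro reg_diff c reg_mult2 reg_first reg_second)+
  have z: "expectation (\<lambda>\<omega>. \<epsilon> (t - 1) \<omega> * \<epsilon> t \<omega>) = 0" for t
  proof -
    have d: "depends_on {..t - 1} (\<lambda>e. e (t - 1))" by (rule depends_on_coordinate) simp
    have i: "integrable M (\<lambda>\<omega>. path \<omega> (t - 1))" by (simp add: path_def)
    show ?thesis
      using expectation_mult_innovation_power(2)[OF d i, of 1] by (simp add: path_def)
  qed
  have z2: "expectation (\<lambda>\<omega>. (\<epsilon> t \<omega>)\<^sup>2 - \<sigma>2) = 0" for t by (simp add: prob_space)
  show ?thesis
    unfolding quad_form_def[abs_def]
    by (intro cent_add cent_lag_mult assms r1 r2) (simp_all add: z z2)
qed

lemma expectation_cent:
  assumes "cent F"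
  shows "expectation (\<lambda>\<omega>. obs F t (path \<omega>)) = 0"
  using cent_orthogonal[OF assms, of t "\<lambda>_. 1"] by simp

end

section \<open>Expansion of the quasi-log-likelihood\<close>

lemma abs_ln_one_plus_le:
  fixes x :: real
  assumes "\<bar>x\<bar> \<le> 1 / 2"
  shows "\<bar>ln (1 + x)\<bar> \<le> 2 * \<bar>x\<bar>"
proof -
  have "ln (1 + x) \<le> x" using ln_add_one_self_le_self2[of x] assms by (simp add: abs_le_iff)
  moreover have "- (2 * \<bar>x\<bar>) \<le> ln (1 + x)"
  proof -
    have "- ln (1 + x) = ln (1 / (1 + x))" using assms by (simp add: ln_div abs_le_iff)
    also have "\<dots> \<le> 1 / (1 + x) - 1" using assms by (intro ln_le_minus_one) (auto simp: abs_le_iff)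
    also have "\<dots> = - x / (1 + x)" using assms by (simp add: field_simps abs_le_iff)
    also have "\<dots> \<le> \<bar>x\<bar> / (1 / 2)"
      using assms by (intro frac_le) (auto simp: abs_le_iff)
    finally show ?thesis by simp
  qed
  ultimately show ?thesis by (simp add: abs_le_iff)
qed

text \<open>The remainder has the exact derivative \<open>u^2 / (1 + u)\<close>, at most twice the
  square of \<open>x\<close> between \<open>- |x|\<close> and \<open>|x|\<close>; the mean value
  inequality adds one more factor \<open>|x|\<close>.\<close>

lemma abs_ln_one_plus_taylor:
  fixes x :: real
  assumes "\<bar>x\<bar> \<le> 1 / 2"
  shows "\<bar>ln (1 + x) - (x - x\<^sup>2 / 2)\<bar> \<le> 2 * \<bar>x\<bar> ^ 3"
proof (cases "x = 0")
  case False
  define f where "f u = ln (1 + u) - (u - u\<^sup>2 / 2)" for u :: real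
  have deriv: "(f has_real_derivative u\<^sup>2 / (1 + u)) (at u)" if "\<bar>u\<bar> \<le> 1 / 2" for u
  proof -
    have "0 < 1 + u" using that by (simp add: abs_le_iff)
    have d1: "((\<lambda>u. 1 + u) has_real_derivative 1) (at u)" by (auto intro!: derivative_eq_intros)
    have d2: "((\<lambda>u. u - u\<^sup>2 / 2) has_real_derivative 1 - u) (at u)" by (auto intro!: derivative_eq_intros)
    have "(f has_real_derivative (1 / (1 + u) - (1 - u))) (at u)"
      using DERIV_diff[OF DERIV_chain2[OF DERIV_ln d1] d2] \<open>0 < 1 + u\<close>
      unfolding f_def by (simp add: inverse_eq_divide)
    also have "1 / (1 + u) - (1 - u) = u\<^sup>2 / (1 + u)" using \<open>0 < 1 + u\<close> by (simp add: field_simps power2_eq_square)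
    finally show ?thesis .
  qed
  have "norm (f x - f 0) \<le> 2 * \<bar>x\<bar>\<^sup>2 * norm (x - 0)"
  proof (rule field_differentiable_bound[where S = "{- \<bar>x\<bar>..\<bar>x\<bar>}" and f' = "\<lambda>u. u\<^sup>2 / (1 + u)"])
    show "(f has_field_derivative u\<^sup>2 / (1 + u)) (at u within {- \<bar>x\<bar>..\<bar>x\<bar>})" if "u \<in> {- \<bar>x\<bar>..\<bar>x\<bar>}" for u
      using that assms by (intro has_field_derivative_at_within[OF deriv]) (auto simp: abs_le_iff)
    show "norm (u\<^sup>2 / (1 + u)) \<le> 2 * \<bar>x\<bar>\<^sup>2" if "u \<in> {- \<bar>x\<bar>..\<bar>x\<bar>}" for u
    proof -
      have u: "\<bar>u\<bar> \<le> \<bar>x\<bar>" using that by (auto simp: abs_le_iff)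
      then have "u\<^sup>2 \<le> \<bar>x\<bar>\<^sup>2" by (simp add: abs_le_square_iff)
      moreover have "1 / 2 \<le> 1 + u" using u assms by linarith
      ultimately have "u\<^sup>2 / (1 + u) \<le> \<bar>x\<bar>\<^sup>2 / (1 / 2)" by (intro frac_le) auto
      then show ?thesis using \<open>1 / 2 \<le> 1 + u\<close> by simp
    qed
  qed auto
  then show ?thesis by (simp add: f_def power2_eq_square power3_eq_cube)
qed simp

lemma inverse_taylor:
  fixes x \<delta> :: real
  assumes "\<bar>x\<bar> \<le> \<delta>" "\<delta> \<le> 1 / 2"
  shows "\<bar>1 / (1 + x) - (1 - x + x\<^sup>2)\<bar> \<le> 2 * \<delta> ^ 3"
proof -
  have pos: "1 / 2 \<le> 1 + x" using assms by linarith
  have "1 / (1 + x) - (1 - x + x\<^sup>2) = - (x ^ 3) / (1 + x)"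
    using pos by (simp add: field_simps power2_eq_square power3_eq_cube)
  then have "\<bar>1 / (1 + x) - (1 - x + x\<^sup>2)\<bar> = \<bar>x\<bar> ^ 3 / (1 + x)" using pos by (simp add: power_abs)
  also have "\<dots> \<le> \<delta> ^ 3 / (1 / 2)"
    using pos assms by (intro frac_le power_mono) auto
  finally show ?thesis by simp
qed

lemma abs_mult_le: "\<bar>a\<bar> \<le> A \<Longrightarrow> \<bar>b\<bar> \<le> B \<Longrightarrow> \<bar>a * b\<bar> \<le> A * B" for a b A B :: real
  unfolding abs_mult by (rule mult_mono) auto

lemma inverse_product_taylor:
  fixes x v \<delta> :: real
  assumes x: "\<bar>x\<bar> \<le> \<delta>" and v: "\<bar>v\<bar> \<le> \<delta>" and \<delta>: "\<delta> \<le> 1 / 2"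
  shows "\<bar>1 / ((1 + x) * (1 + v)) - (1 - (x + v) + (x\<^sup>2 + x * v + v\<^sup>2))\<bar> \<le> 12 * \<delta> ^ 3"
proof -
  have \<delta>0: "0 \<le> \<delta>" using x by linarith
  define r s where "r = 1 / (1 + x) - (1 - x + x\<^sup>2)" and "s = 1 / (1 + v) - (1 - v + v\<^sup>2)"
  have r: "\<bar>r\<bar> \<le> 2 * \<delta> ^ 3" unfolding r_def by (rule inverse_taylor[OF x \<delta>])
  have s: "\<bar>s\<bar> \<le> 2 * \<delta> ^ 3" unfolding s_def by (rule inverse_taylor[OF v \<delta>])
  have sq: "\<bar>x\<^sup>2\<bar> \<le> \<delta>\<^sup>2" "\<bar>v\<^sup>2\<bar> \<le> \<delta>\<^sup>2" using x v by (auto simp: abs_le_square_iff[symmetric])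
  have p: "\<bar>1 / (1 + v)\<bar> \<le> 2"
  proof -
    have "1 / 2 \<le> 1 + v" using v \<delta> by linarith
    then have "1 / (1 + v) \<le> 1 / (1 / 2)" by (intro frac_le) auto
    then show ?thesis using \<open>1 / 2 \<le> 1 + v\<close> by simp
  qed
  have q: "\<bar>1 - x + x\<^sup>2\<bar> \<le> 2"
  proof -
    have "\<delta>\<^sup>2 \<le> (1 / 2)\<^sup>2" using \<delta> \<delta>0 by (intro power_mono) auto
    then show ?thesis using x \<delta> sq(1) by (simp add: power2_eq_square)
  qed
  have eq: "1 / ((1 + x) * (1 + v)) - (1 - (x + v) + (x\<^sup>2 + x * v + v\<^sup>2))
      = r * (1 / (1 + v)) + (1 - x + x\<^sup>2) * s + (- (x * v\<^sup>2) - x\<^sup>2 * v + x\<^sup>2 * v\<^sup>2)"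
  proof -
    have "1 / ((1 + x) * (1 + v)) = (r + (1 - x + x\<^sup>2)) * (1 / (1 + v))" by (simp add: r_def)
    also have "\<dots> = r * (1 / (1 + v)) + (1 - x + x\<^sup>2) * (s + (1 - v + v\<^sup>2))"
      by (simp add: s_def add_divide_distrib)
    finally show ?thesis by (simp add: algebra_simps power2_eq_square)
  qed
  \<comment> \<open>The two Taylor remainders, each multiplied by a factor of size at most 2,
    contribute 4 each and the three mixed terms 1 each: 11, rounded up to 12.\<close>
  have gen: "\<bar>A + B + (- C1 - C2 + C3)\<bar> \<le> 12 * D"
    if "\<bar>A\<bar> \<le> 4 * D" "\<bar>B\<bar> \<le> 4 * D" "\<bar>C1\<bar> \<le> D" "\<bar>C2\<bar> \<le> D" "\<bar>C3\<bar> \<le> D" for A B C1 C2 C3 D :: real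
    using that by linarith
  show ?thesis
    unfolding eq
  proof (rule gen)
    show "\<bar>r * (1 / (1 + v))\<bar> \<le> 4 * \<delta> ^ 3" using abs_mult_le[OF r p] by simp
    show "\<bar>(1 - x + x\<^sup>2) * s\<bar> \<le> 4 * \<delta> ^ 3" using abs_mult_le[OF q s] by simp
    show "\<bar>x * v\<^sup>2\<bar> \<le> \<delta> ^ 3"
      using abs_mult_le[OF x sq(2)] by (simp add: power2_eq_square power3_eq_cube)
    show "\<bar>x\<^sup>2 * v\<bar> \<le> \<delta> ^ 3"
      using abs_mult_le[OF sq(1) v] by (simp add: power2_eq_square power3_eq_cube mult.assoc)
    have "\<delta> ^ 3 * \<delta> \<le> \<delta> ^ 3 * 1" using \<delta> \<delta>0 by (intro mult_left_mono) auto
    then have "\<delta>\<^sup>2 * \<delta>\<^sup>2 \<le> \<delta> ^ 3" by (simp add: power2_eq_square power3_eq_cube mult.assoc)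
    then show "\<bar>x\<^sup>2 * v\<^sup>2\<bar> \<le> \<delta> ^ 3" using abs_mult_le[OF sq] by (rule order_trans[rotated])
  qed
qed

text \<open>The increment of the quasi-log-likelihood depends on the data and on the parameter only through
  the relative changes \<open>x\<close> of \<open>\<sigma>\<^sup>2\<close> and \<open>v\<close> of \<open>1 + b\<^sup>2 y\<^sup>2\<close>, the standardized change \<open>\<kappa>\<close> of the
  mean, and the standardized residual \<open>\<eta>\<close>.\<close>

definition incr_ll :: "real \<Rightarrow> real \<Rightarrow> real \<Rightarrow> real \<Rightarrow> real" where
  "incr_ll x v \<kappa> \<eta> = - (1 / 2) * (ln (1 + x) + ln (1 + v) + (\<eta> - \<kappa>)\<^sup>2 / ((1 + x) * (1 + v)) - \<eta>\<^sup>2)"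

text \<open>The first-order part of \<open>incr_ll\<close>, in which the relative changes enter only
  through their sum \<open>s = x + v\<close>.\<close>

definition lin_ll :: "real \<Rightarrow> real \<Rightarrow> real \<Rightarrow> real" where
  "lin_ll s \<kappa> \<eta> = \<eta> * \<kappa> - s * (1 - \<eta>\<^sup>2) / 2"

text \<open>Minus the second differential: \<open>incr_ll\<close> equals
  \<open>lin_ll - quad_ll / 2\<close> up to third order. The sign is chosen so that the mean at the
  true parameter becomes the information form.\<close>

definition quad_ll :: "real \<Rightarrow> real \<Rightarrow> real \<Rightarrow> real \<Rightarrow> real" where
  "quad_ll x v \<kappa> \<eta> = \<kappa>\<^sup>2 + 2 * \<eta> * \<kappa> * (x + v) - (x\<^sup>2 + v\<^sup>2) / 2 + \<eta>\<^sup>2 * (x\<^sup>2 + x * v + v\<^sup>2)"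

lemma incr_ll_first_order:
  assumes x: "\<bar>x\<bar> \<le> \<delta>" and v: "\<bar>v\<bar> \<le> \<delta>" and \<kappa>: "\<bar>\<kappa>\<bar> \<le> \<delta>" and \<delta>: "\<delta> \<le> 1 / 2"
  shows "\<bar>incr_ll x v \<kappa> \<eta>\<bar> \<le> 40 * \<delta> * (1 + \<eta>\<^sup>2)"
proof -
  have \<delta>0: "0 \<le> \<delta>" using x by linarith
  have \<eta>1: "\<bar>\<eta>\<bar> \<le> 1 + \<eta>\<^sup>2"
    using zero_le_power2[of "\<bar>\<eta>\<bar> - 1"] by (simp add: power2_diff)
  have \<delta>2: "\<delta>\<^sup>2 \<le> \<delta>" "\<delta> ^ 3 \<le> \<delta>"
  proof -
    have "\<delta> * \<delta> \<le> 1 * \<delta>" using \<delta> \<delta>0 by (intro mult_right_mono) auto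
    then show 2: "\<delta>\<^sup>2 \<le> \<delta>" by (simp add: power2_eq_square)
    have "\<delta>\<^sup>2 * \<delta> \<le> 1 * \<delta>" using 2 \<delta> \<delta>0 by (intro mult_right_mono) auto
    then show "\<delta> ^ 3 \<le> \<delta>" by (simp add: power2_eq_square power3_eq_cube)
  qed
  define p where "p = 1 / ((1 + x) * (1 + v))"
  \<comment> \<open>\<open>17 = 12 + 2 + 3\<close>: remainder, linear and quadratic part, after
    estimating higher powers of \<open>\<delta>\<close> by \<open>\<delta>\<close>.\<close>
  have p1: "\<bar>p - 1\<bar> \<le> 17 * \<delta>"
  proof -
    have 1: "\<bar>p - (1 - (x + v) + (x\<^sup>2 + x * v + v\<^sup>2))\<bar> \<le> 12 * \<delta> ^ 3"
      unfolding p_def by (rule inverse_product_taylor[OF x v \<delta>])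
    have 2: "\<bar>x\<^sup>2\<bar> \<le> \<delta>\<^sup>2" "\<bar>v\<^sup>2\<bar> \<le> \<delta>\<^sup>2" using x v by (auto simp: abs_le_square_iff[symmetric])
    have 3: "\<bar>x * v\<bar> \<le> \<delta>\<^sup>2" using abs_mult_le[OF x v] by (simp add: power2_eq_square)
    have 4: "\<bar>x\<^sup>2 + x * v + v\<^sup>2\<bar> \<le> 3 * \<delta>\<^sup>2"
      using abs_triangle_ineq[of "x\<^sup>2 + x * v" "v\<^sup>2"] abs_triangle_ineq[of "x\<^sup>2" "x * v"] 2 3 by linarith
    have 5: "\<bar>x + v\<bar> \<le> 2 * \<delta>" using x v by linarith
    define s1 s2 where "s1 = x + v" and "s2 = x\<^sup>2 + x * v + v\<^sup>2"
    show ?thesis using 1 4 5 \<delta>2 unfolding s1_def[symmetric] s2_def[symmetric] by linarith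
  qed
  have "\<bar>(\<eta> - \<kappa>)\<^sup>2 * p - \<eta>\<^sup>2\<bar> \<le> 76 * \<delta> * (1 + \<eta>\<^sup>2)"
  proof -
    have eq: "(\<eta> - \<kappa>)\<^sup>2 * p - \<eta>\<^sup>2 = (\<eta> - \<kappa>)\<^sup>2 * (p - 1) - 2 * (\<eta> * \<kappa>) + \<kappa>\<^sup>2"
      by (simp add: power2_eq_square algebra_simps)
    have a: "\<bar>(\<eta> - \<kappa>)\<^sup>2\<bar> \<le> 2 * (1 + \<eta>\<^sup>2)"
    proof -
      have "(\<eta> - \<kappa>)\<^sup>2 \<le> 2 * \<eta>\<^sup>2 + 2 * \<kappa>\<^sup>2" using zero_le_power2[of "\<eta> + \<kappa>"] by (simp add: power2_eq_square algebra_simps)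
      moreover have "\<kappa>\<^sup>2 \<le> 1" using \<kappa> \<delta> by (simp add: abs_square_le_1)
      ultimately show ?thesis by simp
    qed
    have "\<bar>(\<eta> - \<kappa>)\<^sup>2 * (p - 1)\<bar> \<le> 2 * (1 + \<eta>\<^sup>2) * (17 * \<delta>)" by (rule abs_mult_le[OF a p1])
    moreover have "\<bar>\<eta> * \<kappa>\<bar> \<le> (1 + \<eta>\<^sup>2) * \<delta>" by (rule abs_mult_le[OF \<eta>1 \<kappa>])
    moreover have "\<bar>\<kappa>\<^sup>2\<bar> \<le> (1 + \<eta>\<^sup>2) * \<delta>"
    proof -
      have "\<bar>\<kappa>\<bar>\<^sup>2 \<le> \<delta>\<^sup>2" by (intro power_mono \<kappa>) simp
      then have "\<kappa>\<^sup>2 \<le> \<delta>" using \<delta>2(1) by simp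
      also have "\<dots> \<le> (1 + \<eta>\<^sup>2) * \<delta>" using \<delta>0 by (simp add: mult_le_cancel_right1)
      finally show ?thesis by simp
    qed
    moreover have "0 \<le> (1 + \<eta>\<^sup>2) * \<delta>" using \<delta>0 by simp
    ultimately have "\<bar>(\<eta> - \<kappa>)\<^sup>2 * p - \<eta>\<^sup>2\<bar> \<le> 76 * ((1 + \<eta>\<^sup>2) * \<delta>)" unfolding eq by linarith
    then show ?thesis by (simp add: mult_ac)
  qed
  moreover have "\<bar>ln (1 + x)\<bar> \<le> 2 * \<delta>" "\<bar>ln (1 + v)\<bar> \<le> 2 * \<delta>"
    using abs_ln_one_plus_le[of x] abs_ln_one_plus_le[of v] x v \<delta> by linarith+
  moreover have "\<delta> \<le> \<delta> * (1 + \<eta>\<^sup>2)" using \<delta>0 by (simp add: mult_le_cancel_left1)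
  moreover have "incr_ll x v \<kappa> \<eta> = - (1 / 2) * (ln (1 + x) + ln (1 + v) + ((\<eta> - \<kappa>)\<^sup>2 * p - \<eta>\<^sup>2))"
    by (simp add: incr_ll_def p_def)
  \<comment> \<open>40 is half of \<open>2 + 2 + 76\<close>.\<close>
  moreover have "\<bar>- (1 / 2) * (L1 + L2 + A)\<bar> \<le> 40 * E"
    if "\<bar>A\<bar> \<le> 76 * E" "\<bar>L1\<bar> \<le> 2 * d" "\<bar>L2\<bar> \<le> 2 * d" "d \<le> E" for A L1 L2 E d :: real
  proof -
    have "\<bar>L1 + L2 + A\<bar> \<le> 80 * E" using that by linarith
    then show ?thesis unfolding abs_mult by simp
  qed
  ultimately show ?thesis unfolding mult.assoc by simp
qed

lemma incr_ll_second_order: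
  assumes x: "\<bar>x\<bar> \<le> \<delta>" and v: "\<bar>v\<bar> \<le> \<delta>" and \<kappa>: "\<bar>\<kappa>\<bar> \<le> \<delta>" and \<delta>: "\<delta> \<le> 1 / 2"
  shows "\<bar>incr_ll x v \<kappa> \<eta> - (lin_ll (x + v) \<kappa> \<eta> - quad_ll x v \<kappa> \<eta> / 2)\<bar> \<le> 40 * \<delta> ^ 3 * (1 + \<eta>\<^sup>2)"
proof -
  have \<delta>0: "0 \<le> \<delta>" using x by linarith
  have \<eta>1: "\<bar>\<eta>\<bar> \<le> 1 + \<eta>\<^sup>2"
    using zero_le_power2[of "\<bar>\<eta>\<bar> - 1"] by (simp add: power2_diff)
  define p where "p = 1 / ((1 + x) * (1 + v))"
  define s1 s2 where "s1 = x + v" and "s2 = x\<^sup>2 + x * v + v\<^sup>2"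
  have p: "\<bar>p - (1 - s1 + s2)\<bar> \<le> 12 * \<delta> ^ 3"
    unfolding p_def s1_def s2_def by (rule inverse_product_taylor[OF x v \<delta>])
  have s1: "\<bar>s1\<bar> \<le> 2 * \<delta>" using x v by (simp add: s1_def)
  have s2: "\<bar>s2\<bar> \<le> 3 * \<delta>\<^sup>2"
  proof -
    have "\<bar>x\<^sup>2\<bar> \<le> \<delta>\<^sup>2" "\<bar>v\<^sup>2\<bar> \<le> \<delta>\<^sup>2" using x v by (auto simp: abs_le_square_iff[symmetric])
    moreover have "\<bar>x * v\<bar> \<le> \<delta>\<^sup>2" using abs_mult_le[OF x v] by (simp add: power2_eq_square)
    ultimately show ?thesis unfolding s2_def by linarith
  qed
  have \<kappa>2: "\<bar>\<kappa>\<^sup>2\<bar> \<le> \<delta>\<^sup>2" using \<kappa> by (auto simp: abs_le_square_iff[symmetric])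
  have d3: "\<delta>\<^sup>2 * (2 * \<delta> + 3 * \<delta>\<^sup>2) \<le> 4 * \<delta> ^ 3"
  proof -
    have "\<delta> ^ 3 * \<delta> \<le> \<delta> ^ 3 * (1 / 2)" using \<delta> \<delta>0 by (intro mult_left_mono) auto
    moreover have "0 \<le> \<delta> ^ 3" using \<delta>0 by simp
    moreover have "\<delta>\<^sup>2 * (2 * \<delta> + 3 * \<delta>\<^sup>2) = 2 * \<delta> ^ 3 + 3 * (\<delta> ^ 3 * \<delta>)"
      by (simp add: power2_eq_square power3_eq_cube algebra_simps)
    ultimately show ?thesis by linarith
  qed
  have a: "\<bar>(\<eta> - \<kappa>)\<^sup>2\<bar> \<le> 2 * (1 + \<eta>\<^sup>2)"
  proof -
    have "(\<eta> - \<kappa>)\<^sup>2 \<le> 2 * \<eta>\<^sup>2 + 2 * \<kappa>\<^sup>2" using zero_le_power2[of "\<eta> + \<kappa>"] by (simp add: power2_eq_square algebra_simps)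
    moreover have "\<kappa>\<^sup>2 \<le> 1" using \<kappa> \<delta> by (simp add: abs_square_le_1)
    ultimately show ?thesis by simp
  qed
  \<comment> \<open>An exact identity: the Taylor polynomials of both logarithms and of the inverse
    variance cancel against \<open>lin_ll\<close> and \<open>quad_ll\<close>. What is left are three
    Taylor remainders and two products that are themselves of order three.\<close>
  have eq: "incr_ll x v \<kappa> \<eta> - (lin_ll (x + v) \<kappa> \<eta> - quad_ll x v \<kappa> \<eta> / 2)
      = - (1 / 2) * ((ln (1 + x) - (x - x\<^sup>2 / 2)) + (ln (1 + v) - (v - v\<^sup>2 / 2))
        + (\<eta> - \<kappa>)\<^sup>2 * (p - (1 - s1 + s2)) - 2 * (\<eta> * (\<kappa> * s2)) + \<kappa>\<^sup>2 * (- s1 + s2))"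
  proof -
    have "incr_ll x v \<kappa> \<eta> = - (1 / 2) * (ln (1 + x) + ln (1 + v) + (\<eta> - \<kappa>)\<^sup>2 * p - \<eta>\<^sup>2)"
      by (simp add: incr_ll_def p_def)
    then show ?thesis
      unfolding lin_ll_def quad_ll_def s1_def s2_def
      by (simp add: power2_eq_square algebra_simps add_divide_distrib diff_divide_distrib)
  qed
  have "\<bar>ln (1 + x) - (x - x\<^sup>2 / 2)\<bar> \<le> 2 * \<delta> ^ 3" "\<bar>ln (1 + v) - (v - v\<^sup>2 / 2)\<bar> \<le> 2 * \<delta> ^ 3"
  proof -
    have "\<bar>x\<bar> ^ 3 \<le> \<delta> ^ 3" "\<bar>v\<bar> ^ 3 \<le> \<delta> ^ 3" using x v by (intro power_mono; simp)+
    then show "\<bar>ln (1 + x) - (x - x\<^sup>2 / 2)\<bar> \<le> 2 * \<delta> ^ 3" "\<bar>ln (1 + v) - (v - v\<^sup>2 / 2)\<bar> \<le> 2 * \<delta> ^ 3"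
      using abs_ln_one_plus_taylor[of x] abs_ln_one_plus_taylor[of v] x v \<delta> by linarith+
  qed
  moreover have "\<bar>(\<eta> - \<kappa>)\<^sup>2 * (p - (1 - s1 + s2))\<bar> \<le> 24 * (\<delta> ^ 3 * (1 + \<eta>\<^sup>2))"
    by (rule order_trans[OF abs_mult_le[OF a p]]) (simp add: algebra_simps)
  moreover have "\<bar>\<eta> * (\<kappa> * s2)\<bar> \<le> 3 * (\<delta> ^ 3 * (1 + \<eta>\<^sup>2))"
    using abs_mult_le[OF \<eta>1 abs_mult_le[OF \<kappa> s2]] by (simp add: power2_eq_square power3_eq_cube mult_ac)
  moreover have "\<bar>\<kappa>\<^sup>2 * (- s1 + s2)\<bar> \<le> 4 * (\<delta> ^ 3 * (1 + \<eta>\<^sup>2))"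
  proof -
    have "\<bar>- s1 + s2\<bar> \<le> 2 * \<delta> + 3 * \<delta>\<^sup>2" using s1 s2 by linarith
    from abs_mult_le[OF \<kappa>2 this] d3 have "\<bar>\<kappa>\<^sup>2 * (- s1 + s2)\<bar> \<le> 4 * \<delta> ^ 3" by linarith
    also have "\<dots> \<le> 4 * (\<delta> ^ 3 * (1 + \<eta>\<^sup>2))" using \<delta>0 by (simp add: mult_le_cancel_left1)
    finally show ?thesis .
  qed
  moreover have "\<delta> ^ 3 \<le> \<delta> ^ 3 * (1 + \<eta>\<^sup>2)" using \<delta>0 by (simp add: mult_le_cancel_left1)
  moreover have "\<bar>- (1 / 2) * (L1 + L2 + A - 2 * B + C)\<bar> \<le> 40 * E"
    if "\<bar>L1\<bar> \<le> 2 * d" "\<bar>L2\<bar> \<le> 2 * d" "\<bar>A\<bar> \<le> 24 * E" "\<bar>B\<bar> \<le> 3 * E" "\<bar>C\<bar> \<le> 4 * E" "d \<le> E"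
    for A B C L1 L2 E d :: real
  proof -
    have "\<bar>L1 + L2 + A - 2 * B + C\<bar> \<le> 80 * E" using that by linarith
    then show ?thesis unfolding abs_mult by simp
  qed
  ultimately show ?thesis unfolding eq mult.assoc[of 40] by blast
qed

section \<open>The likelihood term and its increments in standardized coordinates\<close>

definition ll :: "real ^ 4 \<Rightarrow> real \<Rightarrow> real \<Rightarrow> real" where
  "ll \<theta> y z = - (1 / 2) * (ln (\<theta> $ 3 * (1 + \<theta> $ 4 * y\<^sup>2))
     + (z - \<theta> $ 1 - \<theta> $ 2 * y)\<^sup>2 / (\<theta> $ 3 * (1 + \<theta> $ 4 * y\<^sup>2)))"

definition cond_sd :: "real ^ 4 \<Rightarrow> real \<Rightarrow> real" where
  "cond_sd \<theta> y = sqrt (\<theta> $ 3 * (1 + \<theta> $ 4 * y\<^sup>2))"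

definition resid :: "real ^ 4 \<Rightarrow> real \<Rightarrow> real \<Rightarrow> real" where
  "resid \<theta> y z = (z - \<theta> $ 1 - \<theta> $ 2 * y) / cond_sd \<theta> y"

text \<open>Together with \<open>scale3\<close> and \<open>scale4\<close> this supplies the
  arguments \<open>\<kappa>\<close>, \<open>x\<close> and \<open>v\<close> of
  \<open>incr_ll\<close>. All three are linear in the displacement \<open>h\<close>, so the
  expansion in them is an expansion in \<open>h\<close>.\<close>

definition mean_shift :: "real ^ 4 \<Rightarrow> real ^ 4 \<Rightarrow> real \<Rightarrow> real" where
  "mean_shift \<theta> h y = (h $ 1 + h $ 2 * y) / cond_sd \<theta> y"

definition scale3 :: "real ^ 4 \<Rightarrow> real ^ 4 \<Rightarrow> real" where
  "scale3 \<theta> h = h $ 3 / \<theta> $ 3"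

definition scale4 :: "real ^ 4 \<Rightarrow> real ^ 4 \<Rightarrow> real \<Rightarrow> real" where
  "scale4 \<theta> h y = h $ 4 * (y\<^sup>2 / (1 + \<theta> $ 4 * y\<^sup>2))"

lemma quasi_ll_eq: "quasi_ll Y t \<theta> \<omega> = ll \<theta> (Y (t - 2) \<omega>) (Y t \<omega>)"
  by (simp add: quasi_ll_def cond_var_def ll_def)

text \<open>Positivity of the fourth coordinate makes \<open>cond_sd\<close> grow linearly in
  \<open>|y|\<close>; without it the quotients \<open>y / cond_sd \<theta> y\<close> and
  \<open>y^2 / (1 + \<theta> $ 4 * y^2)\<close> would be unbounded.\<close>

locale pos_param =
  fixes \<theta> :: "real ^ 4"
  assumes pos3: "0 < \<theta> $ 3" and pos4: "0 < \<theta> $ 4"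
begin

lemma one_plus_pos: "0 < 1 + \<theta> $ 4 * y\<^sup>2"
  using pos4 by (simp add: add_pos_nonneg)

lemma var_pos: "0 < \<theta> $ 3 * (1 + \<theta> $ 4 * y\<^sup>2)"
  using pos3 one_plus_pos by simp

lemma cond_sd_pos: "0 < cond_sd \<theta> y"
  using var_pos by (simp add: cond_sd_def)

lemma cond_sd_square: "(cond_sd \<theta> y)\<^sup>2 = \<theta> $ 3 * (1 + \<theta> $ 4 * y\<^sup>2)"
  using var_pos[of y] by (simp add: cond_sd_def)

lemma inverse_cond_sd_le: "1 / cond_sd \<theta> y \<le> 1 / sqrt (\<theta> $ 3)"
proof -
  have "\<theta> $ 3 * 1 \<le> \<theta> $ 3 * (1 + \<theta> $ 4 * y\<^sup>2)" using pos3 pos4 by (intro mult_left_mono) auto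
  then have "sqrt (\<theta> $ 3) \<le> cond_sd \<theta> y" unfolding cond_sd_def by (intro real_sqrt_le_mono) simp
  then show ?thesis using pos3 cond_sd_pos[of y] by (intro divide_left_mono mult_pos_pos) auto
qed

lemma lag_over_cond_sd_le: "\<bar>y\<bar> / cond_sd \<theta> y \<le> 1 / sqrt (\<theta> $ 3 * \<theta> $ 4)"
proof -
  have "sqrt (\<theta> $ 3 * \<theta> $ 4) * \<bar>y\<bar> = sqrt (\<theta> $ 3 * \<theta> $ 4 * y\<^sup>2)" by (simp add: real_sqrt_mult)
  also have "\<dots> \<le> cond_sd \<theta> y"
    unfolding cond_sd_def using pos3 by (intro real_sqrt_le_mono) (simp add: distrib_left mult.assoc)
  finally show ?thesis using pos3 pos4 cond_sd_pos[of y] by (simp add: field_simps)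
qed

lemma square_over_le: "y\<^sup>2 / (1 + \<theta> $ 4 * y\<^sup>2) \<le> 1 / \<theta> $ 4"
  using pos4 one_plus_pos[of y] by (simp add: field_simps)

text \<open>One constant for all three standardized changes: the sum of the suprema over
  \<open>y\<close> of their coefficients. Hence all error bounds are uniform in
  \<open>y\<close>.\<close>

definition lip :: real where
  "lip = 1 / sqrt (\<theta> $ 3) + 1 / sqrt (\<theta> $ 3 * \<theta> $ 4) + 1 / \<theta> $ 3 + 1 / \<theta> $ 4"

lemma lip_nonneg: "0 \<le> lip"
  using pos3 pos4 by (simp add: lip_def)

lemma
  shows mean_shift_le: "\<bar>mean_shift \<theta> h y\<bar> \<le> lip * norm h"
    and scale3_le: "\<bar>scale3 \<theta> h\<bar> \<le> lip * norm h"
    and scale4_le: "\<bar>scale4 \<theta> h y\<bar> \<le> lip * norm h"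
proof -
  have c: "\<bar>h $ i\<bar> \<le> norm h" for i by (rule component_le_norm_cart)
  have p: "0 \<le> 1 / sqrt (\<theta> $ 3)" "0 \<le> 1 / sqrt (\<theta> $ 3 * \<theta> $ 4)" "0 \<le> 1 / \<theta> $ 3" "0 \<le> 1 / \<theta> $ 4"
    using pos3 pos4 by auto
  have le: "a * norm h \<le> lip * norm h"
    if "a \<in> {1 / sqrt (\<theta> $ 3) + 1 / sqrt (\<theta> $ 3 * \<theta> $ 4), 1 / \<theta> $ 3, 1 / \<theta> $ 4}" for a
    using that p by (intro mult_right_mono) (auto simp: lip_def)
  have "mean_shift \<theta> h y = h $ 1 * (1 / cond_sd \<theta> y) + h $ 2 * (y / cond_sd \<theta> y)"
    by (simp add: mean_shift_def add_divide_distrib)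
  moreover have "\<bar>h $ 1 * (1 / cond_sd \<theta> y)\<bar> \<le> norm h * (1 / sqrt (\<theta> $ 3))"
    using inverse_cond_sd_le[of y] cond_sd_pos[of y] by (intro abs_mult_le c) (simp add: less_imp_le)
  moreover have "\<bar>h $ 2 * (y / cond_sd \<theta> y)\<bar> \<le> norm h * (1 / sqrt (\<theta> $ 3 * \<theta> $ 4))"
    using lag_over_cond_sd_le[of y] cond_sd_pos[of y] by (intro abs_mult_le c) (simp add: abs_divide)
  ultimately have "\<bar>mean_shift \<theta> h y\<bar> \<le> norm h * (1 / sqrt (\<theta> $ 3)) + norm h * (1 / sqrt (\<theta> $ 3 * \<theta> $ 4))"
    by linarith
  also have "\<dots> = (1 / sqrt (\<theta> $ 3) + 1 / sqrt (\<theta> $ 3 * \<theta> $ 4)) * norm h"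
    by (simp only: distrib_right mult.commute[of "norm h"])
  also have "\<dots> \<le> lip * norm h" by (rule le) simp
  finally show "\<bar>mean_shift \<theta> h y\<bar> \<le> lip * norm h" .
  have "\<bar>scale3 \<theta> h\<bar> \<le> 1 / \<theta> $ 3 * norm h"
    using pos3 c[of 3] by (simp add: scale3_def abs_divide divide_right_mono)
  also have "\<dots> \<le> lip * norm h" by (rule le) simp
  finally show "\<bar>scale3 \<theta> h\<bar> \<le> lip * norm h" .
  have "\<bar>scale4 \<theta> h y\<bar> \<le> norm h * (1 / \<theta> $ 4)"
    unfolding scale4_def using square_over_le[of y] one_plus_pos[of y]
    by (intro abs_mult_le c) (simp add: less_imp_le)
  also have "\<dots> \<le> lip * norm h" using le[of "1 / \<theta> $ 4"] by (simp add: mult.commute)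
  finally show "\<bar>scale4 \<theta> h y\<bar> \<le> lip * norm h" .
qed

text \<open>The new conditional variance is the old one times \<open>(1 + x) * (1 + v)\<close>, and
  the new residual is the old one minus the mean shift, in units of the old standard deviation.
  Smallness of \<open>h\<close> keeps both factors positive, so the logarithm splits.\<close>

lemma ll_increment:
  assumes "lip * norm h \<le> 1 / 2"
  shows "ll (\<theta> + h) y z - ll \<theta> y z = incr_ll (scale3 \<theta> h) (scale4 \<theta> h y) (mean_shift \<theta> h y) (resid \<theta> y z)"
proof -
  define x v where "x = scale3 \<theta> h" and "v = scale4 \<theta> h y"
  define V where "V = \<theta> $ 3 * (1 + \<theta> $ 4 * y\<^sup>2)"
  have V: "0 < V" unfolding V_def by (rule var_pos)
  have xv: "0 < 1 + x" "0 < 1 + v"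
    using scale3_le[of h] scale4_le[of h y] assms unfolding x_def v_def by linarith+
  have V': "(\<theta> + h) $ 3 * (1 + (\<theta> + h) $ 4 * y\<^sup>2) = V * ((1 + x) * (1 + v))"
  proof -
    have "(\<theta> + h) $ 3 = \<theta> $ 3 * (1 + x)" using pos3 by (simp add: x_def scale3_def field_simps)
    moreover have "1 + (\<theta> + h) $ 4 * y\<^sup>2 = (1 + \<theta> $ 4 * y\<^sup>2) * (1 + v)"
      using one_plus_pos[of y] by (simp add: v_def scale4_def field_simps)
    ultimately show ?thesis unfolding V_def by (simp only: mult_ac)
  qed
  have num: "z - (\<theta> + h) $ 1 - (\<theta> + h) $ 2 * y = cond_sd \<theta> y * (resid \<theta> y z - mean_shift \<theta> h y)"
    using cond_sd_pos[of y] by (simp add: resid_def mean_shift_def field_simps)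
  have num0: "z - \<theta> $ 1 - \<theta> $ 2 * y = cond_sd \<theta> y * resid \<theta> y z"
    using cond_sd_pos[of y] by (simp add: resid_def)
  have "ln (V * ((1 + x) * (1 + v))) = ln V + (ln (1 + x) + ln (1 + v))"
    using V xv by (simp add: ln_mult)
  moreover have "(cond_sd \<theta> y * (resid \<theta> y z - mean_shift \<theta> h y))\<^sup>2 / (V * ((1 + x) * (1 + v)))
      = (resid \<theta> y z - mean_shift \<theta> h y)\<^sup>2 / ((1 + x) * (1 + v))"
    using V by (simp add: power_mult_distrib cond_sd_square flip: V_def)
  moreover have "(cond_sd \<theta> y * resid \<theta> y z)\<^sup>2 / V = (resid \<theta> y z)\<^sup>2"
    using V by (simp add: power_mult_distrib cond_sd_square flip: V_def)
  ultimately show ?thesis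
    unfolding ll_def V' num num0 incr_ll_def x_def[symmetric] v_def[symmetric] unfolding V_def[symmetric]
    by (simp add: algebra_simps)
qed

lemma ll_first_order:
  assumes "lip * norm h \<le> 1 / 2"
  shows "\<bar>ll (\<theta> + h) y z - ll \<theta> y z\<bar> \<le> 40 * (lip * norm h) * (1 + (resid \<theta> y z)\<^sup>2)"
  unfolding ll_increment[OF assms]
  by (rule incr_ll_first_order[OF scale3_le scale4_le mean_shift_le assms])

lemma ll_second_order:
  assumes "lip * norm h \<le> 1 / 2"
  shows "\<bar>ll (\<theta> + h) y z - ll \<theta> y z
    - (lin_ll (scale3 \<theta> h + scale4 \<theta> h y) (mean_shift \<theta> h y) (resid \<theta> y z)
       - quad_ll (scale3 \<theta> h) (scale4 \<theta> h y) (mean_shift \<theta> h y) (resid \<theta> y z) / 2)\<bar>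
    \<le> 40 * (lip * norm h) ^ 3 * (1 + (resid \<theta> y z)\<^sup>2)"
  unfolding ll_increment[OF assms]
  by (rule incr_ll_second_order[OF scale3_le scale4_le mean_shift_le assms])

end

text \<open>Makes the second-order term quadratically small, which turns the expansion into
  differentiability of the likelihood term.\<close>

lemma abs_quad_ll_le:
  assumes x: "\<bar>x\<bar> \<le> \<delta>" and v: "\<bar>v\<bar> \<le> \<delta>" and \<kappa>: "\<bar>\<kappa>\<bar> \<le> \<delta>"
  shows "\<bar>quad_ll x v \<kappa> \<eta>\<bar> \<le> 10 * \<delta>\<^sup>2 * (1 + \<eta>\<^sup>2)"
proof -
  have \<eta>1: "\<bar>\<eta>\<bar> \<le> (1 + \<eta>\<^sup>2) / 2"
    using zero_le_power2[of "\<bar>\<eta>\<bar> - 1"] by (simp add: power2_diff)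
  have sq: "\<bar>x\<^sup>2\<bar> \<le> \<delta>\<^sup>2" "\<bar>v\<^sup>2\<bar> \<le> \<delta>\<^sup>2" "\<bar>\<kappa>\<^sup>2\<bar> \<le> \<delta>\<^sup>2"
    using x v \<kappa> by (auto simp: abs_le_square_iff[symmetric])
  have xv: "\<bar>x * v\<bar> \<le> \<delta>\<^sup>2" using abs_mult_le[OF x v] by (simp add: power2_eq_square)
  have s1: "\<bar>x + v\<bar> \<le> 2 * \<delta>" using x v by linarith
  have s2: "\<bar>x\<^sup>2 + x * v + v\<^sup>2\<bar> \<le> 3 * \<delta>\<^sup>2"
    using abs_triangle_ineq[of "x\<^sup>2 + x * v" "v\<^sup>2"] abs_triangle_ineq[of "x\<^sup>2" "x * v"] sq xv by linarith
  have s3: "\<bar>x\<^sup>2 + v\<^sup>2\<bar> \<le> 2 * \<delta>\<^sup>2" using sq by linarith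
  have gen: "\<bar>A + 2 * B - C / 2 + D\<bar> \<le> 10 * (d + e)"
    if "\<bar>A\<bar> \<le> d" "\<bar>B\<bar> \<le> d + e" "\<bar>C\<bar> \<le> 2 * d" "\<bar>D\<bar> \<le> 3 * e" "0 \<le> e" for A B C D d e :: real
  proof -
    have "\<bar>A + 2 * B\<bar> \<le> 3 * d + 2 * e" using that(1,2) by linarith
    moreover have "\<bar>C / 2\<bar> \<le> d" using that(3) by simp
    ultimately have "\<bar>A + 2 * B - C / 2\<bar> \<le> 4 * d + 2 * e" by linarith
    then have "\<bar>A + 2 * B - C / 2 + D\<bar> \<le> 4 * d + 5 * e" using that(4) by linarith
    moreover have "0 \<le> d" using that(1) by linarith
    ultimately show ?thesis using that(5) unfolding distrib_left by linarith
  qed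
  have "\<bar>\<kappa>\<^sup>2 + 2 * (\<eta> * (\<kappa> * (x + v))) - (x\<^sup>2 + v\<^sup>2) / 2 + \<eta>\<^sup>2 * (x\<^sup>2 + x * v + v\<^sup>2)\<bar> \<le> 10 * (\<delta>\<^sup>2 + \<eta>\<^sup>2 * \<delta>\<^sup>2)"
  proof (rule gen)
    have "\<bar>\<eta> * (\<kappa> * (x + v))\<bar> \<le> (1 + \<eta>\<^sup>2) / 2 * (\<delta> * (2 * \<delta>))" by (rule abs_mult_le[OF \<eta>1 abs_mult_le[OF \<kappa> s1]])
    also have "\<dots> = \<delta>\<^sup>2 + \<eta>\<^sup>2 * \<delta>\<^sup>2" by (simp add: power2_eq_square field_simps)
    finally show "\<bar>\<eta> * (\<kappa> * (x + v))\<bar> \<le> \<delta>\<^sup>2 + \<eta>\<^sup>2 * \<delta>\<^sup>2" .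
    show "\<bar>\<eta>\<^sup>2 * (x\<^sup>2 + x * v + v\<^sup>2)\<bar> \<le> 3 * (\<eta>\<^sup>2 * \<delta>\<^sup>2)"
      using abs_mult_le[OF _ s2, of "\<eta>\<^sup>2" "\<eta>\<^sup>2"] by simp
  qed (use sq s3 in auto)
  then show ?thesis by (simp add: quad_ll_def algebra_simps)
qed

section \<open>Argmax of a locally quadratic criterion\<close>

text \<open>Comparing the criterion at its maximizer \<open>x\<close> with its value at the maximizer
  \<open>L / sqrt n\<close> of the quadratic part bounds the distance of the two, without any
  derivative of the criterion.\<close>

lemma argmax_quadratic_approximation:
  fixes D :: "nat \<Rightarrow> real ^ 'm \<Rightarrow> real" and x s L :: "nat \<Rightarrow> real ^ 'm" and A :: "real ^ 'm ^ 'm"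
  assumes sym: "transpose A = A" and pd: "0 < l" "\<And>h. l * (norm h)\<^sup>2 \<le> h \<bullet> (A *v h)"
    and L: "\<And>n. A *v L n = s n"
    and expand: "0 < r" "0 \<le> C" "\<forall>\<^sub>F n in sequentially. \<forall>h. norm h \<le> r \<longrightarrow>
        \<bar>D n h - (sqrt (real n) * (h \<bullet> s n) - real n / 2 * (h \<bullet> (A *v h)))\<bar> \<le> real n * (norm h)\<^sup>2 * (err n + C * norm h)"
    and err: "err \<longlonglongrightarrow> 0"
    and x: "x \<longlonglongrightarrow> 0"
    and max: "\<forall>\<^sub>F n in sequentially. \<forall>h. norm h \<le> r \<longrightarrow> D n h \<le> D n (x n)"
    and \<eta>: "0 < \<eta>"
  shows "\<forall>\<^sub>F n in sequentially. norm (L n) \<le> K \<longrightarrow> norm (sqrt (real n) *\<^sub>R x n - L n) \<le> \<eta>"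
proof -
  \<comment> \<open>\<open>\<alpha>\<close> is the relative expansion error at the maximizer,
    \<open>\<beta>\<close> the one at the competitor, whose norm is at most \<open>|K|\<close> over
    \<open>sqrt n\<close>.\<close>
  define \<alpha> where "\<alpha> n = \<bar>err n\<bar> + C * norm (x n)" for n
  define \<beta> where "\<beta> n = \<bar>err n\<bar> + C * (\<bar>K\<bar> / sqrt (real n))" for n
  have inv: "(\<lambda>n. c / sqrt (real n)) \<longlonglongrightarrow> 0" for c
    by (rule real_tendsto_divide_at_top[OF tendsto_const])
      (rule filterlim_compose[OF sqrt_at_top filterlim_real_sequentially])
  have err': "(\<lambda>n. \<bar>err n\<bar>) \<longlonglongrightarrow> 0" using tendsto_rabs[OF err] by simp
  have \<alpha>: "\<alpha> \<longlonglongrightarrow> 0"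
    unfolding \<alpha>_def using tendsto_add[OF err' tendsto_mult_left[OF tendsto_norm[OF x], of C]] by simp
  have \<beta>: "\<beta> \<longlonglongrightarrow> 0"
    unfolding \<beta>_def using tendsto_add[OF err' tendsto_mult_left[OF inv, of C]] by simp
  have ab: "(\<lambda>n. (2 * \<alpha> n + \<beta> n) * K\<^sup>2) \<longlonglongrightarrow> (2 * 0 + 0) * K\<^sup>2"
    by (intro tendsto_intros \<alpha> \<beta>)
  have e1: "\<forall>\<^sub>F n in sequentially. \<alpha> n < l / 8" by (rule order_tendstoD(2)[OF \<alpha>]) (use pd in simp)
  have e2: "\<forall>\<^sub>F n in sequentially. (2 * \<alpha> n + \<beta> n) * K\<^sup>2 < l / 4 * \<eta>\<^sup>2"
    by (rule order_tendstoD(2)[OF ab]) (use pd \<eta> in simp)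
  have e3: "\<forall>\<^sub>F n in sequentially. norm (x n) < r"
    by (rule order_tendstoD(2)[OF tendsto_norm[OF x]]) (use expand in simp)
  have e4: "\<forall>\<^sub>F n in sequentially. \<bar>K\<bar> / sqrt (real n) < r" by (rule order_tendstoD(2)[OF inv expand(1)])
  show ?thesis
    using expand(3) max e1 e2 e3 e4 eventually_gt_at_top[of 0]
  proof eventually_elim
    case (elim n)
    show ?case
    proof
      assume K: "norm (L n) \<le> K"
      define N where "N = real n"
      have N: "0 < N" using elim by (simp add: N_def)
      define X where "X = sqrt N *\<^sub>R x n"
      define d where "d = X - L n"
      define h where "h = (1 / sqrt N) *\<^sub>R L n"
      have K0: "0 \<le> K" using K norm_ge_zero order_trans by blast
      have hK: "norm h \<le> \<bar>K\<bar> / sqrt N" using K N K0 by (simp add: h_def divide_right_mono)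
      then have hr: "norm h \<le> r" using elim(6) by (simp add: N_def)
      define E1 where "E1 = D n (x n) - (sqrt N * (x n \<bullet> s n) - N / 2 * (x n \<bullet> (A *v x n)))"
      define E2 where "E2 = D n h - (sqrt N * (h \<bullet> s n) - N / 2 * (h \<bullet> (A *v h)))"
      have X2: "(norm X)\<^sup>2 = N * (norm (x n))\<^sup>2" using N by (simp add: X_def power_mult_distrib)
      have h2: "N * (norm h)\<^sup>2 = (norm (L n))\<^sup>2" using N by (simp add: h_def power_divide)
      have "\<bar>E1\<bar> \<le> N * (norm (x n))\<^sup>2 * (err n + C * norm (x n))"
        using elim(1,5) by (simp add: E1_def N_def)
      also have "\<dots> \<le> N * (norm (x n))\<^sup>2 * \<alpha> n" using N by (intro mult_left_mono) (auto simp: \<alpha>_def)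
      finally have E1: "\<bar>E1\<bar> \<le> \<alpha> n * (norm X)\<^sup>2" by (simp add: X2 mult_ac)
      have "\<bar>E2\<bar> \<le> N * (norm h)\<^sup>2 * (err n + C * norm h)"
        using elim(1) hr by (simp add: E2_def N_def)
      also have "\<dots> \<le> N * (norm h)\<^sup>2 * \<beta> n"
      proof (rule mult_left_mono)
        have "C * norm h \<le> C * (\<bar>K\<bar> / sqrt N)" by (rule mult_left_mono[OF hK expand(2)])
        then show "err n + C * norm h \<le> \<beta> n" by (simp add: \<beta>_def N_def)
      qed (use N in simp)
      also have "\<dots> = \<beta> n * (norm (L n))\<^sup>2" unfolding h2 by simp
      also have "\<dots> \<le> \<beta> n * K\<^sup>2"
        using K expand(2) by (intro mult_left_mono power_mono) (auto simp: \<beta>_def)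
      finally have E2: "\<bar>E2\<bar> \<le> \<beta> n * K\<^sup>2" .
      have symA: "u \<bullet> (A *v w) = w \<bullet> (A *v u)" for u w
        using sym dot_lmul_matrix[of u A w] by (metis inner_commute transpose_matrix_vector)
      have val1: "D n (x n) = X \<bullet> (A *v L n) - X \<bullet> (A *v X) / 2 + E1"
      proof -
        have "X \<bullet> (A *v X) = N * (x n \<bullet> (A *v x n))"
          using N by (simp add: X_def matrix_vector_mult_scaleR flip: mult.assoc)
        then show ?thesis using L[of n] by (simp add: E1_def X_def)
      qed
      have val2: "D n h = L n \<bullet> (A *v L n) / 2 + E2"
      proof -
        have "N * (h \<bullet> (A *v h)) = L n \<bullet> (A *v L n)"
          using N by (simp add: h_def matrix_vector_mult_scaleR flip: mult.assoc)
        moreover have "sqrt N * (h \<bullet> s n) = L n \<bullet> (A *v L n)"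
          using N L[of n] by (simp add: h_def)
        ultimately show ?thesis by (simp add: E2_def)
      qed
      \<comment> \<open>Since \<open>A\<close> applied to \<open>L n\<close> is the linear term, the
        quadratic parts at maximizer and competitor differ by half the form of \<open>A\<close> at
        \<open>d\<close>; maximality bounds it by the two errors.\<close>
      have dd: "d \<bullet> (A *v d) = X \<bullet> (A *v X) - 2 * (X \<bullet> (A *v L n)) + L n \<bullet> (A *v L n)"
        unfolding d_def using symA[of "L n" X]
        by (simp add: matrix_vector_mult_diff_distrib inner_diff_left inner_diff_right)
      have "D n h \<le> D n (x n)" using elim(2) hr by blast
      then have "d \<bullet> (A *v d) / 2 \<le> \<bar>E1\<bar> + \<bar>E2\<bar>" unfolding val1 val2 dd by (simp add: field_simps)
      then have "l / 2 * (norm d)\<^sup>2 \<le> \<alpha> n * (norm X)\<^sup>2 + \<beta> n * K\<^sup>2"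
        using pd(2)[of d] E1 E2 by linarith
      also have "(norm X)\<^sup>2 \<le> 2 * (norm d)\<^sup>2 + 2 * K\<^sup>2"
      proof -
        have "norm X \<le> norm d + K" using norm_triangle_ineq[of d "L n"] K by (simp add: d_def)
        then have "(norm X)\<^sup>2 \<le> (norm d + K)\<^sup>2" by (intro power_mono) auto
        also have "\<dots> \<le> 2 * (norm d)\<^sup>2 + 2 * K\<^sup>2"
          using zero_le_power2[of "norm d - K"] by (simp add: power2_sum power2_diff)
        finally show ?thesis .
      qed
      also have "\<alpha> n * (2 * (norm d)\<^sup>2 + 2 * K\<^sup>2) + \<beta> n * K\<^sup>2 = 2 * \<alpha> n * (norm d)\<^sup>2 + (2 * \<alpha> n + \<beta> n) * K\<^sup>2"
        by (simp add: algebra_simps)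
      \<comment> \<open>The error at the maximizer contains the unknown \<open>d\<close> itself;
        \<open>\<alpha> n < l / 8\<close> allows half of the left-hand side to absorb it.\<close>
      also have "2 * \<alpha> n * (norm d)\<^sup>2 \<le> l / 4 * (norm d)\<^sup>2" using elim(3) by (intro mult_right_mono) auto
      finally have "l / 2 * (norm d)\<^sup>2 \<le> l / 4 * (norm d)\<^sup>2 + (2 * \<alpha> n + \<beta> n) * K\<^sup>2"
        using expand(2) by (simp add: \<alpha>_def mult_left_mono)
      with elim(4) have "l / 4 * (norm d)\<^sup>2 \<le> l / 4 * \<eta>\<^sup>2" by linarith
      then have "(norm d)\<^sup>2 \<le> \<eta>\<^sup>2" using pd(1) by simp
      then have "norm d \<le> \<eta>" by (rule power2_le_imp_le) (use \<eta> in simp)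
      then show "norm (sqrt (real n) *\<^sub>R x n - L n) \<le> \<eta>" by (simp add: d_def X_def N_def)
    qed
  qed
qed

text \<open>The pathwise closeness is only required where \<open>L n\<close> is bounded by
  \<open>K\<close>. Dominated convergence handles that event and Chebyshev's inequality with the
  uniform second moment its complement, so the truncated distance tends to 0 in mean; tightness of
  \<open>X n\<close> follows as well.\<close>

lemma (in prob_space) converges_in_distribution_perturbed:
  fixes X L :: "nat \<Rightarrow> 'a \<Rightarrow> 'b::euclidean_space"
  assumes X: "\<And>n. 1 \<le> n \<Longrightarrow> X n \<in> borel_measurable M" and L: "\<And>n. L n \<in> borel_measurable M"
    and sq: "\<And>n. integrable M (\<lambda>\<omega>. (norm (L n \<omega>))\<^sup>2)" "\<And>n. expectation (\<lambda>\<omega>. (norm (L n \<omega>))\<^sup>2) \<le> c"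
    and close: "AE \<omega> in M. \<forall>K \<eta>. 0 < \<eta> \<longrightarrow> (\<forall>\<^sub>F n in sequentially. norm (L n \<omega>) \<le> K \<longrightarrow> norm (X n \<omega> - L n \<omega>) \<le> \<eta>)"
    and N: "prob_space N" "sets N = sets borel"
    and char: "\<And>u. (\<lambda>n. CLINT \<omega>|M. iexp (u \<bullet> L n \<omega>)) \<longlonglongrightarrow> (CLINT x|N. iexp (u \<bullet> x))"
  shows "converges_in_distribution M X N"
proof -
  \<comment> \<open>Shifted by one because \<open>X 0\<close> need not be measurable; a limit does
    not notice.\<close>
  define X' L' where "X' n = X (Suc n)" and "L' n = L (Suc n)" for n
  have [measurable]: "X' n \<in> borel_measurable M" "L' n \<in> borel_measurable M" for n
    using X L by (auto simp: X'_def L'_def)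
  have c0: "0 \<le> c" by (rule order_trans[OF _ sq(2)[of 0]]) simp
  define \<Delta> where "\<Delta> n \<omega> = min 1 (norm (X' n \<omega> - L' n \<omega>))" for n \<omega>
  have [measurable]: "\<Delta> n \<in> borel_measurable M" for n unfolding \<Delta>_def[abs_def] by measurable
  have \<Delta>_int: "integrable M (\<Delta> n)" for n
    by (rule integrable_const_bound[where B = 1]) (auto simp: \<Delta>_def)
  have cheb: "prob {\<omega> \<in> space M. K < norm (L' n \<omega>)} \<le> c / K\<^sup>2" if K: "0 < K" for K n
  proof -
    have "prob {\<omega> \<in> space M. K < norm (L' n \<omega>)} \<le> prob {\<omega> \<in> space M. K\<^sup>2 \<le> (norm (L' n \<omega>))\<^sup>2}"
      using K by (intro finite_measure_mono) (auto intro!: power_mono)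
    also have "\<dots> \<le> expectation (\<lambda>\<omega>. (norm (L' n \<omega>))\<^sup>2) / K\<^sup>2"
      by (rule integral_Markov_inequality_measure[where A = "space M", simplified])
        (use sq K in \<open>auto simp: L'_def\<close>)
    also have "\<dots> \<le> c / K\<^sup>2" using sq(2) by (simp add: L'_def divide_right_mono)
    finally show ?thesis .
  qed
  have \<Delta>_lim: "(\<lambda>n. expectation (\<Delta> n)) \<longlonglongrightarrow> 0"
    unfolding tendsto_iff dist_real_def
  proof (intro allI impI)
    fix \<eta> :: real assume \<eta>: "0 < \<eta>"
    \<comment> \<open>Makes the Chebyshev bound \<open>c / K^2\<close> smaller than
      \<open>\<eta> / 2\<close>; \<open>c + 1\<close> keeps \<open>K\<close> positive when
      \<open>c = 0\<close>.\<close>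
    define K where "K = sqrt (2 * (c + 1) / \<eta>)"
    have K: "0 < K" "c / K\<^sup>2 < \<eta> / 2"
      using \<eta> c0 by (auto simp: K_def field_simps)
    define f where "f n \<omega> = (if norm (L' n \<omega>) \<le> K then \<Delta> n \<omega> else 0)" for n \<omega>
    have [measurable]: "f n \<in> borel_measurable M" for n unfolding f_def[abs_def] by measurable
    have "(\<lambda>n. expectation (f n)) \<longlonglongrightarrow> expectation (\<lambda>_. 0)"
    proof (rule integral_dominated_convergence[where w = "\<lambda>_. 1"])
      show "AE \<omega> in M. (\<lambda>n. f n \<omega>) \<longlonglongrightarrow> 0"
        using close
      proof eventually_elim
        case (elim \<omega>)
        show ?case
          unfolding tendsto_iff dist_real_def
        proof (intro allI impI)
          fix r :: real assume r: "0 < r"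
          then have "\<forall>\<^sub>F n in sequentially. norm (L n \<omega>) \<le> K \<longrightarrow> norm (X n \<omega> - L n \<omega>) \<le> r / 2"
            using elim[rule_format, of "r / 2" K] by simp
          then have "\<forall>\<^sub>F n in sequentially. norm (L (Suc n) \<omega>) \<le> K \<longrightarrow> norm (X (Suc n) \<omega> - L (Suc n) \<omega>) \<le> r / 2"
            by (rule eventually_sequentially_Suc[THEN iffD2])
          then show "\<forall>\<^sub>F n in sequentially. \<bar>f n \<omega> - 0\<bar> < r"
            by eventually_elim (use r in \<open>auto simp: f_def \<Delta>_def L'_def X'_def min_def\<close>)
        qed
      qed
    qed (auto simp: f_def \<Delta>_def)
    then have "(\<lambda>n. expectation (f n)) \<longlonglongrightarrow> 0" by simp
    then have "\<forall>\<^sub>F n in sequentially. expectation (f n) < \<eta> / 2" by (rule order_tendstoD) (use \<eta> in simp)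
    then show "\<forall>\<^sub>F n in sequentially. \<bar>expectation (\<Delta> n) - 0\<bar> < \<eta>"
    proof eventually_elim
      case (elim n)
      let ?I = "indicat_real {\<omega> \<in> space M. K < norm (L' n \<omega>)}"
      have iI: "integrable M ?I" by (rule integrable_const_bound[where B = 1]) auto
      have if': "integrable M (f n)" by (rule integrable_const_bound[where B = 1]) (auto simp: f_def \<Delta>_def)
      have "expectation (\<Delta> n) \<le> expectation (\<lambda>\<omega>. f n \<omega> + ?I \<omega>)"
      proof (rule integral_mono[OF \<Delta>_int])
        show "integrable M (\<lambda>\<omega>. f n \<omega> + ?I \<omega>)" using iI if' by simp
        show "\<Delta> n \<omega> \<le> f n \<omega> + ?I \<omega>" if "\<omega> \<in> space M" for \<omega>
          using that by (auto simp: f_def \<Delta>_def indicator_def)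
      qed
      also have "\<dots> = expectation (f n) + prob {\<omega> \<in> space M. K < norm (L' n \<omega>)}" using iI if' by simp
      finally have "expectation (\<Delta> n) < \<eta>" using elim cheb[OF K(1), of n] K(2) by linarith
      moreover have "0 \<le> expectation (\<Delta> n)" by (simp add: \<Delta>_def)
      ultimately show ?case by simp
    qed
  qed
  have "converges_in_distribution M X' N"
  proof (rule converges_in_distribution_char[OF _ N])
    show "X' n \<in> borel_measurable M" for n by measurable
    show "(\<lambda>n. CLINT \<omega>|M. iexp (u \<bullet> X' n \<omega>)) \<longlonglongrightarrow> (CLINT x|N. iexp (u \<bullet> x))" for u
    proof (rule Lim_transform)
      show "(\<lambda>n. CLINT \<omega>|M. iexp (u \<bullet> L' n \<omega>)) \<longlonglongrightarrow> (CLINT x|N. iexp (u \<bullet> x))"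
        unfolding L'_def by (rule LIMSEQ_Suc[OF char])
      show "(\<lambda>n. (CLINT \<omega>|M. iexp (u \<bullet> X' n \<omega>)) - (CLINT \<omega>|M. iexp (u \<bullet> L' n \<omega>))) \<longlonglongrightarrow> 0"
      proof (rule Lim_null_comparison)
        show "\<forall>\<^sub>F n in sequentially. norm ((CLINT \<omega>|M. iexp (u \<bullet> X' n \<omega>)) - (CLINT \<omega>|M. iexp (u \<bullet> L' n \<omega>)))
            \<le> (2 + norm u) * expectation (\<Delta> n)"
        proof (intro always_eventually allI)
          fix n
          have iX: "integrable M (\<lambda>\<omega>. iexp (u \<bullet> X' n \<omega>))" "integrable M (\<lambda>\<omega>. iexp (u \<bullet> L' n \<omega>))"
            by (rule integrable_iexp_compose; measurable)+
          have "norm ((CLINT \<omega>|M. iexp (u \<bullet> X' n \<omega>)) - (CLINT \<omega>|M. iexp (u \<bullet> L' n \<omega>)))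
              = norm (CLINT \<omega>|M. iexp (u \<bullet> X' n \<omega>) - iexp (u \<bullet> L' n \<omega>))"
            using iX by simp
          also have "\<dots> \<le> expectation (\<lambda>\<omega>. norm (iexp (u \<bullet> X' n \<omega>) - iexp (u \<bullet> L' n \<omega>)))" by (rule integral_norm_bound)
          also have "\<dots> \<le> expectation (\<lambda>\<omega>. (2 + norm u) * \<Delta> n \<omega>)"
          proof (rule integral_mono)
            show "integrable M (\<lambda>\<omega>. norm (iexp (u \<bullet> X' n \<omega>) - iexp (u \<bullet> L' n \<omega>)))"
              by (intro integrable_norm Bochner_Integration.integrable_diff iX)
            show "integrable M (\<lambda>\<omega>. (2 + norm u) * \<Delta> n \<omega>)" using \<Delta>_int by simp
            fix \<omega>
            \<comment> \<open>The factor \<open>2 + norm u\<close> covers both cases: the Lipschitz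
              bound for distances up to 1, the trivial bound 2 beyond.\<close>
            show "norm (iexp (u \<bullet> X' n \<omega>) - iexp (u \<bullet> L' n \<omega>)) \<le> (2 + norm u) * \<Delta> n \<omega>"
            proof (cases "norm (X' n \<omega> - L' n \<omega>) \<le> 1")
              case True
              have "norm (iexp (u \<bullet> X' n \<omega>) - iexp (u \<bullet> L' n \<omega>)) \<le> \<bar>u \<bullet> X' n \<omega> - u \<bullet> L' n \<omega>\<bar>" by (rule norm_iexp_diff_le)
              also have "\<dots> = \<bar>u \<bullet> (X' n \<omega> - L' n \<omega>)\<bar>" by (simp add: inner_diff_right)
              also have "\<dots> \<le> norm u * norm (X' n \<omega> - L' n \<omega>)" by (rule Cauchy_Schwarz_ineq2)
              also have "\<dots> \<le> (2 + norm u) * \<Delta> n \<omega>" using True by (simp add: \<Delta>_def mult_right_mono)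
              finally show ?thesis .
            next
              case False
              have "norm (iexp (u \<bullet> X' n \<omega>) - iexp (u \<bullet> L' n \<omega>)) \<le> norm (iexp (u \<bullet> X' n \<omega>)) + norm (iexp (u \<bullet> L' n \<omega>))"
                by (rule norm_triangle_ineq4)
              also have "\<dots> = 2" by simp
              also have "\<dots> \<le> (2 + norm u) * \<Delta> n \<omega>" using False by (simp add: \<Delta>_def)
              finally show ?thesis .
            qed
          qed
          finally show "norm ((CLINT \<omega>|M. iexp (u \<bullet> X' n \<omega>)) - (CLINT \<omega>|M. iexp (u \<bullet> L' n \<omega>)))
            \<le> (2 + norm u) * expectation (\<Delta> n)" by simp
        qed
        show "(\<lambda>n. (2 + norm u) * expectation (\<Delta> n)) \<longlonglongrightarrow> 0" using tendsto_mult_left[OF \<Delta>_lim, of "2 + norm u"] by simp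
      qed
    qed
    fix \<eta> :: real assume \<eta>: "0 < \<eta>"
    define K where "K = sqrt (2 * (c + 1) / \<eta>)"
    have K: "0 < K" "c / K\<^sup>2 < \<eta> / 2"
      using \<eta> c0 by (auto simp: K_def field_simps)
    have "\<forall>\<^sub>F n in sequentially. expectation (\<Delta> n) < \<eta> / 2" by (rule order_tendstoD(2)[OF \<Delta>_lim]) (use \<eta> in simp)
    then have "\<forall>\<^sub>F n in sequentially. prob {\<omega> \<in> space M. K + 1 < norm (X' n \<omega>)} \<le> \<eta>"
    proof eventually_elim
      case (elim n)
      let ?I = "indicat_real {\<omega> \<in> space M. K < norm (L' n \<omega>)}"
      let ?J = "indicat_real {\<omega> \<in> space M. K + 1 < norm (X' n \<omega>)}"
      have iI: "integrable M ?I" "integrable M ?J" by (rule integrable_const_bound[where B = 1]; auto)+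
      have "expectation ?J \<le> expectation (\<lambda>\<omega>. \<Delta> n \<omega> + ?I \<omega>)"
      proof (rule integral_mono)
        fix \<omega> assume "\<omega> \<in> space M"
        have "norm (X' n \<omega>) \<le> norm (X' n \<omega> - L' n \<omega>) + norm (L' n \<omega>)"
          using norm_triangle_ineq[of "X' n \<omega> - L' n \<omega>" "L' n \<omega>"] by simp
        then show "?J \<omega> \<le> \<Delta> n \<omega> + ?I \<omega>" using \<open>\<omega> \<in> space M\<close> by (auto simp: \<Delta>_def indicator_def)
      qed (use iI \<Delta>_int in auto)
      also have "\<dots> = expectation (\<Delta> n) + prob {\<omega> \<in> space M. K < norm (L' n \<omega>)}" using iI \<Delta>_int by simp
      finally have "prob {\<omega> \<in> space M. K + 1 < norm (X' n \<omega>)}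
          \<le> expectation (\<Delta> n) + prob {\<omega> \<in> space M. K < norm (L' n \<omega>)}" by simp
      then show ?case using elim cheb[OF K(1), of n] K(2) by linarith
    qed
    then show "\<exists>K. \<forall>\<^sub>F n in sequentially. prob {\<omega> \<in> space M. K < norm (X' n \<omega>)} \<le> \<eta>" by blast
  qed
  then show ?thesis
    unfolding converges_in_distribution_def X'_def by (blast intro: LIMSEQ_imp_Suc)
qed

section \<open>Consistency\<close>

lemma mult_half_inverse: "a \<noteq> 0 \<Longrightarrow> a * (1 / (2 * a)) = 1 / 2" for a :: real
  by simp

text \<open>The square root is the Euclidean norm of the pair \<open>(a, c * y)\<close>, so this is
  the reverse triangle inequality in the plane.\<close>

lemma abs_sqrt_diff_le:
  fixes a c y y' :: real
  shows "\<bar>sqrt (a\<^sup>2 + (c * y)\<^sup>2) - sqrt (a\<^sup>2 + (c * y')\<^sup>2)\<bar> \<le> \<bar>c\<bar> * \<bar>y - y'\<bar>"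
proof -
  have "\<bar>norm (a, c * y) - norm (a, c * y')\<bar> \<le> norm ((a, c * y) - (a, c * y'))" by (rule norm_triangle_ineq3)
  then show ?thesis by (simp add: norm_Pair abs_mult power_mult_distrib real_sqrt_mult flip: right_diff_distrib)
qed

context pos_param
begin

definition sd_low :: real where "sd_low = sqrt (\<theta> $ 3)"
definition sd_lip :: real where "sd_lip = sqrt (\<theta> $ 3 * \<theta> $ 4)"

lemma sd_low_pos: "0 < sd_low" and sd_lip_pos: "0 < sd_lip"
  using pos3 pos4 by (simp_all add: sd_low_def sd_lip_def)

lemma cond_sd_alt: "cond_sd \<theta> y = sqrt (sd_low\<^sup>2 + (sd_lip * y)\<^sup>2)"
  using pos3 pos4 by (simp add: cond_sd_def sd_low_def sd_lip_def power_mult_distrib algebra_simps)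

lemma cond_sd_lipschitz: "\<bar>cond_sd \<theta> y - cond_sd \<theta> y'\<bar> \<le> sd_lip * \<bar>y - y'\<bar>"
  unfolding cond_sd_alt using abs_sqrt_diff_le[of sd_low sd_lip y y'] sd_lip_pos by simp

lemma measurable_cond_sd [measurable]: "cond_sd \<theta> \<in> borel_measurable borel"
  unfolding cond_sd_def[abs_def] by measurable

lemma inverse_cond_sd_le': "1 / cond_sd \<theta> y \<le> 1 / sd_low"
  using inverse_cond_sd_le by (simp add: sd_low_def)

lemma inverse_cond_sd_lipschitz: "\<bar>1 / cond_sd \<theta> y - 1 / cond_sd \<theta> y'\<bar> \<le> sd_lip / sd_low\<^sup>2 * \<bar>y - y'\<bar>"
proof -
  have p: "0 < cond_sd \<theta> y" "0 < cond_sd \<theta> y'" by (rule cond_sd_pos)+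
  have "\<bar>1 / cond_sd \<theta> y - 1 / cond_sd \<theta> y'\<bar>
      = \<bar>cond_sd \<theta> y' - cond_sd \<theta> y\<bar> * (1 / cond_sd \<theta> y * (1 / cond_sd \<theta> y'))"
    using p by (simp add: field_simps abs_divide abs_mult)
  also have "\<dots> \<le> (sd_lip * \<bar>y - y'\<bar>) * (1 / sd_low * (1 / sd_low))"
    using p sd_low_pos cond_sd_lipschitz[of y' y]
    by (intro mult_mono inverse_cond_sd_le') (auto simp: abs_minus_commute)
  finally show ?thesis by (simp add: power2_eq_square)
qed

lemma reg_inverse_sd: "reg 0 (\<lambda>y e e'. 1 / cond_sd \<theta> y)"
proof (rule reg_of_lag[where C = "1 / sd_low + sd_lip / sd_low\<^sup>2"])
  show "\<bar>1 / cond_sd \<theta> y\<bar> \<le> 1 / sd_low + sd_lip / sd_low\<^sup>2" for y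
  proof -
    have "0 \<le> sd_lip / sd_low\<^sup>2" using sd_lip_pos by simp
    then show ?thesis using inverse_cond_sd_le'[of y] cond_sd_pos[of y] by simp
  qed
  show "\<bar>1 / cond_sd \<theta> y - 1 / cond_sd \<theta> y'\<bar> \<le> (1 / sd_low + sd_lip / sd_low\<^sup>2) * \<bar>y - y'\<bar>" for y y'
  proof -
    have "0 \<le> 1 / sd_low * \<bar>y - y'\<bar>" using sd_low_pos by simp
    then show ?thesis using inverse_cond_sd_lipschitz[of y y'] unfolding distrib_right by linarith
  qed
qed measurable

lemma reg_lag_over_sd: "reg 0 (\<lambda>y e e'. y / cond_sd \<theta> y)"
proof (rule reg_of_lag[where C = "1 / sd_lip + 2 / sd_low"])
  have b: "\<bar>y / cond_sd \<theta> y\<bar> \<le> 1 / sd_lip" for y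
    using lag_over_cond_sd_le[of y] cond_sd_pos[of y] by (simp add: sd_lip_def abs_divide)
  show "\<bar>y / cond_sd \<theta> y\<bar> \<le> 1 / sd_lip + 2 / sd_low" for y
  proof -
    have "0 \<le> 2 / sd_low" using sd_low_pos by simp
    then show ?thesis using b[of y] by linarith
  qed
  show "\<bar>y / cond_sd \<theta> y - y' / cond_sd \<theta> y'\<bar> \<le> (1 / sd_lip + 2 / sd_low) * \<bar>y - y'\<bar>" for y y'
  proof -
    have p: "0 < cond_sd \<theta> y" "0 < cond_sd \<theta> y'" by (rule cond_sd_pos)+
    \<comment> \<open>Arranged so that the unbounded \<open>y'\<close> occurs only in the bounded
      quotient \<open>y' / cond_sd \<theta> y'\<close>.\<close>
    have eq: "y / cond_sd \<theta> y - y' / cond_sd \<theta> y'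
        = (y - y') * (1 / cond_sd \<theta> y) + (y' / cond_sd \<theta> y') * ((cond_sd \<theta> y' - cond_sd \<theta> y) * (1 / cond_sd \<theta> y))"
      using p by (simp add: field_simps)
    have i: "\<bar>1 / cond_sd \<theta> y\<bar> \<le> 1 / sd_low" using inverse_cond_sd_le'[of y] p by simp
    have l: "\<bar>cond_sd \<theta> y' - cond_sd \<theta> y\<bar> \<le> sd_lip * \<bar>y - y'\<bar>"
      using cond_sd_lipschitz[of y' y] by (simp add: abs_minus_commute)
    have "\<bar>(y - y') * (1 / cond_sd \<theta> y)\<bar> \<le> \<bar>y - y'\<bar> * (1 / sd_low)" by (rule abs_mult_le[OF order_refl i])
    moreover have "\<bar>(y' / cond_sd \<theta> y') * ((cond_sd \<theta> y' - cond_sd \<theta> y) * (1 / cond_sd \<theta> y))\<bar>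
        \<le> 1 / sd_lip * (sd_lip * \<bar>y - y'\<bar> * (1 / sd_low))"
      by (rule abs_mult_le[OF b abs_mult_le[OF l i]])
    moreover have "1 / sd_lip * (sd_lip * \<bar>y - y'\<bar> * (1 / sd_low)) = \<bar>y - y'\<bar> * (1 / sd_low)"
      using sd_lip_pos by simp
    moreover have "(1 / sd_lip + 2 / sd_low) * \<bar>y - y'\<bar> = 1 / sd_lip * \<bar>y - y'\<bar> + 2 * (\<bar>y - y'\<bar> * (1 / sd_low))"
      by (simp add: algebra_simps)
    moreover have "0 \<le> 1 / sd_lip * \<bar>y - y'\<bar>" using sd_lip_pos by simp
    ultimately show ?thesis unfolding eq by linarith
  qed
qed measurable

lemma square_over_eq: "y\<^sup>2 / (1 + \<theta> $ 4 * y\<^sup>2) = \<theta> $ 3 * ((y / cond_sd \<theta> y) * (y / cond_sd \<theta> y))"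
proof -
  have "(y / cond_sd \<theta> y) * (y / cond_sd \<theta> y) = y\<^sup>2 / (\<theta> $ 3 * (1 + \<theta> $ 4 * y\<^sup>2))"
    by (simp add: power2_eq_square[symmetric] power_divide cond_sd_square)
  then show ?thesis using pos3 by simp
qed

lemma reg_square_over: "reg 0 (\<lambda>y e e'. y\<^sup>2 / (1 + \<theta> $ 4 * y\<^sup>2))"
  unfolding square_over_eq by (intro reg_cmult reg_lag_mult reg_lag_over_sd)

lemma reg_mean_shift: "reg 0 (\<lambda>y e e'. mean_shift \<theta> h y)"
proof -
  have "mean_shift \<theta> h y = h $ 1 * (1 / cond_sd \<theta> y) + h $ 2 * (y / cond_sd \<theta> y)" for y
    by (simp add: mean_shift_def add_divide_distrib)
  then show ?thesis by (simp only:) (intro reg_add reg_cmult reg_inverse_sd reg_lag_over_sd)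
qed

lemma reg_scale4: "reg 0 (\<lambda>y e e'. scale4 \<theta> h y)"
  unfolding scale4_def by (intro reg_cmult reg_square_over)

lemma ln_cond_sd_lipschitz: "\<bar>ln (cond_sd \<theta> y) - ln (cond_sd \<theta> y')\<bar> \<le> sd_lip / sd_low * \<bar>y - y'\<bar>"
proof -
  have le: "ln (cond_sd \<theta> y) - ln (cond_sd \<theta> y') \<le> sd_lip / sd_low * \<bar>y - y'\<bar>" for y y'
  proof -
    have p: "0 < cond_sd \<theta> y" "0 < cond_sd \<theta> y'" by (rule cond_sd_pos)+
    have "ln (cond_sd \<theta> y) - ln (cond_sd \<theta> y') \<le> (cond_sd \<theta> y - cond_sd \<theta> y') * (1 / cond_sd \<theta> y')"
      using p ln_diff_le[of "cond_sd \<theta> y" "cond_sd \<theta> y'"] by simp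
    also have "\<dots> \<le> \<bar>(cond_sd \<theta> y - cond_sd \<theta> y') * (1 / cond_sd \<theta> y')\<bar>" by (rule abs_ge_self)
    also have "\<dots> \<le> sd_lip * \<bar>y - y'\<bar> * (1 / sd_low)"
      using inverse_cond_sd_le'[of y'] p by (intro abs_mult_le cond_sd_lipschitz) simp
    finally show ?thesis by simp
  qed
  show ?thesis using le[of y y'] le[of y' y] by (simp add: abs_le_iff abs_minus_commute)
qed

end

lemma log_ratio_le:
  assumes "pos_param \<theta>" "pos_param \<theta>'"
  shows "ln (\<theta> $ 3 * (1 + \<theta> $ 4 * y\<^sup>2)) - ln (\<theta>' $ 3 * (1 + \<theta>' $ 4 * y\<^sup>2))
    \<le> \<theta> $ 3 / \<theta>' $ 3 * (1 + \<theta> $ 4 / \<theta>' $ 4)"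
proof -
  interpret a: pos_param \<theta> by fact
  interpret b: pos_param \<theta>' by fact
  define u v where "u = \<theta> $ 3 * (1 + \<theta> $ 4 * y\<^sup>2)" and "v = \<theta>' $ 3 * (1 + \<theta>' $ 4 * y\<^sup>2)"
  have uv: "0 < u" "0 < v" unfolding u_def v_def by (rule a.var_pos b.var_pos)+
  have "ln u - ln v = ln (u / v)" using uv by (simp add: ln_div)
  also have "\<dots> \<le> u / v" using ln_le_minus_one[of "u / v"] uv by simp
  also have "u / v = \<theta> $ 3 / \<theta>' $ 3 * ((1 + \<theta> $ 4 * y\<^sup>2) / (1 + \<theta>' $ 4 * y\<^sup>2))" by (simp add: u_def v_def)
  also have "\<dots> \<le> \<theta> $ 3 / \<theta>' $ 3 * (1 + \<theta> $ 4 / \<theta>' $ 4)"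
  proof (rule mult_left_mono)
    have "(1 + \<theta> $ 4 / \<theta>' $ 4) * (1 + \<theta>' $ 4 * y\<^sup>2) = 1 + \<theta> $ 4 * y\<^sup>2 + (\<theta>' $ 4 * y\<^sup>2 + \<theta> $ 4 / \<theta>' $ 4)"
      using b.pos4 by (simp add: field_simps)
    moreover have "0 \<le> \<theta>' $ 4 * y\<^sup>2 + \<theta> $ 4 / \<theta>' $ 4" using a.pos4 b.pos4 by simp
    ultimately have "1 + \<theta> $ 4 * y\<^sup>2 \<le> (1 + \<theta> $ 4 / \<theta>' $ 4) * (1 + \<theta>' $ 4 * y\<^sup>2)" by linarith
    then show "(1 + \<theta> $ 4 * y\<^sup>2) / (1 + \<theta>' $ 4 * y\<^sup>2) \<le> 1 + \<theta> $ 4 / \<theta>' $ 4"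
      using b.one_plus_pos[of y] by (simp add: pos_divide_le_eq)
    show "0 \<le> \<theta> $ 3 / \<theta>' $ 3" using a.pos3 b.pos3 by simp
  qed
  finally show ?thesis by (simp add: u_def v_def)
qed

text \<open>Each logarithm alone grows with \<open>|y|\<close>. The ratio of the two variances is
  bounded above and below uniformly in \<open>y\<close>, and the Lipschitz property is inherited
  from each logarithm separately.\<close>

lemma reg_log_ratio:
  assumes "pos_param \<theta>" "pos_param \<theta>'"
  shows "reg 0 (\<lambda>y e e'. ln (\<theta> $ 3 * (1 + \<theta> $ 4 * y\<^sup>2)) - ln (\<theta>' $ 3 * (1 + \<theta>' $ 4 * y\<^sup>2)))"
proof -
  interpret a: pos_param \<theta> by fact
  interpret b: pos_param \<theta>' by fact
  define R where "R = \<theta> $ 3 / \<theta>' $ 3 * (1 + \<theta> $ 4 / \<theta>' $ 4) + \<theta>' $ 3 / \<theta> $ 3 * (1 + \<theta>' $ 4 / \<theta> $ 4)"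
  have R1: "0 \<le> \<theta> $ 3 / \<theta>' $ 3 * (1 + \<theta> $ 4 / \<theta>' $ 4)" "0 \<le> \<theta>' $ 3 / \<theta> $ 3 * (1 + \<theta>' $ 4 / \<theta> $ 4)"
    using a.pos3 b.pos3 a.pos4 b.pos4 by auto
  define Q where "Q = 2 * (a.sd_lip / a.sd_low) + 2 * (b.sd_lip / b.sd_low)"
  have Q0: "0 \<le> Q" using a.sd_lip_pos a.sd_low_pos b.sd_lip_pos b.sd_low_pos by (simp add: Q_def)
  have R0: "0 \<le> R" using R1 by (simp add: R_def)
  have lnsd: "ln (\<theta> $ 3 * (1 + \<theta> $ 4 * y\<^sup>2)) = 2 * ln (cond_sd \<theta> y)"
    "ln (\<theta>' $ 3 * (1 + \<theta>' $ 4 * y\<^sup>2)) = 2 * ln (cond_sd \<theta>' y)" for y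
    using a.var_pos[of y] b.var_pos[of y] by (simp_all add: cond_sd_def ln_sqrt)
  show ?thesis
  proof (rule reg_of_lag[where C = "R + Q"])
    show "\<bar>ln (\<theta> $ 3 * (1 + \<theta> $ 4 * y\<^sup>2)) - ln (\<theta>' $ 3 * (1 + \<theta>' $ 4 * y\<^sup>2))\<bar> \<le> R + Q" for y
      using log_ratio_le[OF assms, of y] log_ratio_le[OF assms(2,1), of y] R1 Q0 unfolding R_def by linarith
    show "\<bar>ln (\<theta> $ 3 * (1 + \<theta> $ 4 * y\<^sup>2)) - ln (\<theta>' $ 3 * (1 + \<theta>' $ 4 * y\<^sup>2))
        - (ln (\<theta> $ 3 * (1 + \<theta> $ 4 * y'\<^sup>2)) - ln (\<theta>' $ 3 * (1 + \<theta>' $ 4 * y'\<^sup>2)))\<bar> \<le> (R + Q) * \<bar>y - y'\<bar>" for y y'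
    proof -
      have "0 \<le> R * \<bar>y - y'\<bar>" using R0 by simp
      moreover have "(R + Q) * \<bar>y - y'\<bar> = R * \<bar>y - y'\<bar>
          + (2 * (a.sd_lip / a.sd_low * \<bar>y - y'\<bar>) + 2 * (b.sd_lip / b.sd_low * \<bar>y - y'\<bar>))"
        by (simp add: Q_def algebra_simps)
      ultimately show ?thesis
        unfolding lnsd using a.ln_cond_sd_lipschitz[of y y'] b.ln_cond_sd_lipschitz[of y y'] by linarith
    qed
  qed measurable
qed

section \<open>Residuals of an arbitrary parameter, Kullback divergence and consistency\<close>

locale qmle = bilinear_process +
  assumes b_nonzero: "b \<noteq> 0"
begin

definition true_param :: "real ^ 4" where
  "true_param = vector [\<mu>, \<phi>, \<sigma>2, b\<^sup>2]"

lemma true_param_nth [simp]: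
  "true_param $ 1 = \<mu>" "true_param $ 2 = \<phi>" "true_param $ 3 = \<sigma>2" "true_param $ 4 = b\<^sup>2"
  by (simp_all add: true_param_def)

sublocale true: pos_param true_param
  by unfold_locales (simp_all add: variance_pos b_nonzero)

definition model :: "real \<Rightarrow> real \<Rightarrow> real \<Rightarrow> real" where
  "model y e e' = \<mu> + \<phi> * y + b * y * e + e'"

definition eta :: "real ^ 4 \<Rightarrow> real \<Rightarrow> real \<Rightarrow> real \<Rightarrow> real" where
  "eta \<theta> y e e' = resid \<theta> y (model y e e')"

definition bias :: "real ^ 4 \<Rightarrow> real \<Rightarrow> real" where
  "bias \<theta> y = (\<mu> - \<theta> $ 1) * (1 / cond_sd \<theta> y) + (\<phi> - \<theta> $ 2) * (y / cond_sd \<theta> y)"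

definition load1 :: "real ^ 4 \<Rightarrow> real \<Rightarrow> real" where
  "load1 \<theta> y = b * (y / cond_sd \<theta> y)"

definition load2 :: "real ^ 4 \<Rightarrow> real \<Rightarrow> real" where
  "load2 \<theta> y = 1 / cond_sd \<theta> y"

text \<open>The true conditional variance divided by the one that \<open>\<theta>\<close> assigns,
  which is the conditional mean of the squared noise part of the residual.\<close>

definition var_ratio :: "real ^ 4 \<Rightarrow> real \<Rightarrow> real" where
  "var_ratio \<theta> y = \<sigma>2 * (load1 \<theta> y * load1 \<theta> y + load2 \<theta> y * load2 \<theta> y)"

text \<open>The squared residual minus its conditional mean given the lag, laid out as a
  \<open>quad_form\<close> so that it is centred by construction.\<close>

definition eta_sq_cent :: "real ^ 4 \<Rightarrow> real \<Rightarrow> real \<Rightarrow> real \<Rightarrow> real" where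
  "eta_sq_cent \<theta> = quad_form (\<lambda>y. 2 * (bias \<theta> y * load1 \<theta> y)) (\<lambda>y. 2 * (bias \<theta> y * load2 \<theta> y))
     (\<lambda>y. load1 \<theta> y * load1 \<theta> y) (\<lambda>y. load2 \<theta> y * load2 \<theta> y) (\<lambda>y. 2 * (load1 \<theta> y * load2 \<theta> y))"

lemma eta_eq: "eta \<theta> y e e' = bias \<theta> y + load1 \<theta> y * e + load2 \<theta> y * e'"
  by (simp add: eta_def resid_def model_def bias_def load1_def load2_def add_divide_distrib
      diff_divide_distrib algebra_simps)

lemma eta_square: "(eta \<theta> y e e')\<^sup>2 = (bias \<theta> y * bias \<theta> y + var_ratio \<theta> y) + eta_sq_cent \<theta> y e e'"
  by (simp add: eta_eq eta_sq_cent_def quad_form_def var_ratio_def power2_eq_square algebra_simps)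

lemma reg_bias: "pos_param \<theta> \<Longrightarrow> reg 0 (\<lambda>y e e'. bias \<theta> y)"
  and reg_load1: "pos_param \<theta> \<Longrightarrow> reg 0 (\<lambda>y e e'. load1 \<theta> y)"
  and reg_load2: "pos_param \<theta> \<Longrightarrow> reg 0 (\<lambda>y e e'. load2 \<theta> y)"
  unfolding bias_def load1_def load2_def
  by (intro reg_add reg_cmult pos_param.reg_inverse_sd pos_param.reg_lag_over_sd; assumption)+

lemma reg_var_ratio: "pos_param \<theta> \<Longrightarrow> reg 0 (\<lambda>y e e'. var_ratio \<theta> y)"
  unfolding var_ratio_def by (intro reg_cmult reg_add reg_lag_mult reg_load1 reg_load2)

lemma reg_eta:
  assumes "pos_param \<theta>"
  shows "reg 1 (eta \<theta>)"
proof -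
  have "reg 1 (\<lambda>y e e'. bias \<theta> y + load1 \<theta> y * e + load2 \<theta> y * e')"
    by (intro reg_add reg_lag_mult reg_first reg_second reg_load1 reg_load2 reg_mono[OF reg_bias] assms) simp
  then show ?thesis by (simp add: eta_eq[abs_def])
qed

lemma reg_eta_square: "pos_param \<theta> \<Longrightarrow> reg 2 (\<lambda>y e e'. (eta \<theta> y e e')\<^sup>2)"
  unfolding power2_eq_square by (intro reg_mult2 reg_eta)

lemma cent_eta_sq_cent: "pos_param \<theta> \<Longrightarrow> cent (eta_sq_cent \<theta>)"
  unfolding eta_sq_cent_def
  by (intro cent_quad_form reg_cmult reg_lag_mult reg_load1 reg_load2 reg_bias)

lemma var_ratio_eq:
  assumes "pos_param \<theta>"
  shows "var_ratio \<theta> y = (\<sigma>2 * (1 + b\<^sup>2 * y\<^sup>2)) / (\<theta> $ 3 * (1 + \<theta> $ 4 * y\<^sup>2))"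
proof -
  interpret pos_param \<theta> by fact
  have "var_ratio \<theta> y = \<sigma>2 * (1 + b\<^sup>2 * y\<^sup>2) / (cond_sd \<theta> y)\<^sup>2"
    by (simp add: var_ratio_def load1_def load2_def power2_eq_square algebra_simps add_divide_distrib)
  then show ?thesis by (simp add: cond_sd_square)
qed

lemma var_ratio_true: "var_ratio true_param y = 1"
  using true.var_pos[of y] unfolding var_ratio_eq[OF true.pos_param_axioms] true_param_nth
  by (metis divide_self less_irrefl)

lemma bias_true: "bias true_param y = 0"
  by (simp add: bias_def)

definition dll :: "real ^ 4 \<Rightarrow> real \<Rightarrow> real \<Rightarrow> real \<Rightarrow> real" where
  "dll \<theta> y e e' = ll \<theta> y (model y e e') - ll true_param y (model y e e')"

text \<open>Twice the Kullback divergence of the normal law with the conditional mean and variance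
  under \<open>\<theta>\<close> from the one under the true parameter. The innovations need not be
  normal: only their first two moments enter the conditional mean of \<open>dll\<close>.\<close>

definition divergence :: "real ^ 4 \<Rightarrow> real \<Rightarrow> real" where
  "divergence \<theta> y = (ln (\<theta> $ 3 * (1 + \<theta> $ 4 * y\<^sup>2)) - ln (true_param $ 3 * (1 + true_param $ 4 * y\<^sup>2)))
     + bias \<theta> y * bias \<theta> y + var_ratio \<theta> y - 1"

lemma ll_model:
  assumes "pos_param \<theta>"
  shows "ll \<theta> y (model y e e') = - (1 / 2) * (ln (\<theta> $ 3 * (1 + \<theta> $ 4 * y\<^sup>2)) + (eta \<theta> y e e')\<^sup>2)"
proof -
  interpret pos_param \<theta> by fact
  show ?thesis by (simp add: ll_def eta_def resid_def power_divide cond_sd_square)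
qed

lemma dll_eq:
  assumes "pos_param \<theta>"
  shows "dll \<theta> y e e' = (- (1 / 2)) * divergence \<theta> y + (- (1 / 2)) * (eta_sq_cent \<theta> y e e' - eta_sq_cent true_param y e e')"
  unfolding dll_def ll_model[OF assms] ll_model[OF true.pos_param_axioms] eta_square divergence_def
  by (simp add: var_ratio_true bias_true algebra_simps)

lemma reg_divergence: "pos_param \<theta> \<Longrightarrow> reg 0 (\<lambda>y e e'. divergence \<theta> y)"
  unfolding divergence_def
  by (intro reg_add reg_diff reg_lag_mult reg_bias reg_var_ratio reg_const reg_log_ratio true.pos_param_axioms)

lemma reg_dll:
  assumes "pos_param \<theta>"
  shows "reg 2 (dll \<theta>)"
proof -
  have "reg 2 (\<lambda>y e e'. (- (1 / 2)) * divergence \<theta> y + (- (1 / 2)) * (eta_sq_cent \<theta> y e e' - eta_sq_cent true_param y e e'))"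
    by (intro reg_add reg_diff reg_cmult reg_mono[OF reg_divergence] cent_reg cent_eta_sq_cent assms true.pos_param_axioms) simp
  then show ?thesis by (simp add: dll_eq[OF assms, abs_def])
qed

text \<open>It is the sum of \<open>q - 1 - ln q\<close>, with \<open>q\<close> the variance ratio,
  and the squared bias. Both are nonnegative and vanish only for equal variances and equal means,
  which are affine relations in \<open>y\<close> and in its square.\<close>

lemma divergence_nonneg:
  assumes "pos_param \<theta>"
  shows "0 \<le> divergence \<theta> y"
    and "divergence \<theta> y = 0 \<Longrightarrow> (\<mu> - \<theta> $ 1) + (\<phi> - \<theta> $ 2) * y = 0"
    and "divergence \<theta> y = 0 \<Longrightarrow> (\<theta> $ 3 - \<sigma>2) + (\<theta> $ 3 * \<theta> $ 4 - \<sigma>2 * b\<^sup>2) * y\<^sup>2 = 0"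
proof -
  interpret pos_param \<theta> by fact
  define v v0 where "v = \<theta> $ 3 * (1 + \<theta> $ 4 * y\<^sup>2)" and "v0 = \<sigma>2 * (1 + b\<^sup>2 * y\<^sup>2)"
  have v: "0 < v" "0 < v0" using var_pos[of y] true.var_pos[of y] by (simp_all add: v_def v0_def)
  define q where "q = v0 / v"
  have q: "0 < q" using v by (simp add: q_def)
  have eq: "divergence \<theta> y = (q - 1 - ln q) + bias \<theta> y * bias \<theta> y"
    using v by (simp add: divergence_def var_ratio_eq[OF assms] q_def ln_div flip: v_def v0_def)
  have le: "0 \<le> q - 1 - ln q" "0 \<le> bias \<theta> y * bias \<theta> y" using ln_le_minus_one[OF q] by simp_all
  show "0 \<le> divergence \<theta> y" unfolding eq using le by simp
  assume "divergence \<theta> y = 0"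
  then have z: "q - 1 - ln q = 0" "bias \<theta> y * bias \<theta> y = 0" using le unfolding eq by linarith+
  have "bias \<theta> y = ((\<mu> - \<theta> $ 1) + (\<phi> - \<theta> $ 2) * y) / cond_sd \<theta> y"
    by (simp add: bias_def add_divide_distrib)
  then show "(\<mu> - \<theta> $ 1) + (\<phi> - \<theta> $ 2) * y = 0" using z(2) cond_sd_pos[of y] by simp
  have "q = 1" using ln_eq_minus_one[OF q] z(1) by simp
  then have "v0 = v" using v by (simp add: q_def)
  then show "(\<theta> $ 3 - \<sigma>2) + (\<theta> $ 3 * \<theta> $ 4 - \<sigma>2 * b\<^sup>2) * y\<^sup>2 = 0" by (simp add: v_def v0_def algebra_simps)
qed

lemma expectation_lag_zero_iff:
  assumes g: "reg 0 (\<lambda>y e e'. g y)" and nonneg: "\<And>y. 0 \<le> g y"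
    and zero: "expectation (\<lambda>\<omega>. obs (\<lambda>y e e'. g y) 1 (path \<omega>)) = 0"
  shows "AE \<omega> in M. g (causal t (path \<omega>)) = 0"
proof -
  have g2: "reg 2 (\<lambda>y e e'. g y)" by (rule reg_mono[OF g]) simp
  have "expectation (\<lambda>\<omega>. obs (\<lambda>y e e'. g y) (t + 2) (path \<omega>)) = 0"
    using zero expectation_obs[OF g, of "t + 2" 1] by simp
  then have "expectation (\<lambda>\<omega>. g (causal t (path \<omega>))) = 0" by (simp add: obs_def)
  moreover have int: "integrable M (\<lambda>\<omega>. g (causal t (path \<omega>)))" using integrable_obs[OF g2, of "t + 2"] by (simp add: obs_def)
  ultimately show ?thesis using integral_nonneg_eq_0_iff_AE[OF int] nonneg by simp
qed

text \<open>The mean of \<open>dll\<close> is minus half the mean divergence, as the residual parts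
  are centred. Mean zero would force the divergence to vanish along the process, and nondegeneracy
  then identifies the mean coordinates from the affine relation and the variance coordinates from
  the one in the square.\<close>

lemma expectation_dll_neg:
  assumes \<theta>: "pos_param \<theta>" and ne: "\<theta> \<noteq> true_param"
  shows "expectation (\<lambda>\<omega>. obs (dll \<theta>) 1 (path \<omega>)) < 0"
proof -
  interpret pos_param \<theta> by fact
  let ?G = "\<lambda>y (e :: real) (e' :: real). divergence \<theta> y"
  have G: "reg 2 ?G" by (rule reg_mono[OF reg_divergence[OF \<theta>]]) simp
  note C = cent_eta_sq_cent[OF \<theta>] cent_eta_sq_cent[OF true.pos_param_axioms]
  have "expectation (\<lambda>\<omega>. obs (dll \<theta>) 1 (path \<omega>))
      = expectation (\<lambda>\<omega>. (- (1 / 2)) * obs ?G 1 (path \<omega>)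
          + (- (1 / 2)) * (obs (eta_sq_cent \<theta>) 1 (path \<omega>) - obs (eta_sq_cent true_param) 1 (path \<omega>)))"
    by (simp only: obs_def dll_eq[OF \<theta>])
  also have "\<dots> = (- (1 / 2)) * expectation (\<lambda>\<omega>. obs ?G 1 (path \<omega>))"
    using integrable_obs[OF G, of 1] C[THEN cent_reg, THEN integrable_obs, of 1] C[THEN expectation_cent, of 1] by simp
  finally have eq: "expectation (\<lambda>\<omega>. obs (dll \<theta>) 1 (path \<omega>)) = (- (1 / 2)) * expectation (\<lambda>\<omega>. obs ?G 1 (path \<omega>))" .
  have "0 \<le> expectation (\<lambda>\<omega>. obs ?G 1 (path \<omega>))" using divergence_nonneg(1)[OF \<theta>] by (simp add: obs_def)
  moreover have "expectation (\<lambda>\<omega>. obs ?G 1 (path \<omega>)) \<noteq> 0"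
  proof
    assume "expectation (\<lambda>\<omega>. obs ?G 1 (path \<omega>)) = 0"
    then have ae: "AE \<omega> in M. divergence \<theta> (causal t (path \<omega>)) = 0" for t
      by (intro expectation_lag_zero_iff reg_divergence[OF \<theta>] divergence_nonneg(1)[OF \<theta>])
    have 1: "AE \<omega> in M. (\<mu> - \<theta> $ 1) + (\<phi> - \<theta> $ 2) * causal t (path \<omega>) = 0" for t
      using ae[of t] by eventually_elim (rule divergence_nonneg(2)[OF \<theta>])
    have 2: "AE \<omega> in M. (\<theta> $ 3 - \<sigma>2) + (\<theta> $ 3 * \<theta> $ 4 - \<sigma>2 * b\<^sup>2) * (causal t (path \<omega>))\<^sup>2 = 0" for t
      using ae[of t] by eventually_elim (rule divergence_nonneg(3)[OF \<theta>])
    have "\<theta> $ 1 = \<mu>" "\<theta> $ 2 = \<phi>" using causal_affine_degenerate[OF 1] by simp_all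
    moreover have "\<theta> $ 3 = \<sigma>2" "\<theta> $ 4 = b\<^sup>2"
      using causal_square_affine_degenerate[OF b_nonzero 2] variance_pos by simp_all
    ultimately have "\<theta> = true_param" by (simp add: vec_eq_iff forall_4)
    then show False using ne by simp
  qed
  ultimately show ?thesis unfolding eq by simp
qed

definition llsum :: "real ^ 4 \<Rightarrow> nat \<Rightarrow> 'a \<Rightarrow> real" where
  "llsum \<theta> n \<omega> = (\<Sum>i<n. obs (\<lambda>y e e'. ll \<theta> y (model y e e')) (int i + 1) (path \<omega>))"

text \<open>The strong law is applied only at the centre of the ball. Throughout the ball the
  first-order bound has a common envelope, the squared residual at the centre, to which the strong
  law applies too; this avoids a uniform law of large numbers.\<close>

lemma local_inferiority:
  assumes \<theta>: "pos_param \<theta>" and ne: "\<theta> \<noteq> true_param"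
  obtains r where "0 < r"
    "AE \<omega> in M. \<forall>\<^sub>F n in sequentially. \<forall>\<theta>'\<in>ball \<theta> r. llsum \<theta>' n \<omega> < llsum true_param n \<omega>"
proof -
  interpret pos_param \<theta> by fact
  \<comment> \<open>A third of the mean loss: averages of \<open>dll\<close> are eventually below
    \<open>- (2 * c)\<close>, and moving within the ball costs at most \<open>c\<close>.\<close>
  define c where "c = - expectation (\<lambda>\<omega>. obs (dll \<theta>) 1 (path \<omega>)) / 3"
  have c: "0 < c" using expectation_dll_neg[OF \<theta> ne] by (simp add: c_def)
  let ?H = "\<lambda>y e e'. 1 + (eta \<theta> y e e')\<^sup>2"
  have H: "reg 2 ?H" by (intro reg_add reg_eta_square[OF \<theta>] reg_mono[OF reg_const]) simp
  define K where "K = expectation (\<lambda>\<omega>. obs ?H 1 (path \<omega>)) + 1"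
  have K: "0 < K"
  proof -
    have "0 \<le> expectation (\<lambda>\<omega>. obs ?H 1 (path \<omega>))" by (simp add: obs_def)
    then show ?thesis by (simp add: K_def)
  qed
  \<comment> \<open>The first entry makes the first-order bound applicable, the second makes its
    cost at most \<open>c\<close>; \<open>lip + 1\<close> keeps the denominators positive.\<close>
  define r where "r = min (1 / (2 * (lip + 1))) (c / (40 * (lip + 1) * K))"
  have r: "0 < r" using lip_nonneg c K by (simp add: r_def)
  have r1: "lip * r \<le> 1 / 2"
  proof -
    have "lip * r \<le> (lip + 1) * (1 / (2 * (lip + 1)))" using lip_nonneg r by (intro mult_mono) (auto simp: r_def)
    also have "\<dots> = 1 / 2" by (rule mult_half_inverse) (use lip_nonneg in linarith)
    finally show ?thesis .
  qed
  have r2: "40 * (lip * r) * K \<le> c"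
  proof -
    have "lip * r \<le> (lip + 1) * (c / (40 * (lip + 1) * K))"
      using lip_nonneg r by (intro mult_mono) (auto simp: r_def)
    also have "\<dots> = c / (40 * K)"
    proof -
      have "a * (c / (40 * a * K)) = c / (40 * K)" if "a \<noteq> 0" for a :: real using that by simp
      moreover have "lip + 1 \<noteq> 0" using lip_nonneg by linarith
      ultimately show ?thesis by blast
    qed
    finally show ?thesis using K by (simp add: field_simps)
  qed
  have "AE \<omega> in M. \<forall>\<^sub>F n in sequentially. \<forall>\<theta>'\<in>ball \<theta> r. llsum \<theta>' n \<omega> < llsum true_param n \<omega>"
    using strong_law_obs[OF reg_dll[OF \<theta>]] strong_law_obs[OF H]
  proof eventually_elim
    case (elim \<omega>)
    have "\<forall>\<^sub>F n in sequentially. (\<Sum>i<n. obs (dll \<theta>) (int i + 1) (path \<omega>)) / real n < - (2 * c)"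
      by (rule order_tendstoD(2)[OF elim(1)]) (use c in \<open>simp add: c_def\<close>)
    moreover have "\<forall>\<^sub>F n in sequentially. (\<Sum>i<n. obs ?H (int i + 1) (path \<omega>)) / real n < K"
      by (rule order_tendstoD(2)[OF elim(2)]) (simp add: K_def)
    ultimately show ?case using eventually_gt_at_top[of 0]
    proof eventually_elim
      case (elim n)
      show ?case
      proof
        fix \<theta>' assume "\<theta>' \<in> ball \<theta> r"
        define h where "h = \<theta>' - \<theta>"
        have hr: "norm h < r" and \<theta>': "\<theta>' = \<theta> + h"
          using \<open>\<theta>' \<in> ball \<theta> r\<close> by (auto simp: h_def dist_norm norm_minus_commute)
        have lh: "lip * norm h \<le> lip * r" using hr lip_nonneg by (intro mult_left_mono) auto
        have step: "ll \<theta>' y (model y e e') - ll true_param y (model y e e') \<le> dll \<theta> y e e' + 40 * (lip * r) * ?H y e e'" for y e e'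
        proof -
          have "\<bar>ll (\<theta> + h) y (model y e e') - ll \<theta> y (model y e e')\<bar> \<le> 40 * (lip * norm h) * (1 + (resid \<theta> y (model y e e'))\<^sup>2)"
            by (rule ll_first_order) (use lh r1 in linarith)
          also have "\<dots> \<le> 40 * (lip * r) * (1 + (resid \<theta> y (model y e e'))\<^sup>2)"
            by (intro mult_right_mono mult_left_mono[OF lh]) auto
          finally show ?thesis by (simp add: dll_def \<theta>' eta_def)
        qed
        have "llsum \<theta>' n \<omega> - llsum true_param n \<omega>
            = (\<Sum>i<n. obs (\<lambda>y e e'. ll \<theta>' y (model y e e') - ll true_param y (model y e e')) (int i + 1) (path \<omega>))"
          by (simp add: llsum_def obs_def sum_subtractf)
        also have "\<dots> \<le> (\<Sum>i<n. obs (dll \<theta>) (int i + 1) (path \<omega>) + 40 * (lip * r) * obs ?H (int i + 1) (path \<omega>))"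
          unfolding obs_def by (intro sum_mono step)
        also have "\<dots> = (\<Sum>i<n. obs (dll \<theta>) (int i + 1) (path \<omega>)) + 40 * (lip * r) * (\<Sum>i<n. obs ?H (int i + 1) (path \<omega>))"
          by (simp add: sum.distrib sum_distrib_left)
        also have "\<dots> < - (2 * c) * real n + 40 * (lip * r) * (K * real n)"
        proof (rule add_less_le_mono)
          show "(\<Sum>i<n. obs (dll \<theta>) (int i + 1) (path \<omega>)) < - (2 * c) * real n"
            using elim(1,3) by (simp add: pos_divide_less_eq)
          show "40 * (lip * r) * (\<Sum>i<n. obs ?H (int i + 1) (path \<omega>)) \<le> 40 * (lip * r) * (K * real n)"
            using elim(2,3) r lip_nonneg by (intro mult_left_mono) (simp_all add: pos_divide_less_eq less_imp_le)
        qed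
        also have "\<dots> \<le> - (2 * c) * real n + c * real n"
          using mult_right_mono[OF r2, of "real n"] by (simp add: mult.assoc)
        also have "\<dots> < 0" using c elim(3) by (simp add: algebra_simps)
        finally show "llsum \<theta>' n \<omega> < llsum true_param n \<omega>" by simp
      qed
    qed
  qed
  then show ?thesis using r that by blast
qed

theorem uniform_inferiority:
  assumes compact: "compact \<Theta>" and pos: "\<And>\<theta>. \<theta> \<in> \<Theta> \<Longrightarrow> pos_param \<theta>" and \<delta>: "0 < \<delta>"
  shows "AE \<omega> in M. \<forall>\<^sub>F n in sequentially. \<forall>\<theta>\<in>\<Theta>. \<delta> \<le> dist \<theta> true_param \<longrightarrow> llsum \<theta> n \<omega> < llsum true_param n \<omega>"
proof -
  define K where "K = \<Theta> - ball true_param \<delta>"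
  have "compact K" unfolding K_def using compact by (intro compact_diff) auto
  define inf_ball where "inf_ball \<theta> r \<longleftrightarrow>
    (AE \<omega> in M. \<forall>\<^sub>F n in sequentially. \<forall>\<theta>'\<in>ball \<theta> r. llsum \<theta>' n \<omega> < llsum true_param n \<omega>)" for \<theta> r
  have "\<forall>\<theta>\<in>K. \<exists>r. 0 < r \<and> inf_ball \<theta> r"
  proof
    fix \<theta> assume "\<theta> \<in> K"
    then have p: "pos_param \<theta>" "\<theta> \<noteq> true_param" using pos \<delta> by (auto simp: K_def)
    show "\<exists>r. 0 < r \<and> inf_ball \<theta> r"
      unfolding inf_ball_def by (rule local_inferiority[OF p]) blast
  qed
  then have "\<exists>r. \<forall>\<theta>\<in>K. 0 < r \<theta> \<and> inf_ball \<theta> (r \<theta>)" by (rule bchoice)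
  then obtain r where r: "\<forall>\<theta>\<in>K. 0 < r \<theta> \<and> inf_ball \<theta> (r \<theta>)" ..
  obtain F where F: "F \<subseteq> K" "finite F" "K \<subseteq> (\<Union>\<theta>\<in>F. ball \<theta> (r \<theta>))"
    by (rule compactE_image[OF \<open>compact K\<close>, of K "\<lambda>\<theta>. ball \<theta> (r \<theta>)"]) (use r in auto)
  have "AE \<omega> in M. \<forall>\<theta>\<in>F. \<forall>\<^sub>F n in sequentially. \<forall>\<theta>'\<in>ball \<theta> (r \<theta>). llsum \<theta>' n \<omega> < llsum true_param n \<omega>"
    by (rule AE_finite_allI[OF F(2)]) (use r F(1) in \<open>auto simp: inf_ball_def\<close>)
  then show ?thesis
  proof eventually_elim
    case (elim \<omega>)
    then have "\<forall>\<^sub>F n in sequentially. \<forall>\<theta>\<in>F. \<forall>\<theta>'\<in>ball \<theta> (r \<theta>). llsum \<theta>' n \<omega> < llsum true_param n \<omega>"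
      using F(2) by (simp add: eventually_ball_finite)
    then show ?case
    proof eventually_elim
      case (elim n)
      show ?case
      proof (intro ballI impI)
        fix \<theta> assume "\<theta> \<in> \<Theta>" "\<delta> \<le> dist \<theta> true_param"
        then have "\<theta> \<in> K" by (simp add: K_def dist_commute)
        then obtain \<theta>1 where "\<theta>1 \<in> F" "\<theta> \<in> ball \<theta>1 (r \<theta>1)" using F(3) by blast
        then show "llsum \<theta> n \<omega> < llsum true_param n \<omega>" using elim by blast
      qed
    qed
  qed
qed

end

section \<open>Score and information matrix\<close>

lemma bilinear_component_sum:
  fixes B :: "real ^ 'n \<Rightarrow> real ^ 'm \<Rightarrow> real"
  assumes "bilinear B"
  shows "B h k = (\<Sum>i\<in>UNIV. \<Sum>j\<in>UNIV. h $ i * k $ j * B (axis i 1) (axis j 1))"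
proof -
  have "B h k = B (\<Sum>i\<in>UNIV. h $ i *\<^sub>R axis i 1) (\<Sum>j\<in>UNIV. k $ j *\<^sub>R axis j 1)"
    using basis_expansion[of h] basis_expansion[of k] by (simp add: scalar_mult_eq_scaleR)
  also have "\<dots> = (\<Sum>(i, j)\<in>UNIV \<times> UNIV. B (h $ i *\<^sub>R axis i 1) (k $ j *\<^sub>R axis j 1))"
    by (rule bilinear_sum[OF assms])
  also have "\<dots> = (\<Sum>i\<in>UNIV. \<Sum>j\<in>UNIV. h $ i * k $ j * B (axis i 1) (axis j 1))"
    by (simp add: sum.cartesian_product bilinear_lmul[OF assms] bilinear_rmul[OF assms] mult_ac)
  finally show ?thesis .
qed

definition form_matrix :: "(real ^ 'n \<Rightarrow> real ^ 'n \<Rightarrow> real) \<Rightarrow> real ^ 'n ^ 'n" where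
  "form_matrix B = (\<chi> i j. B (axis i 1) (axis j 1))"

lemma form_matrix:
  assumes "bilinear B"
  shows "h \<bullet> (form_matrix B *v k) = B h k"
  unfolding bilinear_component_sum[OF assms, of h k]
  by (simp add: form_matrix_def inner_vec_def matrix_vector_mult_def sum_distrib_left mult_ac)

text \<open>Reduces uniformity over all directions \<open>h\<close> to the finitely many entries of
  the form, which is what makes a pointwise strong law enough for the Hessian.\<close>

lemma bilinear_abs_le:
  fixes B :: "real ^ 'n \<Rightarrow> real ^ 'n \<Rightarrow> real"
  assumes "bilinear B"
  shows "\<bar>B h h\<bar> \<le> (norm h)\<^sup>2 * (\<Sum>i\<in>UNIV. \<Sum>j\<in>UNIV. \<bar>B (axis i 1) (axis j 1)\<bar>)"
proof -
  have "\<bar>B h h\<bar> \<le> (\<Sum>i\<in>UNIV. \<bar>\<Sum>j\<in>UNIV. h $ i * h $ j * B (axis i 1) (axis j 1)\<bar>)"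
    unfolding bilinear_component_sum[OF assms, of h h] by (rule sum_abs)
  also have "\<dots> \<le> (\<Sum>i\<in>UNIV. \<Sum>j\<in>UNIV. \<bar>h $ i * h $ j * B (axis i 1) (axis j 1)\<bar>)"
    by (intro sum_mono sum_abs)
  also have "\<dots> \<le> (\<Sum>i\<in>UNIV. \<Sum>j\<in>UNIV. (norm h)\<^sup>2 * \<bar>B (axis i 1) (axis j 1)\<bar>)"
  proof (intro sum_mono)
    fix i j :: 'n
    have "\<bar>h $ i * h $ j\<bar> \<le> norm h * norm h" by (intro abs_mult_le component_le_norm_cart)
    then show "\<bar>h $ i * h $ j * B (axis i 1) (axis j 1)\<bar> \<le> (norm h)\<^sup>2 * \<bar>B (axis i 1) (axis j 1)\<bar>"
      by (subst abs_mult) (intro mult_right_mono, auto simp: power2_eq_square)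
  qed
  also have "\<dots> = (norm h)\<^sup>2 * (\<Sum>i\<in>UNIV. \<Sum>j\<in>UNIV. \<bar>B (axis i 1) (axis j 1)\<bar>)"
    by (simp add: sum_distrib_left)
  finally show ?thesis .
qed

lemma linear_component_sum:
  fixes f :: "real ^ 'n \<Rightarrow> real"
  assumes "linear f"
  shows "f u = u \<bullet> (\<chi> i. f (axis i 1))"
proof -
  have "f u = f (\<Sum>i\<in>UNIV. u $ i *\<^sub>R axis i 1)"
    using basis_expansion[of u] by (simp add: scalar_mult_eq_scaleR)
  also have "\<dots> = (\<Sum>i\<in>UNIV. u $ i * f (axis i 1))"
    by (simp add: linear_sum[OF assms] linear_scale[OF assms])
  finally show ?thesis by (simp add: inner_vec_def)
qed

text \<open>The minimum over the compact unit sphere is positive, and homogeneity extends it to all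
  vectors.\<close>

lemma positive_definite_lower_bound:
  fixes A :: "real ^ 'n ^ 'n"
  assumes pos: "\<And>h. h \<noteq> 0 \<Longrightarrow> 0 < h \<bullet> (A *v h)"
  obtains l where "0 < l" "\<And>h. l * (norm h)\<^sup>2 \<le> h \<bullet> (A *v h)"
proof -
  have "continuous_on (sphere 0 1) (\<lambda>h. h \<bullet> (A *v h))"
    by (intro continuous_intros linear_continuous_on matrix_vector_mul_bounded_linear)
  moreover have "sphere 0 1 \<noteq> ({} :: (real ^ 'n) set)" by (simp add: sphere_eq_empty)
  ultimately obtain x where x: "x \<in> sphere 0 1" "\<forall>h\<in>sphere 0 1. x \<bullet> (A *v x) \<le> h \<bullet> (A *v h)"
    using continuous_attains_inf[of "sphere 0 1" "\<lambda>h. h \<bullet> (A *v h)"] by auto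
  show ?thesis
  proof (rule that)
    show "0 < x \<bullet> (A *v x)" using x(1) by (intro pos) auto
    show "x \<bullet> (A *v x) * (norm h)\<^sup>2 \<le> h \<bullet> (A *v h)" for h
    proof (cases "h = 0")
      case False
      define g where "g = (1 / norm h) *\<^sub>R h"
      have h: "h = norm h *\<^sub>R g" using False by (simp add: g_def)
      have "g \<in> sphere 0 1" using False by (simp add: g_def)
      then have "x \<bullet> (A *v x) \<le> g \<bullet> (A *v g)" using x(2) by blast
      then have "x \<bullet> (A *v x) * (norm h)\<^sup>2 \<le> g \<bullet> (A *v g) * (norm h)\<^sup>2" by (rule mult_right_mono) simp
      also have "\<dots> = h \<bullet> (A *v h)"
        by (subst (2 3) h) (simp add: matrix_vector_mult_scaleR power2_eq_square)
      finally show ?thesis .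
    qed simp
  qed
qed

lemma positive_definite_invertible:
  fixes A :: "real ^ 'n ^ 'n"
  assumes pos: "\<And>h. h \<noteq> 0 \<Longrightarrow> 0 < h \<bullet> (A *v h)"
  shows "A ** matrix_inv A = mat 1" "matrix_inv A ** A = mat 1"
proof -
  have "h = 0" if "A *v h = 0" for h using pos[of h] that by (cases "h = 0") auto
  then have "\<exists>B. B ** A = mat 1" unfolding matrix_left_invertible_ker by blast
  then have "invertible A" unfolding invertible_left_inverse .
  then have "A ** matrix_inv A = mat 1 \<and> matrix_inv A ** A = mat 1"
    unfolding invertible_def matrix_inv_def by (rule someI_ex)
  then show "A ** matrix_inv A = mat 1" "matrix_inv A ** A = mat 1" by auto
qed

lemma transpose_matrix_inv:
  fixes A :: "real ^ 'n ^ 'n"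
  assumes sym: "transpose A = A" and inv: "A ** matrix_inv A = mat 1" "matrix_inv A ** A = mat 1"
  shows "transpose (matrix_inv A) = matrix_inv A"
proof -
  have "transpose (matrix_inv A) ** A = mat 1"
    using inv(1) sym by (metis matrix_transpose_mul transpose_mat)
  then have "transpose (matrix_inv A) ** (A ** matrix_inv A) = matrix_inv A"
    by (simp add: matrix_mul_assoc)
  then show ?thesis by (simp add: inv(1))
qed

lemma symmetric_inner:
  fixes A :: "real ^ 'n ^ 'n"
  assumes "transpose A = A"
  shows "u \<bullet> (A *v v) = (A *v u) \<bullet> v"
  by (metis assms dot_lmul_matrix inner_commute transpose_matrix_vector)

lemma linear_mean_shift: "linear (\<lambda>h. mean_shift \<theta> h y)"
  and linear_scale3: "linear (scale3 \<theta>)"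
  and linear_scale4: "linear (\<lambda>h. scale4 \<theta> h y)"
  unfolding linear_iff
  by (simp_all add: mean_shift_def scale3_def scale4_def algebra_simps add_divide_distrib)

lemmas shift_add = linear_add[OF linear_mean_shift] linear_add[OF linear_scale3] linear_add[OF linear_scale4]
lemmas shift_scale = linear_scale[OF linear_mean_shift] linear_scale[OF linear_scale3] linear_scale[OF linear_scale4]

context qmle
begin

abbreviation scale :: "real ^ 4 \<Rightarrow> real \<Rightarrow> real" where
  "scale h y \<equiv> scale3 true_param h + scale4 true_param h y"

abbreviation shift :: "real ^ 4 \<Rightarrow> real \<Rightarrow> real" where
  "shift h y \<equiv> mean_shift true_param h y"

lemma reg_scale: "reg 0 (\<lambda>y e e'. scale h y)"
  by (intro reg_add reg_const true.reg_scale4)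

lemma cent_mult_eta:
  assumes g: "reg 0 (\<lambda>y e e'. g y)"
  shows "cent (\<lambda>y e e'. g y * eta true_param y e e')"
proof -
  have "cent (quad_form (\<lambda>y. g y * load1 true_param y) (\<lambda>y. g y * load2 true_param y) (\<lambda>y. 0) (\<lambda>y. 0) (\<lambda>y. 0))"
    by (intro cent_quad_form reg_lag_mult g reg_load1 reg_load2 true.pos_param_axioms reg_const)
  then show ?thesis by (simp add: quad_form_def[abs_def] eta_eq bias_true distrib_left mult.assoc)
qed

lemma cent_mult_eta_square:
  assumes g: "reg 0 (\<lambda>y e e'. g y)"
  shows "cent (\<lambda>y e e'. g y * ((eta true_param y e e')\<^sup>2 - 1))"
proof -
  let ?a = "load1 true_param" and ?c = "load2 true_param"
  have "cent (quad_form (\<lambda>y. 0) (\<lambda>y. 0) (\<lambda>y. g y * (?a y * ?a y)) (\<lambda>y. g y * (?c y * ?c y)) (\<lambda>y. 2 * (g y * (?a y * ?c y))))"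
    by (intro cent_quad_form reg_lag_mult reg_cmult g reg_load1 reg_load2 true.pos_param_axioms reg_const)
  moreover have "(\<lambda>y e e'. g y * ((eta true_param y e e')\<^sup>2 - 1))
      = quad_form (\<lambda>y. 0) (\<lambda>y. 0) (\<lambda>y. g y * (?a y * ?a y)) (\<lambda>y. g y * (?c y * ?c y)) (\<lambda>y. 2 * (g y * (?a y * ?c y)))"
  proof (intro ext)
    fix y e e'
    have "(eta true_param y e e')\<^sup>2 - 1 = eta_sq_cent true_param y e e'"
      by (simp add: eta_square var_ratio_true bias_true)
    then show "g y * ((eta true_param y e e')\<^sup>2 - 1) = quad_form (\<lambda>y. 0) (\<lambda>y. 0) (\<lambda>y. g y * (?a y * ?a y))
        (\<lambda>y. g y * (?c y * ?c y)) (\<lambda>y. 2 * (g y * (?a y * ?c y))) y e e'"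
      by (simp only:) (simp add: quad_form_def eta_sq_cent_def bias_true algebra_simps)
  qed
  ultimately show ?thesis by (simp only:)
qed

text \<open>The directional derivative of \<open>\<ell>\<^sub>t\<close> at the true parameter.\<close>

definition slin :: "real ^ 4 \<Rightarrow> real \<Rightarrow> real \<Rightarrow> real \<Rightarrow> real" where
  "slin u y e e' = lin_ll (scale u y) (shift u y) (eta true_param y e e')"

definition score_obs :: "real \<Rightarrow> real \<Rightarrow> real \<Rightarrow> real ^ 4" where
  "score_obs y e e' = (\<chi> i. slin (axis i 1) y e e')"

lemma cent_slin: "cent (slin u)"
proof -
  have "cent (\<lambda>y e e'. shift u y * eta true_param y e e' + ((1 / 2) * scale u y) * ((eta true_param y e e')\<^sup>2 - 1))"
    by (intro cent_add cent_mult_eta cent_mult_eta_square reg_cmult true.reg_mean_shift reg_scale)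
  moreover have "slin u = (\<lambda>y e e'. shift u y * eta true_param y e e' + ((1 / 2) * scale u y) * ((eta true_param y e e')\<^sup>2 - 1))"
    by (intro ext) (simp add: slin_def lin_ll_def algebra_simps add_divide_distrib diff_divide_distrib)
  ultimately show ?thesis by (simp only:)
qed

lemma linear_slin: "linear (\<lambda>u. slin u y e e')"
  unfolding linear_iff slin_def lin_ll_def shift_add shift_scale
  by (simp add: algebra_simps add_divide_distrib diff_divide_distrib)

lemma slin_eq: "slin u y e e' = u \<bullet> score_obs y e e'"
  unfolding score_obs_def by (rule linear_component_sum[OF linear_slin])

text \<open>The polarization of \<open>quad_ll\<close> at the true parameter, sorted into a part
  depending on the lag alone and parts centred given the lag. The mean is thus that of the first
  summand, which is manifestly positive semidefinite on the diagonal.\<close>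

definition qbil :: "real ^ 4 \<Rightarrow> real ^ 4 \<Rightarrow> real \<Rightarrow> real \<Rightarrow> real \<Rightarrow> real" where
  "qbil h k y e e' =
     (shift h y * shift k y + (1 / 2) * (scale h y * scale k y))
     + (shift h y * scale k y + shift k y * scale h y) * eta true_param y e e'
     + (scale3 true_param h * scale3 true_param k + (1 / 2) * (scale3 true_param h * scale4 true_param k y
          + scale4 true_param h y * scale3 true_param k) + scale4 true_param h y * scale4 true_param k y)
       * ((eta true_param y e e')\<^sup>2 - 1)"

lemma qbil_diag:
  "qbil h h y e e' = quad_ll (scale3 true_param h) (scale4 true_param h y) (shift h y) (eta true_param y e e')"
  by (simp add: qbil_def quad_ll_def power2_eq_square algebra_simps)

lemma bilinear_qbil: "bilinear (\<lambda>h k. qbil h k y e e')"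
  unfolding bilinear_def linear_iff qbil_def shift_add shift_scale by (simp add: algebra_simps)

definition info_form :: "real ^ 4 \<Rightarrow> real ^ 4 \<Rightarrow> real" where
  "info_form h k = expectation (\<lambda>\<omega>. obs (\<lambda>y e e'. shift h y * shift k y + (1 / 2) * (scale h y * scale k y)) 1 (path \<omega>))"

lemma reg_info: "reg 0 (\<lambda>y e e'. shift h y * shift k y + (1 / 2) * (scale h y * scale k y))"
  by (intro reg_add[OF _ reg_cmult] reg_lag_mult true.reg_mean_shift reg_scale)

lemma cent_qbil_rest:
  "cent (\<lambda>y e e'. (shift h y * scale k y + shift k y * scale h y) * eta true_param y e e'
     + (scale3 true_param h * scale3 true_param k + (1 / 2) * (scale3 true_param h * scale4 true_param k y
          + scale4 true_param h y * scale3 true_param k) + scale4 true_param h y * scale4 true_param k y)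
       * ((eta true_param y e e')\<^sup>2 - 1))"
  by (rule cent_add[OF cent_mult_eta cent_mult_eta_square])
     (intro reg_add reg_cmult reg_lag_mult true.reg_mean_shift true.reg_scale4 reg_scale reg_const)+

lemma reg_qbil: "reg 2 (qbil h k)"
  unfolding qbil_def[abs_def] add.assoc[of "_ + (1 / 2) * _"]
  by (rule reg_add[OF reg_mono[OF reg_info] cent_reg[OF cent_qbil_rest]]) simp

lemma expectation_qbil: "expectation (\<lambda>\<omega>. obs (qbil h k) 1 (path \<omega>)) = info_form h k"
proof -
  have i: "reg 2 (\<lambda>y e e'. shift h y * shift k y + (1 / 2) * (scale h y * scale k y))"
    by (rule reg_mono[OF reg_info]) simp
  show ?thesis
    using integrable_obs[OF i, of 1] integrable_obs[OF cent_reg[OF cent_qbil_rest[of h k]], of 1] expectation_cent[OF cent_qbil_rest[of h k], of 1]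
    unfolding info_form_def obs_def qbil_def add.assoc[of "_ + (1 / 2) * _"] by simp
qed

lemma bilinear_info_form: "bilinear info_form"
proof -
  have int: "integrable M (\<lambda>\<omega>. obs (qbil h k) 1 (path \<omega>))" for h k by (rule integrable_obs[OF reg_qbil])
  note b = bilinear_qbil
  show ?thesis
    unfolding bilinear_def linear_iff expectation_qbil[symmetric]
    using int by (simp add: obs_def bilinear_ladd[OF b] bilinear_radd[OF b] bilinear_lmul[OF b] bilinear_rmul[OF b])
qed

definition info :: "real ^ 4 ^ 4" where
  "info = form_matrix info_form"

lemma inner_info: "h \<bullet> (info *v k) = info_form h k"
  unfolding info_def by (rule form_matrix[OF bilinear_info_form])

lemma transpose_info: "transpose info = info"
  by (simp add: info_def form_matrix_def transpose_def info_form_def mult.commute)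

text \<open>In a degenerate direction both the mean shift and the relative change of the variance
  vanish along the process, which are again affine relations in the process and in its
  square.\<close>

lemma info_pos:
  assumes "h \<noteq> 0"
  shows "0 < h \<bullet> (info *v h)"
proof (rule ccontr)
  let ?g = "\<lambda>y. shift h y * shift h y + (1 / 2) * (scale h y * scale h y)"
  have nonneg: "0 \<le> ?g y" for y by simp
  assume "\<not> 0 < h \<bullet> (info *v h)"
  moreover have "0 \<le> h \<bullet> (info *v h)"
    unfolding inner_info info_form_def obs_def by (rule Bochner_Integration.integral_nonneg[OF nonneg])
  ultimately have "expectation (\<lambda>\<omega>. obs (\<lambda>y e e'. ?g y) 1 (path \<omega>)) = 0"
    by (simp add: inner_info info_form_def)
  then have ae: "AE \<omega> in M. ?g (causal t (path \<omega>)) = 0" for t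
    by (rule expectation_lag_zero_iff[OF reg_info nonneg])
  \<comment> \<open>Multiplying the vanishing relative change by
    \<open>\<sigma>2 * (1 + b^2 * y^2)\<close> gives the relation affine in the square of
    \<open>y\<close>.\<close>
  have z: "h $ 1 + h $ 2 * y = 0 \<and> h $ 3 + (h $ 3 * b\<^sup>2 + h $ 4 * \<sigma>2) * y\<^sup>2 = 0" if "?g y = 0" for y
  proof -
    have "0 \<le> shift h y * shift h y" "0 \<le> scale h y * scale h y" by simp_all
    with that have "shift h y * shift h y = 0" "scale h y * scale h y = 0" by linarith+
    then have "shift h y = 0" "scale h y = 0" by simp_all
    moreover have "1 + b\<^sup>2 * y\<^sup>2 \<noteq> 0" "\<sigma>2 + \<sigma>2 * (b\<^sup>2 * y\<^sup>2) \<noteq> 0"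
      using true.one_plus_pos[of y] true.var_pos[of y] by (simp_all add: distrib_left)
    ultimately show ?thesis using true.cond_sd_pos[of y] variance_pos
      by (simp add: mean_shift_def scale3_def scale4_def field_simps)
  qed
  have 1: "AE \<omega> in M. h $ 1 + h $ 2 * causal t (path \<omega>) = 0" for t
    using ae[of t] by eventually_elim (use z in blast)
  have 2: "AE \<omega> in M. h $ 3 + (h $ 3 * b\<^sup>2 + h $ 4 * \<sigma>2) * (causal t (path \<omega>))\<^sup>2 = 0" for t
    using ae[of t] by eventually_elim (use z in blast)
  have "h $ 1 = 0" "h $ 2 = 0" using causal_affine_degenerate[OF 1] by simp_all
  moreover have "h $ 3 = 0" "h $ 4 = 0"
    using causal_square_affine_degenerate[OF b_nonzero 2] variance_pos by simp_all
  ultimately have "h = 0" by (simp add: vec_eq_iff forall_4)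
  then show False using assms by simp
qed

lemma info_inverse: "info ** matrix_inv info = mat 1" "matrix_inv info ** info = mat 1"
  using positive_definite_invertible[of info] info_pos by auto

lemma transpose_info_inverse: "transpose (matrix_inv info) = matrix_inv info"
  by (rule transpose_matrix_inv[OF transpose_info info_inverse])


section \<open>Asymptotic normality\<close>

definition score_at :: "int \<Rightarrow> (int \<Rightarrow> real) \<Rightarrow> real ^ 4" where
  "score_at t e = score_obs (causal (t - 2) e) (e (t - 1)) (e t)"

definition scaled_score :: "nat \<Rightarrow> 'a \<Rightarrow> real ^ 4" where
  "scaled_score n \<omega> = (1 / sqrt (real n)) *\<^sub>R (\<Sum>i<n. score_at (int i + 1) (path \<omega>))"

lemma inner_score_at: "u \<bullet> score_at t e = obs (slin u) t e"
  by (simp add: score_at_def obs_def slin_eq)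

lemma inner_scaled_score: "u \<bullet> scaled_score n \<omega> = (\<Sum>i<n. obs (slin u) (int i + 1) (path \<omega>)) / sqrt (real n)"
  by (simp add: scaled_score_def inner_sum_right inner_score_at)

lemma measurable_scaled_score: "scaled_score n \<in> borel_measurable M"
proof -
  have "(\<lambda>\<omega>. u \<bullet> scaled_score n \<omega>) \<in> borel_measurable M" for u
    unfolding inner_scaled_score using measurable_obs[OF cent_reg[OF cent_slin]] by measurable
  then show ?thesis
    unfolding borel_measurable_euclidean_space[of "scaled_score n"] by (simp add: inner_commute)
qed

text \<open>Uniform in \<open>h\<close> on one event: the linear term is exact, the quadratic one
  involves only the sixteen averages of \<open>qbil\<close> on axes, and the cubic remainder has an
  envelope that does not involve the direction of \<open>h\<close>. The error sequence and the
  constant may depend on the outcome.\<close>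

lemma info_expansion:
  assumes r: "true.lip * r \<le> 1 / 2"
  shows "AE \<omega> in M. \<exists>err C. err \<longlonglongrightarrow> 0 \<and> 0 \<le> C \<and> (\<forall>\<^sub>F n in sequentially. \<forall>h. norm h \<le> r \<longrightarrow>
    \<bar>(llsum (true_param + h) n \<omega> - llsum true_param n \<omega>)
       - (sqrt (real n) * (h \<bullet> scaled_score n \<omega>) - real n / 2 * (h \<bullet> (info *v h)))\<bar>
     \<le> real n * (norm h)\<^sup>2 * (err n + C * norm h))"
proof -
  let ?H = "\<lambda>y e e'. 1 + (eta true_param y e e')\<^sup>2"
  have H: "reg 2 ?H" by (intro reg_add reg_eta_square true.pos_param_axioms reg_mono[OF reg_const]) simp
  have ae: "AE \<omega> in M. \<forall>i\<in>UNIV. \<forall>j\<in>UNIV. (\<lambda>n. (\<Sum>m<n. obs (qbil (axis i 1) (axis j 1)) (int m + 1) (path \<omega>)) / real n)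
      \<longlonglongrightarrow> info_form (axis i 1) (axis j 1)"
  proof (rule AE_finite_allI[OF finite])+
    fix i j
    show "AE \<omega> in M. (\<lambda>n. (\<Sum>m<n. obs (qbil (axis i 1) (axis j 1)) (int m + 1) (path \<omega>)) / real n)
      \<longlonglongrightarrow> info_form (axis i 1) (axis j 1)"
      using strong_law_obs[OF reg_qbil[of "axis i 1" "axis j 1"]] unfolding expectation_qbil .
  qed
  show ?thesis
    using ae strong_law_obs[OF H]
  proof eventually_elim
    case (elim \<omega>)
    let ?avg = "\<lambda>n h k. (\<Sum>m<n. obs (qbil h k) (int m + 1) (path \<omega>)) / real n"
    \<comment> \<open>Half the total deviation of the entries, as \<open>quad_ll\<close> enters the
      expansion with the factor 1/2.\<close>
    define err where "err n = (1 / 2) * (\<Sum>i\<in>UNIV. \<Sum>j\<in>UNIV. \<bar>?avg n (axis i 1) (axis j 1) - info_form (axis i 1) (axis j 1)\<bar>)" for n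
    have err: "err \<longlonglongrightarrow> 0"
    proof -
      have lim: "(\<lambda>n. \<bar>?avg n (axis i 1) (axis j 1) - info_form (axis i 1) (axis j 1)\<bar>) \<longlonglongrightarrow> 0" for i j
        by (rule tendsto_rabs_zero, rule LIM_zero) (use elim(1) in blast)
      have "err \<longlonglongrightarrow> (1 / 2) * (\<Sum>i\<in>(UNIV :: 4 set). \<Sum>j\<in>(UNIV :: 4 set). 0)"
        unfolding err_def[abs_def] by (intro tendsto_mult tendsto_const tendsto_sum lim)
      then show ?thesis by simp
    qed
    define K where "K = expectation (\<lambda>\<omega>. obs ?H 1 (path \<omega>)) + 1"
    have K: "0 \<le> K"
    proof -
      have "0 \<le> expectation (\<lambda>\<omega>. obs ?H 1 (path \<omega>))" by (simp add: obs_def)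
      then show ?thesis by (simp add: K_def)
    qed
    define C where "C = 40 * true.lip ^ 3 * K"
    have C: "0 \<le> C" using K true.lip_nonneg by (simp add: C_def)
    have "\<forall>\<^sub>F n in sequentially. (\<Sum>i<n. obs ?H (int i + 1) (path \<omega>)) / real n < K"
      by (rule order_tendstoD(2)[OF elim(2)]) (simp add: K_def)
    then have "\<forall>\<^sub>F n in sequentially. \<forall>h. norm h \<le> r \<longrightarrow>
      \<bar>(llsum (true_param + h) n \<omega> - llsum true_param n \<omega>)
       - (sqrt (real n) * (h \<bullet> scaled_score n \<omega>) - real n / 2 * (h \<bullet> (info *v h)))\<bar>
      \<le> real n * (norm h)\<^sup>2 * (err n + C * norm h)"
      using eventually_gt_at_top[of 0]
    proof eventually_elim
      case (elim n)
      show ?case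
      proof (intro allI impI)
        fix h :: "real ^ 4" assume hr: "norm h \<le> r"
        let ?S = "\<Sum>i<n. obs (slin h) (int i + 1) (path \<omega>)"
        let ?Q = "\<Sum>i<n. obs (qbil h h) (int i + 1) (path \<omega>)"
        have lh: "true.lip * norm h \<le> 1 / 2"
          by (rule order_trans[OF mult_left_mono[OF hr true.lip_nonneg] r])
        have step: "\<bar>ll (true_param + h) y (model y e e') - ll true_param y (model y e e') - (slin h y e e' - qbil h h y e e' / 2)\<bar>
            \<le> 40 * (true.lip * norm h) ^ 3 * ?H y e e'" for y e e'
          using true.ll_second_order[OF lh, of y "model y e e'"]
          unfolding slin_def qbil_diag by (simp only: eta_def)
        have eq: "llsum (true_param + h) n \<omega> - llsum true_param n \<omega> - (?S - ?Q / 2)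
            = (\<Sum>i<n. obs (\<lambda>y e e'. ll (true_param + h) y (model y e e') - ll true_param y (model y e e')
                 - (slin h y e e' - qbil h h y e e' / 2)) (int i + 1) (path \<omega>))"
          by (simp add: llsum_def obs_def sum_subtractf sum_divide_distrib)
        have "\<bar>llsum (true_param + h) n \<omega> - llsum true_param n \<omega> - (?S - ?Q / 2)\<bar>
            \<le> (\<Sum>i<n. 40 * (true.lip * norm h) ^ 3 * obs ?H (int i + 1) (path \<omega>))"
          unfolding eq by (rule order_trans[OF sum_abs]) (rule sum_mono, unfold obs_def, rule step)
        also have "\<dots> = 40 * (true.lip * norm h) ^ 3 * (\<Sum>i<n. obs ?H (int i + 1) (path \<omega>))"
          by (rule sum_distrib_left[symmetric])
        also have "\<dots> \<le> 40 * (true.lip * norm h) ^ 3 * (K * real n)"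
          using elim true.lip_nonneg by (intro mult_left_mono) (simp_all add: pos_divide_less_eq less_imp_le)
        also have "\<dots> = real n * (norm h)\<^sup>2 * (C * norm h)"
          by (simp add: C_def power_mult_distrib power2_eq_square power3_eq_cube)
        finally have 1: "\<bar>llsum (true_param + h) n \<omega> - llsum true_param n \<omega> - (?S - ?Q / 2)\<bar> \<le> real n * (norm h)\<^sup>2 * (C * norm h)" .
        have bil: "bilinear (\<lambda>h k. ?avg n h k - info_form h k)"
          unfolding bilinear_def linear_iff obs_def
            bilinear_ladd[OF bilinear_qbil] bilinear_radd[OF bilinear_qbil] bilinear_lmul[OF bilinear_qbil] bilinear_rmul[OF bilinear_qbil]
            bilinear_ladd[OF bilinear_info_form] bilinear_radd[OF bilinear_info_form] bilinear_lmul[OF bilinear_info_form] bilinear_rmul[OF bilinear_info_form]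
          by (simp add: sum.distrib add_divide_distrib right_diff_distrib flip: sum_distrib_left)
        have "\<bar>?avg n h h - info_form h h\<bar> \<le> (norm h)\<^sup>2 * (2 * err n)"
          using bilinear_abs_le[OF bil, of h] by (simp add: err_def)
        then have "real n / 2 * \<bar>?avg n h h - info_form h h\<bar> \<le> real n / 2 * ((norm h)\<^sup>2 * (2 * err n))"
          by (rule mult_left_mono) simp
        moreover have "?Q / 2 - real n / 2 * info_form h h = real n / 2 * (?avg n h h - info_form h h)"
          using elim(2) by (simp add: right_diff_distrib)
        ultimately have 2: "\<bar>?Q / 2 - real n / 2 * info_form h h\<bar> \<le> real n * (norm h)\<^sup>2 * err n"
          by (simp only: abs_mult)
        have 3: "sqrt (real n) * (h \<bullet> scaled_score n \<omega>) = ?S"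
          using elim(2) by (simp add: inner_scaled_score)
        show "\<bar>(llsum (true_param + h) n \<omega> - llsum true_param n \<omega>)
          - (sqrt (real n) * (h \<bullet> scaled_score n \<omega>) - real n / 2 * (h \<bullet> (info *v h)))\<bar>
          \<le> real n * (norm h)\<^sup>2 * (err n + C * norm h)"
          unfolding 3 inner_info distrib_left using 1 2 by linarith
      qed
    qed
    then show ?case using err C by blast
  qed
qed

text \<open>Orthogonality at distance two bounds the variance of each score sum by twice the sum of
  the variances; this provides the tightness needed for the limit law.\<close>

lemma scaled_score_moment:
  obtains c where "\<And>n. integrable M (\<lambda>\<omega>. (norm (scaled_score n \<omega>))\<^sup>2)" "\<And>n. expectation (\<lambda>\<omega>. (norm (scaled_score n \<omega>))\<^sup>2) \<le> c"
proof -
  define q where "q i n \<omega> = (\<Sum>m<n. obs (slin (axis i 1)) (int m + 1) (path \<omega>)) / sqrt (real n)" for i :: 4 and n \<omega>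
  define v where "v i = expectation (\<lambda>\<omega>. (obs (slin (axis i 1)) 1 (path \<omega>))\<^sup>2)" for i :: 4
  have eq: "(norm (scaled_score n \<omega>))\<^sup>2 = (\<Sum>i\<in>UNIV. (q i n \<omega>)\<^sup>2)" for n \<omega>
  proof -
    have "(norm (scaled_score n \<omega>))\<^sup>2 = (\<Sum>i\<in>UNIV. (scaled_score n \<omega> $ i)\<^sup>2)"
      by (simp add: power2_norm_eq_inner inner_vec_def) (simp add: power2_eq_square)
    moreover have "scaled_score n \<omega> $ i = q i n \<omega>" for i
      unfolding q_def inner_scaled_score[symmetric] by (simp add: inner_axis')
    ultimately show ?thesis by simp
  qed
  have reg: "reg 2 (slin u)" for u by (rule cent_reg[OF cent_slin])
  have int: "integrable M (\<lambda>\<omega>. (q i n \<omega>)\<^sup>2)" for i n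
    unfolding q_def power_divide
    by (intro integrable_divide integrable_sum_L2 measurable_obs[OF reg] integrable_square_obs[OF reg]) auto
  have le: "expectation (\<lambda>\<omega>. (q i n \<omega>)\<^sup>2) \<le> 2 * v i" for i n
  proof (cases "n = 0")
    case True
    have "0 \<le> v i" by (simp add: v_def)
    then show ?thesis using True by (simp add: q_def)
  next
    case False
    have "expectation (\<lambda>\<omega>. (\<Sum>m<n. obs (slin (axis i 1)) (int m + 1) (path \<omega>))\<^sup>2)
        \<le> 2 * (\<Sum>m<n. expectation (\<lambda>\<omega>. (obs (slin (axis i 1)) (int m + 1) (path \<omega>))\<^sup>2))"
    proof (rule expectation_square_sum_lag2)
      show "expectation (\<lambda>\<omega>. obs (slin (axis i 1)) (int k + 1) (path \<omega>) * obs (slin (axis i 1)) (int m + 1) (path \<omega>)) = 0"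
        if "k + 2 \<le> m" for k m
        by (rule cent_orthogonal[OF cent_slin depends_on_mono[OF depends_on_obs[OF reg]] integrable_square_obs[OF reg]])
           (use that in auto)
    qed (auto intro: measurable_obs[OF reg] integrable_square_obs[OF reg])
    also have "\<dots> = 2 * (real n * v i)"
    proof -
      have "expectation (\<lambda>\<omega>. (obs (slin (axis i 1)) (int m + 1) (path \<omega>))\<^sup>2) = v i" for m
        unfolding v_def by (rule expectation_obs_square[OF reg])
      then show ?thesis by simp
    qed
    finally show ?thesis using False by (simp add: q_def power_divide pos_divide_le_eq mult_ac)
  qed
  show ?thesis
  proof (rule that)
    show "integrable M (\<lambda>\<omega>. (norm (scaled_score n \<omega>))\<^sup>2)" for n
      unfolding eq by (intro Bochner_Integration.integrable_sum int)
    show "expectation (\<lambda>\<omega>. (norm (scaled_score n \<omega>))\<^sup>2) \<le> (\<Sum>i\<in>UNIV. 2 * v i)" for n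
      unfolding eq by (subst Bochner_Integration.integral_sum) (intro int sum_mono le)+
  qed
qed

theorem qmle_asymptotics:
  fixes Om :: "real ^ 4 ^ 4"
  assumes compact: "compact \<Theta>" and pos: "\<And>\<theta>. \<theta> \<in> \<Theta> \<Longrightarrow> pos_param \<theta>" and interior: "true_param \<in> interior \<Theta>"
    and meas: "\<And>n. 1 \<le> n \<Longrightarrow> \<theta>hat n \<in> borel_measurable M"
    and max: "AE \<omega> in M. \<forall>n\<ge>1. is_arg_max (\<lambda>\<theta>. llsum \<theta> n \<omega>) (\<lambda>\<theta>. \<theta> \<in> \<Theta>) (\<theta>hat n \<omega>)"
    and Om: "transpose Om = Om" "\<And>u. u \<bullet> (Om *v u) = long_run_variance (slin u)"
  shows "AE \<omega> in M. (\<lambda>n. \<theta>hat n \<omega>) \<longlonglongrightarrow> true_param"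
    and "\<exists>N. is_normal_law N 0 (matrix_inv info ** Om ** matrix_inv info) \<and>
      converges_in_distribution M (\<lambda>n \<omega>. sqrt (real n) *\<^sub>R (\<theta>hat n \<omega> - true_param)) N"
proof -
  let ?J = "matrix_inv info"
  have true_in: "true_param \<in> \<Theta>" using interior interior_subset by blast
  \<comment> \<open>Countably many radii \<open>1 / (k + 1)\<close> share one null set.\<close>
  have "AE \<omega> in M. \<forall>k. \<forall>\<^sub>F n in sequentially. \<forall>\<theta>\<in>\<Theta>. 1 / real (Suc k) \<le> dist \<theta> true_param \<longrightarrow> llsum \<theta> n \<omega> < llsum true_param n \<omega>"
    unfolding AE_all_countable by (intro allI uniform_inferiority compact pos) auto
  with max show consistent: "AE \<omega> in M. (\<lambda>n. \<theta>hat n \<omega>) \<longlonglongrightarrow> true_param"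
  proof eventually_elim
    case am: (elim \<omega>)
    show ?case
    proof (rule tendstoI)
      fix \<delta> :: real assume "0 < \<delta>"
      then obtain k where k: "1 / real (Suc k) < \<delta>" using nat_approx_posE by (metis of_nat_Suc)
      from am(2) have "\<forall>\<^sub>F n in sequentially. \<forall>\<theta>\<in>\<Theta>. 1 / real (Suc k) \<le> dist \<theta> true_param \<longrightarrow> llsum \<theta> n \<omega> < llsum true_param n \<omega>" by blast
      then show "\<forall>\<^sub>F n in sequentially. dist (\<theta>hat n \<omega>) true_param < \<delta>"
        using eventually_ge_at_top[of 1]
      proof eventually_elim
        case (elim n)
        have "is_arg_max (\<lambda>\<theta>. llsum \<theta> n \<omega>) (\<lambda>\<theta>. \<theta> \<in> \<Theta>) (\<theta>hat n \<omega>)" using am(1) elim(2) by blast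
        then have "\<theta>hat n \<omega> \<in> \<Theta>" "\<not> llsum (\<theta>hat n \<omega>) n \<omega> < llsum true_param n \<omega>"
          using true_in by (auto simp: is_arg_max_def)
        then have "\<not> 1 / real (Suc k) \<le> dist (\<theta>hat n \<omega>) true_param" using elim(1) by blast
        then show ?case using k by linarith
      qed
    qed
  qed
  obtain r0 where r0: "0 < r0" "cball true_param r0 \<subseteq> \<Theta>"
    using interior by (auto simp: mem_interior_cball)
  \<comment> \<open>Small enough for the ball to lie in the parameter set, so that the maximizer
    beats all of it, and for the second-order expansion to hold.\<close>
  define r where "r = min r0 (1 / (2 * (true.lip + 1)))"
  have r: "0 < r" using r0 true.lip_nonneg by (simp add: r_def)
  have r_in: "true_param + h \<in> \<Theta>" if "norm h \<le> r" for h
    using r0(2) that by (intro subsetD[OF r0(2)]) (simp add: r_def dist_norm)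
  have rlip: "true.lip * r \<le> 1 / 2"
  proof -
    have "true.lip * r \<le> (true.lip + 1) * (1 / (2 * (true.lip + 1)))"
      using true.lip_nonneg r by (intro mult_mono) (auto simp: r_def)
    also have "\<dots> = 1 / 2" by (rule mult_half_inverse) (use true.lip_nonneg in linarith)
    finally show ?thesis .
  qed
  obtain l where l: "0 < l" "\<And>h. l * (norm h)\<^sup>2 \<le> h \<bullet> (info *v h)"
    by (rule positive_definite_lower_bound[OF info_pos]) (assumption | rule that)+
  \<comment> \<open>The maximizer of the quadratic part, on the scale \<open>sqrt n\<close>.\<close>
  define L where "L n \<omega> = ?J *v scaled_score n \<omega>" for n \<omega>
  have infoL: "info *v L n \<omega> = scaled_score n \<omega>" for n \<omega>
    unfolding L_def matrix_vector_mul_assoc info_inverse by simp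
  have close: "AE \<omega> in M. \<forall>K \<eta>. 0 < \<eta> \<longrightarrow> (\<forall>\<^sub>F n in sequentially.
      norm (L n \<omega>) \<le> K \<longrightarrow> norm (sqrt (real n) *\<^sub>R (\<theta>hat n \<omega> - true_param) - L n \<omega>) \<le> \<eta>)"
    using info_expansion[OF rlip] consistent max
  proof eventually_elim
    case (elim \<omega>)
    from elim(1) obtain err C where e: "err \<longlonglongrightarrow> 0" "0 \<le> C" "\<forall>\<^sub>F n in sequentially. \<forall>h. norm h \<le> r \<longrightarrow>
      \<bar>(llsum (true_param + h) n \<omega> - llsum true_param n \<omega>)
       - (sqrt (real n) * (h \<bullet> scaled_score n \<omega>) - real n / 2 * (h \<bullet> (info *v h)))\<bar>
      \<le> real n * (norm h)\<^sup>2 * (err n + C * norm h)" by blast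
    have x: "(\<lambda>n. \<theta>hat n \<omega> - true_param) \<longlonglongrightarrow> 0" by (rule LIM_zero[OF elim(2)])
    have m: "\<forall>\<^sub>F n in sequentially. \<forall>h. norm h \<le> r \<longrightarrow> llsum (true_param + h) n \<omega> - llsum true_param n \<omega>
        \<le> llsum (true_param + (\<theta>hat n \<omega> - true_param)) n \<omega> - llsum true_param n \<omega>"
    proof (rule eventually_sequentiallyI[of 1], intro allI impI)
      fix n :: nat and h :: "real ^ 4" assume "1 \<le> n" "norm h \<le> r"
      then show "llsum (true_param + h) n \<omega> - llsum true_param n \<omega>
        \<le> llsum (true_param + (\<theta>hat n \<omega> - true_param)) n \<omega> - llsum true_param n \<omega>"
        using elim(3) r_in[of h] by (auto simp: is_arg_max_def not_less)
    qed
    show ?case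
    proof (intro allI impI)
      fix K \<eta> :: real assume "0 < \<eta>"
      show "\<forall>\<^sub>F n in sequentially. norm (L n \<omega>) \<le> K \<longrightarrow> norm (sqrt (real n) *\<^sub>R (\<theta>hat n \<omega> - true_param) - L n \<omega>) \<le> \<eta>"
        by (rule argmax_quadratic_approximation[OF transpose_info l infoL r e(2,3,1) x m \<open>0 < \<eta>\<close>])
    qed
  qed
  obtain c0 where c0: "\<And>n. integrable M (\<lambda>\<omega>. (norm (scaled_score n \<omega>))\<^sup>2)"
    "\<And>n. expectation (\<lambda>\<omega>. (norm (scaled_score n \<omega>))\<^sup>2) \<le> c0"
    by (rule scaled_score_moment) (rule that)
  have Lm: "L n \<in> borel_measurable M" for n
    unfolding L_def
    by (rule borel_measurable_continuous_onI[THEN measurable_compose[OF measurable_scaled_score]])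
       (intro linear_continuous_on matrix_vector_mul_bounded_linear)
  obtain B where B: "0 < B" "\<And>x. norm (?J *v x) \<le> B * norm x"
    using linear_bounded_pos[OF matrix_vector_mul_linear[of ?J]] by blast
  have Lle: "(norm (L n \<omega>))\<^sup>2 \<le> B\<^sup>2 * (norm (scaled_score n \<omega>))\<^sup>2" for n \<omega>
    unfolding L_def power_mult_distrib[symmetric] by (intro power_mono B) simp
  have Lint: "integrable M (\<lambda>\<omega>. (norm (L n \<omega>))\<^sup>2)" for n
  proof (rule Bochner_Integration.integrable_bound)
    show "integrable M (\<lambda>\<omega>. B\<^sup>2 * (norm (scaled_score n \<omega>))\<^sup>2)" by (intro integrable_mult_right c0)
    show "(\<lambda>\<omega>. (norm (L n \<omega>))\<^sup>2) \<in> borel_measurable M" using Lm by measurable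
    show "AE \<omega> in M. norm ((norm (L n \<omega>))\<^sup>2) \<le> norm (B\<^sup>2 * (norm (scaled_score n \<omega>))\<^sup>2)" using Lle by simp
  qed
  have LE: "expectation (\<lambda>\<omega>. (norm (L n \<omega>))\<^sup>2) \<le> B\<^sup>2 * c0" for n
  proof -
    have "expectation (\<lambda>\<omega>. (norm (L n \<omega>))\<^sup>2) \<le> expectation (\<lambda>\<omega>. B\<^sup>2 * (norm (scaled_score n \<omega>))\<^sup>2)"
      by (rule integral_mono[OF Lint _ Lle]) (intro integrable_mult_right c0)
    also have "\<dots> \<le> B\<^sup>2 * c0" by (simp add: mult_left_mono c0)
    finally show ?thesis .
  qed
  let ?V = "?J ** Om ** ?J"
  \<comment> \<open>By symmetry of the inverse the limiting variance in direction \<open>u\<close>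
    is that of the score in direction \<open>?J *v u\<close>, which reduces the vector limit to the
    scalar central limit theorem.\<close>
  have V: "u \<bullet> (?V *v u) = long_run_variance (slin (?J *v u))" for u
    unfolding Om(2)[symmetric] matrix_vector_mul_assoc[symmetric]
    by (rule symmetric_inner[OF transpose_info_inverse])
  have Vsym: "transpose ?V = ?V"
    by (simp add: matrix_transpose_mul transpose_info_inverse Om(1) matrix_mul_assoc)
  have Vpos: "0 \<le> u \<bullet> (?V *v u)" for u unfolding V by (rule central_limit_obs(1)[OF cent_slin])
  obtain N where N: "is_normal_law N 0 ?V"
    "\<And>u. (CLINT x|N. iexp (u \<bullet> x)) = complex_of_real (exp (- (u \<bullet> (?V *v u)) / 2))"
    by (rule normal_law_exists[OF Vsym Vpos]) (rule that)
  have "converges_in_distribution M (\<lambda>n \<omega>. sqrt (real n) *\<^sub>R (\<theta>hat n \<omega> - true_param)) N"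
  proof (rule converges_in_distribution_perturbed[OF _ Lm Lint LE close])
    show "(\<lambda>\<omega>. sqrt (real n) *\<^sub>R (\<theta>hat n \<omega> - true_param)) \<in> borel_measurable M" if "1 \<le> n" for n
      using meas[OF that] by measurable
    show "prob_space N" "sets N = sets borel" using N(1) by (auto simp: is_normal_law_def)
    show "(\<lambda>n. CLINT \<omega>|M. iexp (u \<bullet> L n \<omega>)) \<longlonglongrightarrow> (CLINT x|N. iexp (u \<bullet> x))" for u
    proof -
      have "u \<bullet> L n \<omega> = (\<Sum>i<n. obs (slin (?J *v u)) (int i + 1) (path \<omega>)) / sqrt (real n)" for n \<omega>
        unfolding L_def symmetric_inner[OF transpose_info_inverse] by (rule inner_scaled_score)
      then show ?thesis
        using central_limit_obs(2)[OF cent_slin[of "?J *v u"]] unfolding N(2) V by (simp only:)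
    qed
  qed
  with N(1) show "\<exists>N. is_normal_law N 0 ?V \<and>
      converges_in_distribution M (\<lambda>n \<omega>. sqrt (real n) *\<^sub>R (\<theta>hat n \<omega> - true_param)) N" by blast
qed

end

section \<open>The score and the matrices of the limit law\<close>

text \<open>Needed because \<open>gradient\<close> is a definite description. The two derivatives
  are compared at the increment \<open>D - E\<close>.\<close>

lemma GDERIV_unique:
  assumes "GDERIV f x :> D" "GDERIV f x :> E"
  shows "D = E"
proof -
  have "(\<lambda>h. h \<bullet> D) = (\<lambda>h. h \<bullet> E)"
    using assms unfolding gderiv_def by (rule has_derivative_unique)
  then have "(D - E) \<bullet> D = (D - E) \<bullet> E" by (rule fun_cong)
  then have "(D - E) \<bullet> (D - E) = 0" by (simp add: inner_diff_right)
  then show ?thesis by simp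
qed

lemma gradient_eqI: "GDERIV f x :> D \<Longrightarrow> gradient f x = D"
  unfolding gradient_def by (rule the_equality) (auto intro: GDERIV_unique)

lemma outer_nth: "outer v $ i $ j = v $ i * v $ j"
  by (simp add: outer_def matrix_matrix_mult_def columnvector_def rowvector_def)

lemma inner_outer: "u \<bullet> (outer v *v w) = (u \<bullet> v) * (v \<bullet> w)"
proof -
  have "outer v *v w = (v \<bullet> w) *\<^sub>R v"
    by (simp add: vec_eq_iff matrix_vector_mult_def outer_nth inner_vec_def sum_distrib_left mult_ac)
  then show ?thesis by simp
qed

section \<open>Integrals of vector and matrix valued functions by entries\<close>

lemma bounded_linear_axis: "bounded_linear (axis i :: 'b::euclidean_space \<Rightarrow> 'b ^ 'n)"
  unfolding linear_conv_bounded_linear[symmetric] linear_iff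
  by (simp add: axis_def vec_eq_iff)

lemma integrable_vecI:
  fixes X :: "'a \<Rightarrow> 'b::euclidean_space ^ 'n"
  assumes "\<And>i. integrable M (\<lambda>\<omega>. X \<omega> $ i)"
  shows "integrable M X"
proof -
  have "integrable M (\<lambda>\<omega>. \<Sum>i\<in>UNIV. axis i (X \<omega> $ i) :: 'b ^ 'n)"
    by (intro Bochner_Integration.integrable_sum integrable_bounded_linear[OF bounded_linear_axis] assms)
  moreover have "(\<Sum>i\<in>UNIV. axis i (X \<omega> $ i)) = X \<omega>" for \<omega>
    by (simp add: vec_eq_iff axis_def if_distrib sum.delta' cong: if_cong)
  ultimately show ?thesis by simp
qed

lemma integrable_matrixI:
  fixes X :: "'a \<Rightarrow> real ^ 'm ^ 'n"
  shows "(\<And>i j. integrable M (\<lambda>\<omega>. X \<omega> $ i $ j)) \<Longrightarrow> integrable M X"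
  by (intro integrable_vecI)

lemma integral_matrix_nth:
  fixes X :: "'a \<Rightarrow> real ^ 'm ^ 'n"
  assumes "\<And>i j. integrable M (\<lambda>\<omega>. X \<omega> $ i $ j)"
  shows "(\<integral>\<omega>. X \<omega> \<partial>M) $ i $ j = (\<integral>\<omega>. X \<omega> $ i $ j \<partial>M)"
proof -
  have "bounded_linear (\<lambda>A :: real ^ 'm ^ 'n. A $ i $ j)"
    by (rule bounded_linear_compose[OF bounded_linear_vec_nth bounded_linear_vec_nth])
  from integral_bounded_linear[OF this integrable_matrixI[OF assms]] show ?thesis by simp
qed

lemma integral_matrix_form:
  fixes X :: "'a \<Rightarrow> real ^ 'n ^ 'n"
  assumes "integrable M X"
  shows "u \<bullet> ((\<integral>\<omega>. X \<omega> \<partial>M) *v w) = (\<integral>\<omega>. u \<bullet> (X \<omega> *v w) \<partial>M)"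
proof -
  have "linear (\<lambda>A :: real ^ 'n ^ 'n. u \<bullet> (A *v w))"
    unfolding linear_iff
    by (simp add: matrix_vector_mult_add_rdistrib inner_add_right scaleR_matrix_vector_assoc[symmetric])
  then have "bounded_linear (\<lambda>A :: real ^ 'n ^ 'n. u \<bullet> (A *v w))"
    by (simp add: linear_conv_bounded_linear)
  from integral_bounded_linear[OF this assms] show ?thesis by simp
qed

lemma (in prob_space) integrable_outer:
  fixes v :: "'a \<Rightarrow> real ^ 'n"
  assumes "\<And>i. (\<lambda>\<omega>. v \<omega> $ i) \<in> borel_measurable M" "\<And>i. integrable M (\<lambda>\<omega>. (v \<omega> $ i)\<^sup>2)"
  shows "integrable M (\<lambda>\<omega>. outer (v \<omega>))"
  unfolding outer_nth[abs_def]
  by (rule integrable_matrixI) (unfold outer_nth, intro integrable_mult_L2 assms)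

lemma (in prob_space) inner_expectation_outer:
  fixes v :: "'a \<Rightarrow> real ^ 'n"
  assumes "\<And>i. (\<lambda>\<omega>. v \<omega> $ i) \<in> borel_measurable M" "\<And>i. integrable M (\<lambda>\<omega>. (v \<omega> $ i)\<^sup>2)"
  shows "u \<bullet> (expectation (\<lambda>\<omega>. outer (v \<omega>)) *v u) = expectation (\<lambda>\<omega>. (u \<bullet> v \<omega>)\<^sup>2)"
  unfolding integral_matrix_form[OF integrable_outer[OF assms]] inner_outer
  by (simp add: power2_eq_square inner_commute)

definition grad_ll :: "real ^ 4 \<Rightarrow> real \<Rightarrow> real \<Rightarrow> real ^ 4" where
  "grad_ll \<theta> y z = (\<chi> i. lin_ll (scale3 \<theta> (axis i 1) + scale4 \<theta> (axis i 1) y) (mean_shift \<theta> (axis i 1) y) (resid \<theta> y z))"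

lemma inner_grad_ll:
  "h \<bullet> grad_ll \<theta> y z = lin_ll (scale3 \<theta> h + scale4 \<theta> h y) (mean_shift \<theta> h y) (resid \<theta> y z)"
proof -
  have "linear (\<lambda>h. lin_ll (scale3 \<theta> h + scale4 \<theta> h y) (mean_shift \<theta> h y) (resid \<theta> y z))"
    unfolding linear_iff lin_ll_def shift_add shift_scale
    by (simp add: algebra_simps add_divide_distrib diff_divide_distrib)
  from linear_component_sum[OF this, of h] show ?thesis by (simp add: grad_ll_def)
qed

context pos_param
begin

text \<open>No rules of differentiation: the second-order expansion bounds the deviation from the
  linear part by a multiple of the squared norm of \<open>h\<close>, which is
  differentiability.\<close>

lemma GDERIV_ll: "GDERIV (\<lambda>\<theta>'. ll \<theta>' y z) \<theta> :> grad_ll \<theta> y z"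
  unfolding gderiv_def has_derivative_at
proof (intro conjI)
  show "bounded_linear (\<lambda>h. h \<bullet> grad_ll \<theta> y z)" by (rule bounded_linear_inner_left)
  let ?R = "\<lambda>h. norm (ll (\<theta> + h) y z - ll \<theta> y z - h \<bullet> grad_ll \<theta> y z)"
  \<comment> \<open>25 is 20 from the cubic remainder, with one factor estimated by 1/2, plus 5 from
    half of the quadratic term.\<close>
  define c where "c = 25 * lip\<^sup>2 * (1 + (resid \<theta> y z)\<^sup>2)"
  have le: "?R h / norm h \<le> c * norm h" if h: "lip * norm h \<le> 1 / 2" for h
  proof -
    let ?\<delta> = "lip * norm h" and ?g = "1 + (resid \<theta> y z)\<^sup>2"
    let ?q = "quad_ll (scale3 \<theta> h) (scale4 \<theta> h y) (mean_shift \<theta> h y) (resid \<theta> y z)"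
    have "?R h \<le> 40 * ?\<delta> ^ 3 * ?g + \<bar>?q\<bar> / 2"
      using ll_second_order[OF h, of y z] unfolding inner_grad_ll real_norm_def by linarith
    also have "\<bar>?q\<bar> / 2 \<le> 10 * ?\<delta>\<^sup>2 * ?g / 2"
      by (intro divide_right_mono abs_quad_ll_le scale3_le scale4_le mean_shift_le) simp
    also have "40 * ?\<delta> ^ 3 * ?g \<le> 20 * ?\<delta>\<^sup>2 * ?g"
    proof (rule mult_right_mono)
      have "40 * d ^ 3 \<le> 20 * d\<^sup>2" if "d \<le> 1 / 2" for d :: real
        using mult_left_mono[OF that, of "d\<^sup>2"] by (simp add: power2_eq_square power3_eq_cube)
      then show "40 * ?\<delta> ^ 3 \<le> 20 * ?\<delta>\<^sup>2" using h by blast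
    qed simp
    finally have "?R h \<le> 20 * ?\<delta>\<^sup>2 * ?g + 10 * ?\<delta>\<^sup>2 * ?g / 2" by simp
    also have "\<dots> = c * norm h * norm h" by (simp add: c_def power2_eq_square algebra_simps)
    finally show ?thesis by (cases "h = 0") (simp_all add: pos_divide_le_eq)
  qed
  show "(\<lambda>h. ?R h / norm h) \<midarrow>0\<rightarrow> 0"
  proof (rule tendsto_sandwich[where f = "\<lambda>_. 0" and h = "\<lambda>h. c * norm h"])
    have "(\<lambda>h :: real ^ 4. lip * norm h) \<midarrow>0\<rightarrow> lip * norm (0 :: real ^ 4)" by (intro tendsto_intros)
    then have "\<forall>\<^sub>F h :: real ^ 4 in at 0. lip * norm h < 1 / 2" by (rule order_tendstoD) simp
    then show "\<forall>\<^sub>F h in at 0. ?R h / norm h \<le> c * norm h"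
      by eventually_elim (rule le, simp)
    have "(\<lambda>h :: real ^ 4. c * norm h) \<midarrow>0\<rightarrow> c * norm (0 :: real ^ 4)" by (intro tendsto_intros)
    then show "(\<lambda>h :: real ^ 4. c * norm h) \<midarrow>0\<rightarrow> 0" by simp
  qed (simp_all add: divide_nonneg_nonneg)
qed

lemma score_eq: "score Y t \<theta> \<omega> = grad_ll \<theta> (Y (t - 2) \<omega>) (Y t \<omega>)"
  unfolding score_def quasi_ll_eq by (rule gradient_eqI[OF GDERIV_ll])

lemma measurable_score:
  assumes [measurable]: "\<And>t. Y t \<in> borel_measurable M"
  shows "(\<lambda>\<omega>. score Y t \<theta> \<omega> $ i) \<in> borel_measurable M"
  unfolding score_eq grad_ll_def lin_ll_def mean_shift_def scale3_def scale4_def resid_def vec_lambda_beta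
  by measurable

end

section \<open>Transfer from the causal solution to the observed process\<close>

locale stationary_qmle = qmle M \<epsilon> \<mu> \<phi> b \<sigma>2 for M :: "'a measure" and \<epsilon> \<mu> \<phi> b \<sigma>2 +
  fixes Y :: "int \<Rightarrow> 'a \<Rightarrow> real"
  assumes stationary: "strictly_stationary M Y" and solution: "bilinear_solution M \<epsilon> \<mu> \<phi> b Y"
begin

lemma measurable_Y [measurable]: "Y t \<in> borel_measurable M"
  using stationary by (simp add: strictly_stationary_def)

lemma observations:
  "AE \<omega> in M. \<forall>t. Y t \<omega> = causal t (path \<omega>) \<and> Y t \<omega> = model (causal (t - 2) (path \<omega>)) (path \<omega> (t - 1)) (path \<omega> t)"
proof -
  have "AE \<omega> in M. \<forall>t. causal t (path \<omega>) = drift t (path \<omega>) + \<epsilon> t \<omega>"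
    unfolding AE_all_countable using causal_recursion by blast
  with stationary_solution_causal[OF stationary solution] show ?thesis
  proof eventually_elim
    case (elim \<omega>)
    show ?case
    proof (intro allI conjI)
      fix t
      show "Y t \<omega> = causal t (path \<omega>)" using elim(1) by blast
      also have "\<dots> = drift t (path \<omega>) + \<epsilon> t \<omega>" using elim(2) by blast
      also have "\<dots> = model (causal (t - 2) (path \<omega>)) (path \<omega> (t - 1)) (path \<omega> t)"
        by (simp add: drift_def model_def path_def algebra_simps)
      finally show "Y t \<omega> = model (causal (t - 2) (path \<omega>)) (path \<omega> (t - 1)) (path \<omega> t)" .
    qed
  qed
qed

text \<open>The null set must not depend on the parameter, since the maximization runs over an
  uncountable set; it is the one outside of which the process equals its causal version at all
  times.\<close>

lemma total_quasi_ll_llsum: "AE \<omega> in M. \<forall>\<theta> n. total_quasi_ll Y n \<theta> \<omega> = llsum \<theta> n \<omega>"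
  using observations
proof eventually_elim
  case (elim \<omega>)
  have "total_quasi_ll Y n \<theta> \<omega> = (\<Sum>i<n. quasi_ll Y (int i + 1) \<theta> \<omega>)" for \<theta> n
    unfolding total_quasi_ll_def
    by (rule sum.reindex_bij_witness[where i = "\<lambda>i. int i + 1" and j = "\<lambda>t. nat (t - 1)"]) auto
  moreover have "quasi_ll Y t \<theta> \<omega> = obs (\<lambda>y e e'. ll \<theta> y (model y e e')) t (path \<omega>)" for t \<theta>
  proof -
    have "Y (t - 2) \<omega> = causal (t - 2) (path \<omega>)" using elim by blast
    moreover have "Y t \<omega> = model (causal (t - 2) (path \<omega>)) (path \<omega> (t - 1)) (path \<omega> t)" using elim by blast
    ultimately show ?thesis by (simp only: quasi_ll_eq obs_def)
  qed
  ultimately show ?case by (simp add: llsum_def)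
qed

lemma score_score_at: "AE \<omega> in M. \<forall>t. score Y t true_param \<omega> = score_at t (path \<omega>)"
  using observations
proof eventually_elim
  case (elim \<omega>)
  have "score Y t true_param \<omega> = score_at t (path \<omega>)" for t
  proof -
    have "Y (t - 2) \<omega> = causal (t - 2) (path \<omega>)" using elim by blast
    moreover have "Y t \<omega> = model (causal (t - 2) (path \<omega>)) (path \<omega> (t - 1)) (path \<omega> t)" using elim by blast
    ultimately show ?thesis
      by (simp only: true.score_eq score_at_def score_obs_def grad_ll_def slin_def eta_def)
  qed
  then show ?case by blast
qed

lemma score_square:
  shows "integrable M (\<lambda>\<omega>. (u \<bullet> score Y t true_param \<omega>)\<^sup>2)"
    and "expectation (\<lambda>\<omega>. (u \<bullet> score Y t true_param \<omega>)\<^sup>2) = expectation (\<lambda>\<omega>. (obs (slin u) t (path \<omega>))\<^sup>2)"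
    and "integrable M (\<lambda>\<omega>. (u \<bullet> (score Y t true_param \<omega> + score Y (t - 1) true_param \<omega>))\<^sup>2)"
    and "expectation (\<lambda>\<omega>. (u \<bullet> (score Y t true_param \<omega> + score Y (t - 1) true_param \<omega>))\<^sup>2)
      = expectation (\<lambda>\<omega>. (obs (slin u) t (path \<omega>) + obs (slin u) (t - 1) (path \<omega>))\<^sup>2)"
proof -
  have reg: "reg 2 (slin u)" by (rule cent_reg[OF cent_slin])
  note m [measurable] = measurable_obs[OF reg] true.measurable_score[OF measurable_Y]
  have m1: "(\<lambda>\<omega>. (u \<bullet> score Y t true_param \<omega>)\<^sup>2) \<in> borel_measurable M"
    and m2: "(\<lambda>\<omega>. (u \<bullet> (score Y t true_param \<omega> + score Y (t - 1) true_param \<omega>))\<^sup>2) \<in> borel_measurable M"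
    unfolding inner_vec_def inner_real_def vector_add_component by measurable
  have a1: "AE \<omega> in M. (obs (slin u) t (path \<omega>))\<^sup>2 = (u \<bullet> score Y t true_param \<omega>)\<^sup>2"
    using score_score_at by eventually_elim (simp add: inner_score_at)
  have a2: "AE \<omega> in M. (obs (slin u) t (path \<omega>) + obs (slin u) (t - 1) (path \<omega>))\<^sup>2
      = (u \<bullet> (score Y t true_param \<omega> + score Y (t - 1) true_param \<omega>))\<^sup>2"
    using score_score_at by eventually_elim (simp add: inner_score_at inner_add_right)
  show "integrable M (\<lambda>\<omega>. (u \<bullet> score Y t true_param \<omega>)\<^sup>2)"
    by (rule integrable_cong_AE_imp[OF integrable_square_obs[OF reg] m1]) (use a1 in auto)
  show "integrable M (\<lambda>\<omega>. (u \<bullet> (score Y t true_param \<omega> + score Y (t - 1) true_param \<omega>))\<^sup>2)"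
    by (rule integrable_cong_AE_imp[OF integrable_add_L2 m2])
       (use a2 in \<open>auto intro: measurable_obs[OF reg] integrable_square_obs[OF reg]\<close>)
  show "expectation (\<lambda>\<omega>. (u \<bullet> score Y t true_param \<omega>)\<^sup>2) = expectation (\<lambda>\<omega>. (obs (slin u) t (path \<omega>))\<^sup>2)"
    using a1 by (intro integral_cong_AE m1) (measurable, auto)
  show "expectation (\<lambda>\<omega>. (u \<bullet> (score Y t true_param \<omega> + score Y (t - 1) true_param \<omega>))\<^sup>2)
      = expectation (\<lambda>\<omega>. (obs (slin u) t (path \<omega>) + obs (slin u) (t - 1) (path \<omega>))\<^sup>2)"
    using a2 by (intro integral_cong_AE m2) (measurable, auto)
qed

text \<open>By stationarity the quadratic form of the first expectation is two variances plus twice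
  the lag 1 covariance. Subtracting one variance leaves the long-run variance, which is why the
  matrix has this form and does not depend on \<open>t\<close>.\<close>

lemma
  shows transpose_Omega: "transpose (Omega M Y t true_param) = Omega M Y t true_param"
    and inner_Omega: "u \<bullet> (Omega M Y t true_param *v u) = long_run_variance (slin u)"
proof -
  let ?s = "\<lambda>t \<omega>. score Y t true_param \<omega>"
  note m = true.measurable_score[OF measurable_Y]
  have m2: "(\<lambda>\<omega>. (?s t \<omega> + ?s (t - 1) \<omega>) $ i) \<in> borel_measurable M" for i
    unfolding vector_add_component by (intro borel_measurable_add m)
  have i1: "integrable M (\<lambda>\<omega>. (?s t \<omega> $ i)\<^sup>2)" for i
    using score_square(1)[of "axis i 1" t] by (simp add: inner_axis')
  have i2: "integrable M (\<lambda>\<omega>. ((?s t \<omega> + ?s (t - 1) \<omega>) $ i)\<^sup>2)" for i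
    using score_square(3)[of "axis i 1" t] by (simp add: inner_axis')
  have ent: "integrable M (\<lambda>\<omega>. outer (?s t \<omega>) $ i $ j)" "integrable M (\<lambda>\<omega>. outer (?s t \<omega> + ?s (t - 1) \<omega>) $ i $ j)" for i j
    unfolding outer_nth by (intro integrable_mult_L2 m m2 i1 i2)+
  show "transpose (Omega M Y t true_param) = Omega M Y t true_param"
    by (simp add: vec_eq_iff transpose_def Omega_def integral_matrix_nth[OF ent(1)] integral_matrix_nth[OF ent(2)])
       (simp add: outer_nth mult.commute)
  have reg: "reg 2 (slin u)" by (rule cent_reg[OF cent_slin])
  let ?o = "\<lambda>t \<omega>. obs (slin u) t (path \<omega>)"
  have sq: "integrable M (\<lambda>\<omega>. (?o t \<omega>)\<^sup>2)" for t by (rule integrable_square_obs[OF reg])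
  have pr: "integrable M (\<lambda>\<omega>. ?o (t - 1) \<omega> * ?o t \<omega>)" for t
    by (intro integrable_mult_L2 measurable_obs[OF reg] sq)
  have "u \<bullet> (Omega M Y t true_param *v u) = expectation (\<lambda>\<omega>. (?o t \<omega> + ?o (t - 1) \<omega>)\<^sup>2) - expectation (\<lambda>\<omega>. (?o t \<omega>)\<^sup>2)"
    unfolding Omega_def matrix_vector_mult_diff_rdistrib inner_diff_right
      inner_expectation_outer[OF m i1] inner_expectation_outer[OF m2 i2] score_square ..
  also have "expectation (\<lambda>\<omega>. (?o t \<omega> + ?o (t - 1) \<omega>)\<^sup>2)
      = expectation (\<lambda>\<omega>. (?o t \<omega>)\<^sup>2 + (?o (t - 1) \<omega>)\<^sup>2 + 2 * (?o (t - 1) \<omega> * ?o t \<omega>))"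
    by (rule Bochner_Integration.integral_cong) (simp_all add: power2_sum mult_ac)
  also have "\<dots> = expectation (\<lambda>\<omega>. (?o t \<omega>)\<^sup>2) + expectation (\<lambda>\<omega>. (?o (t - 1) \<omega>)\<^sup>2) + 2 * expectation (\<lambda>\<omega>. ?o (t - 1) \<omega> * ?o t \<omega>)"
    using sq pr[of t] by simp
  also have "expectation (\<lambda>\<omega>. (?o (t - 1) \<omega>)\<^sup>2) = expectation (\<lambda>\<omega>. (?o 1 \<omega>)\<^sup>2)"
    by (rule expectation_obs_square[OF reg])
  also have "expectation (\<lambda>\<omega>. ?o (t - 1) \<omega> * ?o t \<omega>) = expectation (\<lambda>\<omega>. ?o 1 \<omega> * ?o 2 \<omega>)"
    using expectation_obs_product[OF reg, of "t - 1" 1] by simp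
  finally show "u \<bullet> (Omega M Y t true_param *v u) = long_run_variance (slin u)"
    by (simp add: long_run_variance_def)
qed

lemma lag_expectation:
  assumes "reg 0 (\<lambda>y e e'. g y)"
  shows "integrable M (\<lambda>\<omega>. g (Y t \<omega>))"
    and "expectation (\<lambda>\<omega>. g (Y t \<omega>)) = expectation (\<lambda>\<omega>. obs (\<lambda>y e e'. g y) 1 (path \<omega>))"
proof -
  have "(\<lambda>(y, e :: real, e' :: real). g y) \<in> borel_measurable (borel \<Otimes>\<^sub>M borel \<Otimes>\<^sub>M borel)" by (rule reg_measurable[OF assms])
  from measurable_compose[OF _ this, of "\<lambda>y. (y, 0, 0)" borel] have [measurable]: "g \<in> borel_measurable borel" by simp
  have ae: "AE \<omega> in M. obs (\<lambda>y e e'. g y) (t + 2) (path \<omega>) = g (Y t \<omega>)"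
    using stationary_solution_causal[OF stationary solution] by eventually_elim (simp add: obs_def)
  have r2: "reg 2 (\<lambda>y e e'. g y)" by (rule reg_mono[OF assms]) simp
  note [measurable] = measurable_obs[OF r2]
  show "integrable M (\<lambda>\<omega>. g (Y t \<omega>))"
    by (rule integrable_cong_AE_imp[OF integrable_obs[OF r2]]) (use ae in auto)
  have "expectation (\<lambda>\<omega>. g (Y t \<omega>)) = expectation (\<lambda>\<omega>. obs (\<lambda>y e e'. g y) (t + 2) (path \<omega>))"
    using ae by (intro integral_cong_AE) auto
  also have "\<dots> = expectation (\<lambda>\<omega>. obs (\<lambda>y e e'. g y) 1 (path \<omega>))" by (rule expectation_obs[OF assms])
  finally show "expectation (\<lambda>\<omega>. g (Y t \<omega>)) = expectation (\<lambda>\<omega>. obs (\<lambda>y e e'. g y) 1 (path \<omega>))" .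
qed

lemma shift_scale_axis:
  "shift (axis 1 1) y = 1 / cond_sd true_param y" "shift (axis 2 1) y = y / cond_sd true_param y"
  "shift (axis 3 1) y = 0" "shift (axis 4 1) y = 0"
  "scale (axis 1 1) y = 0" "scale (axis 2 1) y = 0"
  "scale (axis 3 1) y = 1 / \<sigma>2" "scale (axis 4 1) y = y\<^sup>2 / (1 + b\<^sup>2 * y\<^sup>2)"
  by (simp_all add: mean_shift_def scale3_def scale4_def axis_def)

lemma info_nth:
  "info $ i $ j = expectation (\<lambda>\<omega>. shift (axis i 1) (Y t \<omega>) * shift (axis j 1) (Y t \<omega>)
     + (1 / 2) * (scale (axis i 1) (Y t \<omega>) * scale (axis j 1) (Y t \<omega>)))"
  unfolding lag_expectation(2)[OF reg_info] by (simp add: info_def form_matrix_def info_form_def)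

text \<open>Mean shifts vanish in the two variance directions and scale changes in the two mean
  directions, hence the block structure. The square of \<open>1 / cond_sd\<close> is the weight of
  the first block, and half the products of relative scale changes fill the second.\<close>

lemma Sigma_info: "Sigma_mat M Y t true_param = info"
proof -
  let ?y = "\<lambda>\<omega>. Y (t - 2) \<omega>"
  have cv: "1 / cond_var Y t true_param \<omega> = 1 / cond_sd true_param (?y \<omega>) * (1 / cond_sd true_param (?y \<omega>))" for \<omega>
    using true.cond_sd_square[of "?y \<omega>"] by (simp add: cond_var_def power2_eq_square)
  note e = reg_info[of "axis i 1" "axis j 1" for i j, THEN lag_expectation(1), where t = "t - 2"]
  let ?m1 = "\<lambda>\<omega>. (1 / cond_var Y t true_param \<omega>) *\<^sub>R (vector [vector [1, ?y \<omega>], vector [?y \<omega>, (?y \<omega>)\<^sup>2]] :: real ^ 2 ^ 2)"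
  let ?m2 = "\<lambda>\<omega>. (vector [vector [1 / (2 * (true_param $ 3)\<^sup>2), (?y \<omega>)\<^sup>2 / (2 * cond_var Y t true_param \<omega>)],
         vector [(?y \<omega>)\<^sup>2 / (2 * cond_var Y t true_param \<omega>),
                 (?y \<omega>) ^ 4 / (2 * (1 + true_param $ 4 * (?y \<omega>)\<^sup>2)\<^sup>2)]] :: real ^ 2 ^ 2)"
  let ?g = "\<lambda>i j \<omega>. shift (axis i 1) (?y \<omega>) * shift (axis j 1) (?y \<omega>)
      + (1 / 2) * (scale (axis i 1) (?y \<omega>) * scale (axis j 1) (?y \<omega>))"
  have m1: "?m1 \<omega> $ 1 $ 1 = ?g 1 1 \<omega>" "?m1 \<omega> $ 1 $ 2 = ?g 1 2 \<omega>" "?m1 \<omega> $ 2 $ 1 = ?g 2 1 \<omega>" "?m1 \<omega> $ 2 $ 2 = ?g 2 2 \<omega>" for \<omega>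
    unfolding shift_scale_axis cv by (simp_all add: power2_eq_square)
  have m2: "?m2 \<omega> $ 1 $ 1 = ?g 3 3 \<omega>" "?m2 \<omega> $ 1 $ 2 = ?g 3 4 \<omega>" "?m2 \<omega> $ 2 $ 1 = ?g 4 3 \<omega>" "?m2 \<omega> $ 2 $ 2 = ?g 4 4 \<omega>" for \<omega>
    unfolding shift_scale_axis cond_var_def
    by (simp_all add: power2_eq_square power4_eq_xxxx)
  have int1: "integrable M (\<lambda>\<omega>. ?m1 \<omega> $ i $ j)" for i j
  proof -
    have "\<forall>i j. integrable M (\<lambda>\<omega>. ?m1 \<omega> $ i $ j)" unfolding forall_2 m1 by (intro conjI e)
    then show ?thesis by blast
  qed
  have int2: "integrable M (\<lambda>\<omega>. ?m2 \<omega> $ i $ j)" for i j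
  proof -
    have "\<forall>i j. integrable M (\<lambda>\<omega>. ?m2 \<omega> $ i $ j)" unfolding forall_2 m2 by (intro conjI e)
    then show ?thesis by blast
  qed
  have S1: "Sigma1 M Y t true_param $ i $ j = expectation (\<lambda>\<omega>. ?m1 \<omega> $ i $ j)" for i j
    unfolding Sigma1_def by (rule integral_matrix_nth[OF int1])
  have S2: "Sigma2 M Y t true_param $ i $ j = expectation (\<lambda>\<omega>. ?m2 \<omega> $ i $ j)" for i j
    unfolding Sigma2_def by (rule integral_matrix_nth[OF int2])
  have i0: "info $ i $ j = 0" if "\<And>\<omega>. ?g i j \<omega> = 0" for i j
    unfolding info_nth[of i j "t - 2"] that by simp
  have "info $ 1 $ 3 = 0" "info $ 1 $ 4 = 0" "info $ 2 $ 3 = 0" "info $ 2 $ 4 = 0"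
    "info $ 3 $ 1 = 0" "info $ 4 $ 1 = 0" "info $ 3 $ 2 = 0" "info $ 4 $ 2 = 0"
    by (rule i0, unfold shift_scale_axis, simp)+
  moreover have "Sigma1 M Y t true_param $ 1 $ 1 = info $ 1 $ 1" "Sigma1 M Y t true_param $ 1 $ 2 = info $ 1 $ 2"
    "Sigma1 M Y t true_param $ 2 $ 1 = info $ 2 $ 1" "Sigma1 M Y t true_param $ 2 $ 2 = info $ 2 $ 2"
    "Sigma2 M Y t true_param $ 1 $ 1 = info $ 3 $ 3" "Sigma2 M Y t true_param $ 1 $ 2 = info $ 3 $ 4"
    "Sigma2 M Y t true_param $ 2 $ 1 = info $ 4 $ 3" "Sigma2 M Y t true_param $ 2 $ 2 = info $ 4 $ 4"
    unfolding S1 S2 m1 m2 info_nth[of _ _ "t - 2"] by (rule refl)+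
  ultimately show ?thesis
    by (simp add: vec_eq_iff forall_4 Sigma_mat_def block_diag_def)
qed

end

theorem theorem2:
  fixes M :: "'a measure"
    and \<epsilon> Y :: "int \<Rightarrow> 'a \<Rightarrow> real"
    and \<mu>\<^sub>0 \<phi>\<^sub>0 \<sigma>\<^sub>0 b\<^sub>0 \<mu>bar \<phi>bar \<omega>low \<omega>high \<alpha>low \<alpha>high :: real
    and \<Theta> :: "(real ^ 4) set"
    and \<theta>\<^sub>0 :: "real ^ 4"
    and \<theta>hat :: "nat \<Rightarrow> 'a \<Rightarrow> real ^ 4"
    and t :: int
  assumes "prob_space M"
    and "iid M \<epsilon>"
    and "(\<integral>\<omega>. \<epsilon> 1 \<omega> \<partial>M) = 0"
    and "(\<integral>\<omega>. (\<epsilon> 1 \<omega> - (\<integral>\<omega>'. \<epsilon> 1 \<omega>' \<partial>M))\<^sup>2 \<partial>M) = \<sigma>\<^sub>0\<^sup>2"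
    and "\<sigma>\<^sub>0\<^sup>2 > 0"
    and "integrable M (\<lambda>\<omega>. \<epsilon> 1 \<omega> ^ 4)"
    and "strictly_stationary M Y"
    and "bilinear_solution M \<epsilon> \<mu>\<^sub>0 \<phi>\<^sub>0 b\<^sub>0 Y"
    and "\<theta>\<^sub>0 = vector [\<mu>\<^sub>0, \<phi>\<^sub>0, \<sigma>\<^sub>0\<^sup>2, b\<^sub>0\<^sup>2]"
    and "\<mu>bar > 0" "\<phi>bar > 0" "\<omega>low > 0" "\<omega>high > 0" "\<alpha>low > 0" "\<alpha>high > 0"
    and "compact \<Theta>"
    and "\<Theta> \<subseteq> {\<theta>. ereal_expectation M (\<lambda>\<omega>. ln_abs (\<theta> $ 2 + sgn b\<^sub>0 * sqrt (\<theta> $ 4) * \<epsilon> 1 \<omega>)) < 0 \<and>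
                 \<bar>\<theta> $ 1\<bar> \<le> \<mu>bar \<and> \<bar>\<theta> $ 2\<bar> \<le> \<phi>bar \<and>
                 \<omega>low \<le> \<theta> $ 3 \<and> \<theta> $ 3 \<le> \<omega>high \<and> \<alpha>low \<le> \<theta> $ 4 \<and> \<theta> $ 4 \<le> \<alpha>high}"
    and "\<theta>\<^sub>0 \<in> interior \<Theta>"
    and "\<And>n. n \<ge> 1 \<Longrightarrow> \<theta>hat n \<in> borel_measurable M"
    and "\<And>n. n \<ge> 1 \<Longrightarrow>
           AE \<omega> in M. is_arg_max (\<lambda>\<theta>. total_quasi_ll Y n \<theta> \<omega>) (\<lambda>\<theta>. \<theta> \<in> \<Theta>) (\<theta>hat n \<omega>)"
  shows "(AE \<omega> in M. (\<lambda>n. \<theta>hat n \<omega>) \<longlonglongrightarrow> \<theta>\<^sub>0) \<and>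
    (\<exists>N. is_normal_law N 0
           (matrix_inv (Sigma_mat M Y t \<theta>\<^sub>0) ** Omega M Y t \<theta>\<^sub>0 ** matrix_inv (Sigma_mat M Y t \<theta>\<^sub>0)) \<and>
         converges_in_distribution M (\<lambda>n \<omega>. sqrt (real n) *\<^sub>R (\<theta>hat n \<omega> - \<theta>\<^sub>0)) N)"
proof -
  have nth: "\<theta>\<^sub>0 $ 2 = \<phi>\<^sub>0" "\<theta>\<^sub>0 $ 4 = b\<^sub>0\<^sup>2" using assms(9) by simp_all
  have "\<theta>\<^sub>0 \<in> \<Theta>" using assms(18) interior_subset by blast
  then have log: "ereal_expectation M (\<lambda>\<omega>. ln_abs (\<phi>\<^sub>0 + sgn b\<^sub>0 * sqrt (b\<^sub>0\<^sup>2) * \<epsilon> 1 \<omega>)) < 0" and "\<alpha>low \<le> b\<^sub>0\<^sup>2"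
    using assms(17) nth by auto
  \<comment> \<open>The positive lower bound on the fourth coordinate applies to the true parameter,
    which lies in the parameter set.\<close>
  then have b: "b\<^sub>0 \<noteq> 0" using assms(14) by auto
  \<comment> \<open>The sign convention returns the coefficient of the process itself, so membership
    of the true parameter is the log-moment condition of the recursion.\<close>
  have sgn: "sgn b\<^sub>0 * sqrt (b\<^sub>0\<^sup>2) = b\<^sub>0" by (simp add: sgn_mult_abs)
  interpret prob_space M by fact
  interpret stationary_qmle M \<epsilon> \<mu>\<^sub>0 \<phi>\<^sub>0 b\<^sub>0 "\<sigma>\<^sub>0\<^sup>2" Y
  proof
    show "indep_vars (\<lambda>_. borel) \<epsilon> UNIV" "distr M borel (\<epsilon> s) = distr M borel (\<epsilon> t)" for s t
      using assms(2) by (simp_all add: iid_def)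
    show "expectation (\<lambda>\<omega>. (\<epsilon> 1 \<omega>)\<^sup>2) = \<sigma>\<^sub>0\<^sup>2" using assms(3,4) by simp
    show "ereal_expectation M (\<lambda>\<omega>. ln_abs (\<phi>\<^sub>0 + b\<^sub>0 * \<epsilon> 1 \<omega>)) < 0" using log unfolding sgn .
  qed (fact assms b)+
  have \<theta>\<^sub>0: "\<theta>\<^sub>0 = true_param" using assms(9) by (simp add: true_param_def)
  have pos: "pos_param \<theta>" if "\<theta> \<in> \<Theta>" for \<theta>
    using assms(12,14,17) that by unfold_locales auto
  \<comment> \<open>Maximality holds almost surely for each sample size; countably many null sets
    are merged into one.\<close>
  have "AE \<omega> in M. \<forall>n\<in>{1..}. is_arg_max (\<lambda>\<theta>. total_quasi_ll Y n \<theta> \<omega>) (\<lambda>\<theta>. \<theta> \<in> \<Theta>) (\<theta>hat n \<omega>)"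
    using assms(20) by (subst AE_ball_countable) auto
  with total_quasi_ll_llsum have max: "AE \<omega> in M. \<forall>n\<ge>1. is_arg_max (\<lambda>\<theta>. llsum \<theta> n \<omega>) (\<lambda>\<theta>. \<theta> \<in> \<Theta>) (\<theta>hat n \<omega>)"
    by eventually_elim auto
  note main = qmle_asymptotics[OF assms(16) pos assms(18)[unfolded \<theta>\<^sub>0] assms(19) max transpose_Omega[of t] inner_Omega[of _ t]]
  show ?thesis
    unfolding \<theta>\<^sub>0 Sigma_info by (intro conjI main)
qed

end
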